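(* Let $A$ be a complex torus of dimension $2$, let $\sigma\in\mathrm{Aut}_0(A)$ be a non-symplectic group automorphism whose action on $H^2(A,\mathbb{Z})$ has prime order $p$, and let $G_\sigma\subseteq \mathrm{Aut}_0(A)$ be the subgroup generated by $\sigma$ and $-\mathrm{id}_A$. Let $T(G_\sigma)\subseteq H^2(A,\mathbb{Z})$ be the invariant lattice. Denote by $r$ the rank of $T(G_\sigma)$, by $a$ the length of its discriminant group, and by $\dim$ the dimension of the family of abelian surfaces admitting an embedding $G_\sigma\subseteq \mathrm{Aut}_0(A)$. Then $T(G_\sigma)$ is isomorphic to one of the lattices in the following table, with $(p,r,\dim,a)$ as in the corresponding row: $$\begin{array}{c|c|c|c|c} p & r & \dim & a & T(G_\sigma)\\ \hline 2 & 2 & 2 & 0 & U\\ 2 & 2 & 2 & 2 & U(2)\\ 2 & 2 & 2 & 2 & \langle 2\rangle\oplus\langle -2\rangle\\ 2 & 4 & 0 & 2 & U\oplus\langle -2\rangle^{\oplus 2}\\ \hline 3 & 2 & 1 & 0 & U\\ 3 & 2 & 1 & 2 & U(3)\\ 3 & 4 & 0 & 1 & U\oplus A_2(-1)\\ \hline 5 & 2 & 0 & 1 & H_5 \end{array}$$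
   Context: For a complex torus $A$ of dimension $2$, $\mathrm{Aut}_0(A)$ is the group of group automorphisms of $A$ (automorphisms fixing the origin). $H^2(A,\mathbb{Z})$ is a lattice via the cup product $H^2(A,\mathbb{Z})\times H^2(A,\mathbb{Z})\to H^4(A,\mathbb{Z})\cong\mathbb{Z}$; it is isometric to $U^{\oplus 3}$. The group $\mathrm{Aut}_0(A)$ acts on it by isometries through pullback, $\nu:\mathrm{Aut}_0(A)\to O(H^2(A,\mathbb{Z}))$, with kernel $\{\pm \mathrm{id}_A\}$. "The action of $\sigma$ has order $p$" means $\nu(\sigma)$ has order $p$. Let $\omega$ be a generator of the one-dimensional space $H^{2,0}(A)$ (a nowhere vanishing holomorphic $2$-form). $\sigma$ (or $G_\sigma$) is symplectic if $\sigma^*\omega=\omega$ and non-symplectic otherwise. The invariant lattice is $T(G_\sigma)=\{x\in H^2(A,\mathbb{Z}) : g^*x=x \ \forall g\in G_\sigma\}$ with the restricted form. Lattices: $U$ is the rank $2$ lattice with Gram matrix $\begin{pmatrix}0&1\\1&0\end{pmatrix}$; $A_2$ is the rank $2$ lattice with Gram matrix $\begin{pmatrix}2&1\\1&2\end{pmatrix}$; $H_5$ is the rank $2$ lattice with Gram matrix $\begin{pmatrix}2&1\\1&-2\end{pmatrix}$; $\langle k\rangle$ is the rank $1$ lattice generated by an element of square $k$; $L(k)$ is the lattice $L$ with its form multiplied by $k$. The discriminant group of a lattice $L$ is $L^*/L$ with $L^*=\mathrm{Hom}(L,\mathbb{Z})$; when it is isomorphic to $(\mathbb{Z}/p\mathbb{Z})^a$,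 the integer $a$ is called its length. The family and its dimension: choose a marking, i.e. an isometry $\phi:H^2(A,\mathbb{Z})\to U^{\oplus 3}$, let $H=\phi\,\nu(G_\sigma)\,\phi^{-1}\subset O(U^{\oplus 3})$, with generator $h=\phi\,\nu(\sigma)\,\phi^{-1}$, and let $\zeta_p$ be the primitive $p$-th root of unity with $\sigma^*\omega=\zeta_p\omega$. Put $V^H=\{x\in U^{\oplus 3}\otimes\mathbb{C} : h(x)=\zeta_p x\}$ and $D^H=\{[w]\in\mathbb{P}(V^H) : (w,w)=0,\ (w,\bar w)>0\}$, the period domain of the abelian surfaces carrying a group action of this type. The family is parametrized by the quotient $\Gamma^H\backslash D^H$, where $\Gamma^H=\{\gamma\in O(U^{\oplus 3}) : \gamma H=H\gamma\}$ is a discrete group, and $\dim$ is the complex dimension of this quotient, equivalently of $D^H$. *)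

theory Defs
  imports "HOL-Analysis.Analysis" "HOL-Homology.Homology" "HOL-Algebra.Bij"
    "HOL-Algebra.Generated_Groups" "HOL-Algebra.Multiplicative_Group"
begin

section \<open>Integral lattices\<close>

record 'a zlattice = "'a monoid" +
  bform :: "'a \<Rightarrow> 'a \<Rightarrow> int"

definition isometries ::
    "('a, 'c) zlattice_scheme \<Rightarrow> ('b, 'd) zlattice_scheme \<Rightarrow> ('a \<Rightarrow> 'b) set" where
  "isometries L M =
     {h \<in> iso L M. \<forall>x\<in>carrier L. \<forall>y\<in>carrier L. bform M (h x) (h y) = bform L x y}"

definition isometric ::
    "('a, 'c) zlattice_scheme \<Rightarrow> ('b, 'd) zlattice_scheme \<Rightarrow> bool" where
  "isometric L M \<longleftrightarrow> isometries L M \<noteq> {}"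

definition isometry_group :: "('a, 'c) zlattice_scheme \<Rightarrow> ('a \<Rightarrow> 'a) monoid" where
  "isometry_group L = BijGroup (carrier L) \<lparr>carrier := isometries L L \<inter> Bij (carrier L)\<rparr>"

definition has_rank :: "('a, 'c) zlattice_scheme \<Rightarrow> nat \<Rightarrow> bool" where
  "has_rank L r \<longleftrightarrow> L \<cong> free_Abelian_group {..<r}"

definition dual_group :: "('a, 'c) monoid_scheme \<Rightarrow> ('a \<Rightarrow> int) monoid" where
  "dual_group G =
     \<lparr>carrier = hom G integer_group \<inter> extensional (carrier G),
      monoid.mult = (\<lambda>f g. \<lambda>x\<in>carrier G. f x + g x),
      one = (\<lambda>x\<in>carrier G. 0)\<rparr>"

definition discriminant_group :: "('a, 'c) zlattice_scheme \<Rightarrow> ('a \<Rightarrow> int) set monoid" where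
  "discriminant_group L =
     dual_group L Mod ((\<lambda>x. \<lambda>y\<in>carrier L. bform L x y) ` carrier L)"

definition has_length :: "('a, 'c) zlattice_scheme \<Rightarrow> nat \<Rightarrow> nat \<Rightarrow> bool" where
  "has_length L p a \<longleftrightarrow>
     discriminant_group L \<cong> product_group {..<a} (\<lambda>_. integer_mod_group p)"

definition gram_form :: "int^'n^'n \<Rightarrow> 'a^'n \<Rightarrow> 'a^'n \<Rightarrow> 'a::comm_ring_1" where
  "gram_form M x y = (\<Sum>i\<in>UNIV. \<Sum>j\<in>UNIV. x$i * of_int (M$i$j) * y$j)"

definition add_group :: "'a::ab_group_add monoid" where
  "add_group = \<lparr>carrier = UNIV, monoid.mult = (+), one = 0\<rparr>"

definition gram_lattice :: "int^'n^'n \<Rightarrow> (int^'n) zlattice" where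
  "gram_lattice M = \<lparr>carrier = UNIV, monoid.mult = (+), one = 0, bform = gram_form M\<rparr>"

definition block_sum :: "int^'m^'m \<Rightarrow> int^'n^'n \<Rightarrow> int^('m + 'n)^('m + 'n)" (infixr \<open>\<oplus>\<^sub>L\<close> 65)
  where "M \<oplus>\<^sub>L N = (\<chi> i j. case (i, j) of
           (Inl a, Inl b) \<Rightarrow> M$a$b
         | (Inr a, Inr b) \<Rightarrow> N$a$b
         | _ \<Rightarrow> 0)"

definition scaled :: "int^'n^'n \<Rightarrow> int \<Rightarrow> int^'n^'n" where
  "scaled M k = (\<chi> i j. k * M$i$j)"

definition gram_U :: "int^2^2" where
  "gram_U = vector [vector [0, 1], vector [1, 0]]"

definition gram_A2 :: "int^2^2" where
  "gram_A2 = vector [vector [2, 1], vector [1, 2]]"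

definition gram_H5 :: "int^2^2" where
  "gram_H5 = vector [vector [2, 1], vector [1, -2]]"

definition gram_single :: "int \<Rightarrow> int^1^1" where
  "gram_single k = vector [vector [k]]"


section \<open>Singular cohomology with integer coefficients\<close>

definition cochain_group :: "nat \<Rightarrow> 'a topology \<Rightarrow> ('a chain \<Rightarrow> int) monoid" where
  "cochain_group p X = dual_group (chain_group p X)"

definition coboundary :: "nat \<Rightarrow> 'a topology \<Rightarrow> ('a chain \<Rightarrow> int) \<Rightarrow> 'a chain \<Rightarrow> int" where
  "coboundary p X f =
     (\<lambda>c\<in>carrier (chain_group (Suc p) X). f (chain_boundary (Suc p) c))"

definition cocycles :: "nat \<Rightarrow> 'a topology \<Rightarrow> ('a chain \<Rightarrow> int) set" where
  "cocycles p X =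
     {f \<in> carrier (cochain_group p X). coboundary p X f = \<one>\<^bsub>cochain_group (Suc p) X\<^esub>}"

definition coboundaries :: "nat \<Rightarrow> 'a topology \<Rightarrow> ('a chain \<Rightarrow> int) set" where
  "coboundaries p X =
     (case p of
        0 \<Rightarrow> {\<one>\<^bsub>cochain_group 0 X\<^esub>}
      | Suc q \<Rightarrow> coboundary q X ` carrier (cochain_group q X))"

definition cohomology_group :: "nat \<Rightarrow> 'a topology \<Rightarrow> ('a chain \<Rightarrow> int) set monoid" where
  "cohomology_group p X = (cochain_group p X\<lparr>carrier := cocycles p X\<rparr>) Mod coboundaries p X"

definition pullback_cochain ::
    "nat \<Rightarrow> 'a topology \<Rightarrow> ('a \<Rightarrow> 'b) \<Rightarrow> ('b chain \<Rightarrow> int) \<Rightarrow> 'a chain \<Rightarrow> int" where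
  "pullback_cochain p X g f = (\<lambda>c\<in>carrier (chain_group p X). f (chain_map p g c))"

text \<open>
  Cohomology classes are cosets of the coboundaries. Below, the set of all cochains obtained
  from representatives is saturated by adding the coboundaries, which gives a single coset.
\<close>

definition pullback_class ::
    "nat \<Rightarrow> 'a topology \<Rightarrow> ('a \<Rightarrow> 'b) \<Rightarrow> ('b chain \<Rightarrow> int) set \<Rightarrow> ('a chain \<Rightarrow> int) set" where
  "pullback_class p X g x =
     coboundaries p X <#>\<^bsub>cochain_group p X\<^esub> (pullback_cochain p X g ` x)"

definition front_face ::
    "nat \<Rightarrow> ((nat \<Rightarrow> real) \<Rightarrow> 'a) \<Rightarrow> (nat \<Rightarrow> real) \<Rightarrow> 'a" where
  "front_face p s = restrict s (standard_simplex p)"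

definition back_face ::
    "nat \<Rightarrow> nat \<Rightarrow> ((nat \<Rightarrow> real) \<Rightarrow> 'a) \<Rightarrow> (nat \<Rightarrow> real) \<Rightarrow> 'a" where
  "back_face p q s =
     (\<lambda>x\<in>standard_simplex q. s (\<lambda>i. if i < p then 0 else x (i - p)))"

definition cup_cochain ::
    "nat \<Rightarrow> nat \<Rightarrow> 'a topology \<Rightarrow> ('a chain \<Rightarrow> int) \<Rightarrow> ('a chain \<Rightarrow> int) \<Rightarrow> 'a chain \<Rightarrow> int" where
  "cup_cochain p q X f g =
     (\<lambda>c\<in>carrier (chain_group (p + q) X).
        \<Sum>s\<in>Poly_Mapping.keys c.
          Poly_Mapping.lookup c s * (f (frag_of (front_face p s)) * g (frag_of (back_face p q s))))"

definition cup_class ::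
    "nat \<Rightarrow> nat \<Rightarrow> 'a topology \<Rightarrow> ('a chain \<Rightarrow> int) set \<Rightarrow> ('a chain \<Rightarrow> int) set
       \<Rightarrow> ('a chain \<Rightarrow> int) set" where
  "cup_class p q X x y =
     coboundaries (p + q) X <#>\<^bsub>cochain_group (p + q) X\<^esub> {cup_cochain p q X f g | f g. f \<in> x \<and> g \<in> y}"


section \<open>Complex tori of dimension 2\<close>

type_synonym torus_point = "(complex^2) set"

definition lattice_basis :: "(nat \<Rightarrow> complex^2) \<Rightarrow> (complex^2) set \<Rightarrow> bool" where
  "lattice_basis b \<Lambda> \<longleftrightarrow>
     inj_on b {..<4} \<and> independent (b ` {..<4}) \<and>
     \<Lambda> = {\<Sum>i<4. real_of_int (k i) *\<^sub>R b i | k. True}"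

definition complex_lattice :: "(complex^2) set \<Rightarrow> bool" where
  "complex_lattice \<Lambda> \<longleftrightarrow> (\<exists>b. lattice_basis b \<Lambda>)"

definition torus_proj :: "(complex^2) set \<Rightarrow> complex^2 \<Rightarrow> torus_point" where
  "torus_proj \<Lambda> z = \<Lambda> #>\<^bsub>add_group\<^esub> z"

definition torus_group :: "(complex^2) set \<Rightarrow> torus_point monoid" where
  "torus_group \<Lambda> = add_group Mod \<Lambda>"

definition torus_space :: "(complex^2) set \<Rightarrow> torus_point topology" where
  "torus_space \<Lambda> =
     topology (\<lambda>U. U \<subseteq> carrier (torus_group \<Lambda>) \<and> open {z. torus_proj \<Lambda> z \<in> U})"

definition holomorphic_fun :: "(complex^'n \<Rightarrow> complex) \<Rightarrow> (complex^'n) set \<Rightarrow> bool" where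
  "holomorphic_fun f S \<longleftrightarrow>
     (\<forall>z\<in>S. \<exists>L. (f has_derivative L) (at z) \<and> Vector_Spaces.linear (*s) (*) L)"

definition holomorphic_map :: "(complex^'n \<Rightarrow> complex^'m) \<Rightarrow> (complex^'n) set \<Rightarrow> bool" where
  "holomorphic_map F S \<longleftrightarrow> (\<forall>i. holomorphic_fun (\<lambda>z. F z $ i) S)"

text \<open>
  The charts of the torus are the local inverses of the projection, so a local lift is the
  expression of a self-map of the torus in charts.
\<close>

definition local_lift ::
    "(complex^2) set \<Rightarrow> (torus_point \<Rightarrow> torus_point) \<Rightarrow> (complex^2) set
       \<Rightarrow> (complex^2 \<Rightarrow> complex^2) \<Rightarrow> bool" where
  "local_lift \<Lambda> s U F \<longleftrightarrow>
     open U \<and> holomorphic_map F U \<and> (\<forall>w\<in>U. s (torus_proj \<Lambda> w) = torus_proj \<Lambda> (F w))"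

definition torus_holomorphic :: "(complex^2) set \<Rightarrow> (torus_point \<Rightarrow> torus_point) \<Rightarrow> bool" where
  "torus_holomorphic \<Lambda> s \<longleftrightarrow> (\<forall>z. \<exists>U F. z \<in> U \<and> local_lift \<Lambda> s U F)"

definition Aut0 :: "(complex^2) set \<Rightarrow> (torus_point \<Rightarrow> torus_point) monoid" where
  "Aut0 \<Lambda> = AutoGroup (torus_group \<Lambda>)
     \<lparr>carrier := {s \<in> auto (torus_group \<Lambda>).
        torus_holomorphic \<Lambda> s \<and>
        torus_holomorphic \<Lambda> (inv_into (carrier (torus_group \<Lambda>)) s)}\<rparr>"

definition neg_id :: "(complex^2) set \<Rightarrow> torus_point \<Rightarrow> torus_point" where
  "neg_id \<Lambda> = (\<lambda>x\<in>carrier (torus_group \<Lambda>). inv\<^bsub>torus_group \<Lambda>\<^esub> x)"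

definition G_sigma ::
    "(complex^2) set \<Rightarrow> (torus_point \<Rightarrow> torus_point) \<Rightarrow> (torus_point \<Rightarrow> torus_point) set" where
  "G_sigma \<Lambda> \<sigma> = generate (Aut0 \<Lambda>) {\<sigma>, neg_id \<Lambda>}"


subsection \<open>Holomorphic 2-forms\<close>

text \<open>
  The projection from \<^term>\<open>UNIV :: (complex^2) set\<close> identifies every tangent space of the
  torus with \<^typ>\<open>complex^2\<close>.
\<close>

definition tangent_map ::
    "(complex^2) set \<Rightarrow> (torus_point \<Rightarrow> torus_point) \<Rightarrow> torus_point \<Rightarrow> complex^2 \<Rightarrow> complex^2" where
  "tangent_map \<Lambda> s x =
     (THE L. \<exists>z U F. x = torus_proj \<Lambda> z \<and> z \<in> U \<and> local_lift \<Lambda> s U F \<and> (F has_derivative L) (at z))"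

definition H20 :: "(complex^2) set \<Rightarrow> (torus_point \<Rightarrow> complex^2 \<Rightarrow> complex^2 \<Rightarrow> complex) set" where
  "H20 \<Lambda> =
     {\<omega> \<in> extensional (carrier (torus_group \<Lambda>)).
        (\<forall>x\<in>carrier (torus_group \<Lambda>). \<forall>u.
           Vector_Spaces.linear (*s) (*) (\<lambda>v. \<omega> x u v) \<and>
           Vector_Spaces.linear (*s) (*) (\<lambda>v. \<omega> x v u) \<and>
           \<omega> x u u = 0) \<and>
        (\<forall>u v. holomorphic_fun (\<lambda>z. \<omega> (torus_proj \<Lambda> z) u v) UNIV)}"

definition pullback_form ::
    "(complex^2) set \<Rightarrow> (torus_point \<Rightarrow> torus_point)
       \<Rightarrow> (torus_point \<Rightarrow> complex^2 \<Rightarrow> complex^2 \<Rightarrow> complex)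
       \<Rightarrow> torus_point \<Rightarrow> complex^2 \<Rightarrow> complex^2 \<Rightarrow> complex" where
  "pullback_form \<Lambda> s \<omega> =
     (\<lambda>x\<in>carrier (torus_group \<Lambda>). \<lambda>u v. \<omega> (s x) (tangent_map \<Lambda> s x u) (tangent_map \<Lambda> s x v))"

definition symplectic :: "(complex^2) set \<Rightarrow> (torus_point \<Rightarrow> torus_point) \<Rightarrow> bool" where
  "symplectic \<Lambda> \<sigma> \<longleftrightarrow> (\<forall>\<omega>\<in>H20 \<Lambda>. pullback_form \<Lambda> \<sigma> \<omega> = \<omega>)"

definition form_eigenvalue :: "(complex^2) set \<Rightarrow> (torus_point \<Rightarrow> torus_point) \<Rightarrow> complex" where
  "form_eigenvalue \<Lambda> \<sigma> =
     (THE \<zeta>. \<forall>\<omega>\<in>H20 \<Lambda>. pullback_form \<Lambda> \<sigma> \<omega> = (\<lambda>x\<in>carrier (torus_group \<Lambda>). \<lambda>u v. \<zeta> * \<omega> x u v))"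


subsection \<open>The second cohomology lattice\<close>

definition real_coords :: "complex^2 \<Rightarrow> real^4" where
  "real_coords z = vector [Re (z$1), Im (z$1), Re (z$2), Im (z$2)]"

definition positive_basis :: "(nat \<Rightarrow> complex^2) \<Rightarrow> (complex^2) set \<Rightarrow> bool" where
  "positive_basis b \<Lambda> \<longleftrightarrow>
     lattice_basis b \<Lambda> \<and>
     det (vector [real_coords (b 0), real_coords (b 1), real_coords (b 2), real_coords (b 3)]
            :: real^4^4) > 0"

definition affine_simplex ::
    "(complex^2) set \<Rightarrow> nat \<Rightarrow> (nat \<Rightarrow> complex^2) \<Rightarrow> (nat \<Rightarrow> real) \<Rightarrow> torus_point" where
  "affine_simplex \<Lambda> p v = (\<lambda>x\<in>standard_simplex p. torus_proj \<Lambda> (\<Sum>i\<le>p. x i *\<^sub>R v i))"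

text \<open>
  The fundamental class of the torus for its complex orientation is represented by the
  fundamental parallelotope of a positively oriented basis \<open>b\<close> of \<open>\<Lambda>\<close>, cut into the simplices
  with vertices \<open>0, b (\<pi> 0), b (\<pi> 0) + b (\<pi> 1), \<dots>\<close>. Opposite sides of the parallelotope are
  identified in the torus, so this chain is a cycle; its class does not depend on \<open>b\<close>.
\<close>

definition parallelotope_cycle ::
    "(complex^2) set \<Rightarrow> (nat \<Rightarrow> complex^2) \<Rightarrow> torus_point chain" where
  "parallelotope_cycle \<Lambda> b =
     (\<Sum>\<pi> | \<pi> permutes {..<4}.
        frag_cmul (sign \<pi>) (frag_of (affine_simplex \<Lambda> 4 (\<lambda>k. \<Sum>j<k. b (\<pi> j)))))"

definition fundamental_cycle :: "(complex^2) set \<Rightarrow> torus_point chain" where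
  "fundamental_cycle \<Lambda> = parallelotope_cycle \<Lambda> (SOME b. positive_basis b \<Lambda>)"

text \<open>The isomorphism from \<open>H\<^sup>4\<close> to the integers is evaluation on the fundamental class.\<close>

definition integrate_class :: "(complex^2) set \<Rightarrow> (torus_point chain \<Rightarrow> int) set \<Rightarrow> int" where
  "integrate_class \<Lambda> y = the_elem ((\<lambda>f. f (fundamental_cycle \<Lambda>)) ` y)"

definition H2_lattice :: "(complex^2) set \<Rightarrow> (torus_point chain \<Rightarrow> int) set zlattice" where
  "H2_lattice \<Lambda> =
     \<lparr>carrier = carrier (cohomology_group 2 (torus_space \<Lambda>)),
      monoid.mult = monoid.mult (cohomology_group 2 (torus_space \<Lambda>)),
      one = one (cohomology_group 2 (torus_space \<Lambda>)),
      bform = (\<lambda>x y. integrate_class \<Lambda> (cup_class 2 2 (torus_space \<Lambda>) x y))\<rparr>"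

definition nu ::
    "(complex^2) set \<Rightarrow> (torus_point \<Rightarrow> torus_point)
       \<Rightarrow> (torus_point chain \<Rightarrow> int) set \<Rightarrow> (torus_point chain \<Rightarrow> int) set" where
  "nu \<Lambda> s = (\<lambda>x\<in>carrier (H2_lattice \<Lambda>). pullback_class 2 (torus_space \<Lambda>) s x)"

definition invariant_lattice ::
    "(complex^2) set \<Rightarrow> (torus_point \<Rightarrow> torus_point) \<Rightarrow> (torus_point chain \<Rightarrow> int) set zlattice" where
  "invariant_lattice \<Lambda> \<sigma> =
     H2_lattice \<Lambda>\<lparr>carrier := {x \<in> carrier (H2_lattice \<Lambda>). \<forall>g\<in>G_sigma \<Lambda> \<sigma>. nu \<Lambda> g x = x}\<rparr>"


section \<open>Period domains and the dimension of the family\<close>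

definition complex_submanifold :: "nat \<Rightarrow> (complex^'n) set \<Rightarrow> bool" where
  "complex_submanifold d M \<longleftrightarrow>
     (\<forall>w\<in>M. \<exists>W (\<psi> :: complex^'n \<Rightarrow> complex^'n) I.
        open W \<and> w \<in> W \<and> inj_on \<psi> W \<and> open (\<psi> ` W) \<and>
        holomorphic_map \<psi> W \<and> holomorphic_map (inv_into W \<psi>) (\<psi> ` W) \<and>
        card I = d \<and> \<psi> ` (M \<inter> W) = {z \<in> \<psi> ` W. \<forall>i. i \<notin> I \<longrightarrow> z$i = 0})"

definition complex_line :: "complex^'n \<Rightarrow> (complex^'n) set" where
  "complex_line w = range (\<lambda>c. c *s w)"

text \<open>
  Points of projective space are lines through the origin. The standard chart where the
  \<open>i\<close>-th homogeneous coordinate does not vanish is the affine hyperplane \<open>w$i = 1\<close>.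
\<close>

definition projective_dimension :: "(complex^'n) set set \<Rightarrow> nat \<Rightarrow> bool" where
  "projective_dimension D d \<longleftrightarrow>
     D \<noteq> {} \<and> (\<forall>i. complex_submanifold d {w. w$i = 1 \<and> complex_line w \<in> D})"

abbreviation gram_U3 :: "int^(2 + 2 + 2)^(2 + 2 + 2)" where
  "gram_U3 \<equiv> gram_U \<oplus>\<^sub>L gram_U \<oplus>\<^sub>L gram_U"

definition complex_extension :: "(int^'n \<Rightarrow> int^'n) \<Rightarrow> complex^'n \<Rightarrow> complex^'n" where
  "complex_extension h x = (\<Sum>j\<in>UNIV. x$j *s (\<chi> i. of_int (h (axis j 1) $ i)))"

text \<open>
  For a form with integer Gram matrix that is symmetric, \<open>(w, \<bar>w)\<close> is real, so taking its
  real part only changes the type.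
\<close>

definition period_domain ::
    "int^'n^'n \<Rightarrow> (int^'n \<Rightarrow> int^'n) \<Rightarrow> complex \<Rightarrow> (complex^'n) set set" where
  "period_domain M h \<zeta> =
     {complex_line w | w.
        complex_extension h w = \<zeta> *s w \<and> gram_form M w w = 0 \<and>
        Re (gram_form M w (\<chi> i. cnj (w$i))) > 0}"

definition marking ::
    "(complex^2) set \<Rightarrow> ((torus_point chain \<Rightarrow> int) set \<Rightarrow> int^(2 + 2 + 2)) \<Rightarrow> bool" where
  "marking \<Lambda> \<phi> \<longleftrightarrow> \<phi> \<in> isometries (H2_lattice \<Lambda>) (gram_lattice gram_U3)"

text \<open>The dimension is required to be \<open>d\<close> for every choice of the marking.\<close>

definition family_dimension ::
    "(complex^2) set \<Rightarrow> (torus_point \<Rightarrow> torus_point) \<Rightarrow> nat \<Rightarrow> bool" where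
  "family_dimension \<Lambda> \<sigma> d \<longleftrightarrow>
     (\<exists>\<phi>. marking \<Lambda> \<phi>) \<and>
     (\<forall>\<phi>. marking \<Lambda> \<phi> \<longrightarrow>
        projective_dimension
          (period_domain gram_U3
             (\<lambda>x. \<phi> (nu \<Lambda> \<sigma> (inv_into (carrier (H2_lattice \<Lambda>)) \<phi> x)))
             (form_eigenvalue \<Lambda> \<sigma>)) d)"

definition invariants ::
    "(complex^2) set \<Rightarrow> (torus_point \<Rightarrow> torus_point) \<Rightarrow> nat \<Rightarrow> nat \<times> nat \<times> nat \<times> nat \<Rightarrow> bool" where
  "invariants \<Lambda> \<sigma> p = (\<lambda>(q, r, d, a).
     p = q \<and> has_rank (invariant_lattice \<Lambda> \<sigma>) r \<and> family_dimension \<Lambda> \<sigma> d \<and>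
     has_length (invariant_lattice \<Lambda> \<sigma>) p a)"

end

theory Submission
  imports Defs "HOL-Complex_Analysis.Cauchy_Integral_Formula" "HOL-Computational_Algebra.Primes"
begin

text \<open>
  A class of degree two on the torus is determined by the integral alternating form that it induces on
  the lattice \<open>\<Lambda>\<close>: a cocycle is evaluated on the tori spanned by pairs of lattice vectors, and pulled back
  to \<open>\<complex>\<^sup>2\<close> it is a coboundary. The cup product becomes the Pfaffian pairing, and an automorphism with
  linear lift \<open>L\<close> acts by the second exterior power of \<open>L\<close>, with eigenvalue \<open>det L\<close> on the two-form.

  If the action has prime order \<open>p\<close> then \<open>L\<close> or \<open>- L\<close> has order \<open>p\<close>, or \<open>p = 2\<close> and \<open>L\<^sup>2 = - 1\<close>.
  Integrality of the characteristic polynomial leaves \<open>p = 2, 3, 5\<close>. A tuple of lattice vectors of least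
  nonzero volume among those of a prescribed shape is a basis in which \<open>L\<close> is one of five matrices.
  The period domain lies in an eigenspace \<open>V\<close>: if the eigenvalue is not \<open>- 1\<close>, the quadratic form vanishes
  on \<open>V\<close> and the dimension is \<open>dim V - 1\<close>; otherwise the domain is a quadric of dimension \<open>dim V - 2\<close>.
\<close>

section \<open>Complex tori as quotients\<close>

text \<open>The comparison with alternating forms is group cohomology in disguise: the torus is a
  classifying space of \<Lambda>, and the simplices \<open>bar\<close> realise the bar complex of
  \<Lambda>. The least-volume argument replaces module theory over Z[i], the Eisenstein integers and
  the ring generated by a fifth root of unity. A lattice vector with non-integral coordinates is
  reduced modulo integral combinations, and the tuple rebuilt from the remainder has its volume
  multiplied by the norm of the remainder, which is below 1 because these rings are norm-Euclidean.
  The adapted basis may have either orientation, whereas the intersection form refers to the complex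
  one; the sign \<open>\<epsilon>\<close> keeps track of this. It is 1 when the automorphism is a
  scalar. In the other cases the invariant lattice is U, U(k), the sum of <2> and <-2>, or H5, all
  isometric to their negatives, so that the sign can be absorbed. Lattices of equal rank are told
  apart by how the fixed sublattice is glued to a complement: by divisibility of the gluing data by
  p, and for p = 2 also by the parity of a minor.\<close>

lemma add_group_simps [simp]:
  "carrier add_group = UNIV" "x \<otimes>\<^bsub>add_group\<^esub> y = x + y" "\<one>\<^bsub>add_group\<^esub> = 0"
  by (simp_all add: add_group_def)

lemma comm_group_add_group: "comm_group (add_group :: 'a::ab_group_add monoid)"
proof (rule comm_groupI)
  fix x :: 'a
  show "\<exists>y\<in>carrier add_group. y \<otimes>\<^bsub>add_group\<^esub> x = \<one>\<^bsub>add_group\<^esub>"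
    by (rule bexI[of _ "- x"]) auto
qed (auto simp: ac_simps)

lemma inv_add_group [simp]: "inv\<^bsub>add_group\<^esub> x = - x"
  by (rule group.inv_equality) (auto intro: comm_group.axioms comm_group_add_group)

text \<open>The basis is a parameter, because one lattice is used with several bases: an arbitrary
  one, a positively oriented one and one adapted to the automorphism.\<close>

locale torus =
  fixes \<Lambda> :: "(complex^2) set" and b :: "nat \<Rightarrow> complex^2"
  assumes basis: "lattice_basis b \<Lambda>"
begin

lemma inj_b: "inj_on b {..<4}" and indep_b: "independent (b ` {..<4})"
  and lattice_eq: "\<Lambda> = {\<Sum>i<4. of_int (k i) *\<^sub>R b i | k. True}"
  using basis by (auto simp: lattice_basis_def)

lemma comb_in_lattice: "(\<Sum>i<4. of_int (k i) *\<^sub>R b i) \<in> \<Lambda>"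
  unfolding lattice_eq by (rule CollectI, rule exI[of _ k]) simp

lemma span_b: "span (b ` {..<4}) = UNIV"
proof -
  have "card (b ` {..<4}) = 4" by (simp add: card_image inj_b)
  then have "(UNIV :: (complex^2) set) \<subseteq> span (b ` {..<4})"
    by (intro card_ge_dim_independent indep_b) (auto simp: dim_UNIV)
  then show ?thesis by blast
qed

section \<open>Real coordinates with respect to the lattice basis\<close>

definition crd :: "complex^2 \<Rightarrow> nat \<Rightarrow> real" where
  "crd z i = representation (b ` {..<4}) z (b i)"

lemma linear_crd: "linear (\<lambda>z. crd z i)"
  by (rule linearI) (simp_all add: crd_def real_vector.representation_add real_vector.representation_scale indep_b span_b)

lemma crd_add [simp]: "crd (z + w) i = crd z i + crd w i"
  and crd_diff [simp]: "crd (z - w) i = crd z i - crd w i"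
  and crd_minus [simp]: "crd (- z) i = - crd z i"
  and crd_scaleR [simp]: "crd (c *\<^sub>R z) i = c * crd z i"
  and crd_0 [simp]: "crd 0 i = 0"
  and crd_sum: "crd (sum f A) i = (\<Sum>a\<in>A. crd (f a) i)"
  using linear_add[OF linear_crd] linear_diff[OF linear_crd] linear_neg[OF linear_crd]
    linear_cmul[OF linear_crd] linear_0[OF linear_crd] linear_sum[OF linear_crd] by auto

lemma crd_b: "i < 4 \<Longrightarrow> j < 4 \<Longrightarrow> crd (b i) j = (if i = j then 1 else 0)"
  using inj_b by (auto simp: crd_def real_vector.representation_basis indep_b inj_on_def)

lemma sum_crd: "(\<Sum>i<4. crd z i *\<^sub>R b i) = z"
proof -
  have "(\<Sum>v\<in>b ` {..<4}. representation (b ` {..<4}) z v *\<^sub>R v) = z"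
    by (rule real_vector.sum_representation_eq) (auto simp: indep_b span_b)
  then show ?thesis by (simp add: sum.reindex inj_b crd_def)
qed

lemma crd_eqI: "(\<And>i. i < 4 \<Longrightarrow> crd z i = crd w i) \<Longrightarrow> z = w"
  using sum_crd[of z] sum_crd[of w] by (metis (no_types, lifting) lessThan_iff sum.cong)

lemma crd_comb: "j < 4 \<Longrightarrow> crd (\<Sum>i<4. x i *\<^sub>R b i) j = x j"
  by (simp add: crd_sum crd_b if_distrib cong: if_cong)

lemma continuous_on_crd [continuous_intros]:
  "continuous_on S f \<Longrightarrow> continuous_on S (\<lambda>x. crd (f x) i)"
  by (rule continuous_on_compose2[OF linear_continuous_on[of "\<lambda>z. crd z i" UNIV]])
    (auto simp: linear_conv_bounded_linear[symmetric] linear_crd)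

lemma mem_lattice_iff: "z \<in> \<Lambda> \<longleftrightarrow> (\<forall>i<4. crd z i \<in> \<int>)"
proof
  assume "z \<in> \<Lambda>"
  then show "\<forall>i<4. crd z i \<in> \<int>" by (auto simp: lattice_eq crd_comb)
next
  assume *: "\<forall>i<4. crd z i \<in> \<int>"
  have "z = (\<Sum>i<4. of_int \<lfloor>crd z i\<rfloor> *\<^sub>R b i)"
    by (rule crd_eqI) (use * in \<open>auto simp: crd_comb elim!: Ints_cases\<close>)
  then show "z \<in> \<Lambda>" using comb_in_lattice[of "\<lambda>i. \<lfloor>crd z i\<rfloor>"] by simp
qed

lemma crd_lattice: "z \<in> \<Lambda> \<Longrightarrow> i < 4 \<Longrightarrow> of_int \<lfloor>crd z i\<rfloor> = crd z i"
  by (auto simp: mem_lattice_iff elim!: Ints_cases)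

lemma lattice_0 [simp]: "0 \<in> \<Lambda>"
  and lattice_add: "x \<in> \<Lambda> \<Longrightarrow> y \<in> \<Lambda> \<Longrightarrow> x + y \<in> \<Lambda>"
  and lattice_minus: "x \<in> \<Lambda> \<Longrightarrow> - x \<in> \<Lambda>"
  and lattice_diff: "x \<in> \<Lambda> \<Longrightarrow> y \<in> \<Lambda> \<Longrightarrow> x - y \<in> \<Lambda>"
  and lattice_zmul: "x \<in> \<Lambda> \<Longrightarrow> of_int k *\<^sub>R x \<in> \<Lambda>"
  and b_in_lattice: "i < 4 \<Longrightarrow> b i \<in> \<Lambda>"
  by (auto simp: mem_lattice_iff crd_b)

lemma lattice_sum: "(\<And>i. i \<in> I \<Longrightarrow> f i \<in> \<Lambda>) \<Longrightarrow> sum f I \<in> \<Lambda>"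
  by (induction I rule: infinite_finite_induct) (auto intro: lattice_add)

text \<open>A lattice is discrete: each coordinate is a continuous integer-valued function, hence
  constant on a connected set. This gives uniqueness of lifts of simplices, and linearity and
  uniqueness of the derivative for lifts of automorphisms.\<close>

lemma continuous_into_lattice:
  fixes f :: "'a::topological_space \<Rightarrow> complex^2"
  assumes "connected S" "continuous_on S f" "\<And>x. x \<in> S \<Longrightarrow> f x \<in> \<Lambda>" "x \<in> S" "y \<in> S"
  shows "f x = f y"
proof (rule crd_eqI)
  fix i :: nat assume i: "i < 4"
  have "(\<lambda>x. crd (f x) i) constant_on S"
  proof (rule continuous_discrete_range_constant[OF assms(1)])
    show "continuous_on S (\<lambda>x. crd (f x) i)" by (intro continuous_intros assms)
    fix x assume x: "x \<in> S"
    have "1 \<le> norm (crd (f y) i - crd (f x) i)" if "y \<in> S" "crd (f y) i \<noteq> crd (f x) i" for y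
    proof -
      have "crd (f y) i - crd (f x) i \<in> \<int>"
        using x that i assms(3) by (auto simp: mem_lattice_iff intro!: Ints_diff)
      then show ?thesis using that by (simp add: Ints_nonzero_abs_ge1)
    qed
    then show "\<exists>e>0. \<forall>y. y \<in> S \<and> crd (f y) i \<noteq> crd (f x) i \<longrightarrow> e \<le> norm (crd (f y) i - crd (f x) i)"
      by (intro exI[of _ 1]) auto
  qed
  with assms(4,5) show "crd (f x) i = crd (f y) i" by (auto simp: constant_on_def)
qed

text \<open>The lattice point such that \<open>z - fl z\<close> lies in the half-open fundamental
  parallelotope. It commutes with translations by \<Lambda> but is not continuous, which is harmless
  since cochains are arbitrary functions on simplices.\<close>

definition fl :: "complex^2 \<Rightarrow> complex^2" where
  "fl z = (\<Sum>i<4. of_int \<lfloor>crd z i\<rfloor> *\<^sub>R b i)"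

lemma fl_lattice: "fl z \<in> \<Lambda>"
  unfolding fl_def by (rule comb_in_lattice)

lemma fl_add: "l \<in> \<Lambda> \<Longrightarrow> fl (z + l) = fl z + l"
proof (rule crd_eqI)
  fix i :: nat assume "l \<in> \<Lambda>" "i < 4"
  then obtain k where "crd l i = of_int k" by (auto simp: mem_lattice_iff elim!: Ints_cases)
  with \<open>i < 4\<close> show "crd (fl (z + l)) i = crd (fl z + l) i" by (simp add: fl_def crd_comb)
qed

lemma fl_0 [simp]: "fl 0 = 0" by (simp add: fl_def)

lemma fl_id: "l \<in> \<Lambda> \<Longrightarrow> fl l = l" using fl_add[of l 0] by simp

section \<open>The quotient map, its group structure and its topology\<close>

abbreviation proj where "proj \<equiv> torus_proj \<Lambda>"

lemma normal_lattice: "\<Lambda> \<lhd> add_group"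
proof -
  interpret comm_group "add_group :: (complex^2) monoid" by (rule comm_group_add_group)
  have "subgroup \<Lambda> add_group" by (rule subgroupI) (auto simp: lattice_add lattice_minus intro: lattice_0)
  then show ?thesis by (rule subgroup_imp_normal)
qed

lemma mem_proj: "w \<in> proj z \<longleftrightarrow> w - z \<in> \<Lambda>"
  by (auto simp: torus_proj_def r_coset_def algebra_simps) (metis add.commute diff_add_cancel)

lemma proj_eq_iff: "proj z = proj w \<longleftrightarrow> z - w \<in> \<Lambda>"
proof
  assume "proj z = proj w"
  then have "z \<in> proj w" using mem_proj[of z z] by simp
  then show "z - w \<in> \<Lambda>" by (simp add: mem_proj)
next
  assume *: "z - w \<in> \<Lambda>"
  have "x - z \<in> \<Lambda> \<longleftrightarrow> x - w \<in> \<Lambda>" for x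
    using lattice_add[OF *, of "x - z"] lattice_diff[OF _ *, of "x - w"] by (auto simp: algebra_simps)
  then show "proj z = proj w" by (auto simp: mem_proj)
qed

lemma carrier_torus: "carrier (torus_group \<Lambda>) = range proj"
  by (auto simp: torus_group_def FactGroup_def RCOSETS_def torus_proj_def)

lemma mult_torus: "proj z \<otimes>\<^bsub>torus_group \<Lambda>\<^esub> proj w = proj (z + w)"
  using normal.rcos_sum[OF normal_lattice, of z w]
  by (simp add: torus_group_def FactGroup_def torus_proj_def)

lemma group_torus: "group (torus_group \<Lambda>)"
  unfolding torus_group_def by (rule normal.factorgroup_is_group[OF normal_lattice])

lemma one_torus: "\<one>\<^bsub>torus_group \<Lambda>\<^esub> = proj 0"
  by (auto simp: torus_group_def FactGroup_def mem_proj)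

lemma inv_torus: "inv\<^bsub>torus_group \<Lambda>\<^esub> (proj z) = proj (- z)"
  by (rule group.inv_equality[OF group_torus]) (auto simp: carrier_torus mult_torus one_torus)

lemma openin_torus:
  "openin (torus_space \<Lambda>) U \<longleftrightarrow> U \<subseteq> range proj \<and> open {z. proj z \<in> U}"
proof -
  have "istopology (\<lambda>U. U \<subseteq> range proj \<and> open {z. proj z \<in> U})"
    unfolding istopology_def
  proof (intro conjI allI impI)
    fix S T assume "S \<subseteq> range proj \<and> open {z. proj z \<in> S}" "T \<subseteq> range proj \<and> open {z. proj z \<in> T}"
    then show "open {z. proj z \<in> S \<inter> T}"
      using open_Int[of "{z. proj z \<in> S}" "{z. proj z \<in> T}"] by (simp add: Collect_conj_eq)
  next
    fix \<K> assume *: "\<forall>K\<in>\<K>. K \<subseteq> range proj \<and> open {z. proj z \<in> K}"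
    have "{z. proj z \<in> \<Union>\<K>} = (\<Union>K\<in>\<K>. {z. proj z \<in> K})" by auto
    then show "open {z. proj z \<in> \<Union>\<K>}" using * by auto
  qed auto
  then show ?thesis by (simp add: torus_space_def carrier_torus)
qed

lemma topspace_torus: "topspace (torus_space \<Lambda>) = range proj"
proof -
  have "openin (torus_space \<Lambda>) (range proj)" by (simp add: openin_torus)
  then show ?thesis by (metis openin_subset openin_topspace openin_torus subset_antisym)
qed

lemma continuous_map_proj: "continuous_map euclidean (torus_space \<Lambda>) proj"
  by (auto simp: continuous_map_def topspace_torus openin_torus)

lemma continuous_map_from_torus:
  fixes g :: "torus_point \<Rightarrow> 'a::topological_space"
  assumes "continuous_on UNIV (\<lambda>z. g (proj z))"
  shows "continuous_map (torus_space \<Lambda>) euclidean g"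
  unfolding continuous_map_def
proof (intro conjI allI impI)
  fix U :: "'a set" assume "openin euclidean U"
  then have "open ((\<lambda>z. g (proj z)) -` U)" by (intro open_vimage) (auto simp: assms)
  moreover have "{z. proj z \<in> {x \<in> topspace (torus_space \<Lambda>). g x \<in> U}} = (\<lambda>z. g (proj z)) -` U"
    by (auto simp: topspace_torus)
  ultimately show "openin (torus_space \<Lambda>) {x \<in> topspace (torus_space \<Lambda>). g x \<in> U}"
    by (auto simp: openin_torus topspace_torus)
qed auto

end

section \<open>Singular simplices of the torus\<close>

lemma singular_simplex_euclidean:
  "singular_simplex p euclidean t \<longleftrightarrow> continuous_on (standard_simplex p) t \<and> t \<in> extensional (standard_simplex p)"
  by (simp add: singular_simplex_def euclidean_product_topology)

lemma connected_standard_simplex: "connected (standard_simplex p)"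
  using connectedin_standard_simplex[of p] by (simp add: euclidean_product_topology)

text \<open>A simplex of dimension at most 3 is recovered from its first four coordinates. Its image
  under them is a convex subset of a normed space, where logarithms exist by contractibility.
  Dimension 3 is the largest in which lifts occur: there a 2-cochain is checked to be a
  cocycle.\<close>

lemma continuous_log_on_standard_simplex:
  fixes f :: "(nat \<Rightarrow> real) \<Rightarrow> complex"
  assumes p: "p \<le> 3" and f: "continuous_on (standard_simplex p) f" "\<And>x. x \<in> standard_simplex p \<Longrightarrow> f x \<noteq> 0"
  obtains g where "continuous_on (standard_simplex p) g" "\<And>x. x \<in> standard_simplex p \<Longrightarrow> f x = exp (g x)"
proof -
  define q :: "real \<times> real \<times> real \<times> real \<Rightarrow> nat \<Rightarrow> real" where
    "q = (\<lambda>(x0,x1,x2,x3) i. if i = 0 then x0 else if i = 1 then x1 else if i = 2 then x2 else if i = 3 then x3 else 0)"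
  define r :: "(nat \<Rightarrow> real) \<Rightarrow> real \<times> real \<times> real \<times> real" where "r = (\<lambda>x. (x 0, x 1, x 2, x 3))"
  define S where "S = r ` standard_simplex p"
  have qr: "q (r x) = x" if "x \<in> standard_simplex p" for x
    using that p by (auto simp: q_def r_def standard_simplex_def)
  have contq: "continuous_on UNIV q"
    unfolding q_def case_prod_unfold
  proof (rule continuous_on_coordinatewise_then_product)
    fix i :: nat
    consider "i = 0" | "i = 1" | "i = 2" | "i = 3" | "i > 3" by linarith
    then show "continuous_on UNIV (\<lambda>x :: real \<times> real \<times> real \<times> real.
        if i = 0 then fst x else if i = 1 then fst (snd x) else if i = 2 then fst (snd (snd x))
        else if i = 3 then snd (snd (snd x)) else 0)" by cases (auto intro!: continuous_intros)
  qed
  have contr: "continuous_on (standard_simplex p) r"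
    unfolding r_def by (intro continuous_intros continuous_on_subset[OF continuous_on_product_coordinates]) auto
  have "convex S"
    unfolding convex_alt
  proof (intro ballI allI impI)
    fix x y u assume "x \<in> S" "y \<in> S" and u: "0 \<le> (u::real) \<and> u \<le> 1"
    then obtain x' y' where x': "x' \<in> standard_simplex p" "x = r x'" and y': "y' \<in> standard_simplex p" "y = r y'"
      by (auto simp: S_def)
    have "(1 - u) *\<^sub>R x + u *\<^sub>R y = r (\<lambda>i. (1 - u) * x' i + u * y' i)" by (simp add: x' y' r_def)
    then show "(1 - u) *\<^sub>R x + u *\<^sub>R y \<in> S"
      using convex_standard_simplex[OF x'(1) y'(1)] u by (auto simp: S_def)
  qed
  moreover have "continuous_on S (f \<circ> q)"
    using f(1) contq by (intro continuous_on_compose) (auto simp: S_def image_image qr intro: continuous_on_subset)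
  moreover have "(f \<circ> q) z \<noteq> 0" if "z \<in> S" for z
    using that f(2) by (auto simp: S_def qr)
  ultimately obtain g where g: "continuous_on S g" "\<And>z. z \<in> S \<Longrightarrow> (f \<circ> q) z = exp (g z)"
    using continuous_logarithm_on_contractible convex_imp_contractible by blast
  show thesis
  proof
    show "continuous_on (standard_simplex p) (\<lambda>x. g (r x))"
      using g(1) contr by (rule continuous_on_compose2) (auto simp: S_def)
    show "f x = exp (g (r x))" if "x \<in> standard_simplex p" for x using g(2)[of "r x"] that by (auto simp: S_def qr)
  qed
qed

context torus
begin

section \<open>Lifting simplices to the universal cover\<close>

definition lift_of :: "nat \<Rightarrow> ((nat \<Rightarrow> real) \<Rightarrow> torus_point) \<Rightarrow> ((nat \<Rightarrow> real) \<Rightarrow> complex^2) \<Rightarrow> bool" where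
  "lift_of p s t \<longleftrightarrow> singular_simplex p euclidean t \<and> simplex_map p proj t = s"

lemma lift_ofD: "lift_of p s t \<Longrightarrow> singular_simplex p euclidean t" "lift_of p s t \<Longrightarrow> simplex_map p proj t = s"
  by (auto simp: lift_of_def)

text \<open>The functions exp(2 pi i x_j) of the lattice coordinates descend to the torus. Their
  continuous logarithms along the simplex are, divided by 2 pi i, the coordinates of a lift, up to
  integers that project to 0.\<close>

lemma ex_lift:
  assumes p: "p \<le> 3" and s: "singular_simplex p (torus_space \<Lambda>) s"
  shows "\<exists>t. lift_of p s t"
proof -
  let ?D = "standard_simplex p"
  \<comment> \<open>The representative is chosen arbitrarily: two choices differ by integers in each
    coordinate, which the exponential does not see.\<close>
  define E where "E j x = exp (2 * of_real pi * \<i> * of_real (crd (SOME z. x = proj z) j))" for j x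
  have E: "E j (proj z) = exp (2 * of_real pi * \<i> * of_real (crd z j))" if "j < 4" for j z
  proof -
    have "proj z = proj (SOME w. proj z = proj w)" by (rule someI) simp
    then have "(SOME w. proj z = proj w) - z \<in> \<Lambda>" by (metis proj_eq_iff)
    then obtain n where "crd ((SOME w. proj z = proj w) - z) j = of_int n"
      using \<open>j < 4\<close> by (auto simp: mem_lattice_iff elim!: Ints_cases)
    then have "crd (SOME w. proj z = proj w) j = crd z j + of_int n" by simp
    then show ?thesis unfolding E_def exp_eq by (intro exI[of _ n]) (simp add: algebra_simps)
  qed
  have sD: "s x \<in> range proj" if "x \<in> ?D" for x
    using s that by (auto simp: singular_simplex_def continuous_map_def topspace_torus topspace_standard_simplex)
  have "\<exists>g. continuous_on ?D g \<and> (\<forall>x\<in>?D. E j (s x) = exp (g x))" if "j < 4" for j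
  proof -
    have "continuous_map (torus_space \<Lambda>) euclidean (E j)"
      by (rule continuous_map_from_torus) (auto simp: E that intro!: continuous_intros)
    then have "continuous_map (subtopology (powertop_real UNIV) ?D) euclidean (E j \<circ> s)"
      using s by (auto simp: singular_simplex_def intro: continuous_map_compose)
    then have "continuous_on ?D (E j \<circ> s)" by (simp add: euclidean_product_topology)
    moreover have "(E j \<circ> s) x \<noteq> 0" for x by (simp add: E_def)
    ultimately show ?thesis using continuous_log_on_standard_simplex[OF p, of "E j \<circ> s"] by (metis comp_apply)
  qed
  then obtain g where g: "\<And>j. j < 4 \<Longrightarrow> continuous_on ?D (g j)"
    "\<And>j x. j < 4 \<Longrightarrow> x \<in> ?D \<Longrightarrow> E j (s x) = exp (g j x)" by metis
  define t where "t = (\<lambda>x\<in>?D. \<Sum>j<4. (Im (g j x) / (2 * pi)) *\<^sub>R b j)"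
  have "continuous_on ?D (\<lambda>x. \<Sum>j<4. (Im (g j x) / (2 * pi)) *\<^sub>R b j)"
    by (intro continuous_intros g) auto
  then have "singular_simplex p euclidean t"
    unfolding singular_simplex_euclidean t_def by (auto cong: continuous_on_cong)
  moreover have "proj (t x) = s x" if x: "x \<in> ?D" for x
  proof -
    obtain z where z: "s x = proj z" using sD[OF x] by auto
    have "t x - z \<in> \<Lambda>" unfolding mem_lattice_iff
    proof (intro allI impI)
      fix j :: nat assume j: "j < 4"
      have "exp (2 * of_real pi * \<i> * of_real (crd z j)) = exp (g j x)" using g(2)[OF j x] E[OF j, of z] z by simp
      then obtain n :: int where "g j x = 2 * of_real pi * \<i> * of_real (crd z j) + (of_int (2 * n) * pi) * \<i>"
        by (metis exp_eq)
      then have "Im (g j x) = 2 * pi * (crd z j + of_int n)" by (simp add: algebra_simps)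
      then have "crd (t x - z) j = of_int n" using x j by (simp add: t_def crd_comb)
      then show "crd (t x - z) j \<in> \<int>" by simp
    qed
    then show ?thesis using z proj_eq_iff by simp
  qed
  then have "simplex_map p proj t = s"
    using s by (auto simp: simplex_map_def singular_simplex_def extensional_def fun_eq_iff)
  ultimately show ?thesis by (auto simp: lift_of_def)
qed

definition translate :: "nat \<Rightarrow> complex^2 \<Rightarrow> ((nat \<Rightarrow> real) \<Rightarrow> complex^2) \<Rightarrow> (nat \<Rightarrow> real) \<Rightarrow> complex^2" where
  "translate p l = simplex_map p (\<lambda>z. z + l)"

lemma lift_unique:
  assumes "lift_of p s t" "lift_of p s t'"
  obtains l where "l \<in> \<Lambda>" "t' = translate p l t"
proof -
  let ?D = "standard_simplex p"
  have c: "continuous_on ?D (\<lambda>x. t' x - t x)"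
    using assms by (auto simp: lift_of_def singular_simplex_euclidean intro!: continuous_intros)
  have m: "t' x - t x \<in> \<Lambda>" if "x \<in> ?D" for x
  proof -
    have "simplex_map p proj t' x = simplex_map p proj t x" using assms by (simp add: lift_of_def)
    then show ?thesis using that by (simp add: simplex_map_def proj_eq_iff)
  qed
  obtain x0 where x0: "x0 \<in> ?D" using nonempty_standard_simplex by blast
  show thesis
  proof
    show "t' x0 - t x0 \<in> \<Lambda>" by (rule m[OF x0])
    have "t' x - t x = t' x0 - t x0" if "x \<in> ?D" for x
      by (rule continuous_into_lattice[OF connected_standard_simplex c]) (auto intro: m that x0)
    then have "t' x = t x + (t' x0 - t x0)" if "x \<in> ?D" for x using that by (metis diff_add_cancel add.commute)
    moreover have "t' \<in> extensional ?D" using assms by (auto simp: lift_of_def singular_simplex_euclidean)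
    ultimately show "t' = translate p (t' x0 - t x0) t"
      by (auto simp: translate_def simplex_map_def extensional_def fun_eq_iff)
  qed
qed

text \<open>Together with \<open>lift_unique\<close> and \<open>lift_translate\<close> this says
  that the lifts of a simplex form one orbit of \<Lambda>; a \<Lambda>-invariant function of lifts
  is therefore a cochain on the torus.\<close>

lemma singular_simplex_translate:
  "singular_simplex p euclidean t \<Longrightarrow> singular_simplex p euclidean (translate p l t)"
  unfolding translate_def by (rule singular_simplex_simplex_map) (auto intro!: continuous_intros)

lemma lift_translate:
  assumes "lift_of p s t" "l \<in> \<Lambda>"
  shows "lift_of p s (translate p l t)"
proof -
  have "proj \<circ> (\<lambda>z. z + l) = proj" using assms(2) by (simp add: proj_eq_iff fun_eq_iff)
  then have "simplex_map p proj (translate p l t) = simplex_map p proj t"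
    unfolding translate_def by (metis simplex_map_compose comp_apply)
  with assms show ?thesis by (simp add: lift_of_def singular_simplex_translate)
qed

lemma singular_simplex_proj:
  "singular_simplex p euclidean t \<Longrightarrow> singular_simplex p (torus_space \<Lambda>) (simplex_map p proj t)"
  using continuous_map_proj by (rule singular_simplex_simplex_map[rotated])

lemma lift_of_proj: "singular_simplex p euclidean t \<Longrightarrow> lift_of p (simplex_map p proj t) t"
  by (simp add: lift_of_def)

lemma lift_face:
  assumes "lift_of p s t" "1 \<le> p" "k \<le> p"
  shows "lift_of (p - 1) (singular_face p k s) (singular_face p k t)"
  using assms singular_simplex_singular_face[of p euclidean t k]
  by (auto simp: lift_of_def singular_face_simplex_map) (auto simp: singular_face_def simplex_map_def fun_eq_iff)

end

subsection \<open>Affine simplices and cones\<close>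

definition asimp :: "nat \<Rightarrow> (nat \<Rightarrow> 'a::real_normed_vector) \<Rightarrow> (nat \<Rightarrow> real) \<Rightarrow> 'a" where
  "asimp p v = (\<lambda>x\<in>standard_simplex p. \<Sum>i\<le>p. x i *\<^sub>R v i)"

lemma affine_simplex_asimp: "affine_simplex \<Lambda> p v = simplex_map p (torus_proj \<Lambda>) (asimp p v)"
  by (auto simp: affine_simplex_def simplex_map_def asimp_def fun_eq_iff)

lemma singular_simplex_asimp: "singular_simplex p euclidean (asimp p v)"
proof -
  have "continuous_on (standard_simplex p) (\<lambda>x. \<Sum>i\<le>p. x i *\<^sub>R v i)"
    by (intro continuous_intros continuous_on_subset[OF continuous_on_product_coordinates]) auto
  then show ?thesis by (auto simp: singular_simplex_euclidean asimp_def cong: continuous_on_cong)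
qed

lemma simplical_face_sum:
  fixes v :: "nat \<Rightarrow> 'a::real_vector"
  assumes "k \<le> Suc q"
  shows "(\<Sum>i\<le>Suc q. simplical_face k x i *\<^sub>R v i) = (\<Sum>i\<le>q. x i *\<^sub>R v (if i < k then i else Suc i))"
proof -
  let ?h = "\<lambda>i. if i < k then i else Suc i"
  have "(\<Sum>i\<le>Suc q. simplical_face k x i *\<^sub>R v i) = (\<Sum>i\<in>{..Suc q} - {k}. simplical_face k x i *\<^sub>R v i)"
    using assms by (subst sum.remove[of "{..Suc q}" k]) (auto simp: simplical_face_def)
  also have "\<dots> = (\<Sum>i\<le>q. x i *\<^sub>R v (?h i))"
    by (rule sum.reindex_bij_witness[of _ ?h "\<lambda>j. if j < k then j else j - 1"])
      (use assms in \<open>auto simp: simplical_face_def split: if_splits\<close>)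
  finally show ?thesis .
qed

lemma singular_face_asimp:
  assumes "k \<le> Suc q"
  shows "singular_face (Suc q) k (asimp (Suc q) v) = asimp q (\<lambda>i. v (if i < k then i else Suc i))"
proof
  fix x
  show "singular_face (Suc q) k (asimp (Suc q) v) x = asimp q (\<lambda>i. v (if i < k then i else Suc i)) x"
  proof (cases "x \<in> standard_simplex q")
    case True
    then have "simplical_face k x \<in> standard_simplex (Suc q)"
      using simplical_face_in_standard_simplex[of "Suc q" k x] assms by auto
    with True show ?thesis using simplical_face_sum[OF assms, of x v] by (simp add: singular_face_def asimp_def)
  qed (simp add: singular_face_def asimp_def)
qed

lemma asimp_cong: "(\<And>i. i \<le> p \<Longrightarrow> v i = w i) \<Longrightarrow> asimp p v = asimp p w"
  by (auto simp: asimp_def fun_eq_iff)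

text \<open>The straight cone with apex 0, the homotopy that contracts the singular complex of a
  vector space. The apex is vertex 0, so face 0 returns the base and the other faces are cones over
  faces. It is treated separately because the formula divides by \<open>1 - x 0\<close>.\<close>

definition cone :: "nat \<Rightarrow> ((nat \<Rightarrow> real) \<Rightarrow> 'a::real_normed_vector) \<Rightarrow> (nat \<Rightarrow> real) \<Rightarrow> 'a" where
  "cone p s = (\<lambda>x\<in>standard_simplex (Suc p).
     if x 0 = 1 then 0 else (1 - x 0) *\<^sub>R s (\<lambda>i. x (Suc i) / (1 - x 0)))"

lemma standard_simplex_tail:
  assumes "x \<in> standard_simplex (Suc p)" "x 0 \<noteq> 1"
  shows "(\<lambda>i. x (Suc i) / (1 - x 0)) \<in> standard_simplex p"
proof -
  have x: "\<And>i. 0 \<le> x i" "\<And>i. x i \<le> 1" "\<And>i. i > Suc p \<Longrightarrow> x i = 0" and s: "(\<Sum>i\<le>Suc p. x i) = 1"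
    using assms by (auto simp: standard_simplex_def)
  have pos: "1 - x 0 > 0" using x(2)[of 0] assms(2) by linarith
  have s': "(\<Sum>i\<le>p. x (Suc i)) = 1 - x 0"
    using s sum.atMost_Suc_shift[of x p] by simp
  have "x (Suc i) \<le> 1 - x 0" for i
  proof (cases "i \<le> p")
    case True
    then have "x (Suc i) \<le> (\<Sum>i\<le>p. x (Suc i))" by (intro member_le_sum) (auto simp: x)
    then show ?thesis using s' by simp
  qed (use x(3)[of "Suc i"] pos in auto)
  then show ?thesis
    using x pos s' by (auto simp: standard_simplex_def sum_divide_distrib[symmetric])
qed

text \<open>Away from the apex continuity is visible from the formula. At the apex it holds because
  the base is compact, so bounded by some \<open>B\<close>, and the cone has norm at most
  \<open>(1 - x 0) * B\<close>.\<close>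

lemma singular_simplex_cone:
  fixes s :: "(nat \<Rightarrow> real) \<Rightarrow> 'a::real_normed_vector"
  assumes "singular_simplex p euclidean s"
  shows "singular_simplex (Suc p) euclidean (cone p s)"
proof -
  let ?D = "standard_simplex (Suc p)"
  let ?U = "{x :: nat \<Rightarrow> real. x 0 \<noteq> 1}"
  have cs: "continuous_on (standard_simplex p) s" using assms by (simp add: singular_simplex_euclidean)
  have "compact (standard_simplex p)"
    using compactin_standard_simplex[of p] by (simp add: euclidean_product_topology)
  then have "bounded (s ` standard_simplex p)" by (intro compact_imp_bounded compact_continuous_image cs)
  then obtain B where B: "\<And>x. x \<in> standard_simplex p \<Longrightarrow> norm (s x) \<le> B"
    unfolding bounded_iff by blast
  have co: "continuous_on A (\<lambda>x. x i)" for A :: "(nat \<Rightarrow> real) set" and i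
    by (rule continuous_on_subset[OF continuous_on_product_coordinates]) auto
  have openU: "open ?U" by (rule open_Collect_neq) (auto intro: co)
  have cont: "continuous (at x within ?D) (cone p s)" if x: "x \<in> ?D" for x
  proof (cases "x 0 = 1")
    case False
    have "continuous_on (?D \<inter> ?U) (\<lambda>x. (1 - x 0) *\<^sub>R s (\<lambda>i. x (Suc i) / (1 - x 0)))"
      by (intro continuous_intros co continuous_on_compose2[OF cs]) (auto simp: standard_simplex_tail)
    then have "continuous_on (?D \<inter> ?U) (cone p s)" by (rule continuous_on_eq) (auto simp: cone_def)
    then have "continuous (at x within ?D \<inter> ?U) (cone p s)"
      using x False by (auto simp: continuous_on_eq_continuous_within)
    moreover have "at x within ?D \<inter> ?U = at x within ?D" by (rule at_within_nhd[of x ?U]) (use False openU in auto)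
    ultimately show ?thesis by simp
  next
    case True
    have "((\<lambda>y. (1 - y 0) * B) \<longlongrightarrow> (1 - x 0) * B) (at x within ?D)"
      using co[of UNIV 0] by (intro tendsto_intros) (auto simp: continuous_on_def intro: tendsto_within_subset)
    then have lim: "((\<lambda>y. (1 - y 0) * B) \<longlongrightarrow> 0) (at x within ?D)" using True by simp
    have le: "norm (cone p s y) \<le> (1 - y 0) * B" if "y \<in> ?D" for y
    proof (cases "y 0 = 1")
      case F: False
      have "0 \<le> 1 - y 0" using that by (auto simp: standard_simplex_def)
      with B[OF standard_simplex_tail[OF that F]] that F show ?thesis by (auto simp: cone_def intro!: mult_left_mono)
    qed (use that in \<open>auto simp: cone_def\<close>)
    have "(cone p s \<longlongrightarrow> 0) (at x within ?D)"
      by (rule Lim_null_comparison[OF _ lim]) (use le in \<open>auto simp: eventually_at_topological\<close>)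
    then show ?thesis using True x by (simp add: continuous_within cone_def)
  qed
  have "cone p s \<in> extensional ?D" by (simp add: cone_def)
  with cont show ?thesis
    by (simp add: singular_simplex_euclidean continuous_on_eq_continuous_within)
qed

lemma singular_face_cone_0:
  assumes "singular_simplex p euclidean s"
  shows "singular_face (Suc p) 0 (cone p s) = s"
proof
  fix x
  have "simplical_face 0 x \<in> standard_simplex (Suc p)" if "x \<in> standard_simplex p"
    using simplical_face_in_standard_simplex[of "Suc p" 0 x] that by auto
  then show "singular_face (Suc p) 0 (cone p s) x = s x"
    using assms by (auto simp: singular_face_def cone_def simplical_face_def singular_simplex_euclidean extensional_def)
qed

lemma singular_face_cone_Suc:
  assumes "k \<le> Suc p"
  shows "singular_face (Suc (Suc p)) (Suc k) (cone (Suc p) s) = cone p (singular_face (Suc p) k s)"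
proof
  fix x
  show "singular_face (Suc (Suc p)) (Suc k) (cone (Suc p) s) x = cone p (singular_face (Suc p) k s) x"
  proof (cases "x \<in> standard_simplex (Suc p)")
    case True
    then have 1: "simplical_face (Suc k) x \<in> standard_simplex (Suc (Suc p))"
      using simplical_face_in_standard_simplex[of "Suc (Suc p)" "Suc k" x] assms by auto
    have "(\<lambda>i. simplical_face (Suc k) x (Suc i) / (1 - x 0)) = simplical_face k (\<lambda>i. x (Suc i) / (1 - x 0))"
      by (auto simp: simplical_face_def fun_eq_iff)
    moreover have "simplical_face (Suc k) x 0 = x 0" by (simp add: simplical_face_def)
    ultimately show ?thesis using True 1 standard_simplex_tail[OF True] by (simp add: singular_face_def cone_def)
  qed (simp add: singular_face_def cone_def)
qed

section \<open>Cochains\<close>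

lemma dual_group_simps [simp]:
  "carrier (dual_group G) = hom G integer_group \<inter> extensional (carrier G)"
  "f \<otimes>\<^bsub>dual_group G\<^esub> g = (\<lambda>x\<in>carrier G. f x + g x)"
  "\<one>\<^bsub>dual_group G\<^esub> = (\<lambda>x\<in>carrier G. 0)"
  by (simp_all add: dual_group_def)

lemma comm_group_dual_group:
  assumes "group G" shows "comm_group (dual_group G)"
proof (rule comm_groupI)
  interpret group G by fact
  fix f assume f: "f \<in> carrier (dual_group G)"
  show "\<exists>g\<in>carrier (dual_group G). g \<otimes>\<^bsub>dual_group G\<^esub> f = \<one>\<^bsub>dual_group G\<^esub>"
    by (rule bexI[of _ "\<lambda>x\<in>carrier G. - f x"]) (use f in \<open>auto simp: hom_def\<close>)
next
  interpret group G by fact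
  fix f g h
  assume f: "f \<in> carrier (dual_group G)" and g: "g \<in> carrier (dual_group G)" and h: "h \<in> carrier (dual_group G)"
  show "f \<otimes>\<^bsub>dual_group G\<^esub> g \<in> carrier (dual_group G)" using f g by (auto simp: hom_def)
  show "f \<otimes>\<^bsub>dual_group G\<^esub> g \<otimes>\<^bsub>dual_group G\<^esub> h = f \<otimes>\<^bsub>dual_group G\<^esub> (g \<otimes>\<^bsub>dual_group G\<^esub> h)"
    by (auto simp: fun_eq_iff)
  show "f \<otimes>\<^bsub>dual_group G\<^esub> g = g \<otimes>\<^bsub>dual_group G\<^esub> f" by (auto simp: fun_eq_iff)
  show "\<one>\<^bsub>dual_group G\<^esub> \<otimes>\<^bsub>dual_group G\<^esub> f = f" using f by (auto simp: fun_eq_iff extensional_def)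
next
  interpret group G by fact
  show "\<one>\<^bsub>dual_group G\<^esub> \<in> carrier (dual_group G)" by (auto simp: hom_def)
qed

lemma group_chain_group: "group (chain_group p X)"
  by (simp add: chain_group_def)

lemma comm_group_cochain: "comm_group (cochain_group p X)"
  unfolding cochain_group_def by (intro comm_group_dual_group group_chain_group)

lemma mult_chain_group [simp]: "x \<otimes>\<^bsub>chain_group p X\<^esub> y = x + y"
  by (simp add: chain_group_def)

lemma mem_cochain_group:
  "f \<in> carrier (cochain_group p X) \<longleftrightarrow>
     f \<in> extensional (singular_chain_set p X) \<and>
     (\<forall>c d. singular_chain p X c \<longrightarrow> singular_chain p X d \<longrightarrow> f (c + d) = f c + f d)"
  by (auto simp: cochain_group_def hom_def)

lemma mult_cochain_group:
  "f \<otimes>\<^bsub>cochain_group p X\<^esub> g = (\<lambda>c\<in>singular_chain_set p X. f c + g c)"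
  and one_cochain_group: "\<one>\<^bsub>cochain_group p X\<^esub> = (\<lambda>c\<in>singular_chain_set p X. 0)"
  by (simp_all add: cochain_group_def)

locale cochain =
  fixes p :: nat and X :: "'a topology" and f :: "'a chain \<Rightarrow> int"
  assumes cochain: "f \<in> carrier (cochain_group p X)"
begin

lemma add: "singular_chain p X c \<Longrightarrow> singular_chain p X d \<Longrightarrow> f (c + d) = f c + f d"
  using cochain by (simp add: mem_cochain_group)

lemma zero: "f 0 = 0" using add[of 0 0] by simp

lemma minus: "singular_chain p X c \<Longrightarrow> f (- c) = - f c"
  using add[of c "- c"] zero by (simp add: singular_chain_minus)

lemma diff: "singular_chain p X c \<Longrightarrow> singular_chain p X d \<Longrightarrow> f (c - d) = f c - f d"
  using add[of c "- d"] minus[of d] by (simp add: singular_chain_minus)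

lemma sum: "(\<And>i. i \<in> I \<Longrightarrow> singular_chain p X (c i)) \<Longrightarrow> f (sum c I) = (\<Sum>i\<in>I. f (c i))"
  by (induction I rule: infinite_finite_induct) (simp_all add: zero add singular_chain_sum)

lemma sign: "singular_chain p X c \<Longrightarrow> f (frag_cmul ((-1) ^ k) c) = (-1) ^ k * f c"
  by (cases "even k") (simp_all add: minus)

end

text \<open>Chains are freely generated by simplices, and outside the chain group both functions
  take the default value of extensional functions.\<close>

lemma cochain_eqI:
  assumes f: "f \<in> carrier (cochain_group p X)" and g: "g \<in> carrier (cochain_group p X)"
    and eq: "\<And>s. singular_simplex p X s \<Longrightarrow> f (frag_of s) = g (frag_of s)"
  shows "f = g"
proof
  fix c
  interpret f: cochain p X f by (unfold_locales) (rule f)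
  interpret g: cochain p X g by (unfold_locales) (rule g)
  show "f c = g c"
  proof (cases "singular_chain p X c")
    case True
    then have "Poly_Mapping.keys c \<subseteq> singular_simplex_set p X" by (simp add: singular_chain_def)
    then show ?thesis by (rule free_Abelian_group_induct[where S = "singular_simplex_set p X"])
        (auto simp: f.zero g.zero f.diff g.diff eq singular_chain_def)
  next
    case False
    then show ?thesis using f g by (auto simp: mem_cochain_group extensional_def)
  qed
qed

section \<open>Linear extension from simplices to chains; coboundaries\<close>

definition ev :: "('b \<Rightarrow> int) \<Rightarrow> ('b \<Rightarrow>\<^sub>0 int) \<Rightarrow> int" where
  "ev \<phi> c = (\<Sum>s\<in>Poly_Mapping.keys c. Poly_Mapping.lookup c s * \<phi> s)"

lemma ev_superset:
  assumes "finite S" "Poly_Mapping.keys c \<subseteq> S"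
  shows "ev \<phi> c = (\<Sum>s\<in>S. Poly_Mapping.lookup c s * \<phi> s)"
  unfolding ev_def by (rule sum.mono_neutral_left) (use assms in \<open>auto simp: in_keys_iff\<close>)

lemma ev_add: "ev \<phi> (c + d) = ev \<phi> c + ev \<phi> d"
proof -
  let ?S = "Poly_Mapping.keys c \<union> Poly_Mapping.keys d"
  have "ev \<phi> (c + d) = (\<Sum>s\<in>?S. Poly_Mapping.lookup (c + d) s * \<phi> s)"
    by (rule ev_superset) (use keys_add[of c d] in auto)
  then show ?thesis
    by (simp add: ev_superset[of ?S c] ev_superset[of ?S d] lookup_add distrib_right sum.distrib)
qed

lemma ev_0 [simp]: "ev \<phi> 0 = 0" by (simp add: ev_def)

lemma ev_of [simp]: "ev \<phi> (frag_of s) = \<phi> s" by (simp add: ev_def)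

lemma ev_cmul: "ev \<phi> (frag_cmul k c) = k * ev \<phi> c"
  by (subst ev_superset[of "Poly_Mapping.keys c" "frag_cmul k c", OF finite_keys keys_cmul])
    (simp add: ev_def sum_distrib_left mult.assoc)

lemma ev_sum: "ev \<phi> (sum c I) = (\<Sum>i\<in>I. ev \<phi> (c i))"
  by (induction I rule: infinite_finite_induct) (simp_all add: ev_add)

definition cext :: "nat \<Rightarrow> 'a topology \<Rightarrow> (((nat \<Rightarrow> real) \<Rightarrow> 'a) \<Rightarrow> int) \<Rightarrow> 'a chain \<Rightarrow> int" where
  "cext p X \<phi> = (\<lambda>c\<in>singular_chain_set p X. ev \<phi> c)"

lemma cext_cochain: "cext p X \<phi> \<in> carrier (cochain_group p X)"
  by (simp add: mem_cochain_group cext_def ev_add singular_chain_add)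

lemma cext_of: "singular_simplex p X s \<Longrightarrow> cext p X \<phi> (frag_of s) = \<phi> s"
  by (simp add: cext_def singular_chain_of)

lemma coboundary_cochain:
  assumes "f \<in> carrier (cochain_group p X)"
  shows "coboundary p X f \<in> carrier (cochain_group (Suc p) X)"
proof -
  interpret cochain p X f by unfold_locales fact
  show ?thesis
    by (auto simp: mem_cochain_group coboundary_def chain_boundary_add singular_chain_add
        add singular_chain_boundary_alt)
qed

lemma coboundary_of:
  assumes f: "f \<in> carrier (cochain_group p X)" and s: "singular_simplex (Suc p) X s"
  shows "coboundary p X f (frag_of s) = (\<Sum>k\<le>Suc p. (-1) ^ k * f (frag_of (singular_face (Suc p) k s)))"
proof -
  interpret cochain p X f by unfold_locales fact
  have face: "singular_chain p X (frag_of (singular_face (Suc p) k s))" if "k \<le> Suc p" for k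
    using singular_simplex_singular_face[OF s, of k] that by (simp add: singular_chain_of)
  have "coboundary p X f (frag_of s) = f (chain_boundary (Suc p) (frag_of s))"
    by (simp add: coboundary_def singular_chain_of s)
  also have "\<dots> = f (\<Sum>k\<le>Suc p. frag_cmul ((-1) ^ k) (frag_of (singular_face (Suc p) k s)))"
    by (simp only: chain_boundary_of nat.distinct if_False)
  also have "\<dots> = (\<Sum>k\<le>Suc p. f (frag_cmul ((-1) ^ k) (frag_of (singular_face (Suc p) k s))))"
    by (rule sum) (auto intro!: singular_chain_cmul face)
  also have "\<dots> = (\<Sum>k\<le>Suc p. (-1) ^ k * f (frag_of (singular_face (Suc p) k s)))"
    by (rule Finite_Cartesian_Product.sum_cong_aux) (simp add: sign face)
  finally show ?thesis .
qed

lemma coboundary_mult: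
  "coboundary p X (f \<otimes>\<^bsub>cochain_group p X\<^esub> g) =
     coboundary p X f \<otimes>\<^bsub>cochain_group (Suc p) X\<^esub> coboundary p X g"
  by (auto simp: coboundary_def mult_cochain_group singular_chain_boundary_alt fun_eq_iff)

lemma coboundary_coboundary:
  assumes "f \<in> carrier (cochain_group p X)"
  shows "coboundary (Suc p) X (coboundary p X f) = \<one>\<^bsub>cochain_group (Suc (Suc p)) X\<^esub>"
proof -
  interpret cochain p X f by unfold_locales fact
  show ?thesis
    by (auto simp: coboundary_def one_cochain_group singular_chain_boundary_alt chain_boundary_boundary_alt
        zero fun_eq_iff)
qed

lemma group_hom_coboundary:
  "group_hom (cochain_group p X) (cochain_group (Suc p) X) (coboundary p X)"
  by (intro group_hom.intro group_hom_axioms.intro comm_group.axioms(2) comm_group_cochain)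
    (auto simp: coboundary_cochain coboundary_mult hom_def)

lemma subgroup_cocycles: "subgroup (cocycles p X) (cochain_group p X)"
proof -
  have "cocycles p X = kernel (cochain_group p X) (cochain_group (Suc p) X) (coboundary p X)"
    by (auto simp: cocycles_def kernel_def)
  then show ?thesis using group_hom.subgroup_kernel[OF group_hom_coboundary] by metis
qed

lemma subgroup_coboundaries: "subgroup (coboundaries (Suc p) X) (cochain_group (Suc p) X)"
  using group_hom.img_is_subgroup[OF group_hom_coboundary] by (simp add: coboundaries_def)

lemma coboundaries_subset: "coboundaries (Suc p) X \<subseteq> cocycles (Suc p) X"
  by (auto simp: coboundaries_def cocycles_def coboundary_cochain coboundary_coboundary)

lemma coboundary_eval_cycle:
  assumes "h \<in> coboundaries (Suc p) X" "singular_chain (Suc p) X c" "chain_boundary (Suc p) c = 0"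
  shows "h c = 0"
proof -
  obtain f where f: "f \<in> carrier (cochain_group p X)" "h = coboundary p X f"
    using assms(1) by (auto simp: coboundaries_def)
  interpret cochain p X f by unfold_locales fact
  show ?thesis using assms f by (simp add: coboundary_def zero)
qed

section \<open>Cohomology classes\<close>

context
  fixes p :: nat and X :: "'a topology"
begin

interpretation C: comm_group "cochain_group (Suc p) X" by (rule comm_group_cochain)

lemma comm_group_cocycles: "comm_group (cochain_group (Suc p) X\<lparr>carrier := cocycles (Suc p) X\<rparr>)"
  by (rule group.group_comm_groupI[OF C.subgroup_imp_group[OF subgroup_cocycles]])
    (auto intro!: C.m_comm simp: cocycles_def)

lemma subgroup_coboundaries_cocycles:
  "subgroup (coboundaries (Suc p) X) (cochain_group (Suc p) X\<lparr>carrier := cocycles (Suc p) X\<rparr>)"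
  by (rule C.subgroup_incl[OF subgroup_coboundaries subgroup_cocycles coboundaries_subset])

lemma comm_group_cohomology: "comm_group (cohomology_group (Suc p) X)"
  unfolding cohomology_group_def
  by (rule comm_group.abelian_FactGroup[OF comm_group_cocycles subgroup_coboundaries_cocycles])

lemma carrier_cohomology: "carrier (cohomology_group (Suc p) X) = (\<lambda>f. coboundaries (Suc p) X #>\<^bsub>cochain_group (Suc p) X\<^esub> f) ` cocycles (Suc p) X"
  by (auto simp: cohomology_group_def FactGroup_def RCOSETS_def r_coset_def)

lemma self_in_class: "f \<in> cocycles (Suc p) X \<Longrightarrow> f \<in> coboundaries (Suc p) X #>\<^bsub>cochain_group (Suc p) X\<^esub> f"
  using C.rcos_self[OF _ subgroup_coboundaries] subgroup.subset[OF subgroup_cocycles] by blast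

lemma class_member:
  assumes "x \<in> carrier (cohomology_group (Suc p) X)" "f \<in> x"
  shows "f \<in> cocycles (Suc p) X" "x = coboundaries (Suc p) X #>\<^bsub>cochain_group (Suc p) X\<^esub> f"
proof -
  obtain g where g: "g \<in> cocycles (Suc p) X" "x = coboundaries (Suc p) X #>\<^bsub>cochain_group (Suc p) X\<^esub> g"
    using assms by (auto simp: carrier_cohomology)
  then have "g \<in> carrier (cochain_group (Suc p) X)" using subgroup.subset[OF subgroup_cocycles] by blast
  then show "x = coboundaries (Suc p) X #>\<^bsub>cochain_group (Suc p) X\<^esub> f" using C.repr_independence[of f _ g, OF _ _ subgroup_coboundaries] assms(2) g by auto
  obtain h where h: "h \<in> coboundaries (Suc p) X" "f = h \<otimes>\<^bsub>cochain_group (Suc p) X\<^esub> g"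
    using assms(2) g by (auto simp: r_coset_def)
  then show "f \<in> cocycles (Suc p) X"
    using subgroup.m_closed[OF subgroup_cocycles] coboundaries_subset g by blast
qed

lemma class_nonempty: "x \<in> carrier (cohomology_group (Suc p) X) \<Longrightarrow> \<exists>f. f \<in> x"
  using self_in_class by (auto simp: carrier_cohomology)

lemma class_eval:
  assumes x: "x \<in> carrier (cohomology_group (Suc p) X)" "f \<in> x" "g \<in> x"
    and c: "singular_chain (Suc p) X c" "chain_boundary (Suc p) c = 0"
  shows "f c = g c"
proof -
  have "f \<in> coboundaries (Suc p) X #>\<^bsub>cochain_group (Suc p) X\<^esub> g" using class_member[OF x(1,3)] x(2) by simp
  then obtain h where h: "h \<in> coboundaries (Suc p) X" "f = h \<otimes>\<^bsub>cochain_group (Suc p) X\<^esub> g"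
    by (auto simp: r_coset_def)
  then show ?thesis using coboundary_eval_cycle[OF h(1) c] c by (simp add: mult_cochain_group)
qed

lemma class_mult:
  assumes "x \<in> carrier (cohomology_group (Suc p) X)" "y \<in> carrier (cohomology_group (Suc p) X)"
    and "f \<in> x" "g \<in> y"
  shows "f \<otimes>\<^bsub>cochain_group (Suc p) X\<^esub> g \<in> x \<otimes>\<^bsub>cohomology_group (Suc p) X\<^esub> y"
  using assms(3,4) by (auto simp: cohomology_group_def set_mult_def)

lemma class_eqI:
  assumes "x \<in> carrier (cohomology_group (Suc p) X)" "y \<in> carrier (cohomology_group (Suc p) X)"
    and fg: "f \<in> x" "g \<in> y" and h: "h \<in> coboundaries (Suc p) X" "f = h \<otimes>\<^bsub>cochain_group (Suc p) X\<^esub> g"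
  shows "x = y"
proof -
  have "f \<in> coboundaries (Suc p) X #>\<^bsub>cochain_group (Suc p) X\<^esub> g" using h by (auto simp: r_coset_def)
  then have "f \<in> y" using class_member[OF assms(2) fg(2)] by simp
  then show ?thesis using class_member[OF assms(1) fg(1)] class_member(2)[OF assms(2)] by simp
qed

end

lemma coboundary_eqI:
  assumes "f \<in> carrier (cochain_group (Suc p) X)" "h \<in> carrier (cochain_group p X)"
    and "\<And>s. singular_simplex (Suc p) X s \<Longrightarrow>
      f (frag_of s) = (\<Sum>k\<le>Suc p. (-1) ^ k * h (frag_of (singular_face (Suc p) k s)))"
  shows "f = coboundary p X h"
  by (rule cochain_eqI[OF assms(1) coboundary_cochain[OF assms(2)]]) (simp add: assms coboundary_of)

lemma cocycleI:
  assumes "f \<in> carrier (cochain_group p X)"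
    and "\<And>s. singular_simplex (Suc p) X s \<Longrightarrow> (\<Sum>k\<le>Suc p. (-1) ^ k * f (frag_of (singular_face (Suc p) k s))) = 0"
  shows "f \<in> cocycles p X"
proof -
  have "coboundary p X f = \<one>\<^bsub>cochain_group (Suc p) X\<^esub>"
  proof (rule cochain_eqI[OF coboundary_cochain[OF assms(1)]])
    show "\<one>\<^bsub>cochain_group (Suc p) X\<^esub> \<in> carrier (cochain_group (Suc p) X)"
      using comm_group_cochain[of "Suc p" X] by (meson comm_group_def group.is_monoid monoid.one_closed)
  qed (simp only: assms coboundary_of[OF assms(1)], simp add: one_cochain_group singular_chain_of)
  then show ?thesis using assms(1) by (simp add: cocycles_def)
qed

lemma cocycle_of:
  assumes "f \<in> cocycles p X" "singular_simplex (Suc p) X s"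
  shows "(\<Sum>k\<le>Suc p. (-1) ^ k * f (frag_of (singular_face (Suc p) k s))) = 0"
proof -
  have "coboundary p X f (frag_of s) = 0"
    using assms by (simp add: cocycles_def one_cochain_group singular_chain_of)
  then show ?thesis using coboundary_of[OF _ assms(2), of f] assms(1) by (simp only: cocycles_def mem_Collect_eq)
qed

lemma cocycles_cochain: "f \<in> cocycles p X \<Longrightarrow> f \<in> carrier (cochain_group p X)"
  by (simp add: cocycles_def)

subsection \<open>Pullback\<close>

context
  fixes X :: "'a topology" and Y :: "'b topology" and g :: "'a \<Rightarrow> 'b"
  assumes g: "continuous_map X Y g"
begin

lemma pullback_cochain_carrier:
  "f \<in> carrier (cochain_group p Y) \<Longrightarrow> pullback_cochain p X g f \<in> carrier (cochain_group p X)"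
  by (auto simp: mem_cochain_group pullback_cochain_def chain_map_add singular_chain_add
      singular_chain_chain_map[OF _ g])

lemma pullback_cochain_mult:
  "pullback_cochain p X g (f \<otimes>\<^bsub>cochain_group p Y\<^esub> f') =
     pullback_cochain p X g f \<otimes>\<^bsub>cochain_group p X\<^esub> pullback_cochain p X g f'"
  by (auto simp: pullback_cochain_def mult_cochain_group fun_eq_iff singular_chain_chain_map[OF _ g])

lemma pullback_coboundary:
  "pullback_cochain (Suc p) X g (coboundary p Y f) = coboundary p X (pullback_cochain p X g f)"
  by (auto simp: pullback_cochain_def coboundary_def fun_eq_iff singular_chain_chain_map[OF _ g]
      singular_chain_boundary_alt chain_boundary_chain_map)

lemma pullback_coboundaries:
  "h \<in> coboundaries (Suc p) Y \<Longrightarrow> pullback_cochain (Suc p) X g h \<in> coboundaries (Suc p) X"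
  by (auto simp: coboundaries_def pullback_coboundary pullback_cochain_carrier)

lemma pullback_cocycles:
  assumes "f \<in> cocycles p Y" shows "pullback_cochain p X g f \<in> cocycles p X"
proof -
  have "coboundary p X (pullback_cochain p X g f) = pullback_cochain (Suc p) X g \<one>\<^bsub>cochain_group (Suc p) Y\<^esub>"
    using assms by (simp add: pullback_coboundary[symmetric] cocycles_def)
  also have "\<dots> = \<one>\<^bsub>cochain_group (Suc p) X\<^esub>"
    by (auto simp: pullback_cochain_def one_cochain_group fun_eq_iff singular_chain_chain_map[OF _ g])
  finally show ?thesis using assms by (simp add: cocycles_def pullback_cochain_carrier)
qed

text \<open>Representatives of one class differ by coboundaries, and these pull back to
  coboundaries. So the saturated set in \<open>pullback_class\<close> is a single coset, computed
  from any one representative.\<close>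

lemma pullback_class_eq:
  assumes x: "x \<in> carrier (cohomology_group (Suc p) Y)" and f: "f \<in> x"
  shows "pullback_class (Suc p) X g x =
     coboundaries (Suc p) X #>\<^bsub>cochain_group (Suc p) X\<^esub> pullback_cochain (Suc p) X g f"
proof -
  interpret C: comm_group "cochain_group (Suc p) X" by (rule comm_group_cochain)
  interpret D: comm_group "cochain_group (Suc p) Y" by (rule comm_group_cochain)
  let ?pf = "pullback_cochain (Suc p) X g f"
  let ?B = "coboundaries (Suc p) X"
  have fc: "f \<in> carrier (cochain_group (Suc p) Y)" using class_member(1)[OF x f] by (rule cocycles_cochain)
  note pc = pullback_cochain_carrier[OF fc]
  have xf: "x = coboundaries (Suc p) Y #>\<^bsub>cochain_group (Suc p) Y\<^esub> f" by (rule class_member(2)[OF x f])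
  show ?thesis
  proof (intro equalityI subsetI)
    fix u assume "u \<in> pullback_class (Suc p) X g x"
    then obtain h f' where h: "h \<in> ?B" "f' \<in> x" "u = h \<otimes>\<^bsub>cochain_group (Suc p) X\<^esub> pullback_cochain (Suc p) X g f'"
      by (auto simp: pullback_class_def set_mult_def)
    then obtain h' where h': "h' \<in> coboundaries (Suc p) Y" "f' = h' \<otimes>\<^bsub>cochain_group (Suc p) Y\<^esub> f"
      using xf by (auto simp: r_coset_def)
    have ph: "pullback_cochain (Suc p) X g h' \<in> ?B" by (rule pullback_coboundaries[OF h'(1)])
    have sub: "?B \<subseteq> carrier (cochain_group (Suc p) X)" by (rule subgroup.subset[OF subgroup_coboundaries])
    have "u = (h \<otimes>\<^bsub>cochain_group (Suc p) X\<^esub> pullback_cochain (Suc p) X g h') \<otimes>\<^bsub>cochain_group (Suc p) X\<^esub> ?pf"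
      using h h' ph sub pc by (subst C.m_assoc) (auto simp: pullback_cochain_mult)
    moreover have "h \<otimes>\<^bsub>cochain_group (Suc p) X\<^esub> pullback_cochain (Suc p) X g h' \<in> ?B"
      by (rule subgroup.m_closed[OF subgroup_coboundaries h(1) ph])
    ultimately show "u \<in> ?B #>\<^bsub>cochain_group (Suc p) X\<^esub> ?pf" by (auto simp: r_coset_def)
  qed (use f in \<open>auto simp: r_coset_def pullback_class_def set_mult_def\<close>)
qed

lemma pullback_class_mem:
  assumes "x \<in> carrier (cohomology_group (Suc p) Y)" and "f \<in> x"
  shows "pullback_class (Suc p) X g x \<in> carrier (cohomology_group (Suc p) X)"
    "pullback_cochain (Suc p) X g f \<in> pullback_class (Suc p) X g x"
  using pullback_cocycles[OF class_member(1)[OF assms]]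
  by (auto simp: pullback_class_eq[OF assms] carrier_cohomology self_in_class)

end

section \<open>The second cohomology of a complex torus\<close>

definition vx :: "nat \<Rightarrow> nat \<Rightarrow> real" where "vx i = (\<lambda>j. if j = i then 1 else 0)"

lemma vx_in_simplex [simp]: "vx i \<in> standard_simplex p \<longleftrightarrow> i \<le> p"
  by (simp add: vx_def)

lemma simplical_face_vx: "simplical_face k (vx i) = vx (if i < k then i else Suc i)"
  by (auto simp: simplical_face_def vx_def fun_eq_iff)

lemma singular_face_vx: "i \<le> p \<Longrightarrow> singular_face (Suc p) k t (vx i) = t (vx (if i < k then i else Suc i))"
  by (simp add: singular_face_def simplical_face_vx)

lemma face_simplex_map:
  assumes "k \<le> Suc p"
  shows "singular_face (Suc p) k (simplex_map (Suc p) g t) = simplex_map p g (singular_face (Suc p) k t)"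
  using simplical_face_in_standard_simplex[of "Suc p" k] assms
  by (auto simp: singular_face_def simplex_map_def fun_eq_iff)

lemma simplex_map_vx: "i \<le> p \<Longrightarrow> simplex_map p g t (vx i) = g (t (vx i))"
  by (simp add: simplex_map_def)

definition point :: "'a \<Rightarrow> (nat \<Rightarrow> real) \<Rightarrow> 'a" where "point z = (\<lambda>x\<in>standard_simplex 0. z)"

lemma standard_simplex_0_vx: "standard_simplex 0 = {vx 0}"
  by (simp add: standard_simplex_0 vx_def)

lemma face_edge: "k \<le> Suc 0 \<Longrightarrow> singular_face (Suc 0) k s = point (s (vx (if k = 0 then Suc 0 else 0)))"
proof
  fix x
  assume "k \<le> Suc 0"
  then show "singular_face (Suc 0) k s x = point (s (vx (if k = 0 then Suc 0 else 0))) x"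
    by (cases "x = vx 0") (auto simp: singular_face_def point_def standard_simplex_0_vx simplical_face_vx)
qed

definition seg :: "'a::real_normed_vector \<Rightarrow> (nat \<Rightarrow> real) \<Rightarrow> 'a" where "seg z = cone 0 (point z)"

lemma seg_asimp: "seg z = asimp (Suc 0) (\<lambda>i. if i = 0 then 0 else z)"
proof
  fix x
  show "seg z x = asimp (Suc 0) (\<lambda>i. if i = 0 then 0 else z) x"
  proof (cases "x \<in> standard_simplex (Suc 0)")
    case True
    then have "x 0 + x (Suc 0) = 1" by (simp add: standard_simplex_def)
    then have "x (Suc 0) = 1 - x 0" by linarith
    with True standard_simplex_tail[OF True] show ?thesis by (simp add: seg_def cone_def asimp_def point_def)
  qed (simp add: seg_def cone_def asimp_def)
qed

lemma singular_simplex_seg: "singular_simplex (Suc 0) euclidean (seg z)"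
  unfolding seg_asimp by (rule singular_simplex_asimp)

lemma asimp_vx: "i \<le> p \<Longrightarrow> asimp p v (vx i) = v i"
  by (simp add: asimp_def vx_def if_distrib[of "\<lambda>c. c *\<^sub>R _"] sum.delta cong: if_cong)

lemma seg_vx [simp]: "seg z (vx 0) = 0" "seg z (vx (Suc 0)) = z"
  by (simp_all add: seg_asimp asimp_vx)

lemma sum_simplex: "x \<in> standard_simplex p \<Longrightarrow> (\<Sum>i\<le>p. x i *\<^sub>R (l::'a::real_vector)) = l"
  by (simp add: scaleR_left.sum[symmetric] standard_simplex_def)

definition alternating_sum :: "'i set \<Rightarrow> (('i \<Rightarrow> 'i) \<Rightarrow> 'b::comm_ring_1) \<Rightarrow> 'b" where
  "alternating_sum S F = (\<Sum>\<pi> | \<pi> permutes S. of_int (sign \<pi>) * F \<pi>)"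

text \<open>Every permutation of \<open>insert a S\<close> is a transposition of \<open>a\<close>
  with some \<open>c\<close> composed with a permutation of \<open>S\<close>, in a unique way; the
  transposition changes the sign unless it is trivial. Iterating this expands the sum into explicit
  terms.\<close>

lemma alternating_sum_insert:
  assumes S: "finite S" "a \<notin> S"
  shows "alternating_sum (insert a S) F =
    alternating_sum S F - (\<Sum>c\<in>S. alternating_sum S (\<lambda>q. F (Transposition.transpose a c \<circ> q)))"
proof -
  have sgn: "sign (Transposition.transpose a c \<circ> q) = (if a = c then 1 else - 1) * sign q" if "q permutes S" for c q
  proof -
    have "permutation q" using that S(1) permutation_permutes by blast
    then show ?thesis by (simp add: sign_compose[OF permutation_swap_id] sign_swap_id)
  qed
  have "alternating_sum (insert a S) F =
      (\<Sum>c\<in>insert a S. \<Sum>q | q permutes S. of_int (sign (Transposition.transpose a c \<circ> q)) * F (Transposition.transpose a c \<circ> q))"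
    unfolding alternating_sum_def by (rule sum_over_permutations_insert[OF S])
  also have "\<dots> = (\<Sum>c\<in>insert a S. (if a = c then 1 else - 1) * alternating_sum S (\<lambda>q. F (Transposition.transpose a c \<circ> q)))"
    unfolding alternating_sum_def sum_distrib_left by (intro sum.cong refl) (simp add: sgn)
  also have "\<dots> = alternating_sum S F + (\<Sum>c\<in>S. (if a = c then 1 else - 1) * alternating_sum S (\<lambda>q. F (Transposition.transpose a c \<circ> q)))"
    using S by simp
  also have "(\<Sum>c\<in>S. (if a = c then 1 else - 1) * alternating_sum S (\<lambda>q. F (Transposition.transpose a c \<circ> q))) =
      (\<Sum>c\<in>S. - alternating_sum S (\<lambda>q. F (Transposition.transpose a c \<circ> q)))"
    by (rule sum.cong) (use S in auto)
  finally show ?thesis by (simp add: sum_negf)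
qed

lemma alternating_sum_empty: "alternating_sum {} F = F id"
  by (simp add: alternating_sum_def)

text \<open>Stated over any index type, because it serves both the parallelotope, indexed by natural
  numbers, and the determinant, indexed by the type \<open>4\<close>.\<close>

lemma alternating_sum_4:
  assumes "p \<noteq> q" "p \<noteq> r" "p \<noteq> s" "q \<noteq> r" "q \<noteq> s" "r \<noteq> s"
  shows "alternating_sum (insert p (insert q (insert r (insert s {})))) (\<lambda>\<pi>. F (\<pi> p) (\<pi> q) (\<pi> r) (\<pi> s)) =
     F p q r s - F p q s r - F p r q s + F p r s q + F p s q r - F p s r q
   - F q p r s + F q p s r + F q r p s - F q r s p - F q s p r + F q s r p
   + F r p q s - F r p s q - F r q p s + F r q s p + F r s p q - F r s q p
   - F s p q r + F s p r q + F s q p r - F s q r p - F s r p q + F s r q p"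
  using assms by (simp add: alternating_sum_insert alternating_sum_empty Transposition.transpose_def)

lemma sum_permutes_4:
  fixes F :: "nat \<Rightarrow> nat \<Rightarrow> nat \<Rightarrow> nat \<Rightarrow> int"
  shows "(\<Sum>\<pi> | \<pi> permutes {..<4}. sign \<pi> * F (\<pi> 0) (\<pi> 1) (\<pi> 2) (\<pi> 3)) =
     F 0 1 2 3 - F 0 1 3 2 - F 0 2 1 3 + F 0 2 3 1 + F 0 3 1 2 - F 0 3 2 1
   - F 1 0 2 3 + F 1 0 3 2 + F 1 2 0 3 - F 1 2 3 0 - F 1 3 0 2 + F 1 3 2 0
   + F 2 0 1 3 - F 2 0 3 1 - F 2 1 0 3 + F 2 1 3 0 + F 2 3 0 1 - F 2 3 1 0
   - F 3 0 1 2 + F 3 0 2 1 + F 3 1 0 2 - F 3 1 2 0 - F 3 2 0 1 + F 3 2 1 0"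
proof -
  have eq: "{..<4::nat} = insert 0 (insert 1 (insert 2 (insert 3 {})))" by auto
  have "(\<Sum>\<pi> | \<pi> permutes {..<4}. sign \<pi> * F (\<pi> 0) (\<pi> 1) (\<pi> 2) (\<pi> 3)) =
      alternating_sum (insert 0 (insert 1 (insert 2 (insert 3 {})))) (\<lambda>\<pi>. F (\<pi> 0) (\<pi> 1) (\<pi> 2) (\<pi> 3))"
    by (simp only: alternating_sum_def eq of_int_eq_id id_apply)
  then show ?thesis by (simp only: alternating_sum_4 zero_neq_one zero_neq_numeral one_eq_numeral_iff numeral_eq_iff num.distinct num.inject not_False_eq_True simp_thms)
qed

context torus
begin

abbreviation (input) "TS \<equiv> torus_space \<Lambda>"
abbreviation (input) "d2 \<equiv> Suc (Suc 0)"
abbreviation (input) "d3 \<equiv> Suc (Suc (Suc 0))"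

section \<open>The bar complex of the lattice inside the singular complex\<close>

lemma affine_simplex_translate:
  assumes "l \<in> \<Lambda>" "\<And>i. i \<le> p \<Longrightarrow> v i = w i + l"
  shows "affine_simplex \<Lambda> p v = affine_simplex \<Lambda> p w"
proof -
  have "proj (\<Sum>i\<le>p. x i *\<^sub>R v i) = proj (\<Sum>i\<le>p. x i *\<^sub>R w i)" if "x \<in> standard_simplex p" for x
  proof -
    have "(\<Sum>i\<le>p. x i *\<^sub>R v i) = (\<Sum>i\<le>p. x i *\<^sub>R w i) + (\<Sum>i\<le>p. x i *\<^sub>R l)"
      by (simp add: assms(2) scaleR_add_right sum.distrib)
    then show ?thesis by (simp add: proj_eq_iff sum_simplex[OF that] assms(1))
  qed
  then show ?thesis by (auto simp: affine_simplex_def fun_eq_iff)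
qed

lemma singular_face_affine:
  "k \<le> Suc q \<Longrightarrow> singular_face (Suc q) k (affine_simplex \<Lambda> (Suc q) v) =
     affine_simplex \<Lambda> q (\<lambda>i. v (if i < k then i else Suc i))"
  by (simp only: affine_simplex_asimp face_simplex_map singular_face_asimp)

lemma singular_simplex_affine: "singular_simplex p TS (affine_simplex \<Lambda> p v)"
  by (simp only: affine_simplex_asimp singular_simplex_proj singular_simplex_asimp)

text \<open>The vertices upstairs are the partial sums of the list. For lattice vectors all of them
  project to the origin of the torus, and the simplex is the bar symbol [l1|...|lk] of group
  homology.\<close>

definition bar :: "(complex^2) list \<Rightarrow> (nat \<Rightarrow> real) \<Rightarrow> torus_point" where
  "bar l = affine_simplex \<Lambda> (length l) (\<lambda>k. sum_list (take k l))"

lemma singular_simplex_bar: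
  "singular_simplex (Suc 0) TS (bar [a])" "singular_simplex d2 TS (bar [a, b'])"
  "singular_simplex d3 TS (bar [a, b', c])" "singular_simplex (Suc d3) TS (bar [a, b', c, d])"
  by (simp_all add: bar_def singular_simplex_affine)

text \<open>Inner faces add two neighbours and the last face drops the last entry. Face 0 starts at
  \<open>x\<close> instead of 0, which makes no difference after projection since \<open>x\<close>
  is a lattice vector.\<close>

lemma face_bar2:
  assumes "x \<in> \<Lambda>"
  shows "singular_face d2 0 (bar [x, y]) = bar [y]"
    "singular_face d2 (Suc 0) (bar [x, y]) = bar [x + y]"
    "singular_face d2 d2 (bar [x, y]) = bar [x]"
  by (simp_all add: bar_def singular_face_affine, (rule affine_simplex_translate[of x] affine_simplex_translate[of 0];
      use assms in \<open>force simp: le_Suc_eq add.commute\<close>)+)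

lemma face_bar3:
  assumes "x \<in> \<Lambda>"
  shows "singular_face d3 0 (bar [x, y, z]) = bar [y, z]"
    "singular_face d3 (Suc 0) (bar [x, y, z]) = bar [x + y, z]"
    "singular_face d3 d2 (bar [x, y, z]) = bar [x, y + z]"
    "singular_face d3 d3 (bar [x, y, z]) = bar [x, y]"
  by (simp_all add: bar_def singular_face_affine, (rule affine_simplex_translate[of x] affine_simplex_translate[of 0];
      use assms in \<open>force simp: le_Suc_eq ac_simps\<close>)+)

lemma face_bar4:
  assumes "x \<in> \<Lambda>"
  shows "singular_face (Suc d3) 0 (bar [x, y, z, w]) = bar [y, z, w]"
    "singular_face (Suc d3) (Suc 0) (bar [x, y, z, w]) = bar [x + y, z, w]"
    "singular_face (Suc d3) d2 (bar [x, y, z, w]) = bar [x, y + z, w]"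
    "singular_face (Suc d3) d3 (bar [x, y, z, w]) = bar [x, y, z + w]"
    "singular_face (Suc d3) (Suc d3) (bar [x, y, z, w]) = bar [x, y, z]"
  by (simp_all add: bar_def singular_face_affine, (rule affine_simplex_translate[of x] affine_simplex_translate[of 0];
      use assms in \<open>force simp: le_Suc_eq ac_simps\<close>)+)

lemma cocycle_bar:
  assumes f: "f \<in> cocycles d2 TS" and "x \<in> \<Lambda>"
  shows "f (frag_of (bar [y, z])) - f (frag_of (bar [x + y, z])) + f (frag_of (bar [x, y + z]))
    - f (frag_of (bar [x, y])) = 0" using cocycle_of[OF f singular_simplex_bar(3)[of x y z]] by (simp add: face_bar3 assms)

text \<open>The parallelogram on \<open>x\<close> and \<open>y\<close>, cut along its diagonal. For
  lattice vectors opposite sides agree in the torus, so this is the 2-torus spanned by the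
  pair.\<close>

definition par :: "complex^2 \<Rightarrow> complex^2 \<Rightarrow> torus_point chain" where
  "par x y = frag_of (bar [x, y]) - frag_of (bar [y, x])"

lemma par_chain: "singular_chain d2 TS (par x y)"
  by (simp add: par_def singular_chain_diff singular_chain_of singular_simplex_bar)

lemma par_cycle: "x \<in> \<Lambda> \<Longrightarrow> y \<in> \<Lambda> \<Longrightarrow> chain_boundary d2 (par x y) = 0"
  by (simp add: par_def chain_boundary_diff chain_boundary_of face_bar2 add.commute)

lemma eval_par:
  assumes "f \<in> carrier (cochain_group d2 TS)"
  shows "f (par x y) = f (frag_of (bar [x, y])) - f (frag_of (bar [y, x]))"
proof -
  interpret cochain d2 TS f by unfold_locales fact
  show ?thesis by (simp add: par_def diff singular_chain_of singular_simplex_bar)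
qed

text \<open>Antisymmetrising a 2-cocycle of an abelian group yields a bilinear form: three instances
  of the cocycle identity cancel all other terms.\<close>

lemma eval_par_add:
  assumes f: "f \<in> cocycles d2 TS" and m: "x \<in> \<Lambda>" "y \<in> \<Lambda>" "z \<in> \<Lambda>"
  shows "f (par (x + y) z) = f (par x z) + f (par y z)"
  using cocycle_bar[OF f m(1), of y z] cocycle_bar[OF f m(1), of z y] cocycle_bar[OF f m(3), of x y]
  by (simp add: eval_par[OF cocycles_cochain[OF f]] add.commute[of z])

text \<open>The group of pairs is the abelian extension of \<open>\<Lambda>\<close> by the integers with cocycle \<open>c\<close>;
  it splits because \<open>\<Lambda>\<close> is free.\<close>

lemma sym_cocycle_split:
  fixes c :: "complex^2 \<Rightarrow> complex^2 \<Rightarrow> int"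
  assumes sym: "\<And>x y. x \<in> \<Lambda> \<Longrightarrow> y \<in> \<Lambda> \<Longrightarrow> c x y = c y x"
    and coc: "\<And>x y z. x \<in> \<Lambda> \<Longrightarrow> y \<in> \<Lambda> \<Longrightarrow> z \<in> \<Lambda> \<Longrightarrow> c y z + c x (y + z) = c (x + y) z + c x y"
    and zero: "\<And>x. x \<in> \<Lambda> \<Longrightarrow> c 0 x = 0"
  obtains u where "\<And>x y. x \<in> \<Lambda> \<Longrightarrow> y \<in> \<Lambda> \<Longrightarrow> c x y = u (x + y) - u x - u y"
proof -
  define E where "E = \<lparr>carrier = (UNIV::int set) \<times> \<Lambda>,
    monoid.mult = (\<lambda>(m, x) (n, y). (m + n + c x y, x + y)), one = (0, 0)\<rparr>"
  have E: "carrier E = UNIV \<times> \<Lambda>" "(m, x) \<otimes>\<^bsub>E\<^esub> (n, y) = (m + n + c x y, x + y)" "\<one>\<^bsub>E\<^esub> = (0, 0)" for m n x y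
    by (simp_all add: E_def)
  have "comm_group E"
  proof (rule comm_groupI)
    fix p assume "p \<in> carrier E"
    then obtain m x where p: "p = (m, x)" "x \<in> \<Lambda>" by (auto simp: E)
    show "\<exists>q\<in>carrier E. q \<otimes>\<^bsub>E\<^esub> p = \<one>\<^bsub>E\<^esub>"
      by (rule bexI[of _ "(- m - c (- x) x, - x)"]) (use p in \<open>auto simp: E lattice_minus\<close>)
  next
    fix p q r assume "p \<in> carrier E" "q \<in> carrier E" "r \<in> carrier E"
    then show "p \<otimes>\<^bsub>E\<^esub> q \<otimes>\<^bsub>E\<^esub> r = p \<otimes>\<^bsub>E\<^esub> (q \<otimes>\<^bsub>E\<^esub> r)"
      using coc by (auto simp: E algebra_simps)
  next
    fix p q assume "p \<in> carrier E" "q \<in> carrier E"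
    then show "p \<otimes>\<^bsub>E\<^esub> q = q \<otimes>\<^bsub>E\<^esub> p" using sym by (auto simp: E algebra_simps)
  qed (auto simp: E lattice_add zero)
  then interpret E: comm_group E .
  interpret A: comm_group "add_group :: (complex^2) monoid" by (rule comm_group_add_group)
  have snd_hom: "snd \<in> hom E add_group" by (auto simp: hom_def E)
  have npow: "x [^]\<^bsub>add_group\<^esub> (n::nat) = real n *\<^sub>R x" for x :: "complex^2" and n
    by (induction n) (auto simp: algebra_simps)
  have ipow: "x [^]\<^bsub>add_group\<^esub> (n::int) = of_int n *\<^sub>R x" for x :: "complex^2" and n
    by (auto simp: int_pow_def2 npow)
  define e where "e i n = (0, b i) [^]\<^bsub>E\<^esub> (n::int)" for i n
  have e_carrier: "e i n \<in> carrier E" if "i < 4" for i n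
    unfolding e_def by (rule E.int_pow_closed) (simp add: E b_in_lattice that)
  have e_add: "e i (m + n) = e i m \<otimes>\<^bsub>E\<^esub> e i n" if "i < 4" for i m n
    unfolding e_def by (rule E.int_pow_mult) (simp add: E b_in_lattice that)
  have snd_e: "snd (e i n) = of_int n *\<^sub>R b i" if "i < 4" for i n
    unfolding e_def using hom_int_pow[OF snd_hom _ E.group_axioms A.group_axioms, of "(0, b i)" n] that
    by (simp add: E b_in_lattice ipow)
  \<comment> \<open>A section of the projection to \<Lambda>, sending \<open>b i\<close> to
    \<open>(0, b i)\<close>. It is a homomorphism because \<open>E\<close> is commutative, which is
    where the symmetry of \<open>c\<close> is used.\<close>
  define s where "s x = e 0 \<lfloor>crd x 0\<rfloor> \<otimes>\<^bsub>E\<^esub> (e 1 \<lfloor>crd x 1\<rfloor> \<otimes>\<^bsub>E\<^esub> (e 2 \<lfloor>crd x 2\<rfloor> \<otimes>\<^bsub>E\<^esub> e 3 \<lfloor>crd x 3\<rfloor>))" for x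
  have s_carrier: "s x \<in> carrier E" for x by (auto simp: s_def e_carrier)
  have s_add: "s (x + y) = s x \<otimes>\<^bsub>E\<^esub> s y" if "x \<in> \<Lambda>" "y \<in> \<Lambda>" for x y
  proof -
    have fl: "\<lfloor>crd x i + crd y i\<rfloor> = \<lfloor>crd x i\<rfloor> + \<lfloor>crd y i\<rfloor>" if "i < 4" for i
      using crd_lattice[OF \<open>x \<in> \<Lambda>\<close> that] crd_lattice[OF \<open>y \<in> \<Lambda>\<close> that]
      by (metis floor_of_int of_int_add)
    show ?thesis by (simp add: s_def fl e_add e_carrier E.m_ac)
  qed
  have snd_s: "snd (s x) = x" if "x \<in> \<Lambda>" for x
  proof -
    have "snd (p \<otimes>\<^bsub>E\<^esub> q) = snd p + snd q" for p q by (cases p, cases q) (simp add: E)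
    then have "snd (s x) = (\<Sum>i<4. of_int \<lfloor>crd x i\<rfloor> *\<^sub>R b i)"
      by (simp add: s_def snd_e eval_nat_numeral lessThan_Suc)
    also have "\<dots> = (\<Sum>i<4. crd x i *\<^sub>R b i)" by (rule sum.cong) (auto simp: crd_lattice[OF that])
    finally show ?thesis by (simp add: sum_crd)
  qed
  \<comment> \<open>The potential \<open>u\<close> is the integer component of the section
    \<open>s\<close>.\<close>
  show thesis
  proof
    fix x y assume xy: "x \<in> \<Lambda>" "y \<in> \<Lambda>"
    have "s x = (fst (s x), x)" "s y = (fst (s y), y)" using xy snd_s by (metis prod.collapse)+
    then have "fst (s x \<otimes>\<^bsub>E\<^esub> s y) = fst (s x) + fst (s y) + c x y" by (metis E(2) fst_conv)
    then show "c x y = fst (s (x + y)) - fst (s x) - fst (s y)" by (simp add: s_add xy)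
  qed
qed

lemma translate_asimp: "translate p l (asimp p v) = asimp p (\<lambda>i. v i + l)"
  by (auto simp: translate_def simplex_map_def asimp_def fun_eq_iff scaleR_add_right sum.distrib sum_simplex)

lemma translate_vx: "i \<le> p \<Longrightarrow> translate p l t (vx i) = t (vx i) + l"
  by (simp add: translate_def simplex_map_vx)

lemma translate_translate: "translate p l (translate p m t) = translate p (l + m) t"
  by (auto simp: translate_def simplex_map_def fun_eq_iff ac_simps)

lemma translate_0: "singular_simplex p euclidean t \<Longrightarrow> translate p 0 t = t"
  by (auto simp: translate_def simplex_map_def fun_eq_iff singular_simplex_euclidean extensional_def)

lemma translate_face: "k \<le> Suc p \<Longrightarrow> singular_face (Suc p) k (translate (Suc p) l t) = translate p l (singular_face (Suc p) k t)"
  by (simp add: translate_def face_simplex_map)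

text \<open>Pulled back to the contractible space \<open>\<complex>\<^sup>2\<close>, the cocycle becomes the coboundary of the
  cochain \<open>h\<close> given by coning. The failure of \<open>h\<close> to be invariant under \<open>\<Lambda>\<close> is measured by
  functions \<open>k l\<close> on \<open>\<complex>\<^sup>2\<close>, which form a \<open>1\<close>-cocycle of \<open>\<Lambda>\<close> up to the integers \<open>k l m\<close>.
  These are symmetric in \<open>l\<close> and \<open>m\<close>, so \<open>k\<close> can be corrected to a cocycle, and then
  \<open>h\<close> to an invariant cochain.\<close>

lemma symmetric_cocycle_coboundary:
  assumes f: "f \<in> cocycles d2 TS"
    and sym: "\<And>x y. x \<in> \<Lambda> \<Longrightarrow> y \<in> \<Lambda> \<Longrightarrow> f (par x y) = 0"
  shows "f \<in> coboundaries d2 TS"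
proof -
  note fc = cocycles_cochain[OF f]
  define G where "G t = f (frag_of (simplex_map d2 proj t))" for t
  define h where "h s = G (cone (Suc 0) s)" for s
  \<comment> \<open>The cocycle identity on the projected cone over \<open>t\<close>, whose face 0
    is \<open>t\<close> and whose other faces are the cones defining \<open>h\<close>.\<close>
  have G_faces: "G t = h (singular_face d2 0 t) - h (singular_face d2 (Suc 0) t) + h (singular_face d2 d2 t)"
    if t: "singular_simplex d2 euclidean t" for t
  proof -
    have "singular_simplex d3 TS (simplex_map d3 proj (cone d2 t))"
      by (rule singular_simplex_proj[OF singular_simplex_cone[OF t]])
    from cocycle_of[OF f this] show ?thesis
      by (simp add: face_simplex_map singular_face_cone_0[OF t] singular_face_cone_Suc G_def h_def)
  qed
  have G_translate: "G (translate d2 l t) = G t" if "singular_simplex d2 euclidean t" "l \<in> \<Lambda>" for l t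
    using lift_translate[OF lift_of_proj[OF that(1)] that(2)] by (simp add: G_def lift_of_def)
  define k where "k l z = h (translate (Suc 0) l (seg z)) - h (seg z)" for l z
  \<comment> \<open>The cone over \<open>s\<close> and its translate project to the same simplex.
    Comparing their boundaries leaves only the edges from the apex to the two end points of
    \<open>s\<close>.\<close>
  have k: "h (translate (Suc 0) l s) - h s = k l (s (vx (Suc 0))) - k l (s (vx 0))"
    if s: "singular_simplex (Suc 0) euclidean s" and l: "l \<in> \<Lambda>" for s l
  proof -
    have c: "singular_simplex d2 euclidean (cone (Suc 0) s)" by (rule singular_simplex_cone[OF s])
    have faces: "singular_face d2 0 (cone (Suc 0) s) = s"
      "singular_face d2 (Suc 0) (cone (Suc 0) s) = seg (s (vx (Suc 0)))"
      "singular_face d2 d2 (cone (Suc 0) s) = seg (s (vx 0))"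
      by (simp_all add: singular_face_cone_0[OF s] singular_face_cone_Suc face_edge seg_def)
    show ?thesis using G_translate[OF c l] G_faces[OF c] G_faces[OF singular_simplex_translate[OF c, of l]]
      by (simp add: translate_face faces k_def)
  qed
  have k_0: "k 0 z = 0" for z
    by (simp add: k_def translate_0 singular_simplex_seg)
  have k_add: "k (l + m) z = k l (z + m) + k m z - k l m" if "l \<in> \<Lambda>" "m \<in> \<Lambda>" for l m z
    using k[OF singular_simplex_translate[OF singular_simplex_seg, of m z] that(1)]
    by (simp add: translate_translate translate_vx k_def)
  have bar_h: "f (frag_of (bar [l, m])) = h (translate (Suc 0) l (seg m)) - h (seg (l + m)) + h (seg l)" for l m
  proof -
    let ?v = "\<lambda>k. sum_list (take k [l, m])"
    have "asimp (Suc 0) (\<lambda>i. ?v (Suc i)) = translate (Suc 0) l (seg m)"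
      unfolding seg_asimp translate_asimp by (rule asimp_cong) (auto simp: le_Suc_eq add.commute)
    moreover have "asimp (Suc 0) (\<lambda>i. ?v (if i < Suc 0 then i else Suc i)) = seg (l + m)"
      unfolding seg_asimp by (rule asimp_cong) (auto simp: le_Suc_eq)
    moreover have "asimp (Suc 0) (\<lambda>i. ?v (if i < d2 then i else Suc i)) = seg l"
      unfolding seg_asimp by (rule asimp_cong) (auto simp: le_Suc_eq)
    moreover have "f (frag_of (bar [l, m])) = G (asimp d2 ?v)" by (simp add: G_def bar_def affine_simplex_asimp)
    ultimately show ?thesis by (simp add: G_faces singular_simplex_asimp singular_face_asimp)
  qed
  \<comment> \<open>The difference \<open>k m l - k l m\<close> is, up to sign, the value of
    \<open>f\<close> on the torus \<open>par l m\<close>, so this is where the hypothesis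
    \<open>sym\<close> enters.\<close>
  have k_sym: "k l m = k m l" if "l \<in> \<Lambda>" "m \<in> \<Lambda>" for l m
    using sym[OF that] by (simp add: eval_par[OF fc] bar_h k_def add.commute[of l])
  have "- k m n - k l (m + n) = - k (l + m) n - k l m" if "l \<in> \<Lambda>" "m \<in> \<Lambda>" for l m n
    using k_add[OF that, of n] by (simp add: add.commute)
  then obtain u where u: "\<And>l m. l \<in> \<Lambda> \<Longrightarrow> m \<in> \<Lambda> \<Longrightarrow> - k l m = u (l + m) - u l - u m"
    using sym_cocycle_split[of "\<lambda>l m. - k l m"] k_sym k_0 by (metis (no_types, lifting) diff_conv_add_uminus neg_equal_zero)
  define k' where "k' l z = k l z - u l" for l z
  have k'_add: "k' (l + m) z = k' l (z + m) + k' m z" if "l \<in> \<Lambda>" "m \<in> \<Lambda>" for l m z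
    using k_add[OF that, of z] u[OF that] by (simp add: k'_def)
  \<comment> \<open>The action of \<Lambda> by translations is free, so a cocycle with values in
    functions is a coboundary: its potential is set to 0 on the fundamental parallelotope and
    transported by \<open>fl\<close>.\<close>
  define q where "q z = k' (fl z) (z - fl z)" for z
  have q: "q (z + l) = q z + k' l z" if "l \<in> \<Lambda>" for l z
    using k'_add[OF that fl_lattice, of z "z - fl z"] by (simp add: q_def fl_add that add.commute[of l "fl z"])
  define h' where "h' s = h s - (q (s (vx (Suc 0))) - q (s (vx 0)))" for s
  have h'_translate: "h' (translate (Suc 0) l s) = h' s"
    if "singular_simplex (Suc 0) euclidean s" "l \<in> \<Lambda>" for l s
    using k[OF that] by (simp add: h'_def translate_vx q that k'_def)
  \<comment> \<open>The choice of the lift does not matter, because \<open>h'\<close> is invariant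
    under \<Lambda>.\<close>
  define H where "H = cext (Suc 0) TS (\<lambda>s. h' (SOME t. lift_of (Suc 0) s t))"
  have H: "H (frag_of s) = h' t" if lift: "lift_of (Suc 0) s t" for s t
  proof -
    have s: "singular_simplex (Suc 0) TS s" using lift singular_simplex_proj by (auto simp: lift_of_def)
    have "lift_of (Suc 0) s (SOME t. lift_of (Suc 0) s t)" by (rule someI[of "lift_of _ _", OF lift])
    then obtain l where "l \<in> \<Lambda>" "(SOME t. lift_of (Suc 0) s t) = translate (Suc 0) l t"
      using lift_unique[OF lift] by blast
    with lift_ofD(1)[OF lift] show ?thesis by (simp add: H_def cext_of[OF s] h'_translate)
  qed
  have "f = coboundary (Suc 0) TS H"
  proof (rule coboundary_eqI[OF fc])
    show "H \<in> carrier (cochain_group (Suc 0) TS)" unfolding H_def by (rule cext_cochain)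
    fix s assume s: "singular_simplex d2 TS s"
    then obtain t where t: "lift_of d2 s t" using ex_lift[of d2 s] by auto
    have face: "H (frag_of (singular_face d2 k s)) = h' (singular_face d2 k t)" if "k \<le> d2" for k
      using H[of "singular_face d2 k s" "singular_face d2 k t"] lift_face[OF t, of k] that by simp
    have "f (frag_of s) = G t" using t by (simp add: G_def lift_of_def)
    then show "f (frag_of s) = (\<Sum>k\<le>d2. (-1) ^ k * H (frag_of (singular_face d2 k s)))"
      by (simp add: face G_faces[OF lift_ofD(1)[OF t]] h'_def singular_face_vx)
  qed
  then show ?thesis by (auto simp: coboundaries_def H_def cext_cochain)
qed

text \<open>The cup product formula of group cohomology. The vertices of a lift are rounded to
  lattice points by \<open>fl\<close>, and \<open>\<beta>\<close> is applied to the two consecutive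
  edges. Translating the lift moves all rounded vertices alike, so the edges do not depend on
  it.\<close>

lemma cocycle_of_bilinear:
  fixes \<beta> :: "complex^2 \<Rightarrow> complex^2 \<Rightarrow> int"
  assumes add1: "\<And>x y z. x \<in> \<Lambda> \<Longrightarrow> y \<in> \<Lambda> \<Longrightarrow> z \<in> \<Lambda> \<Longrightarrow> \<beta> (x + y) z = \<beta> x z + \<beta> y z"
    and add2: "\<And>x y z. x \<in> \<Lambda> \<Longrightarrow> y \<in> \<Lambda> \<Longrightarrow> z \<in> \<Lambda> \<Longrightarrow> \<beta> x (y + z) = \<beta> x y + \<beta> x z"
  obtains f where "f \<in> cocycles d2 TS"
    "\<And>x y. x \<in> \<Lambda> \<Longrightarrow> y \<in> \<Lambda> \<Longrightarrow> f (frag_of (bar [x, y])) = \<beta> x y"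
proof -
  define \<psi> where "\<psi> t = \<beta> (fl (t (vx (Suc 0))) - fl (t (vx 0))) (fl (t (vx d2)) - fl (t (vx (Suc 0))))" for t
  define f where "f = cext d2 TS (\<lambda>s. \<psi> (SOME t. lift_of d2 s t))"
  have fc: "f \<in> carrier (cochain_group d2 TS)" unfolding f_def by (rule cext_cochain)
  have f: "f (frag_of s) = \<psi> t" if lift: "lift_of d2 s t" for s t
  proof -
    have s: "singular_simplex d2 TS s" using lift singular_simplex_proj by (auto simp: lift_of_def)
    have "lift_of d2 s (SOME t. lift_of d2 s t)" by (rule someI[of "lift_of _ _", OF lift])
    then obtain l where "l \<in> \<Lambda>" "(SOME t. lift_of d2 s t) = translate d2 l t"
      using lift_unique[OF lift] by blast
    then show ?thesis by (simp add: f_def cext_of[OF s] \<psi>_def translate_vx fl_add)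
  qed
  show thesis
  proof
    show "f \<in> cocycles d2 TS"
    proof (rule cocycleI[OF fc])
      fix s assume s: "singular_simplex d3 TS s"
      then obtain t where t: "lift_of d3 s t" using ex_lift[of d3 s] by auto
      have face: "f (frag_of (singular_face d3 k s)) = \<psi> (singular_face d3 k t)" if "k \<le> d3" for k
        using f[of "singular_face d3 k s" "singular_face d3 k t"] lift_face[OF t, of k] that by simp
      define x y z where "x = fl (t (vx (Suc 0))) - fl (t (vx 0))"
        and "y = fl (t (vx d2)) - fl (t (vx (Suc 0)))" and "z = fl (t (vx d3)) - fl (t (vx d2))"
      have xyz: "x \<in> \<Lambda>" "y \<in> \<Lambda>" "z \<in> \<Lambda>" by (auto simp: x_def y_def z_def lattice_diff fl_lattice)
      have "fl (t (vx d2)) - fl (t (vx 0)) = x + y" "fl (t (vx d3)) - fl (t (vx (Suc 0))) = y + z"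
        by (simp_all add: x_def y_def z_def)
      then show "(\<Sum>k\<le>d3. (-1) ^ k * f (frag_of (singular_face d3 k s))) = 0"
        by (simp add: face \<psi>_def singular_face_vx x_def[symmetric] y_def[symmetric] z_def[symmetric]
            add1 add2 xyz)
    qed
    fix x y assume xy: "x \<in> \<Lambda>" "y \<in> \<Lambda>"
    have "lift_of d2 (bar [x, y]) (asimp d2 (\<lambda>k. sum_list (take k [x, y])))"
      by (simp add: lift_of_def bar_def affine_simplex_asimp singular_simplex_asimp)
    then show "f (frag_of (bar [x, y])) = \<beta> x y" using xy by (simp add: f \<psi>_def asimp_vx fl_id lattice_add)
  qed
qed

end

section \<open>The lattice of alternating forms\<close>

context torus
begin

lemma H2_simps:
  "carrier (H2_lattice \<Lambda>) = carrier (cohomology_group d2 TS)"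
  "x \<otimes>\<^bsub>H2_lattice \<Lambda>\<^esub> y = x \<otimes>\<^bsub>cohomology_group d2 TS\<^esub> y"
  "\<one>\<^bsub>H2_lattice \<Lambda>\<^esub> = \<one>\<^bsub>cohomology_group d2 TS\<^esub>"
  by (simp_all add: H2_lattice_def numeral_2_eq_2)

lemma comm_group_H2: "comm_group (H2_lattice \<Lambda>)"
proof -
  interpret C: comm_group "cohomology_group d2 TS" by (rule comm_group_cohomology)
  show ?thesis
    by (rule comm_groupI) (auto simp: H2_simps C.m_ac)
qed

text \<open>For lattice vectors \<open>par u v\<close> is a cycle, so the value does not depend on
  the representative of the class that is chosen.\<close>

definition alt :: "(torus_point chain \<Rightarrow> int) set \<Rightarrow> complex^2 \<Rightarrow> complex^2 \<Rightarrow> int" where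
  "alt x u v = (SOME f. f \<in> x) (par u v)"

abbreviation (input) "H2 \<equiv> carrier (H2_lattice \<Lambda>)"

lemma alt_eq: "x \<in> H2 \<Longrightarrow> f \<in> x \<Longrightarrow> u \<in> \<Lambda> \<Longrightarrow> v \<in> \<Lambda> \<Longrightarrow> alt x u v = f (par u v)"
  unfolding alt_def H2_simps
  by (rule class_eval) (auto intro: someI[of "\<lambda>f. f \<in> x"] par_chain par_cycle)

lemma alt_mult:
  assumes "x \<in> H2" "y \<in> H2" "u \<in> \<Lambda>" "v \<in> \<Lambda>"
  shows "alt (x \<otimes>\<^bsub>H2_lattice \<Lambda>\<^esub> y) u v = alt x u v + alt y u v"
proof -
  interpret C: comm_group "cohomology_group d2 TS" by (rule comm_group_cohomology)
  obtain f g where fg: "f \<in> x" "g \<in> y" using assms class_nonempty unfolding H2_simps by blast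
  have "f \<otimes>\<^bsub>cochain_group d2 TS\<^esub> g \<in> x \<otimes>\<^bsub>H2_lattice \<Lambda>\<^esub> y"
    using assms fg unfolding H2_simps by (intro class_mult)
  moreover have "x \<otimes>\<^bsub>H2_lattice \<Lambda>\<^esub> y \<in> H2" using assms by (simp add: H2_simps)
  ultimately show ?thesis
    using assms fg by (simp add: alt_eq mult_cochain_group par_chain)
qed

lemma alt_add:
  assumes x: "x \<in> H2" and m: "u \<in> \<Lambda>" "v \<in> \<Lambda>" "w \<in> \<Lambda>"
  shows "alt x (u + v) w = alt x u w + alt x v w"
proof -
  obtain f where f: "f \<in> x" using x class_nonempty unfolding H2_simps by blast
  have "f \<in> cocycles d2 TS" using class_member(1) x f unfolding H2_simps by blast
  then show ?thesis using m f x by (simp add: alt_eq lattice_add eval_par_add)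
qed

lemma alt_swap:
  assumes x: "x \<in> H2" and m: "u \<in> \<Lambda>" "v \<in> \<Lambda>"
  shows "alt x v u = - alt x u v"
proof -
  obtain f where f: "f \<in> x" using x class_nonempty unfolding H2_simps by blast
  have "f \<in> cocycles d2 TS" using class_member(1) x f unfolding H2_simps by blast
  then show ?thesis using m f x by (simp add: alt_eq eval_par cocycles_cochain)
qed

text \<open>The difference of two representatives vanishes on every torus \<open>par u v\<close> and
  is then a coboundary by \<open>symmetric_cocycle_coboundary\<close>.\<close>

lemma alt_inj:
  assumes x: "x \<in> H2" and y: "y \<in> H2" and eq: "\<And>u v. u \<in> \<Lambda> \<Longrightarrow> v \<in> \<Lambda> \<Longrightarrow> alt x u v = alt y u v"
  shows "x = y"
proof -
  interpret C: comm_group "cochain_group d2 TS" by (rule comm_group_cochain)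
  obtain f g where fg: "f \<in> x" "g \<in> y" using x y class_nonempty unfolding H2_simps by blast
  have cc: "f \<in> cocycles d2 TS" "g \<in> cocycles d2 TS" using class_member(1) x y fg unfolding H2_simps by blast+
  note fc = cocycles_cochain[OF cc(1)] and gc = cocycles_cochain[OF cc(2)]
  define h where "h = f \<otimes>\<^bsub>cochain_group d2 TS\<^esub> inv\<^bsub>cochain_group d2 TS\<^esub> g"
  have hc: "h \<in> cocycles d2 TS"
    unfolding h_def using cc subgroup_cocycles
    by (intro subgroup.m_closed[OF subgroup_cocycles] subgroup.m_inv_closed[OF subgroup_cocycles])
  have fhg: "f = h \<otimes>\<^bsub>cochain_group d2 TS\<^esub> g" using fc gc by (simp add: h_def C.m_assoc)
  have "h (par u v) = 0" if "u \<in> \<Lambda>" "v \<in> \<Lambda>" for u v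
  proof -
    have "f (par u v) = h (par u v) + g (par u v)" by (subst fhg) (simp add: mult_cochain_group par_chain)
    then show ?thesis using eq[OF that] x y fg that by (simp add: alt_eq)
  qed
  then have "h \<in> coboundaries d2 TS" by (rule symmetric_cocycle_coboundary[OF hc])
  from class_eqI[OF _ _ fg this fhg] x y show ?thesis unfolding H2_simps by blast
qed

text \<open>Every integral alternating form has the shape \<open>\<beta> u v - \<beta> v u\<close>,
  for instance with \<open>\<beta>\<close> its strictly upper triangular part in a basis.\<close>

lemma alt_surj:
  fixes \<beta> :: "complex^2 \<Rightarrow> complex^2 \<Rightarrow> int"
  assumes "\<And>x y z. x \<in> \<Lambda> \<Longrightarrow> y \<in> \<Lambda> \<Longrightarrow> z \<in> \<Lambda> \<Longrightarrow> \<beta> (x + y) z = \<beta> x z + \<beta> y z"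
    and "\<And>x y z. x \<in> \<Lambda> \<Longrightarrow> y \<in> \<Lambda> \<Longrightarrow> z \<in> \<Lambda> \<Longrightarrow> \<beta> x (y + z) = \<beta> x y + \<beta> x z"
  obtains x where "x \<in> H2" "\<And>u v. u \<in> \<Lambda> \<Longrightarrow> v \<in> \<Lambda> \<Longrightarrow> alt x u v = \<beta> u v - \<beta> v u"
proof -
  obtain f where f: "f \<in> cocycles d2 TS" "\<And>x y. x \<in> \<Lambda> \<Longrightarrow> y \<in> \<Lambda> \<Longrightarrow> f (frag_of (bar [x, y])) = \<beta> x y"
    using cocycle_of_bilinear[of \<beta>] assms by blast
  let ?x = "coboundaries d2 TS #>\<^bsub>cochain_group d2 TS\<^esub> f"
  have "?x \<in> H2" using f(1) by (simp add: H2_simps carrier_cohomology)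
  moreover have "f \<in> ?x" by (rule self_in_class[OF f(1)])
  ultimately show thesis
    using that[of ?x] f by (simp add: alt_eq eval_par cocycles_cochain)
qed

subsection \<open>Pullback\<close>

lemma continuous_map_induced:
  assumes s: "\<And>z. s (proj z) = proj (g z)" and g: "continuous_on UNIV g"
  shows "continuous_map TS TS s"
  unfolding continuous_map_def
proof (intro conjI allI impI)
  show "s \<in> topspace TS \<rightarrow> topspace TS" by (auto simp: topspace_torus s)
  fix U assume U: "openin TS U"
  then have "open (g -` {z. proj z \<in> U})" using g by (intro open_vimage) (auto simp: openin_torus)
  moreover have "{z. proj z \<in> {x \<in> topspace TS. s x \<in> U}} = g -` {z. proj z \<in> U}"
    by (auto simp: topspace_torus s)
  ultimately show "openin TS {x \<in> topspace TS. s x \<in> U}" by (auto simp: openin_torus topspace_torus)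
qed

context
  fixes s :: "torus_point \<Rightarrow> torus_point" and g :: "complex^2 \<Rightarrow> complex^2"
  assumes s: "\<And>z. s (proj z) = proj (g z)" and g: "linear g" and g_lattice: "\<And>z. z \<in> \<Lambda> \<Longrightarrow> g z \<in> \<Lambda>"
begin

lemma continuous_map_s: "continuous_map TS TS s"
  using s g by (intro continuous_map_induced) (auto intro: linear_continuous_on simp: linear_conv_bounded_linear)

lemma simplex_map_bar: "simplex_map d2 s (bar [u, v]) = bar [g u, g v]"
proof -
  have "s (proj (\<Sum>i\<le>d2. x i *\<^sub>R sum_list (take i [u, v]))) = proj (\<Sum>i\<le>d2. x i *\<^sub>R sum_list (take i [g u, g v]))" for x
    by (simp add: s linear_add[OF g] linear_0[OF g] linear_cmul[OF g])
  then show ?thesis by (auto simp: simplex_map_def bar_def affine_simplex_def fun_eq_iff)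
qed

lemma alt_nu:
  assumes x: "x \<in> H2" and m: "u \<in> \<Lambda>" "v \<in> \<Lambda>"
  shows "nu \<Lambda> s x \<in> H2" "alt (nu \<Lambda> s x) u v = alt x (g u) (g v)"
proof -
  obtain f where f: "f \<in> x" using x class_nonempty unfolding H2_simps by blast
  have nu: "nu \<Lambda> s x = pullback_class d2 TS s x" using x by (simp add: nu_def numeral_2_eq_2)
  note pm = pullback_class_mem[OF continuous_map_s x[unfolded H2_simps] f]
  show 1: "nu \<Lambda> s x \<in> H2" using pm by (simp add: nu H2_simps)
  have "alt (nu \<Lambda> s x) u v = pullback_cochain d2 TS s f (par u v)"
    using pm(2) by (intro alt_eq 1 m) (simp add: nu)
  also have "\<dots> = f (par (g u) (g v))"
    by (simp add: pullback_cochain_def par_chain) (simp add: par_def chain_map_diff simplex_map_bar)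
  finally show "alt (nu \<Lambda> s x) u v = alt x (g u) (g v)" using x f m by (simp add: alt_eq g_lattice)
qed

end

subsection \<open>The cup product\<close>

lemma parallelotope_eq:
  "parallelotope_cycle \<Lambda> b = (\<Sum>\<pi> | \<pi> permutes {..<4}.
     frag_cmul (sign \<pi>) (frag_of (bar [b (\<pi> 0), b (\<pi> 1), b (\<pi> 2), b (\<pi> 3)])))"
proof -
  have "affine_simplex \<Lambda> 4 (\<lambda>k. \<Sum>j<k. b (\<pi> j)) = bar [b (\<pi> 0), b (\<pi> 1), b (\<pi> 2), b (\<pi> 3)]" for \<pi>
    unfolding bar_def by (simp add: eval_nat_numeral, rule affine_simplex_translate[of 0])
      (force simp: le_Suc_eq eval_nat_numeral lessThan_Suc ac_simps)+
  then show ?thesis by (simp add: parallelotope_cycle_def)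
qed

lemma parallelotope_chain: "singular_chain (Suc d3) TS (parallelotope_cycle \<Lambda> b)"
  unfolding parallelotope_eq
  by (intro singular_chain_sum singular_chain_cmul) (simp add: singular_chain_of singular_simplex_bar)

lemma eval_parallelotope:
  assumes "h \<in> carrier (cochain_group (Suc d3) TS)"
  shows "h (parallelotope_cycle \<Lambda> b) = (\<Sum>\<pi> | \<pi> permutes {..<4}.
     sign \<pi> * h (frag_of (bar [b (\<pi> 0), b (\<pi> 1), b (\<pi> 2), b (\<pi> 3)])))"
proof -
  interpret cochain "Suc d3" TS h by unfold_locales fact
  have "h (frag_cmul (sign \<pi>) c) = sign \<pi> * h c" if "singular_chain (Suc d3) TS c" for \<pi> :: "nat \<Rightarrow> nat" and c
    by (cases \<pi> rule: sign_cases) (simp_all add: minus that)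
  then show ?thesis
    unfolding parallelotope_eq
    by (subst sum) (auto intro!: singular_chain_cmul sum.cong simp: singular_chain_of singular_simplex_bar)
qed

text \<open>The boundary cancels in pairs. Inner faces are unchanged when the two vectors that are
  added trade places. The first face of one permutation is the last face of its cyclic rotation, and
  a rotation of four letters is odd.\<close>

lemma coboundary_parallelotope:
  assumes "h \<in> coboundaries (Suc d3) TS"
  shows "h (parallelotope_cycle \<Lambda> b) = 0"
proof -
  obtain f where f: "f \<in> carrier (cochain_group d3 TS)" "h = coboundary d3 TS f"
    using assms by (auto simp: coboundaries_def)
  define F where "F x y z = f (frag_of (bar [x, y, z]))" for x y z
  have bar: "h (frag_of (bar [b (\<pi> 0), b (\<pi> 1), b (\<pi> 2), b (\<pi> 3)])) =
      F (b (\<pi> 1)) (b (\<pi> 2)) (b (\<pi> 3)) - F (b (\<pi> 0) + b (\<pi> 1)) (b (\<pi> 2)) (b (\<pi> 3))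
      + F (b (\<pi> 0)) (b (\<pi> 1) + b (\<pi> 2)) (b (\<pi> 3)) - F (b (\<pi> 0)) (b (\<pi> 1)) (b (\<pi> 2) + b (\<pi> 3))
      + F (b (\<pi> 0)) (b (\<pi> 1)) (b (\<pi> 2))" if "\<pi> permutes {..<4}" for \<pi>
  proof -
    have "b (\<pi> 0) \<in> \<Lambda>" using permutes_in_image[OF that, of 0] by (simp add: b_in_lattice)
    then show ?thesis by (simp add: f(2) coboundary_of[OF f(1) singular_simplex_bar(4)] face_bar4 F_def)
  qed
  have "h (parallelotope_cycle \<Lambda> b) = (\<Sum>\<pi> | \<pi> permutes {..<4}. sign \<pi> *
      (\<lambda>i j k l. F (b j) (b k) (b l) - F (b i + b j) (b k) (b l) + F (b i) (b j + b k) (b l)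
        - F (b i) (b j) (b k + b l) + F (b i) (b j) (b k)) (\<pi> 0) (\<pi> 1) (\<pi> 2) (\<pi> 3))"
    using coboundary_cochain[OF f(1), folded f(2)]
    by (subst eval_parallelotope) (assumption, rule sum.cong[OF refl], simp only: mem_Collect_eq bar)
  also have "\<dots> = 0"
    unfolding sum_permutes_4[of "\<lambda>i j k l. F (b j) (b k) (b l) - F (b i + b j) (b k) (b l)
        + F (b i) (b j + b k) (b l) - F (b i) (b j) (b k + b l) + F (b i) (b j) (b k)"] by (simp add: add.commute)
  finally show ?thesis .
qed

lemma front_face_bar: "front_face 2 (bar [x, y, z, w]) = bar [x, y]"
proof
  fix t
  show "front_face 2 (bar [x, y, z, w]) t = bar [x, y] t"
  proof (cases "t \<in> standard_simplex d2")
    case True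
    then have "t \<in> standard_simplex (Suc d3)" "t d3 = 0" "t (Suc d3) = 0"
      using standard_simplex_mono[of d2 "Suc d3"] by (auto simp: standard_simplex_def)
    with True show ?thesis by (simp add: front_face_def bar_def affine_simplex_def numeral_2_eq_2)
  qed (simp add: front_face_def bar_def affine_simplex_def numeral_2_eq_2)
qed

lemma back_face_bar:
  assumes "x \<in> \<Lambda>" "y \<in> \<Lambda>"
  shows "back_face 2 2 (bar [x, y, z, w]) = bar [z, w]"
proof
  fix t
  show "back_face 2 2 (bar [x, y, z, w]) t = bar [z, w] t"
  proof (cases "t \<in> standard_simplex d2")
    case True
    then have t: "t 0 + t (Suc 0) + t d2 = 1" "\<And>i. 0 \<le> t i" "\<And>i. t i \<le> 1" "\<And>i. i > d2 \<Longrightarrow> t i = 0"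
      by (auto simp: standard_simplex_def)
    let ?t = "\<lambda>i. if i < d2 then 0 else t (i - d2)"
    have "?t \<in> standard_simplex (Suc d3)" using t by (auto simp: standard_simplex_def eval_nat_numeral)
    \<comment> \<open>Barycentric coordinates add up to 1, so the back face is the triangle of
      \<open>[z, w]\<close> translated by the lattice vector \<open>x + y\<close>.\<close>
    moreover have "(t 0 *\<^sub>R (x + y) + t (Suc 0) *\<^sub>R (x + (y + z)) + t d2 *\<^sub>R (x + (y + (z + w))))
        - (t (Suc 0) *\<^sub>R z + t d2 *\<^sub>R (z + w)) = (t 0 + t (Suc 0) + t d2) *\<^sub>R (x + y)"
      by (simp add: algebra_simps)
    ultimately show ?thesis using True t(1) lattice_add[OF assms]
      by (simp add: back_face_def bar_def affine_simplex_def eval_nat_numeral proj_eq_iff)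
  qed (simp add: back_face_def bar_def affine_simplex_def numeral_2_eq_2)
qed

text \<open>The value on \<open>e 0, e 1, e 2, e 3\<close> of the wedge product of the two
  alternating forms, as a sum over the six shuffles of type (2,2).\<close>

definition pairing :: "(nat \<Rightarrow> complex^2) \<Rightarrow> (torus_point chain \<Rightarrow> int) set \<Rightarrow> (torus_point chain \<Rightarrow> int) set \<Rightarrow> int" where
  "pairing e x y =
     alt x (e 0) (e 1) * alt y (e 2) (e 3) - alt x (e 0) (e 2) * alt y (e 1) (e 3)
   + alt x (e 0) (e 3) * alt y (e 1) (e 2) + alt x (e 1) (e 2) * alt y (e 0) (e 3)
   - alt x (e 1) (e 3) * alt y (e 0) (e 2) + alt x (e 2) (e 3) * alt y (e 0) (e 1)"

text \<open>The front and back faces of the 24 simplices give products of values on pairs of basis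
  vectors; with their signs they group into six products of antisymmetrised values. The hypothesis
  \<open>fund\<close> isolates the basis used by \<open>fundamental_cycle\<close>; other bases are
  reached by a change of basis later.\<close>

lemma bform_pairing:
  assumes fund: "fundamental_cycle \<Lambda> = parallelotope_cycle \<Lambda> b" and x: "x \<in> H2" and y: "y \<in> H2"
  shows "bform (H2_lattice \<Lambda>) x y = pairing b x y"
proof -
  let ?P = "parallelotope_cycle \<Lambda> b"
  have cup: "cup_cochain 2 2 TS f g ?P = pairing b x y" if fg: "f \<in> x" "g \<in> y" for f g
  proof -
    define F where "F i j = f (frag_of (bar [b i, b j]))" for i j
    define G where "G i j = g (frag_of (bar [b i, b j]))" for i j
    have cc: "f \<in> cocycles d2 TS" "g \<in> cocycles d2 TS" using class_member(1) x y fg unfolding H2_simps by blast+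
    have A: "alt x (b i) (b j) = F i j - F j i" "alt y (b i) (b j) = G i j - G j i" if "i < 4" "j < 4" for i j
      using x y fg that cc by (simp_all add: alt_eq eval_par cocycles_cochain b_in_lattice F_def G_def)
    let ?\<phi> = "\<lambda>s. f (frag_of (front_face 2 s)) * g (frag_of (back_face 2 2 s))"
    have \<phi>: "?\<phi> (bar [b (\<pi> 0), b (\<pi> 1), b (\<pi> 2), b (\<pi> 3)]) = F (\<pi> 0) (\<pi> 1) * G (\<pi> 2) (\<pi> 3)"
      if "\<pi> permutes {..<4}" for \<pi> using permutes_in_image[OF that, of 0] permutes_in_image[OF that, of 1]
      by (simp add: front_face_bar back_face_bar b_in_lattice F_def G_def)
    have "?P \<in> carrier (chain_group (2 + 2) TS)" using parallelotope_chain by (simp add: eval_nat_numeral)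
    then have "cup_cochain 2 2 TS f g ?P = ev ?\<phi> ?P" by (simp add: cup_cochain_def ev_def)
    also have "\<dots> = (\<Sum>\<pi> | \<pi> permutes {..<4}. sign \<pi> * (\<lambda>i j k l. F i j * G k l) (\<pi> 0) (\<pi> 1) (\<pi> 2) (\<pi> 3))"
      unfolding parallelotope_eq ev_sum ev_cmul ev_of by (rule sum.cong[OF refl], simp only: mem_Collect_eq \<phi>)
    also have "\<dots> = pairing b x y"
      unfolding sum_permutes_4[of "\<lambda>i j k l. F i j * G k l"] pairing_def by (simp add: A algebra_simps)
    finally show ?thesis .
  qed
  \<comment> \<open>Elements of the cup class differ by coboundaries, which vanish on the
    parallelotope; so evaluation has exactly one value, as \<open>the_elem\<close> requires.\<close>
  have "(\<lambda>f. f (fundamental_cycle \<Lambda>)) ` cup_class 2 2 TS x y = {pairing b x y}"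
  proof (intro equalityI subsetI)
    fix v assume "v \<in> (\<lambda>f. f (fundamental_cycle \<Lambda>)) ` cup_class 2 2 TS x y"
    then obtain h f g where h: "h \<in> coboundaries (2 + 2) TS" and fg: "f \<in> x" "g \<in> y"
      and v: "v = (h \<otimes>\<^bsub>cochain_group (2 + 2) TS\<^esub> cup_cochain 2 2 TS f g) ?P"
      by (auto simp: cup_class_def set_mult_def fund)
    have "h ?P = 0" using coboundary_parallelotope h by (simp add: eval_nat_numeral)
    then show "v \<in> {pairing b x y}"
      using parallelotope_chain cup[OF fg] unfolding v mult_cochain_group by (simp add: eval_nat_numeral)
  next
    fix v assume "v \<in> {pairing b x y}"
    obtain f g where fg: "f \<in> x" "g \<in> y" using x y class_nonempty unfolding H2_simps by blast
    let ?I = "\<one>\<^bsub>cochain_group (2 + 2) TS\<^esub>"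
    have "?I \<in> coboundaries (2 + 2) TS"
      using subgroup.one_closed[OF subgroup_coboundaries[of d3 TS]] by (simp add: eval_nat_numeral)
    then have "?I \<otimes>\<^bsub>cochain_group (2 + 2) TS\<^esub> cup_cochain 2 2 TS f g \<in> cup_class 2 2 TS x y"
      using fg by (auto simp: cup_class_def set_mult_def)
    moreover have "(?I \<otimes>\<^bsub>cochain_group (2 + 2) TS\<^esub> cup_cochain 2 2 TS f g) ?P = v"
      using parallelotope_chain cup[OF fg] \<open>v \<in> _\<close> by (simp add: mult_cochain_group one_cochain_group eval_nat_numeral)
    ultimately show "v \<in> (\<lambda>f. f (fundamental_cycle \<Lambda>)) ` cup_class 2 2 TS x y"
      unfolding fund by (metis image_eqI)
  qed
  then show ?thesis by (simp add: H2_lattice_def integrate_class_def)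
qed

end

section \<open>Determinants and change of basis\<close>

text \<open>The polar form of the Pfaffian: \<open>pf a a\<close> is twice the Pfaffian of
  \<open>a\<close>.\<close>

definition pf :: "(nat \<Rightarrow> nat \<Rightarrow> 'a::comm_ring_1) \<Rightarrow> (nat \<Rightarrow> nat \<Rightarrow> 'a) \<Rightarrow> 'a" where
  "pf a b = a 0 1 * b 2 3 - a 0 2 * b 1 3 + a 0 3 * b 1 2 + a 1 2 * b 0 3 - a 1 3 * b 0 2 + a 2 3 * b 0 1"

text \<open>The form \<open>a\<close> evaluated on the vectors with coordinate rows
  \<open>M i\<close> and \<open>M j\<close>, that is, the second exterior power of \<open>M\<close>
  acting on forms. Only the entries of \<open>a\<close> above the diagonal are read.\<close>

definition wedge :: "(nat \<Rightarrow> nat \<Rightarrow> 'a::comm_ring_1) \<Rightarrow> (nat \<Rightarrow> nat \<Rightarrow> 'a) \<Rightarrow> nat \<Rightarrow> nat \<Rightarrow> 'a" where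
  "wedge M a i j =
     (M i 0 * M j 1 - M i 1 * M j 0) * a 0 1 + (M i 0 * M j 2 - M i 2 * M j 0) * a 0 2
   + (M i 0 * M j 3 - M i 3 * M j 0) * a 0 3 + (M i 1 * M j 2 - M i 2 * M j 1) * a 1 2
   + (M i 1 * M j 3 - M i 3 * M j 1) * a 1 3 + (M i 2 * M j 3 - M i 3 * M j 2) * a 2 3"

text \<open>Laplace expansion along the first two rows. It is the form in which the determinant
  appears when the exterior square acts on the Pfaffian pairing, so \<open>pf_wedge\<close> becomes
  a polynomial identity.\<close>

definition det4 :: "(nat \<Rightarrow> nat \<Rightarrow> 'a::comm_ring_1) \<Rightarrow> 'a" where
  "det4 M =
     (M 0 0 * M 1 1 - M 0 1 * M 1 0) * (M 2 2 * M 3 3 - M 2 3 * M 3 2)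
   - (M 0 0 * M 1 2 - M 0 2 * M 1 0) * (M 2 1 * M 3 3 - M 2 3 * M 3 1)
   + (M 0 0 * M 1 3 - M 0 3 * M 1 0) * (M 2 1 * M 3 2 - M 2 2 * M 3 1)
   + (M 0 1 * M 1 2 - M 0 2 * M 1 1) * (M 2 0 * M 3 3 - M 2 3 * M 3 0)
   - (M 0 1 * M 1 3 - M 0 3 * M 1 1) * (M 2 0 * M 3 2 - M 2 2 * M 3 0)
   + (M 0 2 * M 1 3 - M 0 3 * M 1 2) * (M 2 0 * M 3 1 - M 2 1 * M 3 0)"

lemma pf_wedge: "pf (wedge M a) (wedge M b) = det4 M * pf a b"
  unfolding pf_def wedge_def det4_def by (simp only: algebra_simps)

lemma det4_cong: "(\<And>i j. i < 4 \<Longrightarrow> j < 4 \<Longrightarrow> M i j = N i j) \<Longrightarrow> det4 M = det4 N"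
  by (simp add: det4_def)

lemma det_4:
  fixes A :: "'a::comm_ring_1^4^4"
  shows "det A = det4 (\<lambda>i j. A $ (if i = 0 then 1 else if i = 1 then 2 else if i = 2 then 3 else 4)
     $ (if j = 0 then 1 else if j = 1 then 2 else if j = 2 then 3 else 4))"
proof -
  have eq: "(UNIV :: 4 set) = insert 1 (insert 2 (insert 3 (insert 4 {})))" by (simp add: UNIV_4)
  have "det A = alternating_sum (insert 1 (insert 2 (insert 3 (insert 4 {}))))
      (\<lambda>p. (\<lambda>i j k l. A $ 1 $ i * (A $ 2 $ j * (A $ 3 $ k * A $ 4 $ l))) (p 1) (p 2) (p 3) (p 4))"
    unfolding det_def alternating_sum_def eq by (intro sum.cong refl) simp
  also have "\<dots> = det4 (\<lambda>i j. A $ (if i = 0 then 1 else if i = 1 then 2 else if i = 2 then 3 else 4)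
     $ (if j = 0 then 1 else if j = 1 then 2 else if j = 2 then 3 else 4))"
    by (subst alternating_sum_4[of _ _ _ _ "\<lambda>i j k l. A $ 1 $ i * (A $ 2 $ j * (A $ 3 $ k * A $ 4 $ l))"]) (simp_all add: det4_def algebra_simps)
  finally show ?thesis .
qed

lemma vector_4 [simp]:
  "(vector [x, y, z, w] :: 'a::zero^4) $ 1 = x" "(vector [x, y, z, w] :: 'a::zero^4) $ 2 = y"
  "(vector [x, y, z, w] :: 'a::zero^4) $ 3 = z" "(vector [x, y, z, w] :: 'a::zero^4) $ 4 = w"
  unfolding vector_def by simp_all

definition mat4 :: "(nat \<Rightarrow> nat \<Rightarrow> 'a::comm_ring_1) \<Rightarrow> 'a^4^4" where
  "mat4 M = vector [vector [M 0 0, M 0 1, M 0 2, M 0 3], vector [M 1 0, M 1 1, M 1 2, M 1 3],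
     vector [M 2 0, M 2 1, M 2 2, M 2 3], vector [M 3 0, M 3 1, M 3 2, M 3 3]]"

lemma det_mat4: "det (mat4 M) = det4 M"
  by (simp add: det_4 mat4_def det4_def)

lemma lessThan_4: "{..<4::nat} = {0, 1, 2, 3}" by auto

lemma det4_mult: "det4 (\<lambda>i j. \<Sum>k<4. M i k * N k j) = det4 M * det4 N"
proof -
  have "mat4 (\<lambda>i j. \<Sum>k<4. M i k * N k j) = mat4 M ** mat4 N"
    by (simp add: vec_eq_iff forall_4 matrix_matrix_mult_def sum_4 mat4_def lessThan_4 add.assoc)
  then show ?thesis by (simp add: det_mat4[symmetric] det_mul)
qed

section \<open>Oriented volume and the form dz1 dz2\<close>

definition rc :: "complex^2 \<Rightarrow> nat \<Rightarrow> real" where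
  "rc z j = (if j = 0 then Re (z$1) else if j = 1 then Im (z$1) else if j = 2 then Re (z$2) else Im (z$2))"

lemma rc_linear: "rc (z + w) j = rc z j + rc w j" "rc (c *\<^sub>R z) j = c * rc z j" "rc 0 j = 0"
  by (auto simp: rc_def)

definition vol :: "(nat \<Rightarrow> complex^2) \<Rightarrow> real" where "vol v = det4 (\<lambda>i j. rc (v i) j)"

lemma vol_comb:
  assumes "\<And>i. i < 4 \<Longrightarrow> e i = (\<Sum>k<4. M i k *\<^sub>R v k)"
  shows "vol e = det4 M * vol v"
proof -
  have "vol e = det4 (\<lambda>i j. \<Sum>k<4. M i k * rc (v k) j)"
    unfolding vol_def by (rule det4_cong) (simp add: assms lessThan_4 rc_linear)
  then show ?thesis by (simp add: det4_mult vol_def)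
qed

lemma positive_basis_iff: "positive_basis v \<Lambda> \<longleftrightarrow> lattice_basis v \<Lambda> \<and> vol v > 0"
proof -
  have "det (vector [real_coords (v 0), real_coords (v 1), real_coords (v 2), real_coords (v 3)] :: real^4^4) = vol v"
    by (simp add: det_4 vol_def real_coords_def rc_def det4_def)
  then show ?thesis by (simp add: positive_basis_def)
qed

definition dC :: "complex^2 \<Rightarrow> complex^2 \<Rightarrow> complex" where "dC u v = u$1 * v$2 - u$2 * v$1"

text \<open>This is the identity \<open>dz\<^sub>1 \<and> dz\<^sub>2 \<and> d\<zbar>\<^sub>1 \<and> d\<zbar>\<^sub>2 = 4 vol\<close>.\<close>

lemma pf_dC: "pf (\<lambda>i j. dC (v i) (v j)) (\<lambda>i j. cnj (dC (v i) (v j))) = of_real (4 * vol v)"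
  unfolding complex_eq_iff by (simp add: pf_def dC_def vol_def det4_def rc_def) (simp add: algebra_simps)

text \<open>The Plucker relation: \<open>dC\<close> is decomposable, so its square vanishes. This is
  the equation (w, w) = 0 for the period.\<close>

lemma pf_dC_0: "pf (\<lambda>i j. dC (v i) (v j)) (\<lambda>i j. dC (v i) (v j)) = 0"
  by (simp add: pf_def dC_def algebra_simps)

section \<open>Linear lifts of automorphisms\<close>

definition clinear2 :: "(complex^2 \<Rightarrow> complex^2) \<Rightarrow> bool" where
  "clinear2 L \<longleftrightarrow> (\<forall>x y. L (x + y) = L x + L y) \<and> (\<forall>c x. L (c *s x) = c *s L x)"

lemma scaleR_smult: "r *\<^sub>R (x :: complex^'n) = complex_of_real r *s x"
  unfolding vec_eq_iff vector_scaleR_component vector_smult_component by (simp add: scaleR_conv_of_real)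

lemma clinear2_linear: "clinear2 L \<Longrightarrow> linear L"
  by (rule linearI) (simp_all add: clinear2_def scaleR_smult)

lemma clinear2_add: "clinear2 L \<Longrightarrow> L (x + y) = L x + L y"
  and clinear2_smult: "clinear2 L \<Longrightarrow> L (c *s x) = c *s L x"
  by (simp_all add: clinear2_def)

lemma clinear2_basis:
  assumes "clinear2 L" shows "L z = z$1 *s L (axis 1 1) + z$2 *s L (axis 2 1)"
proof -
  have "z = z$1 *s axis 1 1 + z$2 *s axis 2 1"
    by (simp add: vec_eq_iff forall_2 axis_def)
  then show ?thesis using assms unfolding clinear2_def by metis
qed

definition cdet :: "(complex^2 \<Rightarrow> complex^2) \<Rightarrow> complex" where
  "cdet L = dC (L (axis 1 1)) (L (axis 2 1))"

lemma dC_clinear2: "clinear2 L \<Longrightarrow> dC (L u) (L v) = cdet L * dC u v"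
  unfolding cdet_def clinear2_basis[of L u] clinear2_basis[of L v] by (simp add: dC_def algebra_simps)

lemma linear_smult_iff:
  "Vector_Spaces.linear (*s) (*) L \<longleftrightarrow> (\<forall>x y. L (x + y) = L x + L y) \<and> (\<forall>c x. L (c *s x) = c * L x)"
  for L :: "complex^'n \<Rightarrow> complex"
proof -
  have "vector_space ((*) :: complex \<Rightarrow> _)" by unfold_locales (auto simp: algebra_simps)
  then show ?thesis using vec.vector_space_axioms by (auto simp: Vector_Spaces.linear_iff)
qed

section \<open>Complex derivatives of maps between vector spaces\<close>

lemma has_derivative_vec:
  fixes F :: "'a::real_normed_vector \<Rightarrow> complex^'m"
  assumes "\<And>i. ((\<lambda>z. F z $ i) has_derivative L i) (at z)"
  shows "(F has_derivative (\<lambda>x. \<chi> i. L i x)) (at z)"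
proof (rule has_derivative_componentwise_within[THEN iffD2], rule ballI)
  fix k :: "complex^'m" assume "k \<in> Basis"
  then obtain i u where k: "k = axis i u" by (auto simp: Basis_vec_def)
  show "((\<lambda>x. F x \<bullet> k) has_derivative (\<lambda>x. (\<chi> i. L i x) \<bullet> k)) (at z)"
    unfolding k inner_axis vec_lambda_beta by (rule has_derivative_inner_left[OF assms])
qed

lemma holomorphic_map_continuous:
  assumes "holomorphic_map F U" shows "continuous_on U F"
proof -
  have "continuous_on U (\<lambda>z. F z $ i)" for i
  proof (rule differentiable_imp_continuous_on)
    show "(\<lambda>z. F z $ i) differentiable_on U"
      using assms unfolding holomorphic_map_def holomorphic_fun_def differentiable_on_def differentiable_def
      by (meson has_derivative_at_withinI)
  qed
  then have "continuous_on U (\<lambda>z. \<chi> i. F z $ i)" by (rule continuous_on_vec_lambda)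
  then show ?thesis by simp
qed

lemma holomorphic_map_derivative:
  fixes F :: "complex^2 \<Rightarrow> complex^2"
  assumes "holomorphic_map F U" "z \<in> U"
  obtains L where "(F has_derivative L) (at z)" "clinear2 L"
proof -
  have "\<forall>i. \<exists>l. ((\<lambda>z. F z $ i) has_derivative l) (at z) \<and> Vector_Spaces.linear (*s) (*) l"
    using assms by (auto simp: holomorphic_map_def holomorphic_fun_def)
  then obtain l where l: "\<And>i. ((\<lambda>z. F z $ i) has_derivative l i) (at z)"
    "\<And>i. Vector_Spaces.linear (*s) (*) (l i)" by metis
  have "clinear2 (\<lambda>x. \<chi> i. l i x)"
    using l(2) by (auto simp: clinear2_def linear_smult_iff vec_eq_iff)
  with that has_derivative_vec[of F l, OF l(1)] show thesis by blast
qed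

lemma clinear2_holomorphic: "clinear2 L \<Longrightarrow> holomorphic_map L UNIV"
  unfolding holomorphic_map_def holomorphic_fun_def
proof (intro allI ballI)
  fix i z assume L: "clinear2 L"
  have "bounded_linear (\<lambda>z. L z $ i)"
    using bounded_linear_compose[OF bounded_linear_vec_nth] clinear2_linear[OF L] by (simp add: linear_conv_bounded_linear)
  then have "((\<lambda>z. L z $ i) has_derivative (\<lambda>z. L z $ i)) (at z)" by (rule bounded_linear_imp_has_derivative)
  moreover have "Vector_Spaces.linear (*s) (*) (\<lambda>z. L z $ i)"
    using L by (simp add: linear_smult_iff clinear2_def)
  ultimately show "\<exists>l. ((\<lambda>z. L z $ i) has_derivative l) (at z) \<and> Vector_Spaces.linear (*s) (*) l" by blast
qed

text \<open>Additivity forces \<open>F (z / 2^n)\<close> to be \<open>F z / 2^n\<close>, so the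
  error quotient of the derivative along this sequence is constant. Its limit is 0, hence so is the
  constant.\<close>

lemma locally_additive_derivative:
  fixes F :: "complex^2 \<Rightarrow> complex^2"
  assumes D: "(F has_derivative L) (at 0)" and r: "r > 0"
    and add: "\<And>z w. norm z < r \<Longrightarrow> norm w < r \<Longrightarrow> F (z + w) = F z + F w"
    and z: "norm z < r"
  shows "F z = L z"
proof (cases "z = 0")
  case True
  then show ?thesis using add[of 0 0] r has_derivative_linear[OF D] by (simp add: linear_0)
next
  case False
  define y where "y n = (1/2) ^ n *\<^sub>R z" for n :: nat
  have L: "linear L" by (rule has_derivative_linear[OF D])
  have F0: "F 0 = 0" using add[of 0 0] r by simp
  have small: "norm (y n) < r" for n
  proof -
    have "norm (y n) \<le> norm z" using power_le_one[of "1/2::real" n] by (simp add: y_def mult_left_le_one_le)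
    then show ?thesis using z by linarith
  qed
  have Fy: "F (y n) = (1/2) ^ n *\<^sub>R F z" for n
  proof (induction n)
    case (Suc n)
    have "y n = y (Suc n) + y (Suc n)" by (simp add: y_def scaleR_add_left[symmetric])
    then have "F (y n) = F (y (Suc n)) + F (y (Suc n))" using add[OF small small] by metis
    then have "F (y n) = 2 *\<^sub>R F (y (Suc n))" by (simp add: scaleR_2)
    then have "F (y (Suc n)) = (1/2) *\<^sub>R F (y n)" by simp
    with Suc show ?case by simp
  qed (simp add: y_def)
  have "((\<lambda>y. norm ((F y - F 0) - L (y - 0)) / norm (y - 0)) \<longlongrightarrow> 0) (at 0)"
    using D by (simp add: has_derivative_iff_norm)
  moreover have "filterlim y (at 0) sequentially"
    unfolding filterlim_at
  proof
    have "(\<lambda>n. (1/2::real) ^ n *\<^sub>R z) \<longlonglongrightarrow> 0 *\<^sub>R z" by (intro tendsto_intros LIMSEQ_power_zero) simp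
    then show "y \<longlonglongrightarrow> 0" by (simp add: y_def[abs_def])
  qed (use False in \<open>simp add: y_def\<close>)
  ultimately have "(\<lambda>n. norm ((F (y n) - F 0) - L (y n - 0)) / norm (y n - 0)) \<longlonglongrightarrow> 0"
    by (rule filterlim_compose)
  moreover have "norm ((F (y n) - F 0) - L (y n - 0)) / norm (y n - 0) = norm (F z - L z) / norm z" for n
  proof -
    have Ly: "L (y n) = (1/2) ^ n *\<^sub>R L z" by (simp add: y_def linear_cmul[OF L])
    have FL: "F (y n) - L (y n) = (1/2) ^ n *\<^sub>R (F z - L z)" by (simp only: Fy Ly scaleR_diff_right)
    show ?thesis unfolding F0 diff_zero FL by (simp add: y_def)
  qed
  ultimately have "(\<lambda>n::nat. norm (F z - L z) / norm z) \<longlonglongrightarrow> 0" by simp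
  then have "norm (F z - L z) / norm z = 0" by (simp add: LIMSEQ_const_iff)
  then show ?thesis using False by simp
qed

context torus
begin

section \<open>Automorphisms of the torus and linear maps\<close>

definition induced :: "(torus_point \<Rightarrow> torus_point) \<Rightarrow> (complex^2 \<Rightarrow> complex^2) \<Rightarrow> bool" where
  "induced s L \<longleftrightarrow> clinear2 L \<and> (\<forall>z\<in>\<Lambda>. L z \<in> \<Lambda>) \<and> (\<forall>z. s (proj z) = proj (L z))"

text \<open>For a local lift \<open>F\<close> near 0 the defect \<open>F (z + w) - F z - F w\<close>
  is continuous with values in the lattice, hence constant. So \<open>F - F 0\<close> is additive
  near 0 and equals its derivative \<open>L\<close>. Any vector is an integral multiple of a small
  one, so \<open>L\<close> describes the homomorphism everywhere.\<close>

lemma induced_exists: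
  assumes hom: "\<And>z w. s (proj (z + w)) = s (proj z) \<otimes>\<^bsub>torus_group \<Lambda>\<^esub> s (proj w)"
    and range: "\<And>z. s (proj z) \<in> range proj" and hol: "torus_holomorphic \<Lambda> s"
  obtains L where "induced s L"
proof -
  obtain U F where U: "0 \<in> U" "open U" and F: "holomorphic_map F U" "\<And>w. w \<in> U \<Longrightarrow> s (proj w) = proj (F w)"
  proof -
    have "\<exists>U F. 0 \<in> U \<and> local_lift \<Lambda> s U F" using hol by (simp add: torus_holomorphic_def)
    then show ?thesis using that by (auto simp: local_lift_def)
  qed
  obtain r0 where r0: "r0 > 0" "ball 0 r0 \<subseteq> U" using U open_contains_ball by blast
  define r where "r = r0 / 2"
  have r: "r > 0" "\<And>z w. norm z < r \<Longrightarrow> norm w < r \<Longrightarrow> z + w \<in> U" "\<And>z. norm z < r \<Longrightarrow> z \<in> U"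
  proof -
    show "r > 0" using r0 by (simp add: r_def)
    show "z + w \<in> U" if "norm z < r" "norm w < r" for z w
      using norm_triangle_ineq[of z w] that r0(2) by (auto simp: r_def subset_iff)
    show "z \<in> U" if "norm z < r" for z using that r0 by (auto simp: r_def subset_iff)
  qed
  obtain L where L: "(F has_derivative L) (at 0)" "clinear2 L" using holomorphic_map_derivative[OF F(1) U(1)] .
  have lin: "linear L" by (rule clinear2_linear[OF L(2)])
  define E where "E = (\<lambda>(z, w). F (z + w) - F z - F w)"
  have s0: "s (proj 0) = proj 0"
  proof -
    obtain z where z: "s (proj 0) = proj z" using range[of 0] by auto
    then have "proj z = proj (z + z)" using hom[of 0 0] by (simp add: mult_torus)
    then have "- z \<in> \<Lambda>" by (simp add: proj_eq_iff)
    then show ?thesis using lattice_minus[of "- z"] by (simp add: z proj_eq_iff)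
  qed
  have E: "E p \<in> \<Lambda>" if pb: "p \<in> ball 0 r \<times> ball 0 r" for p
  proof -
    obtain z w where p: "p = (z, w)" "norm z < r" "norm w < r" using pb by (cases p) auto
    have "proj (F (z + w)) = proj (F z + F w)" using hom[of z w] p r by (simp add: F(2)[symmetric] mult_torus[symmetric])
    then show ?thesis using p by (simp add: E_def proj_eq_iff algebra_simps)
  qed
  note cF = holomorphic_map_continuous[OF F(1)]
  have contE: "continuous_on (ball 0 r \<times> ball 0 r) E"
    unfolding E_def case_prod_unfold by (intro continuous_intros continuous_on_compose2[OF cF]) (use r in auto)
  have E0: "E p = - F 0" if "p \<in> ball 0 r \<times> ball 0 r" for p
  proof -
    have "E p = E (0, 0)"
      by (rule continuous_into_lattice[OF _ contE]) (use E that r in \<open>auto intro: connected_Times\<close>)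
    then show ?thesis by (simp add: E_def)
  qed
  have FL: "F z - F 0 = L z" if "norm z < r" for z
  proof (rule locally_additive_derivative[OF _ r(1) _ that])
    show "((\<lambda>z. F z - F 0) has_derivative L) (at 0)" using L(1) by (auto intro!: derivative_eq_intros)
    show "F (z + w) - F 0 = F z - F 0 + (F w - F 0)" if "norm z < r" "norm w < r" for z w
      using E0[of "(z, w)"] that by (simp add: E_def algebra_simps)
  qed
  have F0: "F 0 \<in> \<Lambda>" using s0 F(2)[OF U(1)] by (simp add: proj_eq_iff[of _ 0, simplified] flip: proj_eq_iff)
  have sL_small: "s (proj z) = proj (L z)" if "norm z < r" for z
  proof -
    have "proj (F z) = proj (L z)" using FL[OF that] F0 by (simp add: proj_eq_iff flip: FL[OF that])
    then show ?thesis using F(2) r(3)[OF that] by simp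
  qed
  have mult: "s (proj (real n *\<^sub>R z)) = proj (real n *\<^sub>R L z)" if "norm z < r" for n z
    by (induction n) (simp_all add: s0 scaleR_add_left hom sL_small[OF that] mult_torus add.commute)
  have sL: "s (proj z) = proj (L z)" for z
  proof -
    obtain n :: nat where n: "norm z / r < real n" using reals_Archimedean2 by blast
    then have "0 < real n" using r(1) by (meson divide_nonneg_pos le_less_trans norm_ge_zero)
    then have z: "z = real n *\<^sub>R ((1 / real n) *\<^sub>R z)" by simp
    have "norm ((1 / real n) *\<^sub>R z) < r" using n \<open>0 < real n\<close> r(1) by (simp add: field_simps)
    from mult[OF this, of n] have "s (proj z) = proj (real n *\<^sub>R L ((1 / real n) *\<^sub>R z))" using z by simp
    then show ?thesis using \<open>0 < real n\<close> by (simp add: linear_cmul[OF lin])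
  qed
  have "L z \<in> \<Lambda>" if "z \<in> \<Lambda>" for z
  proof -
    have "proj z = proj 0" using that by (simp add: proj_eq_iff)
    then have "proj (L z) = proj 0" using sL[of z] s0 by simp
    then show ?thesis by (simp add: proj_eq_iff)
  qed
  with sL L(2) that show thesis by (auto simp: induced_def)
qed

lemma induced_comp_id:
  assumes L: "clinear2 L" and L': "clinear2 L'" and "\<And>z. proj (L' (L z)) = proj z"
  shows "L' (L z) = z"
proof -
  have "L' (L z) - z = L' (L 0) - 0"
  proof (rule continuous_into_lattice[of UNIV "\<lambda>z. L' (L z) - z"])
    show "continuous_on UNIV (\<lambda>z. L' (L z) - z)" using clinear2_linear[OF L] clinear2_linear[OF L']
      by (intro continuous_intros linear_continuous_on_compose[where g = L'] linear_continuous_on)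
        (auto simp: linear_conv_bounded_linear)
    show "L' (L x) - x \<in> \<Lambda>" for x using assms(3)[of x] by (simp add: proj_eq_iff)
  qed auto
  then show ?thesis using linear_0[OF clinear2_linear[OF L]] linear_0[OF clinear2_linear[OF L']] by simp
qed

lemma torus_holomorphicI:
  assumes "clinear2 L" "\<And>z. s (proj z) = proj (L z)" shows "torus_holomorphic \<Lambda> s"
  unfolding torus_holomorphic_def local_lift_def
  using clinear2_holomorphic[OF assms(1)] assms(2) by (intro allI exI[of _ UNIV] exI[of _ L]) auto

definition lattice_auto :: "(complex^2 \<Rightarrow> complex^2) \<Rightarrow> (complex^2 \<Rightarrow> complex^2) \<Rightarrow> bool" where
  "lattice_auto L L' \<longleftrightarrow> clinear2 L \<and> clinear2 L' \<and> (\<forall>z\<in>\<Lambda>. L z \<in> \<Lambda>) \<and> (\<forall>z\<in>\<Lambda>. L' z \<in> \<Lambda>)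
     \<and> (\<forall>z. L (L' z) = z) \<and> (\<forall>z. L' (L z) = z)"

text \<open>The interface to the analytic definition: from here on an automorphism is a pair of
  mutually inverse complex linear maps preserving \<Lambda>.\<close>

lemma Aut0_iff:
  "s \<in> carrier (Aut0 \<Lambda>) \<longleftrightarrow>
     s \<in> extensional (range proj) \<and> (\<exists>L L'. lattice_auto L L' \<and> (\<forall>z. s (proj z) = proj (L z)))"
proof (intro iffI conjI)
  assume "s \<in> carrier (Aut0 \<Lambda>)"
  then have auto: "s \<in> auto (torus_group \<Lambda>)" and hol: "torus_holomorphic \<Lambda> s"
    and hol': "torus_holomorphic \<Lambda> (inv_into (carrier (torus_group \<Lambda>)) s)" by (auto simp: Aut0_def)
  interpret T: group "torus_group \<Lambda>" by (rule group_torus)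
  have s: "s \<in> hom (torus_group \<Lambda>) (torus_group \<Lambda>)" "bij_betw s (range proj) (range proj)"
    "s \<in> extensional (range proj)" using auto by (auto simp: auto_def Bij_def carrier_torus)
  show "s \<in> extensional (range proj)" by fact
  have hom: "s (proj (z + w)) = s (proj z) \<otimes>\<^bsub>torus_group \<Lambda>\<^esub> s (proj w)" for z w
    using s(1) by (simp add: hom_def carrier_torus mult_torus[symmetric])
  have range: "s (proj z) \<in> range proj" for z using bij_betwE[OF s(2)] by blast
  obtain L where L: "induced s L" using induced_exists[OF hom range hol] .
  define t where "t = inv_into (range proj) s"
  have t: "s (t x) = x" "t x \<in> range proj" if "x \<in> range proj" for x
    using s(2) that unfolding t_def bij_betw_def by (auto simp: f_inv_into_f inv_into_into)
  have ts: "t (s x) = x" if "x \<in> range proj" for x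
    using s(2) that by (simp add: t_def bij_betw_def)
  have homt: "t (proj (z + w)) = t (proj z) \<otimes>\<^bsub>torus_group \<Lambda>\<^esub> t (proj w)" for z w
  proof -
    obtain z' where z': "t (proj z) = proj z'" using t(2)[of "proj z"] by auto
    obtain w' where w': "t (proj w) = proj w'" using t(2)[of "proj w"] by auto
    have "s (proj z') = proj z" "s (proj w') = proj w" using t(1)[of "proj z"] t(1)[of "proj w"] by (simp_all add: z' w')
    then have "s (proj (z' + w')) = proj (z + w)" by (simp only: hom mult_torus)
    then have "t (proj (z + w)) = proj (z' + w')" using ts[of "proj (z' + w')"] by simp
    then show ?thesis by (simp add: z' w' mult_torus)
  qed
  obtain L' where L': "induced t L'"
    using induced_exists[of t, OF homt t(2)[OF rangeI]] hol' by (auto simp: t_def carrier_torus)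
  have "lattice_auto L L'"
  proof -
    have "proj (L (L' z)) = proj z" for z using L L' t(1)[of "proj z"] by (simp add: induced_def)
    moreover have "proj (L' (L z)) = proj z" for z using L L' ts[of "proj z"] by (simp add: induced_def)
    ultimately show ?thesis using L L' induced_comp_id by (auto simp: lattice_auto_def induced_def)
  qed
  then show "\<exists>L L'. lattice_auto L L' \<and> (\<forall>z. s (proj z) = proj (L z))" using L by (auto simp: induced_def)
next
  assume "s \<in> extensional (range proj) \<and> (\<exists>L L'. lattice_auto L L' \<and> (\<forall>z. s (proj z) = proj (L z)))"
  then obtain L L' where ext: "s \<in> extensional (range proj)" and L: "lattice_auto L L'"
    and s: "\<And>z. s (proj z) = proj (L z)" by blast
  have inj: "proj z = proj w" if "proj (L z) = proj (L w)" for z w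
  proof -
    have "L' (L z - L w) \<in> \<Lambda>" using that L by (auto simp: proj_eq_iff lattice_auto_def)
    then have "z - w \<in> \<Lambda>" using L linear_diff[OF clinear2_linear, of L'] by (simp add: lattice_auto_def)
    then show ?thesis by (simp add: proj_eq_iff)
  qed
  have bij: "bij_betw s (range proj) (range proj)"
    unfolding bij_betw_def
  proof
    show "inj_on s (range proj)" 
    proof (rule inj_onI, elim rangeE)
      fix x y z w assume "s x = s y" "x = proj z" "y = proj w"
      then show "x = y" using inj[of z w] by (simp add: s)
    qed
    show "s ` range proj = range proj"
    proof (intro equalityI subsetI)
      fix x assume "x \<in> range proj"
      then obtain z where "x = proj z" by auto
      then have "x = s (proj (L' z))" using L by (simp add: s lattice_auto_def)
      then show "x \<in> s ` range proj" by blast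
    qed (auto simp: s)
  qed
  have inv: "inv_into (range proj) s (proj z) = proj (L' z)" for z
  proof -
    have "s (proj (L' z)) = proj z" using L by (simp add: s lattice_auto_def)
    then show ?thesis using bij by (metis bij_betw_imp_inj_on inv_into_f_f rangeI)
  qed
  have "s \<in> auto (torus_group \<Lambda>)"
    using ext bij L by (auto simp: auto_def Bij_def carrier_torus hom_def s mult_torus lattice_auto_def clinear2_add)
  moreover have "torus_holomorphic \<Lambda> s" using L s by (auto intro: torus_holomorphicI simp: lattice_auto_def)
  moreover have "torus_holomorphic \<Lambda> (inv_into (carrier (torus_group \<Lambda>)) s)"
    using L by (auto intro!: torus_holomorphicI[of L'] simp: lattice_auto_def inv carrier_torus)
  ultimately show "s \<in> carrier (Aut0 \<Lambda>)" by (simp add: Aut0_def)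
qed

end

section \<open>Holomorphic two-forms\<close>

context torus
begin

text \<open>Any local lift differs from \<open>L\<close> by a lattice-valued continuous function,
  which is locally constant and does not affect the derivative. So the description by
  \<open>THE\<close> is unambiguous.\<close>

lemma tangent_map_eq:
  assumes L: "clinear2 L" and s: "\<And>z. s (proj z) = proj (L z)"
  shows "tangent_map \<Lambda> s (proj z) = L"
  unfolding tangent_map_def
proof (rule the_equality)
  have bl: "bounded_linear L" using clinear2_linear[OF L] by (simp add: linear_conv_bounded_linear)
  show "\<exists>z' U F. proj z = proj z' \<and> z' \<in> U \<and> local_lift \<Lambda> s U F \<and> (F has_derivative L) (at z')"
    using clinear2_holomorphic[OF L] s bl bounded_linear_imp_has_derivative
    by (intro exI[of _ z] exI[of _ UNIV] exI[of _ L]) (auto simp: local_lift_def)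
  fix M assume "\<exists>z' U F. proj z = proj z' \<and> z' \<in> U \<and> local_lift \<Lambda> s U F \<and> (F has_derivative M) (at z')"
  then obtain z' U F where z': "z' \<in> U" and F: "local_lift \<Lambda> s U F" and M: "(F has_derivative M) (at z')" by blast
  then have "open U" and cF: "continuous_on U F" by (auto simp: local_lift_def holomorphic_map_continuous)
  then obtain r where r: "r > 0" "ball z' r \<subseteq> U" using z' open_contains_ball by blast
  have m: "F w - L w \<in> \<Lambda>" if "w \<in> ball z' r" for w
  proof -
    have "s (proj w) = proj (F w)" using F that r by (auto simp: local_lift_def)
    then show ?thesis using s[of w] by (simp add: proj_eq_iff[symmetric])
  qed
  have c: "continuous_on (ball z' r) (\<lambda>w. F w - L w)"
    using r bl by (intro continuous_intros continuous_on_subset[OF cF] linear_continuous_on) auto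
  have "F w - L w = F z' - L z'" if "w \<in> ball z' r" for w
    by (rule continuous_into_lattice[OF _ c]) (use m that r in auto)
  then have eq: "L w + (F z' - L z') = F w" if "w \<in> ball z' r" for w
    using that by (metis add.commute diff_add_cancel)
  have "((\<lambda>w. L w + (F z' - L z')) has_derivative L) (at z')"
    using bounded_linear_imp_has_derivative[OF bl] by (auto intro!: derivative_eq_intros)
  then have "(F has_derivative L) (at z')"
    by (rule has_derivative_transform_within_open[of _ _ _ _ "ball z' r"]) (use r eq in auto)
  then show "M = L" using M has_derivative_unique by blast
qed

text \<open>Every value is attained on a ball containing the fundamental parallelotope, so the
  function is bounded; Liouville's theorem is applied on each complex line through 0.\<close>

lemma holomorphic_periodic_constant:
  assumes hol: "holomorphic_fun f UNIV" and per: "\<And>z l. l \<in> \<Lambda> \<Longrightarrow> f (z + l) = f z"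
  shows "f z = f 0"
proof -
  have D: "\<exists>l. (f has_derivative l) (at z) \<and> Vector_Spaces.linear (*s) (*) l" for z
    using hol by (auto simp: holomorphic_fun_def)
  have cont: "continuous_on UNIV f"
    using D has_derivative_continuous by (metis continuous_at_imp_continuous_on)
  define R where "R = (\<Sum>i<4. norm (b i))"
  have R: "norm (z - fl z) \<le> R" for z
  proof -
    have "z - fl z = (\<Sum>i<4. (crd z i - of_int \<lfloor>crd z i\<rfloor>) *\<^sub>R b i)"
      by (simp add: fl_def scaleR_diff_left sum_subtractf sum_crd)
    also have "norm \<dots> \<le> (\<Sum>i<4. norm ((crd z i - of_int \<lfloor>crd z i\<rfloor>) *\<^sub>R b i))" by (rule norm_sum)
    also have "\<dots> \<le> R" unfolding R_def
    proof (rule sum_mono)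
      fix i
      have "\<bar>crd z i - of_int \<lfloor>crd z i\<rfloor>\<bar> \<le> 1" by linarith
      then show "norm ((crd z i - of_int \<lfloor>crd z i\<rfloor>) *\<^sub>R b i) \<le> norm (b i)"
        by (simp add: mult_left_le_one_le)
    qed
    finally show ?thesis .
  qed
  have "bounded (f ` cball 0 R)"
    by (intro compact_imp_bounded compact_continuous_image continuous_on_subset[OF cont]) auto
  then obtain B where B0: "\<forall>x\<in>f ` cball 0 R. norm x \<le> B" unfolding bounded_iff by blast
  have B: "norm (f z) \<le> B" if "norm z \<le> R" for z using B0 that by simp
  have fB: "norm (f z) \<le> B" for z
    using per[OF lattice_minus[OF fl_lattice[of z]], of z] B[OF R[of z]] by simp
  define g where "g t = f (t *s z)" for t :: complex
  have "g holomorphic_on UNIV"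
    unfolding holomorphic_on_def field_differentiable_def
  proof
    fix t :: complex
    obtain l where l: "(f has_derivative l) (at (t *s z))" "Vector_Spaces.linear (*s) (*) l" using D by blast
    have "bounded_linear (\<lambda>t. t *s z)"
      by (rule linear_conv_bounded_linear[THEN iffD1]) (simp add: linear_iff vec_eq_iff algebra_simps)
    then have "((\<lambda>t. t *s z) has_derivative (\<lambda>t. t *s z)) (at t)" by (rule bounded_linear_imp_has_derivative)
    from has_derivative_compose[OF this l(1)] have "(g has_derivative (\<lambda>h. l (h *s z))) (at t)"
      by (simp add: g_def[abs_def])
    moreover have "(\<lambda>h. l (h *s z)) = (*) (l z)" using l(2) by (auto simp: linear_smult_iff mult.commute)
    ultimately show "\<exists>f'. (g has_field_derivative f') (at t within UNIV)" by (auto simp: has_field_derivative_def)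
  qed
  moreover have "bounded (range g)" using fB by (auto simp: bounded_iff g_def)
  ultimately have "g constant_on UNIV" by (rule Liouville_theorem)
  then have "g 1 = g 0" by (auto simp: constant_on_def)
  then show ?thesis by (simp add: g_def)
qed

lemma H20_const:
  assumes "\<omega> \<in> H20 \<Lambda>" shows "\<omega> (proj z) u v = \<omega> (proj 0) u v"
proof (rule holomorphic_periodic_constant[of "\<lambda>z. \<omega> (proj z) u v"])
  show "holomorphic_fun (\<lambda>z. \<omega> (proj z) u v) UNIV" using assms by (simp add: H20_def)
  show "\<omega> (proj (z + l)) u v = \<omega> (proj z) u v" if "l \<in> \<Lambda>" for z l
  proof -
    have "proj (z + l) = proj z" using that by (simp add: proj_eq_iff)
    then show ?thesis by simp
  qed
qed

lemma H20_bilinear: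
  assumes "\<omega> \<in> H20 \<Lambda>" shows "\<omega> (proj z) u v = dC u v * \<omega> (proj z) (axis 1 1) (axis 2 1)"
proof -
  let ?e = "axis 1 1 :: complex^2" and ?f = "axis 2 1 :: complex^2"
  define w where "w = \<omega> (proj z)"
  have lin: "w u (x + y) = w u x + w u y" "w u (c *s x) = c * w u x"
    "w (x + y) u = w x u + w y u" "w (c *s x) u = c * w x u" "w u u = 0" for u x y c
    using assms by (auto simp: H20_def carrier_torus w_def linear_smult_iff)
  have dec: "z = z$1 *s ?e + z$2 *s ?f" for z :: "complex^2"
    by (simp add: vec_eq_iff forall_2 axis_def)
  have "w (?e + ?f) (?e + ?f) = (w ?e ?e + w ?e ?f) + (w ?f ?e + w ?f ?f)" by (simp only: lin(1) lin(3) add_ac)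
  then have swap: "w ?f ?e = - w ?e ?f" by (simp only: lin(5) eq_neg_iff_add_eq_0 add_0_left add_0_right add.commute)
  have "w u v = w (u$1 *s ?e + u$2 *s ?f) (v$1 *s ?e + v$2 *s ?f)" by (simp flip: dec)
  also have "\<dots> = dC u v * w ?e ?f" by (simp only: lin(1-5) swap) (simp add: dC_def algebra_simps)
  finally show ?thesis by (simp add: w_def)
qed

lemma pullback_form_eq:
  assumes \<omega>: "\<omega> \<in> H20 \<Lambda>" and L: "clinear2 L" and s: "\<And>z. s (proj z) = proj (L z)"
  shows "pullback_form \<Lambda> s \<omega> = (\<lambda>x\<in>carrier (torus_group \<Lambda>). \<lambda>u v. cdet L * \<omega> x u v)"
proof -
  have "\<omega> (s (proj z)) (tangent_map \<Lambda> s (proj z) u) (tangent_map \<Lambda> s (proj z) v) = cdet L * \<omega> (proj z) u v" for z u v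
  proof -
    have "\<omega> (proj (L z)) (L u) (L v) = \<omega> (proj z) (L u) (L v)"
      using H20_const[OF \<omega>, of "L z" "L u" "L v"] H20_const[OF \<omega>, of z "L u" "L v"] by simp
    also have "\<dots> = cdet L * \<omega> (proj z) u v"
      by (simp only: H20_bilinear[OF \<omega>, of z "L u" "L v"] H20_bilinear[OF \<omega>, of z u v] dC_clinear2[OF L] mult.assoc)
    finally show ?thesis by (simp only: s tangent_map_eq[OF L s])
  qed
  then show ?thesis unfolding pullback_form_def carrier_torus by (intro restrict_ext ext) auto
qed

text \<open>A nowhere vanishing 2-form. Its existence makes the scalar in
  \<open>form_eigenvalue\<close> unique.\<close>

definition dz where "dz = (\<lambda>x\<in>carrier (torus_group \<Lambda>). dC)"

lemma dz_in_H20: "dz \<in> H20 \<Lambda>"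
proof -
  have "holomorphic_fun (\<lambda>z. c) UNIV" for c
    unfolding holomorphic_fun_def by (auto intro!: exI[of _ "\<lambda>_. 0"] simp: linear_smult_iff)
  then show ?thesis
    by (auto simp: H20_def dz_def carrier_torus linear_smult_iff dC_def algebra_simps)
qed

lemma dz_nonzero: "dz (proj 0) (axis 1 1) (axis 2 1) = 1"
  by (simp add: dz_def carrier_torus dC_def axis_def)

lemma form_eigenvalue_eq:
  assumes L: "clinear2 L" and s: "\<And>z. s (proj z) = proj (L z)"
  shows "form_eigenvalue \<Lambda> s = cdet L"
  unfolding form_eigenvalue_def
proof (rule the_equality)
  fix \<zeta> assume "\<forall>\<omega>\<in>H20 \<Lambda>. pullback_form \<Lambda> s \<omega> = (\<lambda>x\<in>carrier (torus_group \<Lambda>). \<lambda>u v. \<zeta> * \<omega> x u v)"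
  then have "pullback_form \<Lambda> s dz = (\<lambda>x\<in>carrier (torus_group \<Lambda>). \<lambda>u v. \<zeta> * dz x u v)" using dz_in_H20 by blast
  then have "(\<lambda>x\<in>carrier (torus_group \<Lambda>). \<lambda>u v. cdet L * dz x u v) (proj 0) (axis 1 1) (axis 2 1) =
      (\<lambda>x\<in>carrier (torus_group \<Lambda>). \<lambda>u v. \<zeta> * dz x u v) (proj 0) (axis 1 1) (axis 2 1)"
    unfolding pullback_form_eq[OF dz_in_H20 L s] by (rule arg_cong)
  then show "\<zeta> = cdet L" by (simp add: carrier_torus dz_nonzero)
qed (auto simp: pullback_form_eq[OF _ L s])

lemma symplecticI:
  assumes L: "clinear2 L" and s: "\<And>z. s (proj z) = proj (L z)" and "cdet L = 1"
  shows "symplectic \<Lambda> s"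
  unfolding symplectic_def
proof
  fix \<omega> assume \<omega>: "\<omega> \<in> H20 \<Lambda>"
  then have "\<omega> \<in> extensional (carrier (torus_group \<Lambda>))" by (simp add: H20_def)
  then show "pullback_form \<Lambda> s \<omega> = \<omega>"
    unfolding pullback_form_eq[OF \<omega> L s] by (auto simp: assms fun_eq_iff extensional_def)
qed

section \<open>The invariant lattice of the group\<close>

lemma lattice_auto_sym: "lattice_auto L L' \<Longrightarrow> lattice_auto L' L"
  by (auto simp: lattice_auto_def)

lemma lattice_auto_comp: "lattice_auto L L' \<Longrightarrow> lattice_auto M M' \<Longrightarrow> lattice_auto (L \<circ> M) (M' \<circ> L')"
  by (auto simp: lattice_auto_def clinear2_def)

lemma lattice_auto_id: "lattice_auto (\<lambda>z. z) (\<lambda>z. z)"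
  by (auto simp: lattice_auto_def clinear2_def)

lemma lattice_auto_uminus: "lattice_auto uminus uminus"
  by (auto simp: lattice_auto_def clinear2_def lattice_minus vec_eq_iff)

lemma Aut0_Bij: "s \<in> carrier (Aut0 \<Lambda>) \<Longrightarrow> s \<in> Bij (range proj)"
  by (auto simp: Aut0_def auto_def carrier_torus)

lemma Aut0_ops:
  assumes "s \<in> carrier (Aut0 \<Lambda>)" "t \<in> carrier (Aut0 \<Lambda>)"
  shows "s \<otimes>\<^bsub>Aut0 \<Lambda>\<^esub> t = compose (range proj) s t"
  using assms by (simp add: Aut0_def AutoGroup_def BijGroup_def carrier_torus auto_def)

lemma one_Aut0: "\<one>\<^bsub>Aut0 \<Lambda>\<^esub> = (\<lambda>x\<in>range proj. x)"
  by (simp add: Aut0_def AutoGroup_def BijGroup_def carrier_torus)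

lemma group_Aut0: "group (Aut0 \<Lambda>)"
proof (rule groupI)
  fix s t assume s: "s \<in> carrier (Aut0 \<Lambda>)" and t: "t \<in> carrier (Aut0 \<Lambda>)"
  obtain L L' where L: "lattice_auto L L'" "\<And>z. s (proj z) = proj (L z)" using s Aut0_iff by blast
  obtain M M' where M: "lattice_auto M M'" "\<And>z. t (proj z) = proj (M z)" using t Aut0_iff by blast
  have "compose (range proj) s t (proj z) = proj ((L \<circ> M) z)" for z by (simp add: compose_def L M)
  then show "s \<otimes>\<^bsub>Aut0 \<Lambda>\<^esub> t \<in> carrier (Aut0 \<Lambda>)"
    unfolding Aut0_ops[OF s t] Aut0_iff using lattice_auto_comp[OF L(1) M(1)] by (auto simp: compose_def)
  then show "\<exists>t\<in>carrier (Aut0 \<Lambda>). t \<otimes>\<^bsub>Aut0 \<Lambda>\<^esub> s = \<one>\<^bsub>Aut0 \<Lambda>\<^esub>"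
  proof -
    define t where "t = (\<lambda>x\<in>range proj. proj (L' (SOME z. x = proj z)))"
    have tz: "t (proj z) = proj (L' z)" for z
    proof -
      define c where "c = (SOME w. proj z = proj w)"
      have "proj z = proj c" unfolding c_def by (rule someI) simp
      then have "c - z \<in> \<Lambda>" by (simp flip: proj_eq_iff)
      then have "L' (c - z) \<in> \<Lambda>" using L(1) by (simp add: lattice_auto_def)
      then have "L' c - L' z \<in> \<Lambda>"
        using L(1) linear_diff[OF clinear2_linear, of L'] by (simp add: lattice_auto_def)
      then have "proj (L' c) = proj (L' z)" by (simp add: proj_eq_iff)
      moreover have "t (proj z) = proj (L' c)" unfolding t_def c_def by (rule restrict_apply'[OF rangeI])
      ultimately show ?thesis by simp
    qed
    have t: "t \<in> carrier (Aut0 \<Lambda>)" unfolding Aut0_iff using tz lattice_auto_sym[OF L(1)] by (auto simp: t_def)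
    have "compose (range proj) t s = (\<lambda>x\<in>range proj. x)"
      using L(1) by (auto simp: compose_def L(2) tz lattice_auto_def intro!: restrict_ext)
    then show ?thesis using t Aut0_ops[OF t s] one_Aut0 by metis
  qed
next
  show "\<one>\<^bsub>Aut0 \<Lambda>\<^esub> \<in> carrier (Aut0 \<Lambda>)"
    unfolding Aut0_iff one_Aut0 using lattice_auto_id by force
next
  fix s assume s: "s \<in> carrier (Aut0 \<Lambda>)"
  have "\<one>\<^bsub>Aut0 \<Lambda>\<^esub> \<in> carrier (Aut0 \<Lambda>)" unfolding Aut0_iff one_Aut0 using lattice_auto_id by force
  then show "\<one>\<^bsub>Aut0 \<Lambda>\<^esub> \<otimes>\<^bsub>Aut0 \<Lambda>\<^esub> s = s"
    using Aut0_Bij[OF s] by (simp add: Aut0_ops s one_Aut0 Bij_imp_funcset Bij_imp_extensional Id_compose)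
next
  fix s t r assume m: "s \<in> carrier (Aut0 \<Lambda>)" "t \<in> carrier (Aut0 \<Lambda>)" "r \<in> carrier (Aut0 \<Lambda>)"
  interpret B: group "BijGroup (range proj)" by (rule group_BijGroup)
  have eq: "x \<otimes>\<^bsub>Aut0 \<Lambda>\<^esub> y = x \<otimes>\<^bsub>BijGroup (range proj)\<^esub> y" for x y
    by (simp add: Aut0_def AutoGroup_def carrier_torus)
  have "x \<in> carrier (BijGroup (range proj))" if "x \<in> carrier (Aut0 \<Lambda>)" for x
    using Aut0_Bij[OF that] by (simp add: BijGroup_def)
  with m show "s \<otimes>\<^bsub>Aut0 \<Lambda>\<^esub> t \<otimes>\<^bsub>Aut0 \<Lambda>\<^esub> r = s \<otimes>\<^bsub>Aut0 \<Lambda>\<^esub> (t \<otimes>\<^bsub>Aut0 \<Lambda>\<^esub> r)"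
    unfolding eq by (intro B.m_assoc) auto
qed

lemma neg_id_Aut0: "neg_id \<Lambda> \<in> carrier (Aut0 \<Lambda>)" "neg_id \<Lambda> (proj z) = proj (- z)"
proof -
  show *: "neg_id \<Lambda> (proj z) = proj (- z)" for z by (simp add: neg_id_def carrier_torus inv_torus)
  show "neg_id \<Lambda> \<in> carrier (Aut0 \<Lambda>)"
    unfolding Aut0_iff using * lattice_auto_uminus by (auto simp: neg_id_def carrier_torus)
qed

lemma alt_minus:
  assumes "x \<in> H2" "u \<in> \<Lambda>" "v \<in> \<Lambda>"
  shows "alt x (- u) v = - alt x u v" "alt x u (- v) = - alt x u v"
proof -
  have "alt x 0 v = 0" if "v \<in> \<Lambda>" for v using alt_add[OF assms(1) lattice_0 lattice_0 that] by simp
  then have 1: "alt x (- u) v = - alt x u v" if "u \<in> \<Lambda>" "v \<in> \<Lambda>" for u v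
    using alt_add[OF assms(1) that(1) lattice_minus[OF that(1)] that(2)] that by simp
  then show "alt x (- u) v = - alt x u v" "alt x u (- v) = - alt x u v"
    using assms alt_swap[OF assms(1)] lattice_minus by (metis minus_minus)+
qed

text \<open>The map - id fixes every class, since alternating forms do not change when both
  arguments change sign; so the invariants of the group are those of \<open>\<sigma>\<close>. The
  predicate \<open>P\<close> carries the linear lift through the induction over
  \<open>generate\<close>, because the action of a product is read off from the composed
  lifts.\<close>

lemma invariant_carrier:
  assumes \<sigma>: "\<sigma> \<in> carrier (Aut0 \<Lambda>)"
  shows "carrier (invariant_lattice \<Lambda> \<sigma>) = {x \<in> H2. nu \<Lambda> \<sigma> x = x}"
proof -
  interpret A: group "Aut0 \<Lambda>" by (rule group_Aut0)
  define Inv where "Inv L \<longleftrightarrow>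
    (\<forall>x\<in>H2. nu \<Lambda> \<sigma> x = x \<longrightarrow> (\<forall>u\<in>\<Lambda>. \<forall>v\<in>\<Lambda>. alt x (L u) (L v) = alt x u v))" for L
  define P where "P s \<longleftrightarrow> s \<in> carrier (Aut0 \<Lambda>) \<and>
    (\<exists>L L'. lattice_auto L L' \<and> (\<forall>z. s (proj z) = proj (L z)) \<and> Inv L)" for s
  have InvD: "alt x (L u) (L v) = alt x u v"
    if "Inv L" "x \<in> H2" "nu \<Lambda> \<sigma> x = x" "u \<in> \<Lambda>" "v \<in> \<Lambda>" for L x u v
    using that by (simp add: Inv_def)
  have InvI: "Inv L" if "\<And>x u v. x \<in> H2 \<Longrightarrow> nu \<Lambda> \<sigma> x = x \<Longrightarrow> u \<in> \<Lambda> \<Longrightarrow> v \<in> \<Lambda> \<Longrightarrow> alt x (L u) (L v) = alt x u v" for L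
    using that by (simp add: Inv_def)
  have P_I: "P s" if "s \<in> carrier (Aut0 \<Lambda>)" "lattice_auto L L'" "\<And>z. s (proj z) = proj (L z)" "Inv L" for s L L'
    unfolding P_def using that by blast
  have P\<sigma>: "P \<sigma>"
  proof -
    obtain L L' where L: "lattice_auto L L'" "\<And>z. \<sigma> (proj z) = proj (L z)" using \<sigma> Aut0_iff by blast
    then have "alt x (L u) (L v) = alt x u v" if "x \<in> H2" "nu \<Lambda> \<sigma> x = x" "u \<in> \<Lambda>" "v \<in> \<Lambda>" for x u v
      using alt_nu(2)[of \<sigma> L x u v] that by (simp add: lattice_auto_def clinear2_linear)
    then show ?thesis by (intro P_I[OF \<sigma> L] InvI)
  qed
  have Pneg: "P (neg_id \<Lambda>)"
    by (rule P_I[OF neg_id_Aut0(1) lattice_auto_uminus neg_id_Aut0(2)])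
      (rule InvI, simp add: alt_minus lattice_minus)
  have Pinv: "P (inv\<^bsub>Aut0 \<Lambda>\<^esub> s)" if Ps: "P s" for s
  proof -
    obtain L L' where s: "s \<in> carrier (Aut0 \<Lambda>)" and L: "lattice_auto L L'" "\<And>z. s (proj z) = proj (L z)"
      and x: "Inv L" using Ps unfolding P_def by blast
    let ?t = "inv\<^bsub>Aut0 \<Lambda>\<^esub> s"
    have t: "?t \<in> carrier (Aut0 \<Lambda>)" using s by (rule A.inv_closed)
    have tz: "?t (proj z) = proj (L' z)" for z
    proof -
      have "(?t \<otimes>\<^bsub>Aut0 \<Lambda>\<^esub> s) (proj (L' z)) = proj (L' z)" by (simp only: A.l_inv[OF s] one_Aut0 restrict_apply'[OF rangeI])
      then have "?t (s (proj (L' z))) = proj (L' z)" by (simp only: Aut0_ops[OF t s] compose_eq[OF rangeI])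
      moreover have "s (proj (L' z)) = proj z" using L by (simp add: lattice_auto_def)
      ultimately show ?thesis by simp
    qed
    have "alt x (L' u) (L' v) = alt x u v" if "x \<in> H2" "nu \<Lambda> \<sigma> x = x" "u \<in> \<Lambda>" "v \<in> \<Lambda>" for x u v
      using InvD[OF x that(1,2), of "L' u" "L' v"] that L(1) by (simp add: lattice_auto_def)
    then show ?thesis by (intro P_I[OF t lattice_auto_sym[OF L(1)] tz] InvI)
  qed
  have "P s" if "s \<in> G_sigma \<Lambda> \<sigma>" for s
    using that unfolding G_sigma_def
  proof (induction rule: generate.induct)
    case one
    have "\<one>\<^bsub>Aut0 \<Lambda>\<^esub> (proj z) = proj z" for z by (simp only: one_Aut0 restrict_apply'[OF rangeI])
    then show ?case by (rule P_I[OF A.one_closed lattice_auto_id]) (rule InvI, simp)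
  next
    case (incl h)
    then show ?case using P\<sigma> Pneg by blast
  next
    case (inv h)
    then show ?case using P\<sigma> Pneg Pinv by blast
  next
    case (eng s t)
    obtain L L' where s: "s \<in> carrier (Aut0 \<Lambda>)" and L: "lattice_auto L L'" "\<And>z. s (proj z) = proj (L z)"
      and xs: "Inv L" using \<open>P s\<close> unfolding P_def by blast
    obtain M M' where t: "t \<in> carrier (Aut0 \<Lambda>)" and M: "lattice_auto M M'" "\<And>z. t (proj z) = proj (M z)"
      and xt: "Inv M" using \<open>P t\<close> unfolding P_def by blast
    have st: "s \<otimes>\<^bsub>Aut0 \<Lambda>\<^esub> t \<in> carrier (Aut0 \<Lambda>)" using s t by (rule A.m_closed)
    have a: "(s \<otimes>\<^bsub>Aut0 \<Lambda>\<^esub> t) (proj z) = proj ((L \<circ> M) z)" for z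
      by (simp only: Aut0_ops[OF s t] compose_eq[OF rangeI] L(2) M(2) comp_apply)
    have "alt x ((L \<circ> M) u) ((L \<circ> M) v) = alt x u v"
      if "x \<in> H2" "nu \<Lambda> \<sigma> x = x" "u \<in> \<Lambda>" "v \<in> \<Lambda>" for x u v
      using InvD[OF xs that(1,2), of "M u" "M v"] InvD[OF xt that] that M(1) by (simp add: lattice_auto_def)
    then show ?case by (intro P_I[OF st lattice_auto_comp[OF L(1) M(1)] a] InvI)
  qed
  moreover have "nu \<Lambda> s x = x" if Ps: "P s" and xH: "x \<in> H2" and xx: "nu \<Lambda> \<sigma> x = x" for s x
  proof -
    obtain L L' where L: "lattice_auto L L'" "\<And>z. s (proj z) = proj (L z)" and x: "Inv L"
      using Ps unfolding P_def by blast
    have L3: "linear L" "\<And>z. z \<in> \<Lambda> \<Longrightarrow> L z \<in> \<Lambda>" using L(1) by (auto simp: lattice_auto_def clinear2_linear)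
    show ?thesis
    proof (rule alt_inj)
      show "nu \<Lambda> s x \<in> H2" by (rule alt_nu(1)[OF L(2) L3 xH lattice_0 lattice_0])
      show "alt (nu \<Lambda> s x) u v = alt x u v" if "u \<in> \<Lambda>" "v \<in> \<Lambda>" for u v
        using alt_nu(2)[OF L(2) L3 xH that] InvD[OF x xH xx that] by simp
    qed (rule xH)
  qed
  moreover have "\<sigma> \<in> G_sigma \<Lambda> \<sigma>" by (auto simp: G_sigma_def intro: generate.incl)
  ultimately show ?thesis by (auto simp: invariant_lattice_def)
qed

end

section \<open>Isometries\<close>

lemma isometriesD:
  assumes "h \<in> isometries L M"
  shows "h \<in> hom L M" "bij_betw h (carrier L) (carrier M)"
    "\<And>x y. x \<in> carrier L \<Longrightarrow> y \<in> carrier L \<Longrightarrow> bform M (h x) (h y) = bform L x y"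
  using assms by (auto simp: isometries_def iso_def)

lemma isometries_inv:
  assumes "group L" "h \<in> isometries L M"
  shows "inv_into (carrier L) h \<in> isometries M L"
proof -
  interpret group L by fact
  let ?k = "inv_into (carrier L) h"
  note h = isometriesD[OF assms(2)]
  have k: "?k y \<in> carrier L" "h (?k y) = y" if "y \<in> carrier M" for y
    using that bij_betw_imp_surj_on[OF h(2)] by (auto intro: inv_into_into f_inv_into_f)
  have "?k \<in> iso M L" using iso_set_sym assms(2) by (auto simp: isometries_def)
  moreover have "bform L (?k x) (?k y) = bform M x y" if "x \<in> carrier M" "y \<in> carrier M" for x y
    using h(3)[of "?k x" "?k y"] k that by simp
  ultimately show ?thesis by (auto simp: isometries_def)
qed

lemma isometries_comp: "h \<in> isometries L M \<Longrightarrow> k \<in> isometries M N \<Longrightarrow> k \<circ> h \<in> isometries L N"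
  by (auto simp: isometries_def iso_set_trans) (auto simp: iso_def hom_def Pi_def)

lemma isometries_restrict: "h \<in> isometries L L \<Longrightarrow> group L \<Longrightarrow> restrict h (carrier L) \<in> isometries L L \<inter> Bij (carrier L)"
  using group.is_monoid[THEN monoid.m_closed, of L]
  by (auto simp: isometries_def iso_def hom_def Bij_def bij_betw_def inj_on_def)

lemma subgroup_isometries:
  assumes "group L"
  shows "subgroup (isometries L L \<inter> Bij (carrier L)) (BijGroup (carrier L))"
proof -
  interpret L: group L by fact
  interpret B: group "BijGroup (carrier L)" by (rule group_BijGroup)
  show ?thesis
  proof (rule B.subgroupI)
    have "(\<lambda>x. x) \<in> isometries L L" by (auto simp: isometries_def iso_def hom_def bij_betw_def)
    then show "isometries L L \<inter> Bij (carrier L) \<noteq> {}" using isometries_restrict assms by blast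
  next
    fix h assume h: "h \<in> isometries L L \<inter> Bij (carrier L)"
    then have "inv\<^bsub>BijGroup (carrier L)\<^esub> h = restrict (inv_into (carrier L) h) (carrier L)"
      by (simp add: inv_BijGroup)
    then show "inv\<^bsub>BijGroup (carrier L)\<^esub> h \<in> isometries L L \<inter> Bij (carrier L)"
      using isometries_restrict[OF isometries_inv assms] h assms by auto
  next
    fix h k assume hk: "h \<in> isometries L L \<inter> Bij (carrier L)" "k \<in> isometries L L \<inter> Bij (carrier L)"
    then have "h \<otimes>\<^bsub>BijGroup (carrier L)\<^esub> k = restrict (h \<circ> k) (carrier L)"
      by (auto simp: BijGroup_def compose_def fun_eq_iff)
    then show "h \<otimes>\<^bsub>BijGroup (carrier L)\<^esub> k \<in> isometries L L \<inter> Bij (carrier L)"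
      using isometries_restrict[OF isometries_comp assms] hk by auto
  qed (auto simp: BijGroup_def)
qed

lemma group_isometry_group: "group L \<Longrightarrow> group (isometry_group L)"
  unfolding isometry_group_def
  by (rule group.subgroup_imp_group[OF group_BijGroup subgroup_isometries])

lemma isometry_group_pow:
  assumes L: "group L" and h: "h \<in> isometries L L \<inter> Bij (carrier L)" and x: "x \<in> carrier L"
  shows "(h [^]\<^bsub>isometry_group L\<^esub> n) x = (h ^^ n) x \<and> (h ^^ n) x \<in> carrier L"
  using x
proof (induction n arbitrary: x)
  case 0
  then show ?case by (simp add: isometry_group_def BijGroup_def)
next
  case (Suc n)
  interpret G: group "isometry_group L" by (rule group_isometry_group[OF L])
  have hc: "h \<in> carrier (isometry_group L)" using h by (simp add: isometry_group_def)
  have mult: "f \<otimes>\<^bsub>isometry_group L\<^esub> g = compose (carrier L) f g"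
    if "f \<in> Bij (carrier L)" "g \<in> Bij (carrier L)" for f g using that by (simp add: isometry_group_def BijGroup_def)
  have "h x \<in> carrier L" using h Suc.prems by (auto simp: Bij_def bij_betw_def)
  moreover have "h [^]\<^bsub>isometry_group L\<^esub> n \<in> Bij (carrier L)"
    using G.nat_pow_closed[OF hc, of n] by (simp add: isometry_group_def)
  then have "h [^]\<^bsub>isometry_group L\<^esub> n \<otimes>\<^bsub>isometry_group L\<^esub> h = compose (carrier L) (h [^]\<^bsub>isometry_group L\<^esub> n) h"
    using h mult by blast
  then have "(h [^]\<^bsub>isometry_group L\<^esub> Suc n) x = (h [^]\<^bsub>isometry_group L\<^esub> n) (h x)"
    using Suc.prems by (simp only: nat_pow_Suc compose_eq)
  ultimately show ?case using Suc.IH[of "h x"] by (simp add: funpow_swap1)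
qed

lemma isometry_ord:
  assumes L: "group L" and h: "h \<in> isometries L L \<inter> Bij (carrier L)" and x: "x \<in> carrier L"
  shows "(h ^^ group.ord (isometry_group L) h) x = x"
proof -
  interpret G: group "isometry_group L" by (rule group_isometry_group[OF L])
  have hc: "h \<in> carrier (isometry_group L)" using h by (simp add: isometry_group_def)
  have "h [^]\<^bsub>isometry_group L\<^esub> G.ord h = \<one>\<^bsub>isometry_group L\<^esub>" using hc by (rule G.pow_ord_eq_1)
  moreover have "\<one>\<^bsub>isometry_group L\<^esub> x = x" using x by (simp add: isometry_group_def BijGroup_def)
  ultimately show ?thesis using isometry_group_pow[OF L h x] by metis
qed

section \<open>Coordinates\<close>

context torus
begin

text \<open>Row \<open>i\<close> holds the coordinates of \<open>L (b i)\<close>, the transpose of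
  the usual convention, in accordance with \<open>wedge\<close>.\<close>

definition gmat :: "(complex^2 \<Rightarrow> complex^2) \<Rightarrow> nat \<Rightarrow> nat \<Rightarrow> int" where
  "gmat L i k = \<lfloor>crd (L (b i)) k\<rfloor>"

lemma lattice_comb: "u \<in> \<Lambda> \<Longrightarrow> u = (\<Sum>k<4. of_int \<lfloor>crd u k\<rfloor> *\<^sub>R b k)"
  using fl_id[of u] by (simp add: fl_def)

lemma mat_comb:
  assumes "\<And>z. z \<in> \<Lambda> \<Longrightarrow> L z \<in> \<Lambda>" "i < 4"
  shows "L (b i) = (\<Sum>k<4. of_int (gmat L i k) *\<^sub>R b k)"
  unfolding gmat_def by (rule lattice_comb) (use assms b_in_lattice in auto)

lemma alt_zmul:
  assumes x: "x \<in> H2" and u: "u \<in> \<Lambda>" and v: "v \<in> \<Lambda>"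
  shows "alt x (of_int n *\<^sub>R u) v = n * alt x u v"
proof (induction n rule: int_induct[of _ 0])
  case base
  then show ?case using alt_add[OF x lattice_0 lattice_0 v] by simp
next
  case (step1 n)
  then show ?case using alt_add[OF x lattice_zmul[OF u, of n] u v] by (simp add: algebra_simps)
next
  case (step2 n)
  then show ?case using alt_add[OF x lattice_zmul[OF u, of n] lattice_minus[OF u] v]
    by (simp add: algebra_simps alt_minus[OF x u v])
qed

lemma alt_comb1:
  assumes x: "x \<in> H2" and v: "v \<in> \<Lambda>"
  shows "alt x (\<Sum>k<4. of_int (m k) *\<^sub>R b k) v =
    m 0 * alt x (b 0) v + m 1 * alt x (b 1) v + m 2 * alt x (b 2) v + m 3 * alt x (b 3) v"
  by (simp add: lessThan_4 alt_add[OF x] alt_zmul[OF x] lattice_add lattice_zmul b_in_lattice v)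

lemma alt_self: "x \<in> H2 \<Longrightarrow> u \<in> \<Lambda> \<Longrightarrow> alt x u u = 0"
  using alt_swap[of x u u] by simp

lemma alt_comb:
  assumes x: "x \<in> H2"
    and u: "\<And>i. i < 4 \<Longrightarrow> u i = (\<Sum>k<4. of_int (M i k) *\<^sub>R b k)" and ij: "i < 4" "j < 4"
  shows "alt x (u i) (u j) = wedge M (\<lambda>i j. alt x (b i) (b j)) i j"
proof -
  have uL: "(\<Sum>k<4. of_int (M j k) *\<^sub>R b k) \<in> \<Lambda>" for j by (rule comb_in_lattice)
  have sw: "alt x (b k) (\<Sum>k<4. of_int (M j k) *\<^sub>R b k) = - (M j 0 * alt x (b 0) (b k) + M j 1 * alt x (b 1) (b k)
      + M j 2 * alt x (b 2) (b k) + M j 3 * alt x (b 3) (b k))" if "k < 4" for k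
    using alt_swap[OF x uL b_in_lattice[OF that], of j] alt_comb1[OF x b_in_lattice[OF that], of "M j"] by simp
  have lt: "(0::nat) < 4" "(1::nat) < 4" "(2::nat) < 4" "(3::nat) < 4" by simp_all
  have s: "alt x (b 1) (b 0) = - alt x (b 0) (b 1)" "alt x (b 2) (b 0) = - alt x (b 0) (b 2)"
    "alt x (b 3) (b 0) = - alt x (b 0) (b 3)" "alt x (b 2) (b 1) = - alt x (b 1) (b 2)"
    "alt x (b 3) (b 1) = - alt x (b 1) (b 3)" "alt x (b 3) (b 2) = - alt x (b 2) (b 3)"
    by (rule alt_swap[OF x]; simp add: b_in_lattice)+
  have d: "alt x (b 0) (b 0) = 0" "alt x (b 1) (b 1) = 0" "alt x (b 2) (b 2) = 0" "alt x (b 3) (b 3) = 0"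
    by (rule alt_self[OF x]; simp add: b_in_lattice)+
  show ?thesis
    unfolding u[OF ij(1)] u[OF ij(2)] alt_comb1[OF x uL] sw[OF lt(1)] sw[OF lt(2)] sw[OF lt(3)] sw[OF lt(4)]
    by (simp only: s d wedge_def) (simp add: algebra_simps)
qed

lemma vol_nonzero: "vol b \<noteq> 0"
proof -
  define e :: "nat \<Rightarrow> complex^2" where "e i = (if i = 0 then axis 1 1 else if i = 1 then axis 1 \<i>
    else if i = 2 then axis 2 1 else axis 2 \<i>)" for i
  have "vol e = 1" by (simp add: vol_def det4_def rc_def e_def axis_def)
  moreover have "vol e = det4 (\<lambda>i k. crd (e i) k) * vol b"
    by (rule vol_comb) (simp add: sum_crd)
  ultimately show ?thesis by auto
qed

text \<open>The form dz1 dz2 is multiplied by \<open>cdet L\<close> and its conjugate by the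
  conjugate, so by \<open>pf_dC\<close> the volume is multiplied by the square of the
  modulus.\<close>

lemma vol_clinear2: "clinear2 L \<Longrightarrow> vol (\<lambda>i. L (v i)) = (cmod (cdet L))\<^sup>2 * vol v"
proof -
  assume L: "clinear2 L"
  have "complex_of_real (4 * vol (\<lambda>i. L (v i))) =
     pf (\<lambda>i j. cdet L * dC (v i) (v j)) (\<lambda>i j. cnj (cdet L * dC (v i) (v j)))"
    by (simp only: pf_dC[symmetric] dC_clinear2[OF L])
  also have "\<dots> = (cdet L * cnj (cdet L)) * pf (\<lambda>i j. dC (v i) (v j)) (\<lambda>i j. cnj (dC (v i) (v j)))"
    by (simp add: pf_def algebra_simps)
  also have "\<dots> = complex_of_real ((cmod (cdet L))\<^sup>2 * (4 * vol v))"
    by (simp only: pf_dC complex_norm_square[symmetric] of_real_mult)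
  finally show ?thesis by (simp only: of_real_eq_iff)
qed

text \<open>The source of integrality: the squared modulus of the complex determinant of a lattice
  endomorphism is an integer.\<close>

lemma det_mat:
  assumes "clinear2 L" "\<And>z. z \<in> \<Lambda> \<Longrightarrow> L z \<in> \<Lambda>"
  shows "real_of_int (det4 (gmat L)) = (cmod (cdet L))\<^sup>2"
proof -
  have "vol (\<lambda>i. L (b i)) = det4 (\<lambda>i j. real_of_int (gmat L i j)) * vol b"
    by (rule vol_comb) (rule mat_comb[OF assms(2)])
  moreover have "det4 (\<lambda>i j. real_of_int (gmat L i j)) = real_of_int (det4 (gmat L))"
    by (simp add: det4_def)
  ultimately show ?thesis using vol_clinear2[OF assms(1), of b] vol_nonzero by simp
qed

lemma cdet_comp: "clinear2 L \<Longrightarrow> cdet (\<lambda>z. L (M z)) = cdet L * cdet M"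
  by (simp add: cdet_def[of "\<lambda>z. L (M z)"] dC_clinear2 cdet_def[of M])

lemma cdet_id: "cdet (\<lambda>z. z) = 1"
  by (simp add: cdet_def dC_def axis_def)

lemma lattice_auto_cdet:
  assumes "lattice_auto L L'"
  shows "cmod (cdet L) = 1" "det4 (gmat L) = 1"
proof -
  have L: "clinear2 L" "\<And>z. z \<in> \<Lambda> \<Longrightarrow> L z \<in> \<Lambda>" and L': "clinear2 L'" "\<And>z. z \<in> \<Lambda> \<Longrightarrow> L' z \<in> \<Lambda>"
    using assms by (auto simp: lattice_auto_def)
  have "cdet L * cdet L' = 1"
    using cdet_comp[OF L(1), of L'] assms by (simp add: lattice_auto_def cdet_id)
  then have "(cmod (cdet L))\<^sup>2 * (cmod (cdet L'))\<^sup>2 = 1"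
    by (metis norm_mult norm_one power_mult_distrib power_one)
  then have "real_of_int (det4 (gmat L) * det4 (gmat L')) = 1"
    by (simp add: det_mat[OF L] det_mat[OF L'])
  then have 1: "det4 (gmat L) * det4 (gmat L') = 1" by linarith
  have "0 \<le> real_of_int (det4 (gmat L))"
    using det_mat[OF L] zero_le_power2[of "cmod (cdet L)"] by linarith
  then have d0: "0 \<le> det4 (gmat L)" by (rule of_int_0_le_iff[THEN iffD1])
  with 1 show d: "det4 (gmat L) = 1" by (auto simp: zmult_eq_1_iff)
  have "(cmod (cdet L))\<^sup>2 = 1" using det_mat[OF L] d by simp
  then show "cmod (cdet L) = 1" using power2_eq_1_iff[of "cmod (cdet L)"] norm_ge_zero[of "cdet L"] by linarith
qed

text \<open>The orientation of the basis \<open>b\<close> relative to the complex orientation that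
  defines the fundamental class.\<close>

definition \<epsilon> :: int where "\<epsilon> = (if vol b > 0 then 1 else - 1)"

lemma \<epsilon>_sq: "\<epsilon> * \<epsilon> = 1" by (simp add: \<epsilon>_def)

lemma \<epsilon>_vol: "of_int \<epsilon> * vol b > 0"
  using vol_nonzero by (auto simp: \<epsilon>_def)

abbreviation Alt :: "(torus_point chain \<Rightarrow> int) set \<Rightarrow> nat \<Rightarrow> nat \<Rightarrow> int" where "Alt x \<equiv> \<lambda>i j. alt x (b i) (b j)"

end

lemma positive_basis_exists:
  assumes "lattice_basis b \<Lambda>" shows "\<exists>b. positive_basis b \<Lambda>"
proof -
  interpret torus \<Lambda> b by unfold_locales fact
  show ?thesis
  proof (cases "vol b > 0")
    case True
    then show ?thesis using assms by (auto simp: positive_basis_iff)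
  next
    case False
    define b' where "b' i = (if i = 0 then b 1 else if i = 1 then b 0 else b i)" for i
    define s :: "nat \<Rightarrow> nat" where "s i = (if i = 0 then 1 else if i = 1 then 0 else i)" for i
    have b's: "b' i = b (s i)" for i by (simp add: b'_def s_def)
    have s: "s ` {..<4} = {..<4}" "inj_on s {..<4}" by (auto simp: s_def lessThan_4 inj_on_def)
    have im: "b' ` {..<4} = b ` {..<4}" using s(1) unfolding b's by (metis image_image)
    have inj: "inj_on b' {..<4}"
    proof (rule inj_onI)
      fix i j assume "i \<in> {..<4}" "j \<in> {..<4}" "b' i = b' j"
      then have "s i = s j" using inj_b s(1) unfolding b's by (auto dest!: inj_onD)
      then show "i = j" using s(2) \<open>i \<in> _\<close> \<open>j \<in> _\<close> by (auto dest: inj_onD)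
    qed
    have sum: "(\<Sum>i<4. of_int (k i) *\<^sub>R b' i) = (\<Sum>i<4. real_of_int (k (s i)) *\<^sub>R b i)" for k
      by (simp add: lessThan_4 b'_def s_def algebra_simps)
    have ss: "(\<lambda>i. k (s (s i))) = k" for k :: "nat \<Rightarrow> int" by (simp add: s_def fun_eq_iff)
    have "\<Lambda> = {\<Sum>i<4. of_int (k i) *\<^sub>R b' i |k. True}"
    proof (intro equalityI subsetI)
      fix z assume "z \<in> \<Lambda>"
      then obtain k where "z = (\<Sum>i<4. of_int (k i) *\<^sub>R b i)" by (auto simp: lattice_eq)
      then have "z = (\<Sum>i<4. real_of_int (k (s i)) *\<^sub>R b' i)"
        using sum[of "\<lambda>i. k (s i)"] ss[of k] by (simp add: fun_eq_iff)
      then show "z \<in> {\<Sum>i<4. of_int (k i) *\<^sub>R b' i |k. True}" by (intro CollectI exI[of _ "\<lambda>i. k (s i)"]) simp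
    next
      fix z assume "z \<in> {\<Sum>i<4. of_int (k i) *\<^sub>R b' i |k. True}"
      then show "z \<in> \<Lambda>" using comb_in_lattice by (auto simp: sum)
    qed
    moreover have "vol b' = - vol b" by (simp add: vol_def det4_def b'_def algebra_simps)
    ultimately have "positive_basis b' \<Lambda>"
      using False vol_nonzero inj im indep_b by (auto simp: positive_basis_iff lattice_basis_def)
    then show ?thesis by blast
  qed
qed

context torus
begin

text \<open>The fundamental cycle comes from an unspecified positive basis \<open>c\<close>. The
  transition matrix \<open>M\<close> from \<open>b\<close> to \<open>c\<close> is invertible over
  the integers, and its determinant is \<open>\<epsilon>\<close> because \<open>vol c\<close> is
  positive; \<open>pf_wedge\<close> then moves the pairing from \<open>c\<close> to
  \<open>b\<close>.\<close>

lemma bform_pf: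
  assumes x: "x \<in> H2" and y: "y \<in> H2"
  shows "bform (H2_lattice \<Lambda>) x y = \<epsilon> * pf (Alt x) (Alt y)"
proof -
  define c where "c = (SOME c. positive_basis c \<Lambda>)"
  have "positive_basis c \<Lambda>" unfolding c_def by (rule someI_ex[OF positive_basis_exists[OF basis]])
  then have c: "lattice_basis c \<Lambda>" "vol c > 0" by (auto simp: positive_basis_iff)
  interpret C: torus \<Lambda> c by unfold_locales (rule c)
  have fund: "fundamental_cycle \<Lambda> = parallelotope_cycle \<Lambda> c" by (simp add: fundamental_cycle_def c_def)
  define M where "M i k = \<lfloor>crd (c i) k\<rfloor>" for i k
  have M: "c i = (\<Sum>k<4. of_int (M i k) *\<^sub>R b k)" if "i < 4" for i
    unfolding M_def by (rule lattice_comb) (rule C.b_in_lattice[OF that])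
  define N where "N i k = \<lfloor>C.crd (b i) k\<rfloor>" for i k
  have N: "b i = (\<Sum>k<4. of_int (N i k) *\<^sub>R c k)" if "i < 4" for i
    unfolding N_def by (rule C.lattice_comb) (rule b_in_lattice[OF that])
  have dr: "det4 (\<lambda>i j. real_of_int (K i j)) = real_of_int (det4 K)" for K by (simp add: det4_def)
  have vc: "vol c = real_of_int (det4 M) * vol b" using vol_comb[OF M] by (simp add: dr)
  have vb: "vol b = real_of_int (det4 N) * vol c" using vol_comb[OF N] by (simp add: dr)
  have "real_of_int (det4 M * det4 N) * vol c = 1 * vol c" using vc vb by simp
  then have "real_of_int (det4 M * det4 N) = 1" using c(2) by (metis mult_right_cancel less_irrefl)
  then have "det4 M * det4 N = 1" by linarith
  then have "det4 M = 1 \<or> det4 M = - 1" by (metis zmult_eq_1_iff)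
  then have \<epsilon>M: "det4 M = \<epsilon>" using vc c(2) by (auto simp: \<epsilon>_def)
  have acx: "alt x (c i) (c j) = wedge M (Alt x) i j" if "i < 4" "j < 4" for i j
    by (rule alt_comb[OF x M that])
  have acy: "alt y (c i) (c j) = wedge M (Alt y) i j" if "i < 4" "j < 4" for i j
    by (rule alt_comb[OF y M that])
  have "bform (H2_lattice \<Lambda>) x y = C.pairing c x y" by (rule C.bform_pairing[OF fund x y])
  also have "\<dots> = pf (\<lambda>i j. alt x (c i) (c j)) (\<lambda>i j. alt y (c i) (c j))"
    by (simp add: C.pairing_def pf_def)
  also have "\<dots> = pf (wedge M (Alt x)) (wedge M (Alt y))"
    by (simp add: pf_def acx acy)
  finally show ?thesis by (simp add: pf_wedge \<epsilon>M)
qed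

lemma Alt_inj:
  assumes x: "x \<in> H2" and y: "y \<in> H2"
    and eq: "Alt x 0 1 = Alt y 0 1" "Alt x 0 2 = Alt y 0 2" "Alt x 0 3 = Alt y 0 3"
      "Alt x 1 2 = Alt y 1 2" "Alt x 1 3 = Alt y 1 3" "Alt x 2 3 = Alt y 2 3"
  shows "x = y"
proof (rule alt_inj[OF x y])
  fix u v assume u: "u \<in> \<Lambda>" and v: "v \<in> \<Lambda>"
  define w where "w i = (if i = (0::nat) then u else v)" for i
  define M where "M i k = \<lfloor>crd (w i) k\<rfloor>" for i k
  have w: "w i = (\<Sum>k<4. of_int (M i k) *\<^sub>R b k)" if "i < 4" for i
    unfolding M_def by (rule lattice_comb) (simp add: w_def u v)
  have acx: "alt x (w i) (w j) = wedge M (Alt x) i j" if "i < 4" "j < 4" for i j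
    by (rule alt_comb[OF x w that])
  have acy: "alt y (w i) (w j) = wedge M (Alt y) i j" if "i < 4" "j < 4" for i j
    by (rule alt_comb[OF y w that])
  have "alt x (w 0) (w 1) = alt y (w 0) (w 1)"
    using acx[of 0 1] acy[of 0 1] eq by (simp add: wedge_def)
  then show "alt x u v = alt y u v" by (simp add: w_def)
qed

lemma Alt_surj:
  fixes a :: "nat \<Rightarrow> nat \<Rightarrow> int"
  obtains x where "x \<in> H2" "\<And>i j. i < j \<Longrightarrow> j < 4 \<Longrightarrow> Alt x i j = a i j"
proof -
  let ?c = "\<lambda>u i. \<lfloor>crd u i\<rfloor>"
  \<comment> \<open>The strictly upper triangular part, extended bilinearly over the lattice by
    rounding coordinates.\<close>
  define \<beta> where "\<beta> u v = a 0 1 * (?c u 0 * ?c v 1) + a 0 2 * (?c u 0 * ?c v 2) + a 0 3 * (?c u 0 * ?c v 3)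
    + a 1 2 * (?c u 1 * ?c v 2) + a 1 3 * (?c u 1 * ?c v 3) + a 2 3 * (?c u 2 * ?c v 3)" for u v
  have fl: "\<lfloor>crd x i + crd y i\<rfloor> = \<lfloor>crd x i\<rfloor> + \<lfloor>crd y i\<rfloor>" if "x \<in> \<Lambda>" "y \<in> \<Lambda>" "i < 4" for x y i
    using crd_lattice[OF that(1,3)] crd_lattice[OF that(2,3)] by (metis floor_of_int of_int_add)
  obtain x where x: "x \<in> H2" "\<And>u v. u \<in> \<Lambda> \<Longrightarrow> v \<in> \<Lambda> \<Longrightarrow> alt x u v = \<beta> u v - \<beta> v u"
    by (rule alt_surj[of \<beta>]) (simp_all add: \<beta>_def fl algebra_simps)
  show thesis
  proof (rule that[OF x(1)])
    fix i j :: nat assume ij: "i < j" "j < 4"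
    then have *: "Alt x i j = \<beta> (b i) (b j) - \<beta> (b j) (b i)" by (intro x b_in_lattice) auto
    have "(i = 0 \<or> i = 1 \<or> i = 2) \<and> (j = 1 \<or> j = 2 \<or> j = 3)" using ij by auto
    then show "Alt x i j = a i j" using ij unfolding * \<beta>_def by (auto simp: crd_b)
  qed
qed

lemma Alt_nu:
  assumes L: "lattice_auto L L'" "\<And>z. s (proj z) = proj (L z)" and x: "x \<in> H2" and ij: "i < 4" "j < 4"
  shows "Alt (nu \<Lambda> s x) i j = wedge (gmat L) (Alt x) i j"
proof -
  have L2: "linear L" "\<And>z. z \<in> \<Lambda> \<Longrightarrow> L z \<in> \<Lambda>" using L(1) by (auto simp: lattice_auto_def clinear2_linear)
  have "Alt (nu \<Lambda> s x) i j = alt x (L (b i)) (L (b j))"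
    by (rule alt_nu(2)[OF L(2) L2 x]) (simp_all add: b_in_lattice ij)
  also have "\<dots> = wedge (gmat L) (Alt x) i j"
    using alt_comb[OF x mat_comb[OF L2(2)] ij] .
  finally show ?thesis .
qed

text \<open>The pairing is multiplied by \<open>det4 (gmat L)\<close>, which is a squared modulus
  and a unit of the integers, hence 1.\<close>

lemma nu_isometry:
  assumes \<sigma>: "\<sigma> \<in> carrier (Aut0 \<Lambda>)"
  shows "nu \<Lambda> \<sigma> \<in> isometries (H2_lattice \<Lambda>) (H2_lattice \<Lambda>) \<inter> Bij H2"
proof -
  interpret H: comm_group "H2_lattice \<Lambda>" by (rule comm_group_H2)
  obtain L L' where L: "lattice_auto L L'" and s: "\<And>z. \<sigma> (proj z) = proj (L z)" using \<sigma> Aut0_iff by blast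
  have L2: "linear L" "\<And>z. z \<in> \<Lambda> \<Longrightarrow> L z \<in> \<Lambda>" using L(1) by (auto simp: lattice_auto_def clinear2_linear)
  have L3: "linear L'" "\<And>z. z \<in> \<Lambda> \<Longrightarrow> L' z \<in> \<Lambda>" using L(1) by (auto simp: lattice_auto_def clinear2_linear)
  note nH = alt_nu(1)[OF s L2 _ lattice_0 lattice_0] and nA = alt_nu(2)[OF s L2]
  define \<tau> where "\<tau> = (\<lambda>x\<in>range proj. proj (L' (SOME z. x = proj z)))"
  have \<tau>: "\<tau> (proj z) = proj (L' z)" for z
  proof -
    define c where "c = (SOME w. proj z = proj w)"
    have "proj z = proj c" unfolding c_def by (rule someI) simp
    then have "c - z \<in> \<Lambda>" by (simp flip: proj_eq_iff)
    then have "L' (c - z) \<in> \<Lambda>" by (rule L3)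
    then have "proj (L' c) = proj (L' z)" by (simp add: proj_eq_iff linear_diff[OF L3(1)])
    moreover have "\<tau> (proj z) = proj (L' c)" unfolding \<tau>_def c_def by (rule restrict_apply'[OF rangeI])
    ultimately show ?thesis by simp
  qed
  note tH = alt_nu(1)[OF \<tau> L3 _ lattice_0 lattice_0] and tA = alt_nu(2)[OF \<tau> L3]
  have nt: "nu \<Lambda> \<sigma> (nu \<Lambda> \<tau> x) = x" "nu \<Lambda> \<tau> (nu \<Lambda> \<sigma> x) = x" if "x \<in> H2" for x
    by (rule alt_inj; use that L in \<open>simp add: nH tH nA tA L2 L3 lattice_auto_def\<close>)+
  have bij: "bij_betw (nu \<Lambda> \<sigma>) H2 H2"
    by (rule bij_betwI[where g = "nu \<Lambda> \<tau>"]) (auto simp: nH tH nt)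
  have hom: "nu \<Lambda> \<sigma> \<in> hom (H2_lattice \<Lambda>) (H2_lattice \<Lambda>)"
  proof (rule homI)
    fix x y assume xy: "x \<in> H2" "y \<in> H2"
    show "nu \<Lambda> \<sigma> (x \<otimes>\<^bsub>H2_lattice \<Lambda>\<^esub> y) = nu \<Lambda> \<sigma> x \<otimes>\<^bsub>H2_lattice \<Lambda>\<^esub> nu \<Lambda> \<sigma> y"
      by (rule alt_inj) (use xy in \<open>simp_all add: nH nA alt_mult L2\<close>)
  qed (rule nH)
  have "bform (H2_lattice \<Lambda>) (nu \<Lambda> \<sigma> x) (nu \<Lambda> \<sigma> y) = bform (H2_lattice \<Lambda>) x y" if "x \<in> H2" "y \<in> H2" for x y
  proof -
    have "pf (Alt (nu \<Lambda> \<sigma> x)) (Alt (nu \<Lambda> \<sigma> y)) = pf (wedge (gmat L) (Alt x)) (wedge (gmat L) (Alt y))"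
      using Alt_nu[OF L s that(1)] Alt_nu[OF L s that(2)] by (simp add: pf_def)
    then show ?thesis using that by (simp add: bform_pf nH pf_wedge lattice_auto_cdet[OF L])
  qed
  then show ?thesis using hom bij by (auto simp: isometries_def iso_def Bij_def nu_def)
qed

lemma nu_power:
  assumes L: "lattice_auto L L'" "\<And>z. s (proj z) = proj (L z)" and x: "x \<in> H2" and uv: "u \<in> \<Lambda>" "v \<in> \<Lambda>"
  shows "(nu \<Lambda> s ^^ n) x \<in> H2 \<and> alt ((nu \<Lambda> s ^^ n) x) u v = alt x ((L ^^ n) u) ((L ^^ n) v)"
  using uv
proof (induction n arbitrary: u v)
  case (Suc n)
  have L2: "linear L" "\<And>z. z \<in> \<Lambda> \<Longrightarrow> L z \<in> \<Lambda>" using L(1) by (auto simp: lattice_auto_def clinear2_linear)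
  show ?case
    using Suc.IH[of "L u" "L v"] Suc.prems alt_nu[OF L(2) L2, of "(nu \<Lambda> s ^^ n) x" u v] L2(2)
    by (simp add: funpow_swap1)
qed (use x in simp)

text \<open>A matrix whose exterior square is the identity is plus or minus the identity; this is
  the statement that the kernel of \<nu> is generated by - id.\<close>

lemma minors_identity:
  fixes M :: "nat \<Rightarrow> nat \<Rightarrow> int"
  assumes m: "\<And>i j k l. i < 4 \<Longrightarrow> j < 4 \<Longrightarrow> k < 4 \<Longrightarrow> l < 4 \<Longrightarrow> M i k * M j l - M i l * M j k =
      (if i = k \<and> j = l then 1 else 0) - (if i = l \<and> j = k then 1 else 0)"
  shows "\<exists>c. (c = 1 \<or> c = - 1) \<and> (\<forall>i<4. \<forall>k<4. M i k = (if i = k then c else 0))"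
proof -
  have off: "M i k = 0" if ik: "i < 4" "k < 4" "i \<noteq> k" for i k
  proof -
    have "\<exists>j<4::nat. j \<noteq> i \<and> j \<noteq> k" by presburger
    then obtain j where j: "j < 4" "j \<noteq> i" "j \<noteq> k" by blast
    have 1: "M i i * M j j - M i j * M j i = 1" using m[of i j i j] ik j by simp
    have 2: "M i k * M j j = M i j * M j k" using m[of i j k j] ik j by simp
    have 3: "M i i * M j k = M i k * M j i" using m[of i j i k] ik j by simp
    \<comment> \<open>With a third index \<open>j\<close>, the entry is multiplied by the principal
      minor on \<open>i\<close> and \<open>j\<close>, which is 1; the two vanishing minors
      \<open>2\<close> and \<open>3\<close> cancel the products.\<close>
    have "M i k = M i k * (M i i * M j j - M i j * M j i)" by (simp only: 1 mult_1_right)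
    also have "\<dots> = M i i * (M i k * M j j) - M i j * (M i k * M j i)" by (simp add: algebra_simps)
    also have "\<dots> = 0" by (simp only: 2 3[symmetric]) (simp add: algebra_simps)
    finally show ?thesis .
  qed
  have d: "M i i * M j j = 1" if "i < 4" "j < 4" "i \<noteq> j" for i j
    using m[of i j i j] off[of i j] that by simp
  have "M 0 0 = 1 \<or> M 0 0 = - 1" using d[of 0 1] by (auto simp: zmult_eq_1_iff)
  moreover have diag: "M i i = M 0 0" if "i < 4" for i
    using d[of 0 i] that by (cases "i = 0") (auto simp: zmult_eq_1_iff)
  have "M i k = (if i = k then M 0 0 else 0)" if "i < 4" "k < 4" for i k
    using diag[OF that(1)] off[OF that] by (cases "i = k") simp_all
  ultimately show ?thesis by blast
qed

text \<open>Invariance is tested on the elementary forms, the antisymmetrised products of the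
  coordinates \<open>k\<close> and \<open>l\<close>; this computes all minors of size 2 of the
  matrix of \<open>K\<close>.\<close>

lemma pm_identity:
  assumes K: "linear K" "\<And>z. z \<in> \<Lambda> \<Longrightarrow> K z \<in> \<Lambda>"
    and alt: "\<And>x u v. x \<in> H2 \<Longrightarrow> u \<in> \<Lambda> \<Longrightarrow> v \<in> \<Lambda> \<Longrightarrow> alt x (K u) (K v) = alt x u v"
  shows "(\<forall>z. K z = z) \<or> (\<forall>z. K z = - z)"
proof -
  have fl: "\<lfloor>crd x i + crd y i\<rfloor> = \<lfloor>crd x i\<rfloor> + \<lfloor>crd y i\<rfloor>" if "x \<in> \<Lambda>" "y \<in> \<Lambda>" "i < 4" for x y i
    using crd_lattice[OF that(1,3)] crd_lattice[OF that(2,3)] by (metis floor_of_int of_int_add)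
  have "gmat K i k * gmat K j l - gmat K i l * gmat K j k =
      (if i = k \<and> j = l then 1 else 0) - (if i = l \<and> j = k then 1 else 0)"
    if ij: "i < 4" "j < 4" "k < 4" "l < 4" for i j k l
  proof -
    define \<beta> where "\<beta> u v = \<lfloor>crd u k\<rfloor> * \<lfloor>crd v l\<rfloor>" for u v
    obtain x where x: "x \<in> H2" "\<And>u v. u \<in> \<Lambda> \<Longrightarrow> v \<in> \<Lambda> \<Longrightarrow> alt x u v = \<beta> u v - \<beta> v u"
      by (rule alt_surj[of \<beta>]) (simp_all add: \<beta>_def fl ij algebra_simps)
    have "alt x (K (b i)) (K (b j)) = alt x (b i) (b j)" by (intro alt x b_in_lattice ij)
    moreover have "alt x (K (b i)) (K (b j)) = \<beta> (K (b i)) (K (b j)) - \<beta> (K (b j)) (K (b i))"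
      by (intro x K b_in_lattice ij)
    moreover have "alt x (b i) (b j) = \<beta> (b i) (b j) - \<beta> (b j) (b i)" by (intro x b_in_lattice ij)
    moreover have "\<beta> (b i) (b j) = (if i = k \<and> j = l then 1 else 0)" "\<beta> (b j) (b i) = (if i = l \<and> j = k then 1 else 0)"
      by (auto simp: \<beta>_def crd_b ij)
    moreover have "\<beta> (K (b i)) (K (b j)) = gmat K i k * gmat K j l" "\<beta> (K (b j)) (K (b i)) = gmat K i l * gmat K j k"
      by (simp_all add: \<beta>_def gmat_def)
    ultimately show ?thesis by linarith
  qed
  from minors_identity[of "gmat K", OF this] obtain c :: int where c: "c = 1 \<or> c = - 1"
    and M: "\<And>i k. i < 4 \<Longrightarrow> k < 4 \<Longrightarrow> gmat K i k = (if i = k then c else 0)" by blast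
  have Kb: "K (b i) = of_int c *\<^sub>R b i" if "i < 4" for i
  proof -
    have "K (b i) = (\<Sum>k<4. of_int (gmat K i k) *\<^sub>R b k)" by (rule mat_comb[OF K(2) that])
    also have "\<dots> = (\<Sum>k<4. (if k = i then of_int c *\<^sub>R b i else 0))" by (rule sum.cong) (auto simp: M that)
    finally show ?thesis using that by simp
  qed
  have "K z = of_int c *\<^sub>R z" for z
  proof -
    have "K z = K (\<Sum>i<4. crd z i *\<^sub>R b i)" by (simp add: sum_crd)
    also have "\<dots> = (\<Sum>i<4. crd z i *\<^sub>R K (b i))" by (simp add: linear_sum[OF K(1)] linear_cmul[OF K(1)])
    also have "\<dots> = (\<Sum>i<4. of_int c *\<^sub>R crd z i *\<^sub>R b i)" by (rule sum.cong) (simp_all add: Kb)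
    finally show ?thesis by (simp only: scaleR_sum_right[symmetric] sum_crd)
  qed
  then show ?thesis using c by auto
qed

lemma order_lift:
  assumes \<sigma>: "\<sigma> \<in> carrier (Aut0 \<Lambda>)" and L: "lattice_auto L L'" "\<And>z. \<sigma> (proj z) = proj (L z)"
    and ord: "group.ord (isometry_group (H2_lattice \<Lambda>)) (nu \<Lambda> \<sigma>) = p"
  shows "(\<forall>z. (L ^^ p) z = z) \<or> (\<forall>z. (L ^^ p) z = - z)"
proof (rule pm_identity)
  interpret H: comm_group "H2_lattice \<Lambda>" by (rule comm_group_H2)
  have L2: "linear L" "\<And>z. z \<in> \<Lambda> \<Longrightarrow> L z \<in> \<Lambda>" using L(1) by (auto simp: lattice_auto_def clinear2_linear)
  show "linear (L ^^ p)"
    by (induction p) (simp_all only: funpow.simps linear_id linear_compose L2(1))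
  show "(L ^^ p) z \<in> \<Lambda>" if "z \<in> \<Lambda>" for z by (induction p) (use that L2 in auto)
  fix x u v assume x: "x \<in> H2" and uv: "u \<in> \<Lambda>" "v \<in> \<Lambda>"
  have "(nu \<Lambda> \<sigma> ^^ p) x = x" using isometry_ord[OF H.group_axioms nu_isometry[OF \<sigma>] x] ord by simp
  then show "alt x ((L ^^ p) u) ((L ^^ p) v) = alt x u v" using nu_power[OF L x uv, of p] by simp
qed

end

section \<open>Eigenvalues\<close>

definition ctr :: "(complex^2 \<Rightarrow> complex^2) \<Rightarrow> complex" where
  "ctr L = L (axis 1 1) $ 1 + L (axis 2 1) $ 2"

lemma cayley_hamilton:
  assumes "clinear2 L" shows "L (L z) = ctr L *s L z - cdet L *s z"
proof -
  have 1: "L (L z) = L z $ 1 *s L (axis 1 1) + L z $ 2 *s L (axis 2 1)" by (rule clinear2_basis[OF assms])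
  have 2: "L z = z $ 1 *s L (axis 1 1) + z $ 2 *s L (axis 2 1)" by (rule clinear2_basis[OF assms])
  show ?thesis
    unfolding 1 unfolding 2 by (simp add: vec_eq_iff forall_2 ctr_def cdet_def dC_def algebra_simps)
qed

lemma clinear2_shift: "clinear2 L \<Longrightarrow> clinear2 (\<lambda>z. x *s z - L z)"
  by (simp add: clinear2_def vec_eq_iff algebra_simps)

lemma cdet_shift: "clinear2 L \<Longrightarrow> cdet (\<lambda>z. x *s z - L z) = x\<^sup>2 - ctr L * x + cdet L"
  by (simp add: cdet_def dC_def ctr_def axis_def power2_eq_square algebra_simps)

lemma ctr_square:
  assumes "clinear2 L" shows "ctr (\<lambda>z. L (L z)) = (ctr L)\<^sup>2 - 2 * cdet L"
  unfolding ctr_def[of "\<lambda>z. L (L z)"] cayley_hamilton[OF assms]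
  by (simp add: ctr_def axis_def power2_eq_square algebra_simps)

lemma quadratic_roots:
  fixes t d :: complex obtains \<alpha> \<beta> where "\<alpha> + \<beta> = t" "\<alpha> * \<beta> = d"
proof
  let ?r = "csqrt (t\<^sup>2 - 4 * d)"
  show "(t + ?r) / 2 + (t - ?r) / 2 = t" by (simp add: field_simps)
  have "(t + ?r) / 2 * ((t - ?r) / 2) = (t\<^sup>2 - ?r\<^sup>2) / 4" by (simp add: field_simps power2_eq_square)
  then show "(t + ?r) / 2 * ((t - ?r) / 2) = d" by simp
qed

text \<open>By Cayley-Hamilton, \<open>L z - \<beta> *s z\<close> is an eigenvector for
  \<open>\<alpha>\<close> as soon as it is nonzero. If it always vanishes then \<open>L\<close> is a
  scalar and \<open>\<alpha> = \<beta>\<close>.\<close>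

lemma eigenvector_exists:
  assumes L: "clinear2 L" and t: "\<alpha> + \<beta> = ctr L" and d: "\<alpha> * \<beta> = cdet L"
  shows "\<exists>v. v \<noteq> 0 \<and> L v = \<alpha> *s v"
proof (cases "\<forall>z. L z = \<beta> *s z")
  case True
  then have "ctr L = \<beta> + \<beta>" by (simp add: ctr_def axis_def)
  then have "\<alpha> = \<beta>" using t by simp
  then show ?thesis using True by (intro exI[of _ "axis 1 1"]) simp
next
  case False
  then obtain z where z: "L z \<noteq> \<beta> *s z" by blast
  have "L (L z) = (\<alpha> + \<beta>) *s L z - (\<alpha> * \<beta>) *s z" using cayley_hamilton[OF L, of z] t d by simp
  moreover have "L (L z - \<beta> *s z) = L (L z) - \<beta> *s L z"
    by (simp only: linear_diff[OF clinear2_linear[OF L]] clinear2_smult[OF L])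
  ultimately have "L (L z - \<beta> *s z) = \<alpha> *s (L z - \<beta> *s z)"
    by (simp only: vec_eq_iff) (simp add: algebra_simps)
  then show ?thesis using z by (intro exI[of _ "L z - \<beta> *s z"]) simp
qed

lemma clinear2_pow: "clinear2 L \<Longrightarrow> L v = x *s v \<Longrightarrow> (L ^^ n) v = (x ^ n) *s v"
  by (induction n) (simp_all add: clinear2_smult mult.commute)

lemma norm_1_root: "x ^ n = 1 \<Longrightarrow> n > 0 \<Longrightarrow> cmod x = 1"
proof -
  assume x: "x ^ n = 1" "n > 0"
  then have "cmod x ^ n = 1 ^ n" by (simp flip: norm_power)
  then show ?thesis using power_eq_imp_eq_base[of "cmod x" n 1] x(2) by simp
qed

section \<open>Roots of unity and their traces\<close>

lemma circle_norm:
  assumes "cmod a = 1" shows "(cmod (of_real x - a))\<^sup>2 = x\<^sup>2 - 2 * Re a * x + 1"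
proof -
  have "(Re a)\<^sup>2 + (Im a)\<^sup>2 = 1" using assms by (simp add: cmod_def)
  then show ?thesis unfolding cmod_power2 by (simp add: power2_eq_square algebra_simps)
qed

lemma circle_trace:
  assumes "cmod a = 1" shows "a\<^sup>2 = of_real (2 * Re a) * a - 1"
proof -
  have "(Re a)\<^sup>2 + (Im a)\<^sup>2 = 1" using assms by (simp add: cmod_def)
  then show ?thesis by (simp add: complex_eq_iff power2_eq_square algebra_simps)
qed

lemma circle_power_4:
  fixes a w :: complex
  assumes a: "a * a = w * a - 1"
  shows "(a * a) * (a * a) = w * w * (a * a) - 2 * (w * a) + 1"
proof -
  have "(a * a) * (a * a) = (w * a - 1) * (w * a - 1)" by (simp only: a)
  then show ?thesis by (simp add: algebra_simps)
qed

text \<open>Here \<open>w\<close> is the trace \<open>a + 1/a\<close>. The conditions on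
  \<open>w\<close> are the minimal polynomials of the traces of roots of unity of orders 6, 3, 4, 8,
  12, 10 and 5, in this sequence; powers of \<open>a\<close> are reduced by its quadratic
  equation.\<close>

lemma circle_orders:
  fixes a w :: complex
  assumes a: "a * a = w * a - 1"
  shows "w = 1 \<Longrightarrow> a ^ 3 = - 1" "w = - 1 \<Longrightarrow> a ^ 3 = 1" "w = 0 \<Longrightarrow> a ^ 2 = - 1"
    "w * w = 2 \<Longrightarrow> a ^ 4 = - 1" "w * w = 3 \<Longrightarrow> a ^ 6 = - 1"
    "w * w = w + 1 \<Longrightarrow> a ^ 5 = - 1" "w * w = 1 - w \<Longrightarrow> a ^ 5 = 1"
proof -
  have u: "w * a = a * a + 1" using a by simp
  have ua: "w * (a * a) = a * a * a + a"
  proof -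
    have "w * (a * a) = (w * a) * a" by (simp only: mult.assoc)
    then show ?thesis by (simp only: u distrib_right mult_1)
  qed
  have e: "a ^ 2 = a * a" "a ^ 3 = a * a * a" "a ^ 4 = (a * a) * (a * a)"
    "a ^ 5 = (a * a) * (a * a) * a" "a ^ 6 = (a * a) * (a * a) * (a * a)" by (simp_all add: eval_nat_numeral mult.assoc)
  note p = circle_power_4[OF a]
  have 3: "a * a * a = w * (a * a) - a"
  proof -
    have "a * a * a = (w * a - 1) * a" by (simp only: a)
    then show ?thesis by (simp only: left_diff_distrib mult_1 mult.assoc)
  qed
  show "a ^ 3 = - 1" if "w = 1" unfolding e 3 using a that by simp
  show "a ^ 3 = 1" if "w = - 1" unfolding e 3 using a that by simp
  show "a ^ 2 = - 1" if "w = 0" unfolding e using a that by simp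
  show "a ^ 4 = - 1" if w: "w * w = 2" unfolding e p w u by simp
  show "a ^ 6 = - 1" if w: "w * w = 3"
  proof -
    have 4: "(a * a) * (a * a) = a * a - 1" unfolding p w u by simp
    have "(a * a) * (a * a) * (a * a) = (a * a) * (a * a) - a * a" by (simp only: 4 left_diff_distrib mult_1)
    then show ?thesis unfolding e 4 by simp
  qed
  show "a ^ 5 = - 1" if w: "w * w = w + 1"
  proof -
    have 4: "(a * a) * (a * a) = a * a * a + a - a * a - 1" unfolding p w distrib_right ua u by simp
    have "(a * a) * (a * a) * a = (a * a) * (a * a) + a * a - a * a * a - a"
      by (simp only: 4 left_diff_distrib distrib_right mult_1) (simp only: mult.assoc 4[unfolded mult.assoc])
    then show ?thesis unfolding e 4 by simp
  qed
  show "a ^ 5 = 1" if w: "w * w = 1 - w"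
  proof -
    have 4: "(a * a) * (a * a) = - (a * a * a) - a - a * a - 1" unfolding p w left_diff_distrib ua u by simp
    have "(a * a) * (a * a) * a = - ((a * a) * (a * a)) - a * a - a * a * a - a"
      by (simp only: 4 left_diff_distrib minus_mult_left[symmetric] mult_1) (simp only: mult.assoc 4[unfolded mult.assoc])
    then show ?thesis unfolding e 4 by simp
  qed
qed

text \<open>The traces \<open>2 Re \<alpha>\<close> of roots of unity of degree at most \<open>2\<close> over the rationals
  belong to the orders \<open>1, 2, 3, 4, 6\<close> and \<open>5, 8, 10, 12\<close>, whose least common multiple
  is \<open>120\<close>.\<close>

lemma root_order_120:
  fixes a :: complex and A B :: real and s q :: int
  assumes a: "cmod a = 1" "A = 2 * Re a" and B: "\<bar>B\<bar> \<le> 2" and s: "A + B = of_int s" and q: "A * B = of_int q"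
  shows "a ^ 120 = 1"
proof -
  have "\<bar>Re a\<bar> \<le> 1" using abs_Re_le_cmod[of a] a(1) by simp
  then have A: "\<bar>A\<bar> \<le> 2" using a(2) by simp
  have a2: "a\<^sup>2 = of_real A * a - 1" using circle_trace[OF a(1)] a(2) by simp
  have aw: "a * a = of_real A * a - 1" using a2 by (simp only: power2_eq_square)
  have Aw: "(of_real A :: complex) * of_real A = of_real (A\<^sup>2)" by (simp add: power2_eq_square)
  have Aq: "A\<^sup>2 = of_int s * A - of_int q" using s q by (simp flip: s q add: power2_eq_square algebra_simps)
  \<comment> \<open>The polynomial with roots \<open>A\<close> and \<open>B\<close> is non-negative
    at 2 and at -2, and so is its discriminant. These three inequalities leave the nineteen integral
    pairs listed below.\<close>
  have f: "0 \<le> (2 - A) * (2 - B)" "0 \<le> (2 + A) * (2 + B)" using A B by (simp_all add: abs_le_iff)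
  have "real_of_int (4 - 2 * s + q) = (2 - A) * (2 - B)" "real_of_int (4 + 2 * s + q) = (2 + A) * (2 + B)"
    "real_of_int (s\<^sup>2 - 4 * q) = (A - B)\<^sup>2" by (simp_all flip: s q add: power2_eq_square algebra_simps)
  then have b: "4 - 2 * s + q \<ge> 0" "4 + 2 * s + q \<ge> 0" "s\<^sup>2 - 4 * q \<ge> 0"
    using f by (metis of_int_0_le_iff zero_le_power2)+
  have "real_of_int \<bar>s\<bar> \<le> 4" using A B s by linarith
  then have s4: "\<bar>s\<bar> \<le> 4" by linarith
  have "q \<le> 4 \<and> - 4 \<le> q"
  proof
    have "s\<^sup>2 \<le> 4\<^sup>2" using s4 by (metis abs_le_square_iff abs_numeral)
    then show "q \<le> 4" using b(3) by simp
    show "- 4 \<le> q" using b(1,2) by linarith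
  qed
  moreover have "s \<le> 4 \<and> - 4 \<le> s" using s4 by linarith
  ultimately have "s \<in> {-4,-3,-2,-1,0,1,2,3,4}" "q \<in> {-4,-3,-2,-1,0,1,2,3,4}" by auto
  then have "(s, q) \<in> {(-4, 4), (-3, 2), (-2, 0), (-2, 1), (-1, -2), (-1, -1), (-1, 0), (0, -4), (0, -3), (0, -2), (0, -1), (0, 0), (1, -2), (1, -1), (1, 0), (2, 0), (2, 1), (3, 2), (4, 4)}"
    using b by (elim insertE emptyE) simp_all
  consider "A = 2" | "A = - 2" | "A = 1" | "A = - 1" | "A = 0" | "A\<^sup>2 = 2" | "A\<^sup>2 = 3" | "A\<^sup>2 = A + 1" | "A\<^sup>2 = 1 - A"
  proof -
    \<comment> \<open>Used for the pairs whose polynomial splits over the integers; the four others,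
      such as \<open>s = -1\<close> and \<open>q = -1\<close>, are themselves minimal polynomials in
      the list of cases.\<close>
    have f: "A = x \<or> A = y" if "A\<^sup>2 = (x + y) * A - x * y" for x y
    proof -
      have "(A - x) * (A - y) = 0" using that by (simp add: power2_eq_square algebra_simps)
      then show ?thesis by auto
    qed
    from \<open>(s, q) \<in> _\<close> have "s = -4 \<and> q = 4 \<or> s = -3 \<and> q = 2 \<or> s = -2 \<and> q = 0 \<or> s = -2 \<and> q = 1 \<or> s = -1 \<and> q = -2 \<or> s = -1 \<and> q = -1 \<or> s = -1 \<and> q = 0 \<or> s = 0 \<and> q = -4 \<or> s = 0 \<and> q = -3 \<or> s = 0 \<and> q = -2 \<or> s = 0 \<and> q = -1 \<or> s = 0 \<and> q = 0 \<or> s = 1 \<and> q = -2 \<or> s = 1 \<and> q = -1 \<or> s = 1 \<and> q = 0 \<or> s = 2 \<and> q = 0 \<or> s = 2 \<and> q = 1 \<or> s = 3 \<and> q = 2 \<or> s = 4 \<and> q = 4" by simp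
    then show ?thesis
    proof (elim disjE conjE)
      assume "s = -4" "q = 4" then have "A = -2 \<or> A = -2" using Aq by (intro f) simp
      then show ?thesis using that by auto
    next
      assume "s = -3" "q = 2" then have "A = -2 \<or> A = -1" using Aq by (intro f) simp
      then show ?thesis using that by auto
    next
      assume "s = -2" "q = 0" then have "A = -2 \<or> A = 0" using Aq by (intro f) simp
      then show ?thesis using that by auto
    next
      assume "s = -2" "q = 1" then have "A = -1 \<or> A = -1" using Aq by (intro f) simp
      then show ?thesis using that by auto
    next
      assume "s = -1" "q = -2" then have "A = -2 \<or> A = 1" using Aq by (intro f) simp
      then show ?thesis using that by auto
    next
      assume "s = -1" "q = -1" then show ?thesis using Aq that by simp
    next
      assume "s = -1" "q = 0" then have "A = -1 \<or> A = 0" using Aq by (intro f) simp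
      then show ?thesis using that by auto
    next
      assume "s = 0" "q = -4" then have "A = 2 \<or> A = -2" using Aq by (intro f) simp
      then show ?thesis using that by auto
    next
      assume "s = 0" "q = -3" then show ?thesis using Aq that by simp
    next
      assume "s = 0" "q = -2" then show ?thesis using Aq that by simp
    next
      assume "s = 0" "q = -1" then have "A = 1 \<or> A = -1" using Aq by (intro f) simp
      then show ?thesis using that by auto
    next
      assume "s = 0" "q = 0" then have "A = 0 \<or> A = 0" using Aq by (intro f) simp
      then show ?thesis using that by auto
    next
      assume "s = 1" "q = -2" then have "A = 2 \<or> A = -1" using Aq by (intro f) simp
      then show ?thesis using that by auto
    next
      assume "s = 1" "q = -1" then show ?thesis using Aq that by simp
    next
      assume "s = 1" "q = 0" then have "A = 1 \<or> A = 0" using Aq by (intro f) simp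
      then show ?thesis using that by auto
    next
      assume "s = 2" "q = 0" then have "A = 2 \<or> A = 0" using Aq by (intro f) simp
      then show ?thesis using that by auto
    next
      assume "s = 2" "q = 1" then have "A = 1 \<or> A = 1" using Aq by (intro f) simp
      then show ?thesis using that by auto
    next
      assume "s = 3" "q = 2" then have "A = 2 \<or> A = 1" using Aq by (intro f) simp
      then show ?thesis using that by auto
    next
      assume "s = 4" "q = 4" then have "A = 2 \<or> A = 2" using Aq by (intro f) simp
      then show ?thesis using that by auto
    qed
  qed
  then show ?thesis
  proof cases
    case 1
    then have "(a - 1)\<^sup>2 = 0" using a2 by (simp add: power2_eq_square algebra_simps)
    then show ?thesis by simp
  next
    case 2
    then have "a * a = - 2 * a - 1" using aw by simp
    moreover have "(a + 1) * (a + 1) = a * a + 2 * a + 1" by (simp add: algebra_simps)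
    ultimately have "(a + 1) * (a + 1) = 0" by simp
    then have "a + 1 = 0" by simp
    then have "a = - 1" by (simp add: eq_neg_iff_add_eq_0)
    then show ?thesis by simp
  next
    case 3
    then have "a ^ 3 = - 1" using circle_orders(1)[OF aw] by simp
    then have "(a ^ 3) ^ 40 = 1" by simp
    then show ?thesis by (simp flip: power_mult)
  next
    case 4
    then have "a ^ 3 = 1" using circle_orders(2)[OF aw] by simp
    then have "(a ^ 3) ^ 40 = 1" by simp
    then show ?thesis by (simp flip: power_mult)
  next
    case 5
    then have "a ^ 2 = - 1" using circle_orders(3)[OF aw] by simp
    then have "(a ^ 2) ^ 60 = 1" by simp
    then show ?thesis by (simp flip: power_mult)
  next
    case 6
    then have "a ^ 4 = - 1" using circle_orders(4)[OF aw] Aw by simp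
    then have "(a ^ 4) ^ 30 = 1" by simp
    then show ?thesis by (simp flip: power_mult)
  next
    case 7
    then have "a ^ 6 = - 1" using circle_orders(5)[OF aw] Aw by simp
    then have "(a ^ 6) ^ 20 = 1" by simp
    then show ?thesis by (simp flip: power_mult)
  next
    case 8
    then have "a ^ 5 = - 1" using circle_orders(6)[OF aw] Aw by simp
    then have "(a ^ 5) ^ 24 = 1" by simp
    then show ?thesis by (simp flip: power_mult)
  next
    case 9
    then have "a ^ 5 = 1" using circle_orders(7)[OF aw] Aw by simp
    then have "(a ^ 5) ^ 24 = 1" by simp
    then show ?thesis by (simp flip: power_mult)
  qed
qed

lemma coprime_power_eq_1:
  fixes a :: complex
  assumes "a ^ m = 1" "a ^ n = 1" "coprime m n" "m > 0"
  shows "a = 1"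
proof -
  obtain x y where "m * x = n * y + gcd m n" using bezout_nat[of m n] assms(4) by blast
  then have "m * x = n * y + 1" using assms(3) by simp
  then have "a ^ (m * x) = a ^ (n * y) * a" by simp
  then show ?thesis using assms by (simp add: power_mult)
qed

context torus
begin

section \<open>Integrality of the characteristic polynomial\<close>

lemma norm_cdet_int:
  assumes "clinear2 K" "\<And>z. z \<in> \<Lambda> \<Longrightarrow> K z \<in> \<Lambda>"
  shows "(cmod (cdet K))\<^sup>2 \<in> \<int>"
  using det_mat[OF assms] by (metis Ints_of_int)

text \<open>For an integer \<open>x\<close> the map \<open>x - L\<close> again preserves \<Lambda>,
  so the squared modulus of its determinant is an integer. It is the value at \<open>x\<close> of
  the characteristic polynomial of \<open>L\<close> on \<Lambda>, factored over the two pairs of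
  conjugate eigenvalues.\<close>

lemma charpoly_int:
  assumes L: "clinear2 L" "\<And>z. z \<in> \<Lambda> \<Longrightarrow> L z \<in> \<Lambda>"
    and t: "\<alpha> + \<beta> = ctr L" and d: "\<alpha> * \<beta> = cdet L" and n: "cmod \<alpha> = 1" "cmod \<beta> = 1"
  shows "(real_of_int x ^ 2 - 2 * Re \<alpha> * of_int x + 1) * (real_of_int x ^ 2 - 2 * Re \<beta> * of_int x + 1) \<in> \<int>"
proof -
  let ?K = "\<lambda>z. complex_of_real (of_int x) *s z - L z"
  have "?K z \<in> \<Lambda>" if "z \<in> \<Lambda>" for z
    using lattice_diff[OF lattice_zmul[OF that, of x] L(2)[OF that]] by (simp only: scaleR_smult)
  then have 1: "(cmod (cdet ?K))\<^sup>2 \<in> \<int>" by (intro norm_cdet_int clinear2_shift L(1))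
  have "cdet ?K = (of_real (of_int x) - \<alpha>) * (of_real (of_int x) - \<beta>)"
    by (simp add: cdet_shift[OF L(1)] t[symmetric] d[symmetric] power2_eq_square algebra_simps)
  then have "(cmod (cdet ?K))\<^sup>2 = (cmod (of_real (of_int x) - \<alpha>))\<^sup>2 * (cmod (of_real (of_int x) - \<beta>))\<^sup>2"
    by (simp add: norm_mult power_mult_distrib)
  also have "\<dots> = (real_of_int x ^ 2 - 2 * Re \<alpha> * of_int x + 1) * (real_of_int x ^ 2 - 2 * Re \<beta> * of_int x + 1)"
    by (simp only: circle_norm[OF n(1)] circle_norm[OF n(2)])
  finally show ?thesis using 1 by simp
qed

text \<open>The value at \<open>x\<close> is
  \<open>(x^2 + 1)^2 - x * (x^2 + 1) * (A + B) + x^2 * (A * B)\<close>. As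
  \<open>x * (x^2 + 1)\<close> is always even, integer values can only detect twice the sum; the
  arguments 1, -1 and 2 are enough for that.\<close>

lemma half_int_traces:
  assumes L: "clinear2 L" "\<And>z. z \<in> \<Lambda> \<Longrightarrow> L z \<in> \<Lambda>"
    and t: "\<alpha> + \<beta> = ctr L" and d: "\<alpha> * \<beta> = cdet L" and n: "cmod \<alpha> = 1" "cmod \<beta> = 1"
  defines "A \<equiv> 2 * Re \<alpha>" and "B \<equiv> 2 * Re \<beta>"
  shows "2 * (A + B) \<in> \<int>" "A * B \<in> \<int>"
proof -
  note c = charpoly_int[OF L t d n, folded A_def B_def]
  have 1: "(2 - A) * (2 - B) \<in> \<int>" "(2 + A) * (2 + B) \<in> \<int>" "(5 - 2 * A) * (5 - 2 * B) \<in> \<int>"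
  proof -
    have "(2 - A) * (2 - B) = (real_of_int 1 ^ 2 - A * of_int 1 + 1) * (real_of_int 1 ^ 2 - B * of_int 1 + 1)"
      "(2 + A) * (2 + B) = (real_of_int (-1) ^ 2 - A * of_int (-1) + 1) * (real_of_int (-1) ^ 2 - B * of_int (-1) + 1)"
      "(5 - 2 * A) * (5 - 2 * B) = (real_of_int 2 ^ 2 - A * of_int 2 + 1) * (real_of_int 2 ^ 2 - B * of_int 2 + 1)"
      by (simp_all add: algebra_simps)
    then show "(2 - A) * (2 - B) \<in> \<int>" "(2 + A) * (2 + B) \<in> \<int>" "(5 - 2 * A) * (5 - 2 * B) \<in> \<int>"
      using c[of 1] c[of "-1"] c[of 2] by (simp_all only:)
  qed
  have e2: "2 * (A + B) = 4 * ((2 - A) * (2 - B)) - (5 - 2 * A) * (5 - 2 * B) + 9" by (simp add: algebra_simps)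
  show s: "2 * (A + B) \<in> \<int>"
    unfolding e2 by (intro Ints_add Ints_diff Ints_mult 1 Ints_numeral)
  have e3: "A * B = (2 - A) * (2 - B) + 2 * (A + B) - 4" by (simp add: algebra_simps)
  show "A * B \<in> \<int>" unfolding e3 by (intro Ints_add Ints_diff 1 s Ints_numeral)
qed

text \<open>The missing factor 2 comes from the square of \<open>L\<close>, whose traces are
  \<open>A^2 - 2\<close> and \<open>B^2 - 2\<close>. Integrality of twice their sum makes the square
  of the integer \<open>r = 2 * (A + B)\<close> even, so \<open>r\<close> is even.\<close>

lemma int_traces:
  assumes L: "clinear2 L" "\<And>z. z \<in> \<Lambda> \<Longrightarrow> L z \<in> \<Lambda>"
    and t: "\<alpha> + \<beta> = ctr L" and d: "\<alpha> * \<beta> = cdet L" and n: "cmod \<alpha> = 1" "cmod \<beta> = 1"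
  defines "A \<equiv> 2 * Re \<alpha>" and "B \<equiv> 2 * Re \<beta>"
  shows "\<exists>s q :: int. A + B = of_int s \<and> A * B = of_int q"
proof -
  have h: "2 * (A + B) \<in> \<int>" "A * B \<in> \<int>" unfolding A_def B_def
    using half_int_traces(1)[OF L t d n] half_int_traces(2)[OF L t d n] by blast+
  have L2: "clinear2 (\<lambda>z. L (L z))" using L(1) by (simp add: clinear2_def)
  have "2 * (2 * Re (\<alpha>\<^sup>2) + 2 * Re (\<beta>\<^sup>2)) \<in> \<int>"
  proof (rule half_int_traces(1)[OF L2])
    show "\<alpha>\<^sup>2 + \<beta>\<^sup>2 = ctr (\<lambda>z. L (L z))"
      by (simp add: ctr_square[OF L(1)] t[symmetric] d[symmetric] power2_eq_square algebra_simps)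
    show "\<alpha>\<^sup>2 * \<beta>\<^sup>2 = cdet (\<lambda>z. L (L z))"
      by (simp only: cdet_comp[OF L(1), of L] d[symmetric] power2_eq_square ac_simps)
  qed (simp_all add: L n norm_power)
  moreover have "2 * Re (x\<^sup>2) = (2 * Re x)\<^sup>2 - 2" if "cmod x = 1" for x
    using circle_trace[OF that] by (simp add: power2_eq_square complex_eq_iff)
  ultimately have "2 * (A\<^sup>2 + B\<^sup>2) - 8 \<in> \<int>" using n by (simp add: A_def B_def algebra_simps)
  then obtain k where k: "2 * (A\<^sup>2 + B\<^sup>2) - 8 = real_of_int k" by (rule Ints_cases)
  obtain r q where r: "2 * (A + B) = real_of_int r" and q: "A * B = real_of_int q" using h by (auto elim!: Ints_cases)
  have "(2 * (A + B))\<^sup>2 = 2 * (2 * (A\<^sup>2 + B\<^sup>2) - 8) + 16 + 8 * (A * B)" by (simp add: power2_eq_square algebra_simps)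
  then have "(real_of_int r)\<^sup>2 = 2 * real_of_int k + 16 + 8 * real_of_int q" unfolding r k q .
  then have "real_of_int (r\<^sup>2) = real_of_int (2 * k + 16 + 8 * q)" by simp
  then have "r\<^sup>2 = 2 * k + 16 + 8 * q" by (simp only: of_int_eq_iff)
  then have "even (r\<^sup>2)" by simp
  then have "even r" by simp
  then obtain s where "r = 2 * s" by blast
  then have "A + B = of_int s" using r by simp
  then show ?thesis using q by blast
qed

text \<open>The eigenvalues are roots of unity of order dividing both \<open>p\<close> and 120. If
  \<open>p\<close> did not divide 120 both would be 1, against
  \<open>cdet L \<noteq> 1\<close>.\<close>

lemma prime_order:
  assumes L: "clinear2 L" "\<And>z. z \<in> \<Lambda> \<Longrightarrow> L z \<in> \<Lambda>" and p: "prime p" and Lp: "\<And>z. (L ^^ p) z = z"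
    and d1: "cdet L \<noteq> 1" and t: "\<alpha> + \<beta> = ctr L" and d: "\<alpha> * \<beta> = cdet L"
  shows "\<alpha> ^ p = 1" "\<beta> ^ p = 1" "p = 2 \<or> p = 3 \<or> p = 5"
    "\<exists>s q :: int. 2 * Re \<alpha> + 2 * Re \<beta> = of_int s \<and> 2 * Re \<alpha> * (2 * Re \<beta>) = of_int q"
proof -
  have pw: "x ^ p = 1" if "v \<noteq> 0" "L v = x *s v" for v x
  proof -
    have "x ^ p *s v = 1 *s v" using clinear2_pow[OF L(1) that(2), of p] Lp[of v] by simp
    then show ?thesis using that(1) by (simp only: vec.scale_cancel_right) auto
  qed
  show \<alpha>: "\<alpha> ^ p = 1" using eigenvector_exists[OF L(1) t d] pw by blast
  show \<beta>: "\<beta> ^ p = 1" using eigenvector_exists[OF L(1), of \<beta> \<alpha>] t d pw by (metis add.commute mult.commute)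
  have p0: "p > 0" using p prime_gt_0_nat by blast
  have n: "cmod \<alpha> = 1" "cmod \<beta> = 1" using \<alpha> \<beta> p0 norm_1_root by blast+
  show i: "\<exists>s q :: int. 2 * Re \<alpha> + 2 * Re \<beta> = of_int s \<and> 2 * Re \<alpha> * (2 * Re \<beta>) = of_int q"
    by (rule int_traces[OF L t d n])
  then obtain s q :: int where s: "2 * Re \<alpha> + 2 * Re \<beta> = of_int s" and q: "2 * Re \<alpha> * (2 * Re \<beta>) = of_int q" by blast
  have b: "\<bar>2 * Re \<alpha>\<bar> \<le> 2" "\<bar>2 * Re \<beta>\<bar> \<le> 2"
    using abs_Re_le_cmod[of \<alpha>] abs_Re_le_cmod[of \<beta>] n by auto
  have \<alpha>120: "\<alpha> ^ 120 = 1" by (rule root_order_120[OF n(1) refl b(2) s q])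
  have \<beta>120: "\<beta> ^ 120 = 1"
    by (rule root_order_120[OF n(2) refl b(1), of s q]) (use s q in \<open>simp_all add: ac_simps\<close>)
  have "p dvd 120"
  proof (rule ccontr)
    assume "\<not> p dvd 120"
    then have "coprime p 120" using p by (simp add: prime_imp_coprime)
    then have "\<alpha> = 1" "\<beta> = 1" using coprime_power_eq_1[OF \<alpha> \<alpha>120] coprime_power_eq_1[OF \<beta> \<beta>120] p0 by auto
    then show False using d d1 by simp
  qed
  moreover have "(120::nat) = 2 * (2 * (2 * (3 * 5)))" by simp
  ultimately have "p dvd 2 \<or> p dvd 3 \<or> p dvd 5"
    using p by (metis prime_dvd_mult_iff)
  then show "p = 2 \<or> p = 3 \<or> p = 5"
    using p by (auto dest!: primes_dvd_imp_eq[OF p, rotated])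
qed

end

section \<open>Charts of period domains\<close>

lemma holomorphic_mapI:
  fixes F :: "complex^'n \<Rightarrow> complex^'m"
  assumes "\<And>i z. z \<in> S \<Longrightarrow> \<exists>L. ((\<lambda>z. F z $ i) has_derivative L) (at z) \<and> (\<forall>c x. L (c *s x) = c * L x)"
  shows "holomorphic_map F S"
  unfolding holomorphic_map_def holomorphic_fun_def
proof (intro allI ballI)
  fix i z assume "z \<in> S"
  then obtain L where L: "((\<lambda>z. F z $ i) has_derivative L) (at z)" "\<forall>c x. L (c *s x) = c * L x" using assms by blast
  have "Vector_Spaces.linear (*s) (*) L"
    using L linear_add[OF has_derivative_linear[OF L(1)]] by (simp add: linear_smult_iff)
  then show "\<exists>L. ((\<lambda>z. F z $ i) has_derivative L) (at z) \<and> Vector_Spaces.linear (*s) (*) L" using L(1) by blast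
qed

section \<open>Holomorphic functions of several variables\<close>

definition hol_at :: "(complex^'n \<Rightarrow> complex) \<Rightarrow> complex^'n \<Rightarrow> bool" where
  "hol_at f z \<longleftrightarrow> (\<exists>L. (f has_derivative L) (at z) \<and> (\<forall>c x. L (c *s x) = c * L x))"

lemma hol_at_const: "hol_at (\<lambda>z. c) z"
  unfolding hol_at_def by (intro exI[of _ "\<lambda>_. 0"]) auto

lemma hol_at_nth: "hol_at (\<lambda>z. z $ i) z"
  unfolding hol_at_def
  by (intro exI[of _ "\<lambda>z. z $ i"]) (auto intro!: bounded_linear_imp_has_derivative bounded_linear_vec_nth)

lemma hol_at_add: "hol_at f z \<Longrightarrow> hol_at g z \<Longrightarrow> hol_at (\<lambda>z. f z + g z) z"
  unfolding hol_at_def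
proof (elim exE conjE)
  fix L M assume "(f has_derivative L) (at z)" "(g has_derivative M) (at z)"
    "\<forall>c x. L (c *s x) = c * L x" "\<forall>c x. M (c *s x) = c * M x"
  then show "\<exists>L. ((\<lambda>z. f z + g z) has_derivative L) (at z) \<and> (\<forall>c x. L (c *s x) = c * L x)"
    by (intro exI[of _ "\<lambda>h. L h + M h"]) (auto intro: has_derivative_add simp: algebra_simps)
qed

lemma hol_at_mult: "hol_at f z \<Longrightarrow> hol_at g z \<Longrightarrow> hol_at (\<lambda>z. f z * g z) z"
  unfolding hol_at_def
proof (elim exE conjE)
  fix L M assume "(f has_derivative L) (at z)" "(g has_derivative M) (at z)"
    "\<forall>c x. L (c *s x) = c * L x" "\<forall>c x. M (c *s x) = c * M x"
  then show "\<exists>L. ((\<lambda>z. f z * g z) has_derivative L) (at z) \<and> (\<forall>c x. L (c *s x) = c * L x)"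
    by (intro exI[of _ "\<lambda>h. f z * M h + L h * g z"] conjI has_derivative_mult) (simp_all add: algebra_simps)
qed

lemma hol_at_inverse: "hol_at f z \<Longrightarrow> f z \<noteq> 0 \<Longrightarrow> hol_at (\<lambda>z. inverse (f z)) z"
  unfolding hol_at_def
proof (elim exE conjE)
  fix L assume "(f has_derivative L) (at z)" "\<forall>c x. L (c *s x) = c * L x" "f z \<noteq> 0"
  then show "\<exists>L. ((\<lambda>z. inverse (f z)) has_derivative L) (at z) \<and> (\<forall>c x. L (c *s x) = c * L x)"
    by (intro exI[of _ "\<lambda>h. - (inverse (f z) * L h * inverse (f z))"] conjI Deriv.has_derivative_inverse) (simp_all add: algebra_simps)
qed

lemma hol_at_divide: "hol_at f z \<Longrightarrow> hol_at g z \<Longrightarrow> g z \<noteq> 0 \<Longrightarrow> hol_at (\<lambda>z. f z / g z) z"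
  using hol_at_mult[OF _ hol_at_inverse, of f z g] by (simp add: divide_inverse)

lemma hol_at_uminus: "hol_at f z \<Longrightarrow> hol_at (\<lambda>z. - f z) z"
  using hol_at_mult[OF hol_at_const[of "- 1"], of f z] by simp

lemma hol_at_diff: "hol_at f z \<Longrightarrow> hol_at g z \<Longrightarrow> hol_at (\<lambda>z. f z - g z) z"
  using hol_at_add[OF _ hol_at_uminus, of f z g] by simp

lemma hol_at_sum: "(\<And>i. i \<in> I \<Longrightarrow> hol_at (f i) z) \<Longrightarrow> hol_at (\<lambda>z. \<Sum>i\<in>I. f i z) z"
  by (induction I rule: infinite_finite_induct) (auto intro: hol_at_const hol_at_add)

lemmas hol_at_intros = hol_at_const hol_at_nth hol_at_add hol_at_mult hol_at_divide hol_at_uminus hol_at_diff hol_at_sum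

lemma hol_at_comp_isCont: "hol_at f z \<Longrightarrow> isCont f z"
  by (auto simp: hol_at_def dest: has_derivative_continuous)

lemma holomorphic_map_hol_at: "(\<And>i z. z \<in> S \<Longrightarrow> hol_at (\<lambda>z. F z $ i) z) \<Longrightarrow> holomorphic_map F S"
  by (rule holomorphic_mapI) (auto simp: hol_at_def)

section \<open>Complex linear maps and adapted coordinates\<close>

definition clin :: "(complex^'n \<Rightarrow> complex^'m) \<Rightarrow> bool" where
  "clin L \<longleftrightarrow> (\<forall>x y. L (x + y) = L x + L y) \<and> (\<forall>c x. L (c *s x) = c *s L x)"

lemma clin_add: "clin L \<Longrightarrow> L (x + y) = L x + L y"
  and clin_smult: "clin L \<Longrightarrow> L (c *s x) = c *s L x"
  by (auto simp: clin_def)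

lemma clin_0: "clin L \<Longrightarrow> L 0 = 0"
  using clin_smult[of L 0 0] by simp

lemma clin_diff: "clin L \<Longrightarrow> L (x - y) = L x - L y"
  using clin_add[of L x "(- 1) *s y"] clin_smult[of L "- 1" y] by simp

lemma clin_sum: "clin L \<Longrightarrow> L (sum f A) = (\<Sum>a\<in>A. L (f a))"
  by (induction A rule: infinite_finite_induct) (simp_all add: clin_0 clin_add)

lemma basis_expansion_smult: "(\<Sum>j\<in>UNIV. x $ j *s axis j 1) = (x :: complex^'n)"
  by (simp add: vec_eq_iff axis_def if_distrib sum.delta cong: if_cong)

lemma clin_expand: "clin L \<Longrightarrow> L x $ i = (\<Sum>j\<in>UNIV. x $ j * (L (axis j 1) $ i))"
  using clin_sum[of L "\<lambda>j. x $ j *s axis j 1" UNIV]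
  by (simp add: basis_expansion_smult clin_smult)

lemma clin_hol_at_comp:
  assumes "clin L" "\<And>j. hol_at (\<lambda>z. f z $ j) z" shows "hol_at (\<lambda>z. L (f z) $ i) z"
proof -
  have "(\<lambda>z. L (f z) $ i) = (\<lambda>z. \<Sum>j\<in>UNIV. f z $ j * (L (axis j 1) $ i))"
    by (intro ext clin_expand assms(1))
  then show ?thesis by (rule ssubst) (intro hol_at_intros assms(2))
qed

lemma clin_hol_at: "clin L \<Longrightarrow> hol_at (\<lambda>z. L z $ i) z"
  by (rule clin_hol_at_comp[where f = "\<lambda>z. z"]) (auto intro: hol_at_nth)

lemma hol_at_open:
  assumes "\<And>z. hol_at f z" shows "open {z. f z \<noteq> 0}"
  by (rule open_Collect_neq) (auto intro!: continuous_at_imp_continuous_on hol_at_comp_isCont assms)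

text \<open>A basis of \<open>T\<close> is extended to the whole space. In its coordinates
  \<open>T\<close> is a coordinate subspace, the only model that the definition of a submanifold
  admits.\<close>

lemma subspace_coordinates:
  fixes T :: "(complex^'n) set"
  assumes T: "vec.subspace T"
  obtains A B :: "complex^'n \<Rightarrow> complex^'n" and I :: "'n set"
  where "clin A" "clin B" "\<And>x. A (B x) = x" "\<And>x. B (A x) = x" "card I = vec.dim T"
    "\<And>x. x \<in> T \<longleftrightarrow> (\<forall>j. j \<notin> I \<longrightarrow> A x $ j = 0)"
proof -
  obtain S where S: "S \<subseteq> T" "vec.independent S" "T \<subseteq> vec.span S" "card S = vec.dim T"
    using vec.basis_exists[of T] by blast
  obtain E where E: "S \<subseteq> E" "vec.independent E" "vec.span E = UNIV"
    using vec.maximal_independent_subset_extend[of S UNIV] S(2) by (metis subset_UNIV top.extremum_uniqueI)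
  have fE: "finite E" by (rule vec.finiteI_independent[OF E(2)])
  have "card E = vec.dim (UNIV :: (complex^'n) set)"
    using vec.dim_eq_card[of E UNIV] E by simp
  then have "card E = CARD('n)" by (simp only: vec_dim_card)
  then obtain f where f: "bij_betw f (UNIV :: 'n set) E" using fE by (metis finite_UNIV bij_betw_iff_card finite)
  have inj: "inj f" and ran: "range f = E" using f by (auto simp: bij_betw_def)
  define A where "A x = (\<chi> j. vec.representation E x (f j))" for x
  define B where "B x = (\<Sum>j\<in>UNIV. x $ j *s f j)" for x :: "complex^'n"
  define I where "I = {j. f j \<in> S}"
  have A: "clin A"
    by (simp add: clin_def A_def vec_eq_iff vec.representation_add vec.representation_scale E)
  have B: "clin B"
    by (simp add: clin_def B_def vec.scale_left_distrib sum.distrib vec.scale_sum_right)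
  have BA: "B (A x) = x" for x
  proof -
    have "B (A x) = (\<Sum>v\<in>range f. vec.representation E x v *s v)" by (simp add: B_def A_def sum.reindex inj)
    also have "\<dots> = x" unfolding ran by (rule vec.sum_representation_eq) (use E fE in auto)
    finally show ?thesis .
  qed
  have Af: "A (f j) = axis j 1" for j
  proof -
    have "vec.representation E (f j) (f i) = (if i = j then 1 else 0)" for i
    proof -
      have "f j \<in> E" using ran by blast
      then show ?thesis using vec.representation_basis[OF E(2), of "f j"] inj by (simp add: inj_eq)
    qed
    then show ?thesis by (simp add: A_def vec_eq_iff axis_def)
  qed
  have AB: "A (B x) = x" for x
    by (simp add: B_def clin_sum[OF A] clin_smult[OF A] Af basis_expansion_smult)
  have "card I = card (f ` I)" by (rule card_image[symmetric]) (rule inj_on_subset[OF inj], simp)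
  moreover have "f ` I = S" using E(1) ran by (auto simp: I_def)
  ultimately have cI: "card I = vec.dim T" using S(4) by simp
  have "x \<in> T \<longleftrightarrow> (\<forall>j. j \<notin> I \<longrightarrow> A x $ j = 0)" for x
  proof
    assume "x \<in> T"
    then have "x \<in> vec.span S" using S(3) by blast
    then have "vec.representation E x = vec.representation S x" by (rule vec.representation_extend[OF E(2) _ E(1)])
    then show "\<forall>j. j \<notin> I \<longrightarrow> A x $ j = 0"
      using vec.representation_ne_zero[of S x] by (auto simp: A_def I_def)
  next
    assume *: "\<forall>j. j \<notin> I \<longrightarrow> A x $ j = 0"
    have "A x $ j *s f j \<in> T" for j
      using * S(1) T by (cases "j \<in> I") (auto simp: I_def vec.subspace_scale vec.subspace_0)
    then have "B (A x) \<in> T" unfolding B_def by (intro vec.subspace_sum[OF T])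
    then show "x \<in> T" by (simp add: BA)
  qed
  then show thesis using that[OF A B AB BA cI] by blast
qed

abbreviation chart_at :: "nat \<Rightarrow> (complex^'n) set \<Rightarrow> complex^'n \<Rightarrow> bool" where
  "chart_at d M w \<equiv> \<exists>W (\<psi> :: complex^'n \<Rightarrow> complex^'n) I.
     open W \<and> w \<in> W \<and> inj_on \<psi> W \<and> open (\<psi> ` W) \<and>
     holomorphic_map \<psi> W \<and> holomorphic_map (inv_into W \<psi>) (\<psi> ` W) \<and>
     card I = d \<and> \<psi> ` (M \<inter> W) = {z \<in> \<psi> ` W. \<forall>i. i \<notin> I \<longrightarrow> z$i = 0}"

text \<open>Reduces a chart to an explicit biholomorphic pair \<open>\<psi>\<close>,
  \<open>\<theta>\<close> that straightens \<open>M\<close> to a linear subspace; a linear change of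
  coordinates does the rest. With both maps explicit, the inverse function theorem is
  avoided.\<close>

lemma submanifold_chart:
  fixes \<psi> \<theta> :: "complex^'n \<Rightarrow> complex^'n"
  assumes T: "vec.subspace T" "vec.dim T = d"
    and W: "open W" "w \<in> W" and Z: "open Z"
    and \<psi>: "\<And>w. w \<in> W \<Longrightarrow> \<psi> w \<in> Z" "\<And>w. w \<in> W \<Longrightarrow> \<theta> (\<psi> w) = w"
    and \<theta>: "\<And>z. z \<in> Z \<Longrightarrow> \<theta> z \<in> W" "\<And>z. z \<in> Z \<Longrightarrow> \<psi> (\<theta> z) = z"
    and hol: "\<And>w j. w \<in> W \<Longrightarrow> hol_at (\<lambda>w. \<psi> w $ j) w" "\<And>z j. z \<in> Z \<Longrightarrow> hol_at (\<lambda>z. \<theta> z $ j) z"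
    and M: "\<And>w. w \<in> W \<Longrightarrow> w \<in> M \<longleftrightarrow> \<psi> w \<in> T"
  shows "chart_at d M w"
proof -
  obtain A B and I :: "'n set" where A: "clin A" and B: "clin B" and AB: "\<And>x. A (B x) = x" and BA: "\<And>x. B (A x) = x"
    and I: "card I = vec.dim T" "\<And>x. x \<in> T \<longleftrightarrow> (\<forall>j. j \<notin> I \<longrightarrow> A x $ j = 0)"
    using subspace_coordinates[OF T(1)] by blast
  let ?f = "\<lambda>w. A (\<psi> w)"
  have im: "?f ` W = {z. B z \<in> Z}"
  proof (intro equalityI subsetI)
    fix z assume "z \<in> {z. B z \<in> Z}"
    then have "z = ?f (\<theta> (B z))" "\<theta> (B z) \<in> W" using \<theta> AB by simp_all
    then show "z \<in> ?f ` W" by blast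
  qed (use \<psi> BA in auto)
  have inj: "inj_on ?f W" by (rule inj_on_inverseI[of _ "\<lambda>z. \<theta> (B z)"]) (simp add: BA \<psi>)
  have inv: "inv_into W ?f z = \<theta> (B z)" if "B z \<in> Z" for z
    by (rule inv_into_f_eq[OF inj]) (use that \<theta> AB in simp_all)
  have contB: "continuous_on UNIV B"
  proof -
    have "continuous_on UNIV (\<lambda>z. B z $ i)" for i
      by (intro continuous_at_imp_continuous_on ballI hol_at_comp_isCont clin_hol_at B)
    then have "continuous_on UNIV (\<lambda>z. \<chi> i. B z $ i)" by (rule continuous_on_vec_lambda)
    then show ?thesis by simp
  qed
  have openZ: "open {z. B z \<in> Z}" using open_vimage[OF Z contB] by (simp add: vimage_def)
  have h1: "holomorphic_map ?f W"
    by (rule holomorphic_map_hol_at, rule clin_hol_at_comp[OF A, of \<psi>], rule hol(1))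
  have h2: "holomorphic_map (\<lambda>z. \<theta> (B z)) {z. B z \<in> Z}"
  proof (rule holomorphic_map_hol_at)
    fix j z assume z: "z \<in> {z. B z \<in> Z}"
    obtain L where L: "((\<lambda>z. \<theta> z $ j) has_derivative L) (at (B z))" "\<forall>c x. L (c *s x) = c * L x"
      using hol(2) z unfolding hol_at_def by blast
    have lB: "linear B" by (rule linearI) (simp_all add: clin_add[OF B] clin_smult[OF B] scaleR_smult)
    then have "(B has_derivative B) (at z)"
      by (intro bounded_linear_imp_has_derivative) (simp add: linear_conv_bounded_linear)
    from has_derivative_compose[OF this L(1)]
    show "hol_at (\<lambda>z. \<theta> (B z) $ j) z"
      unfolding hol_at_def using L(2) clin_smult[OF B] by (intro exI[of _ "\<lambda>x. L (B x)"]) simp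
  qed
  have h3: "holomorphic_map (inv_into W ?f) (?f ` W)"
    unfolding im holomorphic_map_def holomorphic_fun_def
  proof (intro allI ballI)
    fix j z assume z: "z \<in> {z. B z \<in> Z}"
    then obtain L where L: "((\<lambda>z. \<theta> (B z) $ j) has_derivative L) (at z)" "Vector_Spaces.linear (*s) (*) L"
      using h2 by (auto simp: holomorphic_map_def holomorphic_fun_def)
    have "((\<lambda>z. inv_into W ?f z $ j) has_derivative L) (at z)"
      by (rule has_derivative_transform_within_open[OF L(1) openZ z]) (simp add: inv)
    then show "\<exists>L. ((\<lambda>z. inv_into W ?f z $ j) has_derivative L) (at z) \<and> Vector_Spaces.linear (*s) (*) L"
      using L(2) by blast
  qed
  have oi: "open (?f ` W)" unfolding im by (rule openZ)
  have "?f ` (M \<inter> W) = {z \<in> ?f ` W. \<forall>i. i \<notin> I \<longrightarrow> z$i = 0}"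
  proof (intro equalityI subsetI)
    fix z assume "z \<in> ?f ` (M \<inter> W)"
    then obtain w where "z = ?f w" "w \<in> M" "w \<in> W" by blast
    then show "z \<in> {z \<in> ?f ` W. \<forall>i. i \<notin> I \<longrightarrow> z$i = 0}" using M[of w] I(2)[of "\<psi> w"] by simp
  next
    fix z assume "z \<in> {z \<in> ?f ` W. \<forall>i. i \<notin> I \<longrightarrow> z$i = 0}"
    then obtain w where "z = ?f w" "w \<in> W" "\<forall>i. i \<notin> I \<longrightarrow> z$i = 0" by blast
    then show "z \<in> ?f ` (M \<inter> W)" using M[of w] I(2)[of "\<psi> w"] by simp
  qed
  then show ?thesis
    using W inj oi h1 h3 I(1) T(2) by (intro exI[of _ W] exI[of _ ?f] exI[of _ I] conjI) simp_all
qed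

lemma gram_form_bilinear:
  fixes x y z :: "'a::comm_ring_1^'n"
  shows "gram_form M (x + y) z = gram_form M x z + gram_form M y z"
    "gram_form M z (x + y) = gram_form M z x + gram_form M z y"
    "gram_form M (c *s x) z = c * gram_form M x z" "gram_form M z (c *s x) = c * gram_form M z x"
    "gram_form M 0 z = 0" "gram_form M z 0 = 0" by (simp_all add: gram_form_def algebra_simps sum.distrib sum_distrib_left)

lemma gram_form_sym:
  assumes "\<And>i j. M $ i $ j = M $ j $ i" shows "gram_form M x y = gram_form M y x"
  unfolding gram_form_def by (subst sum.swap) (simp add: assms algebra_simps)

lemma hol_at_gram: "(\<And>i. hol_at (\<lambda>z. f z $ i) z) \<Longrightarrow> (\<And>i. hol_at (\<lambda>z. g z $ i) z) \<Longrightarrow> hol_at (\<lambda>z. gram_form M (f z) (g z)) z"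
  unfolding gram_form_def by (intro hol_at_intros)

text \<open>Inside \<open>V\<close> the affine hyperplane where coordinate \<open>i\<close> is 1 is
  a translate of \<open>T\<close>, which has one dimension less; the chart is the
  translation.\<close>

lemma linear_chart:
  fixes V :: "(complex^'n) set"
  assumes V: "vec.subspace V" "vec.dim V = Suc d" and U: "open U" and w0: "w0 \<in> V" "w0 $ i = 1" "w0 \<in> U"
    and M: "\<And>w. w \<in> U \<Longrightarrow> w \<in> M \<longleftrightarrow> w \<in> V \<and> w $ i = 1"
  shows "chart_at d M w0"
proof -
  define T where "T = {x \<in> V. x $ i = 0}"
  have T: "vec.subspace T"
    using V(1) by (auto simp: T_def vec.subspace_def)
  have spT: "vec.span T = T" using T by (simp only: vec.span_eq_iff)
  have "w0 \<notin> vec.span T" unfolding spT using w0 by (simp add: T_def)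
  moreover have "V = vec.span (insert w0 T)"
  proof (intro equalityI subsetI)
    fix x assume x: "x \<in> V"
    then have "x - x $ i *s w0 \<in> T" using w0 V(1) by (simp add: T_def vec.subspace_diff vec.subspace_scale)
    then show "x \<in> vec.span (insert w0 T)" using vec.span_breakdown_eq vec.span_base by blast
  next
    fix x assume "x \<in> vec.span (insert w0 T)"
    moreover have "vec.span (insert w0 T) \<subseteq> V" using w0 V(1) by (intro vec.span_minimal) (auto simp: T_def)
    ultimately show "x \<in> V" by blast
  qed
  ultimately have "vec.dim V = Suc (vec.dim T)" by (metis vec.dim_insert vec.dim_span Suc_eq_plus1)
  then have dT: "vec.dim T = d" using V(2) by simp
  show ?thesis
  proof (rule submanifold_chart[OF T dT U w0(3), where \<psi> = "\<lambda>w. w - w0" and \<theta> = "\<lambda>z. z + w0" and Z = "{z. z + w0 \<in> U}"])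
    show "open {z. z + w0 \<in> U}"
      using open_vimage[OF U, of "\<lambda>z. z + w0"] by (simp add: vimage_def continuous_intros)
    show "hol_at (\<lambda>w. (w - w0) $ j) w" "hol_at (\<lambda>z. (z + w0) $ j) w" for w j
      by (simp_all only: vector_minus_component vector_add_component) (intro hol_at_intros)+
    show "w \<in> M \<longleftrightarrow> w - w0 \<in> T" if "w \<in> U" for w
    proof -
      have "w - w0 \<in> V \<longleftrightarrow> w \<in> V" using w0(1) V(1) by (metis diff_add_cancel vec.subspace_add vec.subspace_diff)
      then show ?thesis using M[OF that] w0 by (simp add: T_def)
    qed
  qed auto
qed

text \<open>The isotropic vectors \<open>w0\<close> and \<open>v0\<close> span a hyperbolic plane.
  Writing a vector of \<open>V\<close> as \<open>y + a *s v0 + b *s w0\<close> with \<open>y\<close>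
  orthogonal to the plane, its square is \<open>?g y y + 2 * c * a * b\<close>, so near
  \<open>w0\<close>, where \<open>b\<close> is close to 1, the equation can be solved for
  \<open>a\<close>. In the application \<open>v0\<close> is the complex conjugate of
  \<open>w0\<close>.\<close>

lemma quadric_chart:
  fixes V :: "(complex^'n) set" and G :: "int^'n^'n"
  assumes sym: "\<And>i j. G $ i $ j = G $ j $ i"
    and V: "vec.subspace V" "vec.dim V = Suc (Suc d)" and U: "open U" and w0: "w0 \<in> V" "w0 $ i = 1" "w0 \<in> U"
    and v0: "v0 \<in> V" "v0 $ i = 1" and q: "gram_form G w0 w0 = 0" "gram_form G v0 v0 = 0" "gram_form G w0 v0 \<noteq> 0"
    and M: "\<And>w. w \<in> U \<Longrightarrow> w \<in> M \<longleftrightarrow> w \<in> V \<and> w $ i = 1 \<and> gram_form G w w = 0"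
  shows "chart_at d M w0"
proof -
  let ?g = "gram_form G :: complex^'n \<Rightarrow> complex^'n \<Rightarrow> complex"
  define c where "c = ?g w0 v0"
  have c: "c \<noteq> 0" "?g v0 w0 = c" "?g w0 v0 = c" using q(3) gram_form_sym[OF sym, of v0 w0] by (auto simp: c_def)
  note gb = gram_form_bilinear[where 'a = complex and M = G]
  obtain A B and I :: "'n set" where A: "clin A" and B: "clin B" and AB: "\<And>x. A (B x) = x" and BA: "\<And>x. B (A x) = x"
    and I: "\<And>x. x \<in> V \<longleftrightarrow> (\<forall>j. j \<notin> I \<longrightarrow> A x $ j = 0)"
    using subspace_coordinates[OF V(1)] by metis
  \<comment> \<open>A linear projection onto \<open>V\<close>; \<open>k\<close> below is the
    component killed by it, so that the chart is defined on the whole ambient space.\<close>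
  define P where "P x = B (\<chi> j. if j \<in> I then A x $ j else 0)" for x
  have PV: "P x \<in> V" for x by (simp add: I P_def AB)
  have Pid: "P x = x" if "x \<in> V" for x
  proof -
    have "(\<chi> j. if j \<in> I then A x $ j else 0) = A x" using that by (auto simp: I vec_eq_iff)
    then show ?thesis by (simp add: P_def BA)
  qed
  have P: "clin P"
    unfolding clin_def
  proof (intro conjI allI)
    fix x y and c :: complex
    have "(\<chi> j. if j \<in> I then A (x + y) $ j else 0) = (\<chi> j. if j \<in> I then A x $ j else 0) + (\<chi> j. if j \<in> I then A y $ j else 0)"
      by (simp add: vec_eq_iff clin_add[OF A])
    then show "P (x + y) = P x + P y" by (simp only: P_def clin_add[OF B])
    have "(\<chi> j. if j \<in> I then A (c *s x) $ j else 0) = c *s (\<chi> j. if j \<in> I then A x $ j else 0)"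
      by (simp add: vec_eq_iff clin_smult[OF A])
    then show "P (c *s x) = c *s P x" by (simp only: P_def clin_smult[OF B])
  qed
  define a where "a x = ?g (P x) w0 / c" for x
  define b where "b x = ?g (P x) v0 / c" for x
  define y where "y x = P x - a x *s v0 - b x *s w0" for x
  define k where "k x = x - P x" for x
  define T where "T = {x \<in> V. ?g x w0 = 0 \<and> ?g x v0 = 0}"
  have gm: "?g (x - z) u = ?g x u - ?g z u" for x z u
    using gb(1)[of x "- z" u] gb(3)[of "- 1" z u] by simp
  have yT: "y x \<in> T" for x
  proof -
    have "y x \<in> V" unfolding y_def by (intro vec.subspace_diff vec.subspace_scale V(1) PV w0(1) v0(1))
    moreover have "?g (y x) w0 = 0" unfolding y_def gm gb(3) using c q by (simp add: a_def)
    moreover have "?g (y x) v0 = 0" unfolding y_def gm gb(3) using c q by (simp add: b_def)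
    ultimately show ?thesis by (simp add: T_def)
  qed
  have Pk: "P (k x) = 0" for x by (simp add: k_def clin_diff[OF P] Pid[OF PV])
  have dec: "x = y x + a x *s v0 + b x *s w0 + k x" for x by (simp add: y_def k_def)
  have rec: "a (Y + s *s v0 + t *s w0 + K) = s" "b (Y + s *s v0 + t *s w0 + K) = t"
    "y (Y + s *s v0 + t *s w0 + K) = Y" "k (Y + s *s v0 + t *s w0 + K) = K"
    if "Y \<in> T" "P K = 0" for Y s t K
  proof -
    have Y: "Y \<in> V" "?g Y w0 = 0" "?g Y v0 = 0" using that by (auto simp: T_def)
    have PP: "P (Y + s *s v0 + t *s w0 + K) = Y + s *s v0 + t *s w0"
      by (simp only: clin_add[OF P] clin_smult[OF P] that(2) Pid[OF Y(1)] Pid[OF v0(1)] Pid[OF w0(1)] add_0_right)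
    show a: "a (Y + s *s v0 + t *s w0 + K) = s" unfolding a_def PP gb using Y c q by simp
    show b: "b (Y + s *s v0 + t *s w0 + K) = t" unfolding b_def PP gb using Y c q by simp
    show "y (Y + s *s v0 + t *s w0 + K) = Y" unfolding y_def a b PP by simp
    show "k (Y + s *s v0 + t *s w0 + K) = K" unfolding k_def PP by simp
  qed
  have T: "vec.subspace T" using V(1) by (auto simp: T_def vec.subspace_def gb)
  have sT: "r *s x \<in> T" if "x \<in> T" for r x using that T by (rule vec.subspace_scale[rotated])
  have dimT: "vec.dim T = d"
  proof -
    have spT: "vec.span T = T" using T by (simp only: vec.span_eq_iff)
    have 1: "w0 \<notin> vec.span T" unfolding spT using c by (simp add: T_def)
    have "vec.subspace {x. ?g x w0 = 0}" by (auto simp: vec.subspace_def gb)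
    then have "vec.span (insert w0 T) \<subseteq> {x. ?g x w0 = 0}"
      by (rule vec.span_minimal[rotated]) (use q in \<open>auto simp: T_def\<close>)
    then have 2: "v0 \<notin> vec.span (insert w0 T)" using c by auto
    have "V = vec.span (insert v0 (insert w0 T))"
    proof (intro equalityI subsetI)
      fix x assume "x \<in> V"
      then have "k x = 0" by (simp add: k_def Pid)
      then have x: "x = y x + a x *s v0 + b x *s w0" using dec[of x] by simp
      have sp: "v0 \<in> vec.span (insert v0 (insert w0 T))" "w0 \<in> vec.span (insert v0 (insert w0 T))"
        "y x \<in> vec.span (insert v0 (insert w0 T))" using yT[of x] by (auto intro: vec.span_base)
      have "y x + a x *s v0 + b x *s w0 \<in> vec.span (insert v0 (insert w0 T))" by (intro vec.span_add vec.span_scale sp)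
      then show "x \<in> vec.span (insert v0 (insert w0 T))" using x by simp
    next
      fix x assume "x \<in> vec.span (insert v0 (insert w0 T))"
      moreover have "vec.span (insert v0 (insert w0 T)) \<subseteq> V"
        using w0 v0 V(1) by (intro vec.span_minimal) (auto simp: T_def)
      ultimately show "x \<in> V" by blast
    qed
    then have "vec.dim V = Suc (Suc (vec.dim T))" using 1 2 by (simp add: vec.dim_insert vec.dim_span)
    then show ?thesis using V(2) by simp
  qed
  \<comment> \<open>The quadratic form divided by \<open>b^2\<close>. Together with
    \<open>y / b\<close> it replaces the coordinate \<open>a\<close>, and coordinate
    \<open>i\<close> replaces \<open>b\<close>.\<close>
  define S where "S w = ?g (y w) (y w) / (b w * b w) + 2 * c * a w / b w" for w
  define \<psi> where "\<psi> w = (1 / b w) *s y w + S w *s v0 + (w $ i) *s w0 + k w" for w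
  \<comment> \<open>\<open>\<alpha>\<close> recovers \<open>a / b\<close> from the new coordinates.
    Since \<open>w0\<close> and \<open>v0\<close> have coordinate \<open>i\<close> equal to 1,
    \<open>D\<close> recovers \<open>(w $ i - k w $ i) / b\<close>, and \<open>\<beta>\<close> then
    recovers \<open>b\<close>.\<close>
  define \<alpha> where "\<alpha> z = (a z - ?g (y z) (y z)) / (2 * c)" for z
  define D where "D z = y z $ i + \<alpha> z + 1" for z
  define \<beta> where "\<beta> z = (b z - k z $ i) / D z" for z
  define \<theta> where "\<theta> z = \<beta> z *s y z + (\<beta> z * \<alpha> z) *s v0 + \<beta> z *s w0 + k z" for z
  have \<psi>r: "a (\<psi> w) = S w" "b (\<psi> w) = w $ i" "y (\<psi> w) = (1 / b w) *s y w" "k (\<psi> w) = k w" for w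
    unfolding \<psi>_def by (rule rec; simp add: sT yT Pk)+
  have \<theta>r: "a (\<theta> z) = \<beta> z * \<alpha> z" "b (\<theta> z) = \<beta> z" "y (\<theta> z) = \<beta> z *s y z" "k (\<theta> z) = k z" for z
    unfolding \<theta>_def by (rule rec; simp add: sT yT Pk)+
  have wi: "w $ i - k w $ i = y w $ i + a w + b w" for w
    using arg_cong[OF dec[of w], of "\<lambda>x. x $ i"] w0(2) v0(2) by simp
  have \<alpha>\<psi>: "\<alpha> (\<psi> w) = a w / b w" if "b w \<noteq> 0" for w
    unfolding \<alpha>_def \<psi>r S_def gb using c(1) that by (simp add: field_simps)
  have D\<psi>: "D (\<psi> w) = (w $ i - k w $ i) / b w" if "b w \<noteq> 0" for w
    unfolding D_def \<alpha>\<psi>[OF that] wi \<psi>r using that by (simp add: field_simps)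
  have \<theta>\<psi>: "\<theta> (\<psi> w) = w" if "b w \<noteq> 0" "w $ i - k w $ i \<noteq> 0" for w
  proof -
    have \<beta>: "\<beta> (\<psi> w) = b w" unfolding \<beta>_def \<psi>r D\<psi>[OF that(1)] using that by simp
    have "\<theta> (\<psi> w) = y w + a w *s v0 + b w *s w0 + k w"
      unfolding \<theta>_def \<beta> \<alpha>\<psi>[OF that(1)] \<psi>r using that(1) by simp
    then show ?thesis using dec[of w] by simp
  qed
  have \<theta>i: "\<theta> z $ i = b z" if "D z \<noteq> 0" for z
  proof -
    have "\<theta> z $ i = \<beta> z * D z + k z $ i" by (simp add: \<theta>_def D_def w0 v0 algebra_simps)
    then show ?thesis using that by (simp add: \<beta>_def)
  qed
  have \<psi>\<theta>: "\<psi> (\<theta> z) = z" if "D z \<noteq> 0" "b z - k z $ i \<noteq> 0" for z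
  proof -
    have \<beta>: "\<beta> z \<noteq> 0" using that by (simp add: \<beta>_def)
    have "S (\<theta> z) = a z" unfolding S_def \<theta>r gb using \<beta> c(1) by (simp add: \<alpha>_def field_simps)
    then have "\<psi> (\<theta> z) = y z + a z *s v0 + b z *s w0 + k z"
      unfolding \<psi>_def \<theta>r \<theta>i[OF that(1)] using \<beta> by simp
    then show ?thesis using dec[of z] by simp
  qed
  have hP: "hol_at (\<lambda>z. P z $ j) z" for z j by (rule clin_hol_at[OF P])
  have ha: "hol_at a z" for z unfolding a_def[abs_def] using c(1) by (intro hol_at_intros hol_at_gram hP)
  have hb: "hol_at b z" for z unfolding b_def[abs_def] using c(1) by (intro hol_at_intros hol_at_gram hP)
  have hy: "hol_at (\<lambda>z. y z $ j) z" for z j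
    unfolding y_def vector_minus_component vector_smult_component by (intro hol_at_intros ha hb hP)
  have hk: "hol_at (\<lambda>z. k z $ j) z" for z j
    unfolding k_def vector_minus_component by (intro hol_at_intros hP)
  have h\<alpha>: "hol_at \<alpha> z" for z unfolding \<alpha>_def[abs_def] using c(1) by (intro hol_at_intros hol_at_gram ha hy) simp
  have hD: "hol_at D z" for z unfolding D_def[abs_def] by (intro hol_at_intros hy h\<alpha>)
  have h\<theta>: "hol_at (\<lambda>z. \<theta> z $ j) z" if "D z \<noteq> 0" for z j
    unfolding \<theta>_def \<beta>_def vector_add_component vector_smult_component
    by (intro hol_at_intros hb hk hD hy h\<alpha> that)
  have h\<psi>: "hol_at (\<lambda>w. \<psi> w $ j) w" if "b w \<noteq> 0" for w j
    unfolding \<psi>_def S_def vector_add_component vector_smult_component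
    by (intro hol_at_intros hb hk hy ha hol_at_gram) (use that in simp_all)
  let ?W = "U \<inter> {w. b w \<noteq> 0 \<and> w $ i - k w $ i \<noteq> 0}"
  let ?Z0 = "{z. D z \<noteq> 0 \<and> b z - k z $ i \<noteq> 0}"
  have openW: "open ?W"
    unfolding Collect_conj_eq by (intro open_Int U hol_at_open hb hol_at_intros hk)
  have openZ0: "open ?Z0"
    unfolding Collect_conj_eq by (intro open_Int hol_at_open hD hb hol_at_intros hk)
  have cont\<theta>: "continuous_on ?Z0 \<theta>"
  proof -
    have "continuous_on ?Z0 (\<lambda>z. \<theta> z $ j)" for j
      by (intro continuous_at_imp_continuous_on ballI hol_at_comp_isCont h\<theta>) simp
    then have "continuous_on ?Z0 (\<lambda>z. \<chi> j. \<theta> z $ j)" by (rule continuous_on_vec_lambda)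
    then show ?thesis by simp
  qed
  let ?Z1 = "?Z0 \<inter> \<theta> -` U"
  have openZ1: "open ?Z1" by (rule continuous_open_preimage[OF cont\<theta> openZ0 U])
  have b0: "b w0 = 1" "k w0 = 0" using c w0 by (simp_all add: b_def k_def Pid)
  show ?thesis
  proof (rule submanifold_chart[OF T dimT openW, where \<psi> = "\<lambda>w. \<psi> w - w0" and \<theta> = "\<lambda>z. \<theta> (z + w0)" and Z = "{z. z + w0 \<in> ?Z1}"])
    show "w0 \<in> ?W" using w0 b0 by simp
    show "open {z. z + w0 \<in> ?Z1}"
      using open_vimage[OF openZ1, of "\<lambda>z. z + w0"] by (simp add: vimage_def continuous_intros)
    show "\<psi> w - w0 \<in> {z. z + w0 \<in> ?Z1}" if "w \<in> ?W" for w
      using that by (simp add: D\<psi> \<psi>r \<theta>\<psi>)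
    show "\<theta> (\<psi> w - w0 + w0) = w" if "w \<in> ?W" for w using that by (simp add: \<theta>\<psi>)
    show "\<theta> (z + w0) \<in> ?W" if "z \<in> {z. z + w0 \<in> ?Z1}" for z
      using that by (simp add: \<theta>r \<theta>i) (simp add: \<beta>_def)
    show "\<psi> (\<theta> (z + w0)) - w0 = z" if "z \<in> {z. z + w0 \<in> ?Z1}" for z
      using that by (simp add: \<psi>\<theta>)
    show "hol_at (\<lambda>w. (\<psi> w - w0) $ j) w" if "w \<in> ?W" for w j
      unfolding vector_minus_component using that by (intro hol_at_intros h\<psi>) simp
    show "hol_at (\<lambda>z. \<theta> (z + w0) $ j) z" if "z \<in> {z. z + w0 \<in> ?Z1}" for z j
    proof -
      have "D (z + w0) \<noteq> 0" using that by simp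
      then obtain L where L: "((\<lambda>z. \<theta> z $ j) has_derivative L) (at (z + w0))" "\<forall>c x. L (c *s x) = c * L x"
        using h\<theta>[of "z + w0" j] by (auto simp: hol_at_def)
      have "((\<lambda>z. z + w0) has_derivative (\<lambda>h. h)) (at z)" by (auto intro!: derivative_eq_intros)
      from has_derivative_compose[OF this L(1)] show ?thesis unfolding hol_at_def using L(2) by blast
    qed
    show "w \<in> M \<longleftrightarrow> \<psi> w - w0 \<in> T" if w: "w \<in> ?W" for w
    proof -
      have bw: "b w \<noteq> 0" using w by simp
      have e: "\<psi> w - w0 = (1 / b w) *s y w + S w *s v0 + (w $ i - 1) *s w0 + k w"
        by (simp add: \<psi>_def vec.scale_left_diff_distrib)
      have r: "a (\<psi> w - w0) = S w" "b (\<psi> w - w0) = w $ i - 1" "k (\<psi> w - w0) = k w"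
        unfolding e by (rule rec; simp add: sT yT Pk)+
      have kV: "k x = 0 \<longleftrightarrow> x \<in> V" for x using PV[of x] Pid[of x] by (auto simp: k_def)
      have "\<psi> w - w0 \<in> T \<longleftrightarrow> k w = 0 \<and> S w = 0 \<and> w $ i = 1"
      proof
        assume "\<psi> w - w0 \<in> T"
        then have x: "\<psi> w - w0 \<in> V" "?g (\<psi> w - w0) w0 = 0" "?g (\<psi> w - w0) v0 = 0" by (auto simp: T_def)
        then have "k (\<psi> w - w0) = 0" "a (\<psi> w - w0) = 0" "b (\<psi> w - w0) = 0"
          using kV by (auto simp: a_def b_def Pid)
        then show "k w = 0 \<and> S w = 0 \<and> w $ i = 1" using r by simp
      next
        assume "k w = 0 \<and> S w = 0 \<and> w $ i = 1"
        then show "\<psi> w - w0 \<in> T" unfolding e using sT yT by simp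
      qed
      moreover have "w \<in> V \<Longrightarrow> ?g w w = b w * b w * S w"
      proof -
        assume "w \<in> V"
        then have wd: "w = y w + a w *s v0 + b w *s w0" using dec[of w] kV[of w] by simp
        have yw: "?g (y w) w0 = 0" "?g (y w) v0 = 0" "?g w0 (y w) = 0" "?g v0 (y w) = 0"
          using yT[of w] gram_form_sym[OF sym, of w0 "y w"] gram_form_sym[OF sym, of v0 "y w"] by (auto simp: T_def)
        have "?g w w = ?g (y w + a w *s v0 + b w *s w0) (y w + a w *s v0 + b w *s w0)" by (simp flip: wd)
        also have "\<dots> = ?g (y w) (y w) + 2 * c * a w * b w" unfolding gb using yw q c by (simp add: algebra_simps)
        finally show ?thesis using bw by (simp add: S_def field_simps)
      qed
      ultimately show ?thesis using M[of w] w bw kV[of w] by auto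
    qed
  qed
qed

section \<open>Complexification of additive maps of integral vectors\<close>

lemma complex_extension_expand: "complex_extension h x $ i = (\<Sum>j\<in>UNIV. x $ j * of_int (h (axis j 1) $ i))"
  by (simp add: complex_extension_def)

lemma clin_complex_extension: "clin (complex_extension h)"
  by (simp add: clin_def vec_eq_iff complex_extension_expand algebra_simps sum.distrib sum_distrib_left)

definition cvec :: "int^'n \<Rightarrow> complex^'n" where "cvec x = (\<chi> i. of_int (x $ i))"

lemma additive_expand:
  fixes h :: "int^'n \<Rightarrow> int^'m"
  assumes "\<And>x y. h (x + y) = h x + h y"
  shows "h x $ i = (\<Sum>j\<in>UNIV. x $ j * h (axis j 1) $ i)"
proof -
  have ad: "Modules.additive h" by (rule Modules.additive.intro) (rule assms)
  have nat: "h (int n *s x) = int n *s h x" for n x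
  proof (induction n)
    case 0
    have "int 0 *s x = 0" "int 0 *s h x = 0" by (simp_all add: vec_eq_iff)
    then show ?case by (simp only: Modules.additive.zero[OF ad])
  next
    case (Suc n)
    have "int (Suc n) *s x = x + int n *s x" "int (Suc n) *s h x = h x + int n *s h x" by (simp_all add: vec_eq_iff algebra_simps)
    then show ?case by (simp only: assms Suc)
  qed
  have mul: "h (k *s x) = k *s h x" for k x
  proof (cases k rule: int_cases2)
    case (nonpos n)
    have "h (- (int n *s x)) = - (int n *s h x)" by (simp only: Modules.additive.minus[OF ad] nat)
    moreover have "k *s x = - (int n *s x)" "k *s h x = - (int n *s h x)" using nonpos by (simp_all add: vec_eq_iff)
    ultimately show ?thesis by (simp only:)
  qed (simp add: nat)
  have "x = (\<Sum>j\<in>UNIV. x $ j *s axis j 1)"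
    by (simp add: vec_eq_iff axis_def if_distrib sum.delta cong: if_cong)
  then have "h x = (\<Sum>j\<in>UNIV. h (x $ j *s axis j 1))" by (metis Modules.additive.sum[OF ad])
  then show ?thesis by (simp add: mul)
qed

lemma complex_extension_cvec:
  assumes "\<And>x y. h (x + y) = h x + h y"
  shows "complex_extension h (cvec x) = cvec (h x)"
proof (rule vec_eq_iff[THEN iffD2], rule allI)
  fix i
  have "complex_of_int (h x $ i) = (\<Sum>j\<in>UNIV. of_int (x $ j) * of_int (h (axis j 1) $ i))"
    by (subst additive_expand[OF assms]) simp
  then show "complex_extension h (cvec x) $ i = cvec (h x) $ i"
    by (simp add: complex_extension_expand cvec_def)
qed

lemma clin_eqI:
  assumes "clin F" "clin G" "\<And>j. F (axis j 1) = G (axis j 1)" shows "F x = G x"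
proof (rule vec_eq_iff[THEN iffD2], rule allI)
  fix i
  have "F x $ i = (\<Sum>j\<in>UNIV. x $ j * (F (axis j 1) $ i))" by (rule clin_expand[OF assms(1)])
  also have "\<dots> = (\<Sum>j\<in>UNIV. x $ j * (G (axis j 1) $ i))" by (simp only: assms(3))
  also have "\<dots> = G x $ i" by (rule clin_expand[OF assms(2), symmetric])
  finally show "F x $ i = G x $ i" .
qed

lemma cvec_axis: "cvec (axis j 1) = axis j 1"
  by (simp add: cvec_def vec_eq_iff axis_def)

lemma complex_extension_eqI:
  assumes "\<And>x y. h (x + y) = h x + h y" "clin F" "\<And>x. F (cvec x) = cvec (h x)"
  shows "complex_extension h w = F w"
  by (rule clin_eqI[OF clin_complex_extension assms(2)])
    (metis complex_extension_cvec[OF assms(1)] assms(3) cvec_axis)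

lemma clin_comp: "clin F \<Longrightarrow> clin G \<Longrightarrow> clin (\<lambda>x. F (G x))"
  by (simp add: clin_def)

lemma complex_extension_comp:
  assumes "\<And>x y. h (x + y) = h x + h y" "\<And>x y. k (x + y) = k x + k y"
  shows "complex_extension (\<lambda>x. h (k x)) w = complex_extension h (complex_extension k w)"
  by (rule complex_extension_eqI) (simp_all add: assms complex_extension_cvec clin_comp clin_complex_extension)

lemma complex_extension_cnj:
  "complex_extension h (\<chi> i. cnj (w $ i)) = (\<chi> i. cnj (complex_extension h w $ i))"
  by (simp add: vec_eq_iff complex_extension_expand cnj_sum)

lemma gram_form_clin:
  fixes F :: "complex^'n \<Rightarrow> complex^'n"
  assumes F: "clin F" and e: "\<And>i j. gram_form M (F (axis i 1)) (F (axis j 1)) = of_int (M $ i $ j)"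
  shows "gram_form M (F x) (F y) = gram_form M x y"
proof -
  note gb = gram_form_bilinear[where 'a = complex and M = M]
  have s1: "gram_form M (sum f A) z = (\<Sum>a\<in>A. gram_form M (f a) z)" for f :: "'n \<Rightarrow> complex^'n" and A z
    by (induction A rule: infinite_finite_induct) (simp_all add: gb)
  have s2: "gram_form M z (sum f A) = (\<Sum>a\<in>A. gram_form M z (f a))" for f :: "'n \<Rightarrow> complex^'n" and A z
    by (induction A rule: infinite_finite_induct) (simp_all add: gb)
  have ex: "F x = (\<Sum>j\<in>UNIV. x $ j *s F (axis j 1))" for x
    using clin_sum[OF F, of "\<lambda>j. x $ j *s axis j 1" UNIV] by (simp add: basis_expansion_smult clin_smult[OF F])
  show ?thesis
    unfolding ex[of x] ex[of y] s1 s2 gb e by (simp add: gram_form_def sum_distrib_left algebra_simps) (rule sum.swap)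
qed

lemma sum_axis [simp]:
  fixes a :: "'n::finite \<Rightarrow> 'a::comm_ring_1"
  shows "(\<Sum>l\<in>UNIV. a l * axis j 1 $ l) = a j" "(\<Sum>l\<in>UNIV. axis j 1 $ l * a l) = a j"
proof -
  have "a l * axis j 1 $ l = (if l = j then a l else 0)" "axis j 1 $ l * a l = (if l = j then a l else 0)" for l
    by (simp_all add: axis_def)
  then show "(\<Sum>l\<in>UNIV. a l * axis j 1 $ l) = a j" "(\<Sum>l\<in>UNIV. axis j 1 $ l * a l) = a j"
    by (simp_all add: sum.delta)
qed

lemma gram_form_axis: "gram_form M (axis i 1) (axis j 1) = of_int (M $ i $ j)"
proof -
  have "gram_form M (axis i 1) (axis j 1) = (\<Sum>k\<in>UNIV. axis i 1 $ k * (\<Sum>l\<in>UNIV. of_int (M $ k $ l) * axis j 1 $ l))"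
    unfolding gram_form_def by (simp only: sum_distrib_left mult.assoc)
  then show ?thesis by (simp only: sum_axis)
qed

lemma gram_form_cvec: "gram_form M (cvec x) (cvec y) = of_int (gram_form M x y)"
  by (simp add: gram_form_def cvec_def)

lemma complex_extension_isometry:
  assumes "\<And>x y. h (x + y) = h x + h y" "\<And>x y. gram_form M (h x) (h y) = gram_form M x y"
  shows "gram_form M (complex_extension h w) (complex_extension h z) = gram_form M w z"
proof (rule gram_form_clin[OF clin_complex_extension])
  fix i j
  have "gram_form M (complex_extension h (cvec (axis i 1))) (complex_extension h (cvec (axis j 1))) = (of_int (M $ i $ j) :: complex)"
    unfolding complex_extension_cvec[OF assms(1)] gram_form_cvec assms(2) gram_form_axis by simp
  then show "gram_form M (complex_extension h (axis i 1)) (complex_extension h (axis j 1)) = (of_int (M $ i $ j) :: complex)"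
    by (simp only: cvec_axis)
qed

section \<open>Dimension of period domains\<close>

lemma complex_line_eqD:
  assumes "complex_line w = complex_line w'" obtains c where "w = c *s w'"
proof -
  have "1 *s w \<in> complex_line w" unfolding complex_line_def by blast
  then show thesis using that assms by (auto simp: complex_line_def)
qed

text \<open>The positivity condition is open, so only the eigenspace and the quadric matter. For
  eigenvalue -1 the eigenspace is stable under conjugation; it contains the conjugate of
  \<open>w\<close>, and positivity says that the two are not orthogonal, as
  \<open>quadric_chart\<close> demands. The vector \<open>w1\<close> shows that the domain is not
  empty.\<close>

lemma projective_dimensionI:
  fixes h :: "int^'n \<Rightarrow> int^'n" and \<zeta> :: complex
  assumes sym: "\<And>i j. M $ i $ j = M $ j $ i"
    and h: "\<And>x y. h (x + y) = h x + h y" "\<And>x y. gram_form M (h x) (h y) = gram_form M x y"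
    and w1: "complex_extension h w1 = \<zeta> *s w1" "gram_form M w1 w1 = 0" "Re (gram_form M w1 (\<chi> i. cnj (w1$i))) > 0"
    and d: "\<zeta>^2 \<noteq> 1 \<and> vec.dim {w. complex_extension h w = \<zeta> *s w} = Suc d \<or>
      \<zeta> = - 1 \<and> vec.dim {w. complex_extension h w = \<zeta> *s w} = Suc (Suc d)"
  shows "projective_dimension (period_domain M h \<zeta>) d"
proof -
  let ?C = "complex_extension h"
  let ?V = "{w. ?C w = \<zeta> *s w}"
  let ?n = "\<lambda>w::complex^'n. Re (gram_form M w (\<chi> i. cnj (w$i)))"
  note gb = gram_form_bilinear[where 'a = complex and M = M]
  have V: "vec.subspace ?V"
    unfolding vec.subspace_def using clin_complex_extension[of h]
    by (auto simp: clin_0 clin_add clin_smult vec.scale_right_distrib mult.commute)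
  have n: "?n (c *s w) = (cmod c)\<^sup>2 * ?n w" for c w
  proof -
    have "(\<chi> i. cnj ((c *s w)$i)) = cnj c *s (\<chi> i. cnj (w$i))" by (simp add: vec_eq_iff)
    then have "gram_form M (c *s w) (\<chi> i. cnj ((c *s w)$i)) = of_real ((cmod c)\<^sup>2) * gram_form M w (\<chi> i. cnj (w$i))"
      by (simp only: gb complex_norm_square mult_ac)
    then show ?thesis by simp
  qed
  have line: "complex_line w \<in> period_domain M h \<zeta> \<longleftrightarrow> w \<in> ?V \<and> gram_form M w w = 0 \<and> ?n w > 0" for w
  proof
    assume "complex_line w \<in> period_domain M h \<zeta>"
    then obtain w' where w': "complex_line w = complex_line w'" "?C w' = \<zeta> *s w'" "gram_form M w' w' = 0" "?n w' > 0"
      unfolding period_domain_def by blast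
    obtain c where c: "w = c *s w'" using complex_line_eqD[OF w'(1)] by blast
    obtain c' where c': "w' = c' *s w" using complex_line_eqD[OF w'(1)[symmetric]] by blast
    have "c \<noteq> 0"
    proof
      assume "c = 0"
      then have "w' = 0" using c c' by simp
      then show False using w'(4) by (simp add: gb)
    qed
    then have "?n w > 0" unfolding c n using w'(4) by simp
    moreover have "w \<in> ?V" unfolding c using w'(2) V vec.subspace_scale[of ?V w' c] by simp
    moreover have "gram_form M w w = 0" unfolding c gb w'(3) by simp
    ultimately show "w \<in> ?V \<and> gram_form M w w = 0 \<and> ?n w > 0" by blast
  next
    assume "w \<in> ?V \<and> gram_form M w w = 0 \<and> ?n w > 0"
    then show "complex_line w \<in> period_domain M h \<zeta>" unfolding period_domain_def by blast
  qed
  have openU: "open {w. ?n w > 0}"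
    unfolding gram_form_def by (intro open_Collect_less continuous_intros)
  have isot: "gram_form M w w = 0" if "w \<in> ?V" "\<zeta>^2 \<noteq> 1" for w
  proof -
    have "gram_form M w w = gram_form M (\<zeta> *s w) (\<zeta> *s w)"
      using complex_extension_isometry[OF h, of w w] that(1) by simp
    also have "\<dots> = \<zeta>^2 * gram_form M w w" by (simp add: gb power2_eq_square)
    finally show ?thesis using that(2) by simp
  qed
  show ?thesis
    unfolding projective_dimension_def
  proof (intro conjI allI)
    show "period_domain M h \<zeta> \<noteq> {}" using line[of w1] w1 by auto
    fix i
    show "complex_submanifold d {w. w $ i = 1 \<and> complex_line w \<in> period_domain M h \<zeta>}"
      unfolding complex_submanifold_def
    proof (intro ballI)
      fix w assume "w \<in> {w. w $ i = 1 \<and> complex_line w \<in> period_domain M h \<zeta>}"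
      then have w: "w $ i = 1" "w \<in> ?V" "gram_form M w w = 0" "?n w > 0" using line[of w] by auto
      show "chart_at d {w. w $ i = 1 \<and> complex_line w \<in> period_domain M h \<zeta>} w" using d
      proof (elim disjE conjE)
        assume z: "\<zeta>^2 \<noteq> 1" and dim: "vec.dim ?V = Suc d"
        show ?thesis by (rule linear_chart[OF V dim openU w(2) w(1)]) (use w(4) line isot[OF _ z] in auto)
      next
        assume z: "\<zeta> = - 1" and dim: "vec.dim ?V = Suc (Suc d)"
        let ?v = "\<chi> i. cnj (w $ i)"
        have v: "?v \<in> ?V" using w(2) z by (simp add: complex_extension_cnj vec_eq_iff)
        have "gram_form M ?v ?v = cnj (gram_form M w w)" by (simp add: gram_form_def)
        then have qv: "gram_form M ?v ?v = 0" using w(3) by simp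
        have nv: "gram_form M w ?v \<noteq> 0" using w(4) by auto
        show ?thesis by (rule quadric_chart[OF sym V dim openU w(2) w(1) _ v _ w(3) qv nv]) (use w line in auto)
      qed
    qed
  qed
qed

text \<open>Two markings differ by an invertible integral map \<open>\<theta>\<close>, whose
  complexification carries one eigenspace onto the other.\<close>

lemma dim_eigenspace_conj:
  fixes \<theta> \<kappa> h h' :: "int^'n \<Rightarrow> int^'n"
  assumes add: "\<And>x y. \<theta> (x + y) = \<theta> x + \<theta> y" "\<And>x y. \<kappa> (x + y) = \<kappa> x + \<kappa> y" "\<And>x y. h (x + y) = h x + h y"
    and inv: "\<And>x. \<kappa> (\<theta> x) = x" "\<And>x. \<theta> (\<kappa> x) = x" and h': "\<And>x. h' x = \<theta> (h (\<kappa> x))"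
  shows "vec.dim {w. complex_extension h' w = \<zeta> *s w} = vec.dim {w. complex_extension h w = \<zeta> *s w}"
    "complex_extension h' (complex_extension \<theta> w) = complex_extension \<theta> (complex_extension h w)"
proof -
  have id: "complex_extension (\<lambda>x. x) w = w" for w :: "complex^'n"
    by (rule complex_extension_eqI) (simp_all add: clin_def)
  have i1: "complex_extension \<kappa> (complex_extension \<theta> w) = w" for w
    using complex_extension_comp[OF add(2,1), of w] by (simp add: inv id)
  have i2: "complex_extension \<theta> (complex_extension \<kappa> w) = w" for w
    using complex_extension_comp[OF add(1,2), of w] by (simp add: inv id)
  have addh: "\<And>x y. h (\<kappa> (x + y)) = h (\<kappa> x) + h (\<kappa> y)" by (simp add: add)
  have e: "h' = (\<lambda>x. \<theta> (h (\<kappa> x)))" using h' by blast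
  have h'e: "complex_extension h' w = complex_extension \<theta> (complex_extension h (complex_extension \<kappa> w))" for w
    unfolding e by (simp only: complex_extension_comp[OF add(1) addh] complex_extension_comp[OF add(3,2)])
  show "complex_extension h' (complex_extension \<theta> w) = complex_extension \<theta> (complex_extension h w)" by (simp add: h'e i1)
  let ?t = "complex_extension \<theta>"
  have "{w. complex_extension h' w = \<zeta> *s w} = ?t ` {w. complex_extension h w = \<zeta> *s w}"
  proof (intro equalityI subsetI)
    fix w assume w: "w \<in> {w. complex_extension h' w = \<zeta> *s w}"
    then have "complex_extension \<kappa> (complex_extension h' w) = \<zeta> *s complex_extension \<kappa> w"
      by (simp add: clin_smult[OF clin_complex_extension])
    then have "complex_extension \<kappa> w \<in> {w. complex_extension h w = \<zeta> *s w}" by (simp add: h'e i1)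
    then show "w \<in> ?t ` {w. complex_extension h w = \<zeta> *s w}" using i2[of w] by (metis image_eqI)
  next
    fix w assume "w \<in> ?t ` {w. complex_extension h w = \<zeta> *s w}"
    then show "w \<in> {w. complex_extension h' w = \<zeta> *s w}" by (auto simp: h'e i1 clin_smult[OF clin_complex_extension])
  qed
  moreover have lt: "Vector_Spaces.linear (*s) (*s) ?t"
    using clin_complex_extension[of \<theta>] by (simp add: Vector_Spaces.linear_iff vec.vector_space_axioms clin_def)
  moreover have "inj ?t" by (rule inj_on_inverseI[of _ "complex_extension \<kappa>"]) (rule i1)
  then have it: "inj_on ?t (vec.span {w. complex_extension h w = \<zeta> *s w})" by (rule inj_on_subset) simp
  ultimately show "vec.dim {w. complex_extension h' w = \<zeta> *s w} = vec.dim {w. complex_extension h w = \<zeta> *s w}"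
    by (simp only: vec.dim_image_eq[OF lt it])
qed

lemma dim_eq_1I:
  fixes V :: "(complex^'n) set"
  assumes V: "vec.subspace V" and w: "w \<in> V" "w \<noteq> 0" and inj: "\<And>x. x \<in> V \<Longrightarrow> x $ i = 0 \<Longrightarrow> x = 0"
  shows "vec.dim V = 1"
proof -
  have wi: "w $ i \<noteq> 0" using w inj by blast
  have "V = vec.span {w}"
  proof (intro equalityI subsetI)
    fix x assume x: "x \<in> V"
    have "x - (x $ i / w $ i) *s w = 0" using wi by (intro inj vec.subspace_diff[OF V] vec.subspace_scale[OF V] x w) simp
    then have e: "x = (x $ i / w $ i) *s w" by simp
    show "x \<in> vec.span {w}" by (subst e) (intro vec.span_scale vec.span_base, simp)
  qed (use V w vec.span_minimal[of "{w}" V] in blast)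
  moreover have "vec.independent {w}" using w by (simp add: vec.dependent_single)
  ultimately show ?thesis using vec.dim_eq_card[of "{w}" V] by (simp add: vec.span_span)
qed

lemma dim_param:
  fixes F :: "complex^'k \<Rightarrow> complex^'n"
  assumes "clin F" "\<And>x. F x = 0 \<Longrightarrow> x = 0" "range F = V"
  shows "vec.dim V = CARD('k)"
proof -
  have l: "Vector_Spaces.linear (*s) (*s) F" using assms(1) by (simp add: Vector_Spaces.linear_iff vec.vector_space_axioms clin_def)
  have "inj F" using assms(2) clin_diff[OF assms(1)] by (metis injI right_minus_eq)
  then have "inj_on F (vec.span UNIV)" by (rule inj_on_subset) simp
  then have "vec.dim (range F) = vec.dim (UNIV :: (complex^'k) set)"
    by (rule vec.dim_image_eq[OF l])
  then show ?thesis using assms(3) by (simp only: vec_dim_card)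
qed

section \<open>Rank and discriminant group of a lattice given by a Gram matrix\<close>

lemma isometriesI:
  assumes "c \<in> hom L (gram_lattice N)" "\<And>x y. x \<in> carrier L \<Longrightarrow> y \<in> carrier L \<Longrightarrow> c x = c y \<Longrightarrow> x = y"
    "\<And>v. \<exists>x\<in>carrier L. c x = v"
    "\<And>x y. x \<in> carrier L \<Longrightarrow> y \<in> carrier L \<Longrightarrow> bform L x y = gram_form N (c x) (c y)"
  shows "c \<in> isometries L (gram_lattice N)"
proof -
  have "c ` carrier L = UNIV" using assms(3) by (metis UNIV_eq_I imageI)
  then have "bij_betw c (carrier L) UNIV" using assms(2) by (simp add: bij_betw_def inj_on_def)
  then show ?thesis using assms(1,4) by (simp add: isometries_def iso_def gram_lattice_def)
qed

lemma has_rank_gram: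
  fixes M :: "int^'n^'n"
  assumes h: "h \<in> isometries L (gram_lattice M)"
  shows "has_rank L (CARD('n))"
proof -
  obtain f where f: "bij_betw f (UNIV :: 'n set) {..<CARD('n)}"
    using ex_bij_betw_finite_nat[of "UNIV :: 'n set"] by (auto simp: lessThan_atLeast0)
  let ?F = "\<lambda>x :: int^'n. \<Sum>i\<in>UNIV. frag_cmul (x $ i) (frag_of (f i))"
  have inj: "f i = f j \<longleftrightarrow> i = j" for i j using f by (auto simp: bij_betw_def inj_eq)
  have lk: "Poly_Mapping.lookup (?F x) (f j) = x $ j" for x j
    by (simp add: lookup_sum lookup_single when_def inj if_distrib sum.delta cong: if_cong)
  have keys: "Poly_Mapping.keys (?F x) \<subseteq> {..<CARD('n)}" for x
  proof -
    have "Poly_Mapping.keys (?F x) \<subseteq> (\<Union>i\<in>UNIV. Poly_Mapping.keys (frag_cmul (x $ i) (frag_of (f i))))" by (rule keys_sum)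
    also have "\<dots> \<subseteq> range f"
    proof (rule UN_least)
      fix i
      have "Poly_Mapping.keys (frag_cmul (x $ i) (frag_of (f i))) \<subseteq> {f i}" by (rule order_trans[OF keys_cmul]) simp
      then show "Poly_Mapping.keys (frag_cmul (x $ i) (frag_of (f i))) \<subseteq> range f" by blast
    qed
    finally show ?thesis using f by (simp add: bij_betw_def)
  qed
  have "?F \<in> iso (gram_lattice M) (free_Abelian_group {..<CARD('n)})"
  proof (rule isoI)
    show "?F \<in> hom (gram_lattice M) (free_Abelian_group {..<CARD('n)})"
      using keys by (auto simp: hom_def gram_lattice_def frag_cmul_distrib sum.distrib)
    have "inj ?F" 
  proof (rule injI)
    fix x y assume e: "?F x = ?F y"
    show "x = y" unfolding vec_eq_iff
    proof
      fix j show "x $ j = y $ j" using lk[of x j] lk[of y j] unfolding e by (rule trans[OF sym])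
    qed
  qed
    moreover have "c \<in> range ?F" if c: "Poly_Mapping.keys c \<subseteq> {..<CARD('n)}" for c
    proof -
      have "c = ?F (\<chi> i. Poly_Mapping.lookup c (f i))"
      proof (rule poly_mapping_eqI)
        fix k show "Poly_Mapping.lookup c k = Poly_Mapping.lookup (?F (\<chi> i. Poly_Mapping.lookup c (f i))) k"
        proof (cases "k \<in> {..<CARD('n)}")
          case True
          then obtain i where "k = f i" using f by (auto simp: bij_betw_def)
          then show ?thesis using lk[of "\<chi> i. Poly_Mapping.lookup c (f i)" i] by simp
        next
          case False
          have "k \<notin> Poly_Mapping.keys c" "k \<notin> Poly_Mapping.keys (?F (\<chi> i. Poly_Mapping.lookup c (f i)))"
            using c keys[of "\<chi> i. Poly_Mapping.lookup c (f i)"] False by blast+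
          then show ?thesis by (simp only: in_keys_iff not_not)
        qed
      qed
      then show ?thesis by blast
    qed
    ultimately show "bij_betw ?F (carrier (gram_lattice M)) (carrier (free_Abelian_group {..<CARD('n)}))"
      using keys by (auto simp: bij_betw_def gram_lattice_def)
  qed
  moreover have "h \<in> iso L (gram_lattice M)" using h by (simp add: isometries_def)
  ultimately show ?thesis unfolding has_rank_def is_iso_def using iso_set_trans by blast
qed

lemma integer_mod_group_simps:
  "p > 0 \<Longrightarrow> carrier (integer_mod_group p) = {0..<int p}"
  "x \<otimes>\<^bsub>integer_mod_group p\<^esub> y = (x + y) mod int p" "\<one>\<^bsub>integer_mod_group p\<^esub> = 0"
  by (auto simp: integer_mod_group_def integer_group_def)

text \<open>Functionals on the lattice are written as integral vectors \<open>y\<close> in dual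
  coordinates, where the image of the lattice is the row space of \<open>M\<close>. The congruences
  given by \<open>C\<close> describe a surjection onto \<open>a\<close> copies of the integers
  modulo \<open>p\<close> with exactly this kernel, and the first isomorphism theorem
  applies.\<close>

lemma has_length_gram:
  fixes M :: "int^'n^'n" and C :: "nat \<Rightarrow> int^'n"
  assumes p: "p > 0" and L: "group L" and h: "h \<in> isometries L (gram_lattice M)"
    and surj: "\<And>t. \<exists>y::int^'n. \<forall>k<a. (\<Sum>j\<in>UNIV. C k $ j * y $ j) mod int p = t k mod int p"
    and ker: "\<And>y::int^'n. (\<forall>k<a. (\<Sum>j\<in>UNIV. C k $ j * y $ j) mod int p = 0) \<longleftrightarrow> (\<exists>x. \<forall>j. y $ j = (\<Sum>i\<in>UNIV. x $ i * M $ i $ j))"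
  shows "has_length L p a"
proof -
  interpret L: group L by (rule L)
  interpret D: comm_group "dual_group L" by (rule comm_group_dual_group[OF L])
  have hh: "h (x \<otimes>\<^bsub>L\<^esub> y) = h x + h y" if "x \<in> carrier L" "y \<in> carrier L" for x y
    using h that by (auto simp: isometries_def iso_def hom_def gram_lattice_def)
  have bij: "bij_betw h (carrier L) UNIV" using h by (auto simp: isometries_def iso_def gram_lattice_def)
  define k where "k = inv_into (carrier L) h"
  have kh: "k (h x) = x" if "x \<in> carrier L" for x
    using bij_betw_inv_into_left[OF bij that] by (simp add: k_def)
  have hk: "h (k v) = v" for v
    using bij_betw_inv_into_right[OF bij] by (simp add: k_def)
  have kc: "k v \<in> carrier L" for v
    using bij unfolding k_def by (metis UNIV_I bij_betw_def inv_into_into)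
  have kadd: "k (u + v) = k u \<otimes>\<^bsub>L\<^esub> k v" for u v
    using kh[of "k u \<otimes>\<^bsub>L\<^esub> k v"] hh[of "k u" "k v"] by (simp add: kc hk)
  \<comment> \<open>The coordinates of a functional in the basis dual to the standard one,
    transported by \<open>h\<close>.\<close>
  define d where "d f = (\<chi> i. f (k (axis i 1)))" for f :: "'a \<Rightarrow> int"
  have fk: "f (k v) = (\<Sum>j\<in>UNIV. v $ j * d f $ j)" if f: "f \<in> hom L integer_group" for f v
  proof -
    have "(\<lambda>v. (\<chi> i::1. f (k v))) (x + y) = (\<lambda>v. (\<chi> i::1. f (k v))) x + (\<lambda>v. (\<chi> i::1. f (k v))) y" for x y
      using f by (simp add: kadd hom_def kc integer_group_def vec_eq_iff)
    from additive_expand[of "\<lambda>v. (\<chi> i::1. f (k v))", OF this, of v 1] show ?thesis by (simp add: d_def)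
  qed
  have dsurj: "\<exists>f\<in>carrier (dual_group L). d f = y" for y
  proof (intro bexI)
    let ?f = "\<lambda>x\<in>carrier L. \<Sum>j\<in>UNIV. h x $ j * y $ j"
    show "?f \<in> carrier (dual_group L)" by (auto simp: hom_def hh algebra_simps sum.distrib integer_group_def)
    show "d ?f = y" by (simp add: d_def vec_eq_iff kc hk)
  qed
  have dinj: "f = g" if "f \<in> carrier (dual_group L)" "g \<in> carrier (dual_group L)" "d f = d g" for f g
  proof (rule extensionalityI[of _ "carrier L"])
    fix x assume "x \<in> carrier L"
    then show "f x = g x" using fk[of f "h x"] fk[of g "h x"] that by (simp add: kh)
  qed (use that in auto)
  let ?P = "product_group {..<a} (\<lambda>_. integer_mod_group p)"
  define q where "q f = (\<lambda>l\<in>{..<a}. (\<Sum>j\<in>UNIV. C l $ j * d f $ j) mod int p)" for f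
  have q: "q \<in> hom (dual_group L) ?P"
  proof (rule homI)
    fix f g assume f: "f \<in> carrier (dual_group L)" and g: "g \<in> carrier (dual_group L)"
    show "q f \<in> carrier ?P" using p by (auto simp: q_def integer_mod_group_simps)
    have "d (f \<otimes>\<^bsub>dual_group L\<^esub> g) = d f + d g" by (simp add: d_def vec_eq_iff kc)
    then show "q (f \<otimes>\<^bsub>dual_group L\<^esub> g) = q f \<otimes>\<^bsub>?P\<^esub> q g"
      by (auto simp: q_def integer_mod_group_simps fun_eq_iff algebra_simps sum.distrib mod_simps)
  qed
  interpret q: group_hom "dual_group L" ?P q
    by (rule group_hom.intro[OF D.group_axioms product_group]) (simp_all add: group_hom_axioms_def q)
  have qs: "q ` carrier (dual_group L) = carrier ?P"
  proof (intro equalityI subsetI)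
    fix t assume t: "t \<in> carrier ?P"
    obtain y :: "int^'n" where y: "\<forall>l<a. (\<Sum>j\<in>UNIV. C l $ j * y $ j) mod int p = t l mod int p" using surj by blast
    obtain f where f: "f \<in> carrier (dual_group L)" "d f = y" using dsurj by blast
    have "q f = t"
    proof (rule extensionalityI[of _ "{..<a}"])
      fix l assume l: "l \<in> {..<a}"
      have "t l \<in> carrier (integer_mod_group p)" using t l by (simp add: PiE_iff)
      then have "t l \<in> {0..<int p}" by (simp only: integer_mod_group_simps(1)[OF p])
      then show "q f l = t l" using y f(2) l by (simp add: q_def)
    qed (use t in \<open>auto simp: q_def PiE_def\<close>)
    then show "t \<in> q ` carrier (dual_group L)" using f(1) by blast
  qed (use q.hom_closed in blast)
  have B: "(\<lambda>y\<in>carrier L. bform L x y) \<in> carrier (dual_group L)" "d (\<lambda>y\<in>carrier L. bform L x y) = (\<chi> j. \<Sum>i\<in>UNIV. h x $ i * M $ i $ j)"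
    if x: "x \<in> carrier L" for x
  proof -
    have bf: "bform L x y = gram_form M (h x) (h y)" if "y \<in> carrier L" for y
      using h x that by (auto simp: isometries_def gram_lattice_def)
    show "(\<lambda>y\<in>carrier L. bform L x y) \<in> carrier (dual_group L)"
      by (auto simp: hom_def integer_group_def bf hh gram_form_def algebra_simps sum.distrib)
    show "d (\<lambda>y\<in>carrier L. bform L x y) = (\<chi> j. \<Sum>i\<in>UNIV. h x $ i * M $ i $ j)"
      by (simp add: d_def vec_eq_iff kc bf hk gram_form_def sum_distrib_right[symmetric])
  qed
  have kerq: "kernel (dual_group L) ?P q = (\<lambda>x. \<lambda>y\<in>carrier L. bform L x y) ` carrier L"
  proof -
    have K: "f \<in> kernel (dual_group L) ?P q \<longleftrightarrow> (\<exists>x. d f = (\<chi> j. \<Sum>i\<in>UNIV. x $ i * M $ i $ j))"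
      if "f \<in> carrier (dual_group L)" for f
    proof -
      have "q f = \<one>\<^bsub>?P\<^esub> \<longleftrightarrow> (\<forall>l<a. (\<Sum>j\<in>UNIV. C l $ j * d f $ j) mod int p = 0)"
        by (auto simp: q_def fun_eq_iff integer_mod_group_simps)
      then show ?thesis using that ker[of "d f"] by (simp add: kernel_def vec_eq_iff)
    qed
    show ?thesis
    proof (intro equalityI subsetI)
      fix f assume f: "f \<in> kernel (dual_group L) ?P q"
      then have fc: "f \<in> carrier (dual_group L)" by (simp add: kernel_def)
      then obtain x where x: "d f = (\<chi> j. \<Sum>i\<in>UNIV. x $ i * M $ i $ j)" using f K by blast
      have "f = (\<lambda>y\<in>carrier L. bform L (k x) y)" by (rule dinj[OF fc B(1)[OF kc]]) (simp only: x B(2)[OF kc] hk)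
      then show "f \<in> (\<lambda>x. \<lambda>y\<in>carrier L. bform L x y) ` carrier L" using kc by blast
    next
      fix f assume "f \<in> (\<lambda>x. \<lambda>y\<in>carrier L. bform L x y) ` carrier L"
      then obtain x where x: "x \<in> carrier L" "f = (\<lambda>y\<in>carrier L. bform L x y)" by blast
      show "f \<in> kernel (dual_group L) ?P q" unfolding x(2) K[OF B(1)[OF x(1)]] B(2)[OF x(1)] by blast
    qed
  qed
  have "(\<lambda>X. the_elem (q ` X)) \<in> iso (dual_group L Mod kernel (dual_group L) ?P q) ?P"
    by (rule q.FactGroup_iso_set[OF qs])
  then show ?thesis unfolding has_length_def discriminant_group_def is_iso_def kerq by blast
qed

section \<open>Gram matrices of small size, entry by entry\<close>

lemma sum_UNIV_Plus: "(\<Sum>i\<in>(UNIV :: ('a::finite + 'b::finite) set). f i) = (\<Sum>i\<in>UNIV. f (Inl i)) + (\<Sum>i\<in>UNIV. f (Inr i))"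
  by (simp add: UNIV_Plus_UNIV[symmetric] sum.Plus del: UNIV_Plus_UNIV)

lemma block_sum_simps [simp]:
  "(M \<oplus>\<^sub>L N) $ Inl a $ Inl b = M $ a $ b" "(M \<oplus>\<^sub>L N) $ Inr c $ Inr d = N $ c $ d"
  "(M \<oplus>\<^sub>L N) $ Inl a $ Inr d = 0" "(M \<oplus>\<^sub>L N) $ Inr c $ Inl b = 0"
  by (simp_all add: block_sum_def)

lemma gram_simps [simp]:
  "gram_U $ 1 $ 1 = 0" "gram_U $ 1 $ 2 = 1" "gram_U $ 2 $ 1 = 1" "gram_U $ 2 $ 2 = 0"
  "gram_A2 $ 1 $ 1 = 2" "gram_A2 $ 1 $ 2 = 1" "gram_A2 $ 2 $ 1 = 1" "gram_A2 $ 2 $ 2 = 2"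
  "gram_H5 $ 1 $ 1 = 2" "gram_H5 $ 1 $ 2 = 1" "gram_H5 $ 2 $ 1 = 1" "gram_H5 $ 2 $ 2 = -2"
  "gram_single k $ 1 $ 1 = k" "scaled M k $ i $ j = k * M $ i $ j"
  by (simp_all add: gram_U_def gram_A2_def gram_H5_def gram_single_def scaled_def vector_def)

definition vcat :: "'a^'m \<Rightarrow> 'a^'n \<Rightarrow> 'a^('m + 'n)" where
  "vcat x y = (\<chi> i. case i of Inl a \<Rightarrow> x $ a | Inr b \<Rightarrow> y $ b)"

lemma vcat_simps [simp]: "vcat x y $ Inl a = x $ a" "vcat x y $ Inr b = y $ b"
  by (simp_all add: vcat_def)

definition vec2 :: "'a::zero \<Rightarrow> 'a \<Rightarrow> 'a^2" where "vec2 a b = vector [a, b]"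
definition vec1 :: "'a::zero \<Rightarrow> 'a^1" where "vec1 a = vector [a]"

lemma vec2_simps [simp]: "vec2 a b $ 1 = a" "vec2 a b $ 2 = b" "vec1 a $ 1 = a"
  by (simp_all add: vec2_def vec1_def)

lemma ex_vec2: "(\<exists>x :: int^2. P (x $ 1) (x $ 2)) \<longleftrightarrow> (\<exists>a b. P a b)"
  by (metis vec2_simps(1,2))

lemma forall_plus: "(\<forall>i :: 'a + 'b. P i) \<longleftrightarrow> (\<forall>a. P (Inl a)) \<and> (\<forall>b. P (Inr b))"
  by (rule split_sum_all)

lemma ex_vec4: "(\<exists>x :: int^(2+2). P (x $ Inl 1) (x $ Inl 2) (x $ Inr 1) (x $ Inr 2)) \<longleftrightarrow> (\<exists>a b c d. P a b c d)"
  by (metis vec2_simps(1,2) vcat_simps)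

lemma ex_vec211: "(\<exists>x :: int^(2+(1+1)). P (x $ Inl 1) (x $ Inl 2) (x $ Inr (Inl 1)) (x $ Inr (Inr 1))) \<longleftrightarrow> (\<exists>a b c d. P a b c d)"
  by (metis vec2_simps vcat_simps)

lemma ex_vec11: "(\<exists>x :: int^(1+1). P (x $ Inl 1) (x $ Inr 1)) \<longleftrightarrow> (\<exists>a b. P a b)"
  by (metis vec2_simps(3) vcat_simps)

lemma forall_1': "(\<forall>i::1. P i) \<longleftrightarrow> P 1"
  by (metis (full_types) num1_eq1)

lemmas small_vec = sum_UNIV_Plus sum_2 sum_1 forall_plus forall_2 forall_1'

lemma all_less_2: "(\<forall>k<2. P (k::nat)) \<longleftrightarrow> P 0 \<and> P 1"
  by (auto simp: less_2_cases_iff)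

section \<open>Discriminant groups of the lattices in the table\<close>

lemma length_U:
  assumes "p > 0" "group L" "h \<in> isometries L (gram_lattice gram_U)" shows "has_length L p 0"
proof (rule has_length_gram[OF assms, where C = "\<lambda>_. 0"])
  fix y :: "int^2"
  have "\<exists>x. \<forall>j. y $ j = (\<Sum>i\<in>UNIV. x $ i * gram_U $ i $ j)"
    by (rule exI[of _ "vec2 (y $ 2) (y $ 1)"]) (simp add: small_vec)
  then show "(\<forall>k<0. (\<Sum>j\<in>UNIV. 0 $ j * y $ j) mod int p = 0) \<longleftrightarrow> (\<exists>x. \<forall>j. y $ j = (\<Sum>i\<in>UNIV. x $ i * gram_U $ i $ j))"
    by simp
qed simp

lemma length_Uk:
  assumes "p > 0" "group L" "h \<in> isometries L (gram_lattice (scaled gram_U (int p)))" shows "has_length L p 2"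
proof (rule has_length_gram[OF assms, where C = "\<lambda>k. if k = 0 then axis 1 1 else axis 2 1"])
  show "\<exists>y::int^2. \<forall>k<(2::nat). (\<Sum>j\<in>UNIV. (if k = 0 then axis 1 1 else axis 2 1) $ j * y $ j) mod int p = t k mod int p" for t :: "nat \<Rightarrow> int"
    by (rule exI[of _ "vec2 (t 0) (t 1)"]) (simp add: small_vec all_less_2 axis_def)
  fix y :: "int^2"
  show "(\<forall>k<(2::nat). (\<Sum>j\<in>UNIV. (if k = 0 then axis 1 1 else axis 2 1) $ j * y $ j) mod int p = 0) \<longleftrightarrow>
      (\<exists>x. \<forall>j. y $ j = (\<Sum>i\<in>UNIV. x $ i * scaled gram_U (int p) $ i $ j))"
  proof -
    have "(\<exists>x. \<forall>j. y $ j = (\<Sum>i\<in>UNIV. x $ i * scaled gram_U (int p) $ i $ j)) \<longleftrightarrow> (\<exists>a b. y $ 1 = b * int p \<and> y $ 2 = a * int p)"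
      unfolding ex_vec2[symmetric] by (simp add: small_vec)
    then show ?thesis by (simp add: small_vec all_less_2 axis_def mod_eq_0_iff_dvd) (auto simp: dvd_def mult.commute)
  qed
qed

lemma length_2m2:
  assumes "group L" "h \<in> isometries L (gram_lattice (gram_single 2 \<oplus>\<^sub>L gram_single (-2)))" shows "has_length L 2 2"
proof (rule has_length_gram[OF _ assms, where C = "\<lambda>k. if k = 0 then axis (Inl 1) 1 else axis (Inr 1) 1"])
  show "\<exists>y::int^(1+1). \<forall>k<(2::nat). (\<Sum>j\<in>UNIV. (if k = 0 then axis (Inl 1) 1 else axis (Inr 1) 1) $ j * y $ j) mod int 2 = t k mod int 2" for t :: "nat \<Rightarrow> int"
    by (rule exI[of _ "vcat (vec1 (t 0)) (vec1 (t 1))"]) (simp add: small_vec all_less_2 axis_def)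
  fix y :: "int^(1+1)"
  have e: "(\<exists>a b. u = a * 2 \<and> v = - (b * 2)) \<longleftrightarrow> even u \<and> even v" for u v :: int
    by (metis dvd_def dvd_triv_right even_minus minus_minus mult.commute minus_mult_left)
  show "(\<forall>k<(2::nat). (\<Sum>j\<in>UNIV. (if k = 0 then axis (Inl 1) 1 else axis (Inr 1) 1) $ j * y $ j) mod int 2 = 0) \<longleftrightarrow>
      (\<exists>x. \<forall>j. y $ j = (\<Sum>i\<in>UNIV. x $ i * (gram_single 2 \<oplus>\<^sub>L gram_single (-2)) $ i $ j))"
  proof -
    have "(\<exists>x. \<forall>j. y $ j = (\<Sum>i\<in>UNIV. x $ i * (gram_single 2 \<oplus>\<^sub>L gram_single (-2)) $ i $ j)) \<longleftrightarrow>
        (\<exists>a b. y $ Inl 1 = a * 2 \<and> y $ Inr 1 = - (b * 2))"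
      unfolding ex_vec11[symmetric] by (simp add: small_vec)
    then show ?thesis unfolding e by (simp add: small_vec all_less_2 axis_def even_iff_mod_2_eq_zero)
  qed
qed simp

lemma length_Um2m2:
  assumes "group L" "h \<in> isometries L (gram_lattice (gram_U \<oplus>\<^sub>L gram_single (-2) \<oplus>\<^sub>L gram_single (-2)))" shows "has_length L 2 2"
proof (rule has_length_gram[OF _ assms, where C = "\<lambda>k. if k = 0 then axis (Inr (Inl 1)) 1 else axis (Inr (Inr 1)) 1"])
  show "\<exists>y::int^(2+(1+1)). \<forall>k<(2::nat). (\<Sum>j\<in>UNIV. (if k = 0 then axis (Inr (Inl 1)) 1 else axis (Inr (Inr 1)) 1) $ j * y $ j) mod int 2 = t k mod int 2" for t :: "nat \<Rightarrow> int"
    by (rule exI[of _ "vcat (vec2 0 0) (vcat (vec1 (t 0)) (vec1 (t 1)))"]) (simp add: small_vec all_less_2 axis_def)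
  fix y :: "int^(2+(1+1))"
  have e: "(\<exists>a b c d. u = b \<and> v = a \<and> w = - (c * 2) \<and> z = - (d * 2)) \<longleftrightarrow> even w \<and> even z" for u v w z :: int
    by (metis dvd_def dvd_triv_right even_minus minus_minus mult.commute minus_mult_left)
  show "(\<forall>k<(2::nat). (\<Sum>j\<in>UNIV. (if k = 0 then axis (Inr (Inl 1)) 1 else axis (Inr (Inr 1)) 1) $ j * y $ j) mod int 2 = 0) \<longleftrightarrow>
      (\<exists>x. \<forall>j. y $ j = (\<Sum>i\<in>UNIV. x $ i * (gram_U \<oplus>\<^sub>L gram_single (-2) \<oplus>\<^sub>L gram_single (-2)) $ i $ j))"
  proof -
    have "(\<exists>x. \<forall>j. y $ j = (\<Sum>i\<in>UNIV. x $ i * (gram_U \<oplus>\<^sub>L gram_single (-2) \<oplus>\<^sub>L gram_single (-2)) $ i $ j)) \<longleftrightarrow>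
        (\<exists>a b c d. y $ Inl 1 = b \<and> y $ Inl 2 = a \<and> y $ Inr (Inl 1) = - (c * 2) \<and> y $ Inr (Inr 1) = - (d * 2))"
      unfolding ex_vec211[symmetric] by (simp add: small_vec)
    then show ?thesis unfolding e by (simp add: small_vec all_less_2 axis_def even_iff_mod_2_eq_zero)
  qed
qed simp

text \<open>U is unimodular and contributes no condition. Both rows of the negated
  \<open>A_2\<close> matrix have entries adding up to a multiple of 3, whence the functional that
  adds the last two coordinates.\<close>

lemma length_UA2:
  assumes "group L" "h \<in> isometries L (gram_lattice (gram_U \<oplus>\<^sub>L scaled gram_A2 (-1)))" shows "has_length L 3 1"
proof (rule has_length_gram[OF _ assms, where C = "\<lambda>k. axis (Inr 1) 1 + axis (Inr 2) 1"])
  show "\<exists>y::int^(2+2). \<forall>k<(1::nat). (\<Sum>j\<in>UNIV. (axis (Inr 1) 1 + axis (Inr 2) 1) $ j * y $ j) mod int 3 = t k mod int 3" for t :: "nat \<Rightarrow> int"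
    by (rule exI[of _ "vcat (vec2 0 0) (vec2 (t 0) 0)"]) (simp add: small_vec axis_def)
  fix y :: "int^(2+2)"
  have e: "(\<exists>a b c d. u = b \<and> v = a \<and> w = - (c * 2) - d \<and> z = - c - (d * 2)) \<longleftrightarrow> (w + z) mod 3 = 0" for u v w z :: int
  proof
    assume "(w + z) mod 3 = 0"
    then obtain m where m: "w + z = 3 * m" by auto
    \<comment> \<open>Cramer's rule for the negated \<open>A_2\<close> matrix of determinant 3; the
      quotient \<open>m\<close> makes the solution integral.\<close>
    show "\<exists>a b c d. u = b \<and> v = a \<and> w = - (c * 2) - d \<and> z = - c - (d * 2)"
      by (rule exI[of _ v], rule exI[of _ u], rule exI[of _ "m - w"], rule exI[of _ "w - 2 * m"]) (use m in simp)
  qed presburger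
  show "(\<forall>k<(1::nat). (\<Sum>j\<in>UNIV. (axis (Inr 1) 1 + axis (Inr 2) 1) $ j * y $ j) mod int 3 = 0) \<longleftrightarrow>
      (\<exists>x. \<forall>j. y $ j = (\<Sum>i\<in>UNIV. x $ i * (gram_U \<oplus>\<^sub>L scaled gram_A2 (-1)) $ i $ j))"
  proof -
    have "(\<exists>x. \<forall>j. y $ j = (\<Sum>i\<in>UNIV. x $ i * (gram_U \<oplus>\<^sub>L scaled gram_A2 (-1)) $ i $ j)) \<longleftrightarrow>
        (\<exists>a b c d. y $ Inl 1 = b \<and> y $ Inl 2 = a \<and> y $ Inr 1 = - (c * 2) - d \<and> y $ Inr 2 = - c - (d * 2))"
      unfolding ex_vec4[symmetric] by (simp add: small_vec)
    then show ?thesis unfolding e by (simp add: small_vec axis_def)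
  qed
qed simp

text \<open>The rows (2, 1) and (1, -2) both satisfy the congruence 2 u + v = 0 modulo 5, and the
  determinant is -5.\<close>

lemma length_H5:
  assumes "group L" "h \<in> isometries L (gram_lattice gram_H5)" shows "has_length L 5 1"
proof (rule has_length_gram[OF _ assms, where C = "\<lambda>k. 2 *s axis 1 1 + axis 2 1"])
  show "\<exists>y::int^2. \<forall>k<(1::nat). (\<Sum>j\<in>UNIV. (2 *s axis 1 1 + axis 2 1) $ j * y $ j) mod int 5 = t k mod int 5" for t :: "nat \<Rightarrow> int"
    by (rule exI[of _ "vec2 0 (t 0)"]) (simp add: small_vec axis_def)
  fix y :: "int^2"
  have e: "(\<exists>a b. u = a * 2 + b \<and> v = a - b * 2) \<longleftrightarrow> (2 * u + v) mod 5 = 0" for u v :: int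
  proof
    assume "(2 * u + v) mod 5 = 0"
    then obtain m where m: "2 * u + v = 5 * m" by auto
    show "\<exists>a b. u = a * 2 + b \<and> v = a - b * 2"
      by (rule exI[of _ m], rule exI[of _ "u - 2 * m"]) (use m in simp)
  qed presburger
  show "(\<forall>k<(1::nat). (\<Sum>j\<in>UNIV. (2 *s axis 1 1 + axis 2 1) $ j * y $ j) mod int 5 = 0) \<longleftrightarrow>
      (\<exists>x. \<forall>j. y $ j = (\<Sum>i\<in>UNIV. x $ i * gram_H5 $ i $ j))"
  proof -
    have "(\<exists>x. \<forall>j. y $ j = (\<Sum>i\<in>UNIV. x $ i * gram_H5 $ i $ j)) \<longleftrightarrow> (\<exists>a b. y $ 1 = a * 2 + b \<and> y $ 2 = a - b * 2)"
      unfolding ex_vec2[symmetric] by (simp add: small_vec)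
    then show ?thesis unfolding e by (simp add: small_vec axis_def)
  qed
qed simp

section \<open>Adapted lattice bases\<close>

lemma less_4_cases: "i < (4::nat) \<longleftrightarrow> i = 0 \<or> i = 1 \<or> i = 2 \<or> i = 3"
  by auto

lemma sum_unit_4:
  fixes v :: "nat \<Rightarrow> 'a::real_vector"
  assumes "j < 4" shows "v j = (\<Sum>k<4. (if j = k then 1 else 0) *\<^sub>R v k)"
  using assms by (auto simp: less_4_cases lessThan_4)

section \<open>Volume, exchange and descent\<close>

lemma vol_replace:
  assumes i: "i < 4" and x: "x = (\<Sum>k<4. c k *\<^sub>R v k)" shows "vol (v(i := x)) = c i * vol v"
proof -
  have "vol (v(i := x)) = det4 (\<lambda>j k. if j = i then c k else if j = k then 1 else 0) * vol v"
  proof (rule vol_comb)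
    fix j :: nat assume j: "j < 4"
    show "(v(i := x)) j = (\<Sum>k<4. (if j = i then c k else if j = k then 1 else 0) *\<^sub>R v k)"
      using x sum_unit_4[OF j, of v] by (cases "j = i") simp_all
  qed
  moreover have "det4 (\<lambda>j k. if j = i then c k else if j = k then 1 else 0) = c i"
    using i by (auto simp: less_4_cases det4_def)
  ultimately show ?thesis by simp
qed

lemma vol_swap:
  assumes i: "i < 4" "j < 4" "i \<noteq> j" shows "vol (v(i := v j, j := v i)) = - vol v"
proof -
  have "vol (v(i := v j, j := v i)) = det4 (\<lambda>k l. if (if k = i then j else if k = j then i else k) = l then 1 else 0) * vol v"
  proof (rule vol_comb)
    fix k :: nat assume k: "k < 4"
    have e: "(v(i := v j, j := v i)) k = v (if k = i then j else if k = j then i else k)" using i by simp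
    have lt: "(if k = i then j else if k = j then i else k) < 4" using i k by simp
    show "(v(i := v j, j := v i)) k = (\<Sum>l<4. (if (if k = i then j else if k = j then i else k) = l then 1 else 0) *\<^sub>R v l)"
      unfolding e by (rule sum_unit_4[OF lt])
  qed
  moreover have "det4 (\<lambda>k l. if (if k = i then j else if k = j then i else k) = l then 1 else (0::real)) = - 1"
    using i unfolding less_4_cases by (elim disjE) (simp_all add: det4_def)
  ultimately show ?thesis by simp
qed

lemma lattice_basis_of_vol:
  assumes "vol v \<noteq> 0" shows "lattice_basis v {\<Sum>i<4. of_int (k i) *\<^sub>R v i | k. True}"
proof -
  have zero: "c i = 0" if "(\<Sum>k<4. c k *\<^sub>R v k) = 0" "i < 4" for c i
    using vol_replace[of i 0 c v] vol_replace[of i 0 "\<lambda>_. 0" v] that assms by simp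
  have inj: "inj_on v {..<4}"
  proof (rule inj_onI)
    fix i j :: nat assume ij: "i \<in> {..<4}" "j \<in> {..<4}" "v i = v j"
    show "i = j"
    proof (rule ccontr)
      assume "i \<noteq> j"
      have "(\<Sum>k<4. ((if i = k then 1 else 0) - (if j = k then 1 else 0)) *\<^sub>R v k) = v i - v j"
        using ij sum_unit_4[of i v] sum_unit_4[of j v] by (simp add: scaleR_left_diff_distrib sum_subtractf)
      then show False using zero[of "\<lambda>k. (if i = k then 1 else 0) - (if j = k then 1 else 0)" i] ij \<open>i \<noteq> j\<close> by simp
    qed
  qed
  have "independent (v ` {..<4})"
  proof
    assume "dependent (v ` {..<4})"
    then obtain u where u: "\<exists>x\<in>v ` {..<4}. u x \<noteq> 0" "(\<Sum>x\<in>v ` {..<4}. u x *\<^sub>R x) = 0"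
      using dependent_finite[of "v ` {..<4}"] by auto
    have "(\<Sum>k<4. u (v k) *\<^sub>R v k) = 0" using u(2) by (simp add: sum.reindex[OF inj])
    then show False using zero[of "\<lambda>k. u (v k)"] u(1) by auto
  qed
  then show ?thesis using inj by (simp add: lattice_basis_def)
qed

lemma vol_coords:
  assumes "vol v \<noteq> 0" obtains y where "z = (\<Sum>k<4. y k *\<^sub>R v k)"
proof -
  interpret V: torus "{\<Sum>i<4. of_int (k i) *\<^sub>R v i | k. True}" v
    by unfold_locales (rule lattice_basis_of_vol[OF assms])
  show thesis by (rule that[of "V.crd z"]) (rule V.sum_crd[symmetric])
qed

text \<open>Steinitz exchange with prescribed positions: \<open>f\<close> replaces
  \<open>v j\<close> and is then moved to place \<open>i\<close>, the vector displaced from there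
  going to place \<open>j\<close>.\<close>

lemma vol_insert:
  assumes v: "vol v \<noteq> 0" and f: "f = (\<Sum>k<4. y k *\<^sub>R v k)" and j: "j < 4" "y j \<noteq> 0" and i: "i < 4"
  shows "\<exists>v'. vol v' \<noteq> 0 \<and> v' i = f \<and> (\<forall>k<4. k \<noteq> i \<longrightarrow> k \<noteq> j \<longrightarrow> v' k = v k) \<and> (\<forall>k<4. v' k \<in> insert f (v ` {..<4}))"
proof (cases "i = j")
  case True
  show ?thesis by (rule exI[of _ "v(i := f)"]) (use vol_replace[OF i f] True v j in auto)
next
  case False
  let ?u = "v(j := f)"
  have "vol (?u(i := ?u j, j := ?u i)) \<noteq> 0"
    unfolding vol_swap[OF i j(1) False] using vol_replace[OF j(1) f] v j by simp
  then show ?thesis by (intro exI[of _ "?u(i := ?u j, j := ?u i)"] conjI) (use False i j in auto)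
qed

lemma abs_mult_less:
  fixes x y n :: real
  assumes "x = n * y" "y \<noteq> 0" "0 \<le> n" "n < 1" "n \<noteq> 0" shows "x \<noteq> 0 \<and> \<bar>x\<bar> < \<bar>y\<bar>"
  using assms by (simp add: abs_mult)

context torus begin

lemma vol_lattice:
  assumes "\<And>i. i < 4 \<Longrightarrow> v i \<in> \<Lambda>" obtains n :: int where "vol v = of_int n * vol b"
proof -
  have "vol v = det4 (\<lambda>i k. real_of_int \<lfloor>crd (v i) k\<rfloor>) * vol b"
    by (rule vol_comb) (rule lattice_comb, rule assms)
  moreover have "det4 (\<lambda>i k. real_of_int \<lfloor>crd (v i) k\<rfloor>) = of_int (det4 (\<lambda>i k. \<lfloor>crd (v i) k\<rfloor>))"
    by (simp add: det4_def)
  ultimately have e: "vol v = of_int (det4 (\<lambda>i k. \<lfloor>crd (v i) k\<rfloor>)) * vol b" by (simp only:)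
  show thesis by (rule that[OF e])
qed

lemma lattice_int_comb:
  fixes v :: "nat \<Rightarrow> complex^2" shows "(\<And>i. i < 4 \<Longrightarrow> v i \<in> \<Lambda>) \<Longrightarrow> (\<Sum>i<4. of_int (k i) *\<^sub>R v i) \<in> \<Lambda>"
  by (intro lattice_sum lattice_zmul) simp

text \<open>Volumes of lattice tuples are integral multiples of \<open>vol b\<close>, so a least one
  exists. The predicate \<open>P\<close> is the shape of the tuple; \<open>reduce\<close> is the
  step of Euclidean division and the only part that depends on the automorphism.\<close>

lemma adapted_basis:
  assumes ex: "\<exists>v. P v \<and> vol v \<noteq> 0" and in_lattice: "\<And>v i. P v \<Longrightarrow> i < 4 \<Longrightarrow> v i \<in> \<Lambda>"
    and reduce: "\<And>v y. P v \<Longrightarrow> vol v \<noteq> 0 \<Longrightarrow> (\<Sum>k<4. y k *\<^sub>R v k) \<in> \<Lambda> \<Longrightarrow>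
      (\<forall>i<4. y i \<in> \<int>) \<or> (\<exists>v'. P v' \<and> vol v' \<noteq> 0 \<and> \<bar>vol v'\<bar> < \<bar>vol v\<bar>)"
  shows "\<exists>v. P v \<and> lattice_basis v \<Lambda>"
proof -
  define m where "m v = nat \<lfloor>\<bar>vol v\<bar> / \<bar>vol b\<bar>\<rfloor>" for v
  have mv: "\<bar>vol v\<bar> = real (m v) * \<bar>vol b\<bar>" if "P v" for v
  proof -
    obtain n :: int where n: "vol v = of_int n * vol b" using vol_lattice[of v] in_lattice[OF \<open>P v\<close>] by blast
    then have "\<bar>vol v\<bar> / \<bar>vol b\<bar> = of_int \<bar>n\<bar>" using vol_nonzero by (simp add: abs_mult)
    then show ?thesis by (simp add: m_def n abs_mult)
  qed
  obtain v where v: "P v \<and> vol v \<noteq> 0" "\<And>v'. P v' \<and> vol v' \<noteq> 0 \<Longrightarrow> m v \<le> m v'"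
    using ex_has_least_nat[of "\<lambda>v. P v \<and> vol v \<noteq> 0" _ m] ex by blast
  have least: "\<not> \<bar>vol v'\<bar> < \<bar>vol v\<bar>" if "P v'" "vol v' \<noteq> 0" for v'
  proof -
    have "m v \<le> m v'" using v(2) that by blast
    then show ?thesis using mv[of v] mv[of v'] v(1) that(1) by (simp add: mult_right_mono not_less)
  qed
  have "{\<Sum>i<4. of_int (k i) *\<^sub>R v i | k. True} = \<Lambda>"
  proof (intro equalityI subsetI)
    fix z assume "z \<in> {\<Sum>i<4. of_int (k i) *\<^sub>R v i | k. True}"
    then obtain k where "z = (\<Sum>i<4. of_int (k i) *\<^sub>R v i)" by blast
    then show "z \<in> \<Lambda>" using lattice_int_comb[of v k] in_lattice v(1) by simp
  next
    fix z assume z: "z \<in> \<Lambda>"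
    obtain y where y: "z = (\<Sum>k<4. y k *\<^sub>R v k)" using vol_coords[of v z] v(1) by metis
    then have "\<forall>i<4. y i \<in> \<int>" using reduce[of v y] v(1) z least by metis
    then have "z = (\<Sum>k<4. of_int \<lfloor>y k\<rfloor> *\<^sub>R v k)" unfolding y by (intro sum.cong) simp_all
    then show "z \<in> {\<Sum>i<4. of_int (k i) *\<^sub>R v i | k. True}"
      by (intro CollectI exI[of _ "\<lambda>k. \<lfloor>y k\<rfloor>"] conjI TrueI)
  qed
  then show ?thesis using lattice_basis_of_vol[of v] v(1) by auto
qed

text \<open>By Cramer's rule, putting the fractional part of a lattice vector in place
  \<open>i\<close> multiplies the volume by the fractional part of coordinate
  \<open>i\<close>.\<close>

lemma reduce_coordinate:
  assumes v: "\<And>i. i < 4 \<Longrightarrow> v i \<in> \<Lambda>" "vol v \<noteq> 0" and w: "(\<Sum>k<4. y k *\<^sub>R v k) \<in> \<Lambda>" and i: "i < 4" "y i \<notin> \<int>"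
  obtains x where "x = (\<Sum>k<4. (y k - of_int \<lfloor>y k\<rfloor>) *\<^sub>R v k)" "x \<in> \<Lambda>" "vol (v(i := x)) \<noteq> 0" "\<bar>vol (v(i := x))\<bar> < \<bar>vol v\<bar>"
proof -
  let ?x = "\<Sum>k<4. (y k - of_int \<lfloor>y k\<rfloor>) *\<^sub>R v k"
  have "?x = (\<Sum>k<4. y k *\<^sub>R v k) - (\<Sum>k<4. of_int \<lfloor>y k\<rfloor> *\<^sub>R v k)"
    by (simp add: scaleR_left_diff_distrib sum_subtractf)
  then have xL: "?x \<in> \<Lambda>" using lattice_diff[OF w lattice_int_comb] v(1) by simp
  have vx: "vol (v(i := ?x)) = (y i - of_int \<lfloor>y i\<rfloor>) * vol v" by (rule vol_replace[OF i(1) refl])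
  have f: "0 < y i - of_int \<lfloor>y i\<rfloor>" "y i - of_int \<lfloor>y i\<rfloor> < 1"
    using i(2) by (metis Ints_of_int eq_iff_diff_eq_0 frac_def frac_ge_0 less_eq_real_def) linarith
  show thesis by (rule that[OF refl xL]) (use f v(2) in \<open>simp_all add: vx abs_mult\<close>)
qed

section \<open>Automorphisms with fixed vectors\<close>

lemma fixed_line:
  assumes g: "clinear2 g" "cdet g \<noteq> 1" and u: "g u = u" "g v = v" shows "dC u v = 0"
  using dC_clinear2[OF g(1), of u v] u g(2) by simp

text \<open>Since \<open>cdet g \<noteq> 1\<close>, any two fixed vectors are complex dependent, so
  three fixed vectors are real dependent. Thus \<open>v 0\<close> and \<open>v 1\<close> already
  span the fixed vectors.\<close>

lemma fixed_coords:
  assumes g: "clinear2 g" "cdet g \<noteq> 1" and v: "vol v \<noteq> 0" "g (v 0) = v 0" "g (v 1) = v 1"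
    and f: "g f = f" "f = (\<Sum>k<4. y k *\<^sub>R v k)"
  shows "y 2 = 0" "y 3 = 0"
proof -
  note fl = fixed_line[OF g]
  have vf: "vol (v(i := f)) = 0" if i: "i = 2 \<or> i = 3" for i :: nat
  proof -
    let ?v = "v(i := f)"
    have "dC (?v 0) (?v 1) = 0" "dC (?v 0) (?v i) = 0" "dC (?v 1) (?v i) = 0" using i fl v f by auto
    then have "complex_of_real (4 * vol ?v) = 0" unfolding pf_dC[symmetric] using i by (auto simp: pf_def)
    then have "4 * vol ?v = 0" by (simp only: of_real_eq_0_iff)
    then show ?thesis by simp
  qed
  show "y 2 = 0" using vol_replace[OF _ f(2), of 2] vf[of 2] v(1) by simp
  show "y 3 = 0" using vol_replace[OF _ f(2), of 3] vf[of 3] v(1) by simp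
qed

text \<open>The map \<open>k\<close> is an averaging operator such as \<open>1 + g\<close> and turns
  lattice vectors into fixed ones. Its image is a nonzero complex subspace, so two images of basis
  vectors are real independent; they are exchanged into the basis.\<close>

lemma fixed_pair:
  assumes k: "clinear2 k" "\<And>z. z \<in> \<Lambda> \<Longrightarrow> k z \<in> \<Lambda>" "k z0 \<noteq> 0" and gk: "\<And>z. g (k z) = k z"
  shows "\<exists>v. (\<forall>i<4. v i \<in> \<Lambda>) \<and> g (v 0) = v 0 \<and> g (v 1) = v 1 \<and> vol v \<noteq> 0"
proof -
  have kc: "k (\<Sum>i<4. c i *\<^sub>R b i) = (\<Sum>i<4. c i *\<^sub>R k (b i))" for c
    using clinear2_linear[OF k(1)] by (simp add: linear_sum linear_scale)
  obtain i where i: "i < 4" "k (b i) \<noteq> 0"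
  proof (rule ccontr)
    assume "\<not> thesis"
    then have "\<And>i. i < 4 \<Longrightarrow> k (b i) = 0" using that by blast
    then have "k z0 = 0" using kc[of "crd z0"] by (simp add: sum_crd)
    then show False using k(3) by simp
  qed
  let ?f = "k (b i)"
  obtain j where j: "j < 4" "\<forall>r. k (b j) \<noteq> r *\<^sub>R ?f"
  proof (rule ccontr)
    assume "\<not> thesis"
    then have "\<forall>j. \<exists>r. j < 4 \<longrightarrow> k (b j) = r *\<^sub>R ?f" using that by blast
    then obtain r where r: "\<And>j. j < 4 \<Longrightarrow> k (b j) = r j *\<^sub>R ?f" by metis
    have "\<exists>s. k z = s *\<^sub>R ?f" for z
    proof -
      have "k z = (\<Sum>j<4. crd z j *\<^sub>R k (b j))" using kc[of "crd z"] by (simp add: sum_crd)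
      also have "\<dots> = (\<Sum>j<4. (crd z j * r j) *\<^sub>R ?f)" by (intro sum.cong) (simp_all add: r)
      also have "\<dots> = (\<Sum>j<4. crd z j * r j) *\<^sub>R ?f" by (simp add: scaleR_sum_left)
      finally show ?thesis by blast
    qed
    \<comment> \<open>If all images were real multiples of one vector \<open>?f\<close>, then
      \<open>\<i>\<close> times \<open>?f\<close>, the image of \<open>\<i> *s b i\<close>, would be
      one too.\<close>
    then obtain s where s: "k (\<i> *s b i) = s *\<^sub>R ?f" by blast
    then have "(\<i> - of_real s) *s ?f = 0" by (simp add: clinear2_smult[OF k(1)] scaleR_smult vec.scale_left_diff_distrib)
    then have "\<i> - complex_of_real s = 0" using i(2) by simp
    then show False by (simp add: complex_eq_iff)
  qed
  have "\<exists>l<4. crd ?f l \<noteq> 0" using crd_eqI[of ?f 0] i(2) by (auto simp: crd_0)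
  then obtain l where l: "l < 4" "crd ?f l \<noteq> 0" by blast
  have lt4: "0 < (4::nat)" "1 < (4::nat)" by simp_all
  obtain v where v: "vol v \<noteq> 0" "v 0 = ?f" and vin: "\<forall>k<4. v k \<in> insert ?f (b ` {..<4})"
    using vol_insert[OF vol_nonzero sum_crd[symmetric] l lt4(1)] by blast
  obtain y where y: "k (b j) = (\<Sum>k<4. y k *\<^sub>R v k)" using vol_coords[OF v(1)] by blast
  have "\<exists>m<4. m \<noteq> 0 \<and> y m \<noteq> 0"
  proof (rule ccontr)
    assume "\<not> ?thesis"
    then have "y m = 0" if "m < 4" "m \<noteq> 0" for m using that by blast
    then have "y 1 = 0" "y 2 = 0" "y 3 = 0" by simp_all
    then have "k (b j) = y 0 *\<^sub>R ?f" using y v(2) by (simp add: lessThan_4)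
    then show False using j(2) by blast
  qed
  then obtain m where m: "m < 4" "m \<noteq> 0" "y m \<noteq> 0" by blast
  obtain u where u: "vol u \<noteq> 0" "u 1 = k (b j)" "\<forall>l<4. l \<noteq> 1 \<longrightarrow> l \<noteq> m \<longrightarrow> u l = v l"
    "\<forall>l<4. u l \<in> insert (k (b j)) (v ` {..<4})" using vol_insert[OF v(1) y m(1,3) lt4(2)] by blast
  have u0: "u 0 = ?f" using u(3) m(2) v(2) by simp
  have "v l \<in> \<Lambda>" if "l < 4" for l using vin that k(2) b_in_lattice i j by auto
  then have "u l \<in> \<Lambda>" if "l < 4" for l using u(4) that k(2) b_in_lattice j by auto
  then show ?thesis using u(1,2) u0 gk by (intro exI[of _ u] conjI) simp_all
qed

text \<open>The first two vectors span the fixed sublattice, the others are an arbitrary complement.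
  For each of these \<open>v + g v\<close> is fixed, hence an integral combination of the first two;
  the coefficients \<open>n\<close> and \<open>m\<close> are the gluing data.\<close>

lemma involution_basis:
  assumes g: "clinear2 g" "\<And>z. z \<in> \<Lambda> \<Longrightarrow> g z \<in> \<Lambda>" "cdet g \<noteq> 1" and gg: "\<And>z. g (g z) = z" and z0: "g z0 \<noteq> - z0"
  obtains e and n m :: "nat \<Rightarrow> int" where "lattice_basis e \<Lambda>" "g (e 0) = e 0" "g (e 1) = e 1"
    "g (e 2) = - e 2 + of_int (n 0) *\<^sub>R e 0 + of_int (n 1) *\<^sub>R e 1" "g (e 3) = - e 3 + of_int (m 0) *\<^sub>R e 0 + of_int (m 1) *\<^sub>R e 1"
proof -
  let ?P = "\<lambda>v. (\<forall>i<4. v i \<in> \<Lambda>) \<and> g (v 0) = v 0 \<and> g (v 1) = v 1"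
  have lin: "linear g" by (rule clinear2_linear[OF g(1)])
  have kc: "clinear2 (\<lambda>z. z + g z)"
    using g(1) by (simp add: clinear2_def vec.scale_right_distrib)
  have "\<exists>v. (\<forall>i<4. v i \<in> \<Lambda>) \<and> g (v 0) = v 0 \<and> g (v 1) = v 1 \<and> vol v \<noteq> 0"
  proof (rule fixed_pair[OF kc])
    show "z0 + g z0 \<noteq> 0" using z0 by (metis add_eq_0_iff)
  qed (use g(2) lattice_add gg in \<open>auto simp: linear_add[OF lin] add.commute\<close>)
  then have ex: "\<exists>v. ?P v \<and> vol v \<noteq> 0" by blast
  have "\<exists>v. ?P v \<and> lattice_basis v \<Lambda>"
  proof (rule adapted_basis[OF ex])
    fix v y assume P: "?P v" and v: "vol v \<noteq> 0" and w: "(\<Sum>k<4. y k *\<^sub>R v k) \<in> \<Lambda>"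
    show "(\<forall>i<4. y i \<in> \<int>) \<or> (\<exists>v'. ?P v' \<and> vol v' \<noteq> 0 \<and> \<bar>vol v'\<bar> < \<bar>vol v\<bar>)"
    proof (rule disjCI)
      assume no: "\<nexists>v'. ?P v' \<and> vol v' \<noteq> 0 \<and> \<bar>vol v'\<bar> < \<bar>vol v\<bar>"
      have vL: "v i \<in> \<Lambda>" if "i < 4" for i using P that by blast
      \<comment> \<open>The shape puts no condition on places 2 and 3, so any remainder may be
        inserted there. Once these coordinates are integral, the remainder lies in the fixed plane
        and may be inserted in place 0 or 1.\<close>
      have y23: "y i \<in> \<int>" if i: "i = 2 \<or> i = 3" for i
      proof (rule ccontr)
        assume yi: "y i \<notin> \<int>"
        have i4: "i < 4" using i by auto
        obtain x where x0: "x = (\<Sum>k<4. (y k - of_int \<lfloor>y k\<rfloor>) *\<^sub>R v k)" and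
          x: "x \<in> \<Lambda>" "vol (v(i := x)) \<noteq> 0" "\<bar>vol (v(i := x))\<bar> < \<bar>vol v\<bar>"
          by (rule reduce_coordinate[OF vL v w i4 yi])
        have "?P (v(i := x))" using P x(1) i by auto
        then show False using no x by blast
      qed
      have "y i \<in> \<int>" if i: "i = 0 \<or> i = 1" for i
      proof (rule ccontr)
        assume yi: "y i \<notin> \<int>"
        have i4: "i < 4" using i by auto
        obtain x where x: "x = (\<Sum>k<4. (y k - of_int \<lfloor>y k\<rfloor>) *\<^sub>R v k)" "x \<in> \<Lambda>" "vol (v(i := x)) \<noteq> 0" "\<bar>vol (v(i := x))\<bar> < \<bar>vol v\<bar>"
          by (rule reduce_coordinate[OF vL v w i4 yi])
        have "x = (y 0 - of_int \<lfloor>y 0\<rfloor>) *\<^sub>R v 0 + (y 1 - of_int \<lfloor>y 1\<rfloor>) *\<^sub>R v 1"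
          using x(1) y23 by (simp add: lessThan_4)
        then have "g x = x" using P by (simp add: linear_add[OF lin] linear_scale[OF lin])
        then have "?P (v(i := x))" using P x(2) i by auto
        then show False using no x by blast
      qed
      then show "\<forall>i<4. y i \<in> \<int>" using y23 by (auto simp: less_4_cases)
    qed
  qed blast
  then obtain v where v: "?P v" "lattice_basis v \<Lambda>" by blast
  interpret V: torus \<Lambda> v by unfold_locales (rule v(2))
  have n: "\<exists>n :: nat \<Rightarrow> int. g (v i) = - v i + of_int (n 0) *\<^sub>R v 0 + of_int (n 1) *\<^sub>R v 1" if i: "i < 4" for i
  proof -
    let ?f = "v i + g (v i)"
    have f: "?f \<in> \<Lambda>" using v(1) i g(2) lattice_add by blast
    have gf: "g ?f = ?f" by (simp add: linear_add[OF lin] gg add.commute)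
    define c where "c k = \<lfloor>V.crd ?f k\<rfloor>" for k
    have lc: "?f = (\<Sum>k<4. of_int (c k) *\<^sub>R v k)" unfolding c_def by (rule V.lattice_comb[OF f])
    have c23: "real_of_int (c 2) = 0" "real_of_int (c 3) = 0"
      using fixed_coords[OF g(1,3) V.vol_nonzero _ _ gf lc] v(1) by auto
    have "g (v i) = - v i + ?f" by simp
    also have "?f = of_int (c 0) *\<^sub>R v 0 + of_int (c 1) *\<^sub>R v 1"
      unfolding lc using c23 by (simp add: lessThan_4)
    finally show ?thesis by (intro exI[of _ c]) (simp only: add.assoc)
  qed
  have "\<exists>n :: nat \<Rightarrow> int. g (v 2) = - v 2 + of_int (n 0) *\<^sub>R v 0 + of_int (n 1) *\<^sub>R v 1" by (rule n) simp
  then obtain n2 :: "nat \<Rightarrow> int" where n2: "g (v 2) = - v 2 + of_int (n2 0) *\<^sub>R v 0 + of_int (n2 1) *\<^sub>R v 1" by (rule exE)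
  have "\<exists>n :: nat \<Rightarrow> int. g (v 3) = - v 3 + of_int (n 0) *\<^sub>R v 0 + of_int (n 1) *\<^sub>R v 1" by (rule n) simp
  then obtain n3 :: "nat \<Rightarrow> int" where n3: "g (v 3) = - v 3 + of_int (n3 0) *\<^sub>R v 0 + of_int (n3 1) *\<^sub>R v 1" by (rule exE)
  show thesis by (rule that[OF v(2) _ _ n2 n3]; use v(1) in blast)
qed

text \<open>The norm forms of Z[i] for \<open>s = 0\<close> and of the Eisenstein integers for
  \<open>s = 1\<close>. That they stay below 1 on centred remainders is the Euclidean
  property.\<close>

lemma norm_form_less_1:
  fixes x y s :: real assumes "s = 0 \<or> s = 1" "\<bar>x\<bar> \<le> 1/2" "\<bar>y\<bar> \<le> 1/2"
  shows "x\<^sup>2 - s * x * y + y\<^sup>2 < 1" "x\<^sup>2 - s * x * y + y\<^sup>2 \<ge> 0" "x\<^sup>2 - s * x * y + y\<^sup>2 = 0 \<Longrightarrow> x = 0 \<and> y = 0"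
proof -
  have a: "x\<^sup>2 \<le> 1/4" "y\<^sup>2 \<le> 1/4"
    using power_mono[OF assms(2), of 2] power_mono[OF assms(3), of 2] by (simp_all add: power_divide)
  have "\<bar>x * y\<bar> \<le> 1/2 * (1/2)" unfolding abs_mult by (rule mult_mono) (use assms in auto)
  then show "x\<^sup>2 - s * x * y + y\<^sup>2 < 1" using a assms(1) by auto
  define N r where "N = x\<^sup>2 - s * x * y + y\<^sup>2" and "r = (if s = 0 then x\<^sup>2 + y\<^sup>2 else (x - y)\<^sup>2)"
  have e: "2 * N = x\<^sup>2 + y\<^sup>2 + r"
    using assms(1) by (auto simp: N_def r_def power2_eq_square algebra_simps)
  have p: "x\<^sup>2 \<ge> 0" "y\<^sup>2 \<ge> 0" "r \<ge> 0" by (simp_all add: r_def)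
  show "x\<^sup>2 - s * x * y + y\<^sup>2 \<ge> 0" unfolding N_def[symmetric] using e p by linarith
  assume "x\<^sup>2 - s * x * y + y\<^sup>2 = 0"
  then have "N = 0" by (simp only: N_def)
  then have "x\<^sup>2 = 0" "y\<^sup>2 = 0" using e p by linarith+
  then show "x = 0 \<and> y = 0" by simp
qed

text \<open>Modulo the fixed sublattice, \<open>1 + g + g^2\<close> vanishes and the lattice is a
  module of rank one over the Eisenstein integers. Replacing \<open>v 2\<close> by a remainder
  \<open>x\<close> and \<open>v 3\<close> by \<open>g x\<close> multiplies the volume by the norm of
  the last two coordinates of \<open>x\<close>.\<close>

lemma order_3_basis:
  assumes g: "clinear2 g" "\<And>z. z \<in> \<Lambda> \<Longrightarrow> g z \<in> \<Lambda>" "cdet g \<noteq> 1" and ggg: "\<And>z. g (g (g z)) = z"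
    and z0: "z0 \<noteq> 0" "g z0 = z0"
  obtains e and n :: "nat \<Rightarrow> int" where "lattice_basis e \<Lambda>" "g (e 0) = e 0" "g (e 1) = e 1" "g (e 2) = e 3"
    "g (e 3) = - e 2 - e 3 + of_int (n 0) *\<^sub>R e 0 + of_int (n 1) *\<^sub>R e 1"
proof -
  let ?P = "\<lambda>v. (\<forall>i<4. v i \<in> \<Lambda>) \<and> g (v 0) = v 0 \<and> g (v 1) = v 1 \<and> v 3 = g (v 2)"
  let ?k = "\<lambda>z. z + g z + g (g z)"
  have lin: "linear g" by (rule clinear2_linear[OF g(1)])
  note gl = linear_add[OF lin] linear_scale[OF lin] linear_diff[OF lin]
  have gk: "g (?k z) = ?k z" for z by (simp add: gl ggg add_ac)
  have kL: "?k z \<in> \<Lambda>" if "z \<in> \<Lambda>" for z using that g(2) lattice_add by blast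
  have kc: "clinear2 ?k" using g(1) by (simp add: clinear2_def vec.scale_right_distrib add_ac)
  have "?k z0 = 3 *\<^sub>R z0" using z0(2) by (simp add: scaleR_left.add[of 1 2, simplified] scaleR_2)
  then have k0: "?k z0 \<noteq> 0" using z0(1) by simp
  have kv: "\<exists>p q. ?k z = p *\<^sub>R v 0 + q *\<^sub>R v 1" if v: "g (v 0) = v 0" "g (v 1) = v 1" "vol v \<noteq> 0" for v z
  proof -
    obtain c where c: "?k z = (\<Sum>k<4. c k *\<^sub>R v k)" using vol_coords[OF v(3)] by blast
    have "c 2 = 0" "c 3 = 0" using fixed_coords[OF g(1,3) v(3,1,2) gk c] by auto
    then show ?thesis using c by (intro exI[of _ "c 0"] exI[of _ "c 1"]) (simp add: lessThan_4)
  qed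
  have ex: "\<exists>v. ?P v \<and> vol v \<noteq> 0"
  proof -
    obtain v where v: "\<forall>i<4. v i \<in> \<Lambda>" "g (v 0) = v 0" "g (v 1) = v 1" "vol v \<noteq> 0"
      using fixed_pair[OF kc kL k0 gk] by blast
    obtain z where z: "g (v 2) = (\<Sum>k<4. z k *\<^sub>R v k)" using vol_coords[OF v(4)] by blast
    \<comment> \<open>Otherwise \<open>g\<close> acts on \<open>v 2\<close> modulo the fixed plane
      by the real number \<open>z 2\<close>. As \<open>1 + g + g^2\<close> has fixed values,
      \<open>1 + z 2 + z 2 * z 2\<close> would vanish.\<close>
    have "z 3 \<noteq> 0"
    proof
      assume z3: "z 3 = 0"
      have g2: "g (v 2) = z 0 *\<^sub>R v 0 + z 1 *\<^sub>R v 1 + z 2 *\<^sub>R v 2" using z z3 by (simp add: lessThan_4)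
      have g22: "g (g (v 2)) = z 0 *\<^sub>R v 0 + z 1 *\<^sub>R v 1 + z 2 *\<^sub>R (z 0 *\<^sub>R v 0 + z 1 *\<^sub>R v 1 + z 2 *\<^sub>R v 2)"
        by (subst g2) (simp only: gl v(2,3) g2)
      let ?c = "\<lambda>k::nat. if k = 2 then 1 + z 2 + z 2 * z 2 else if k = 3 then 0 else z k + z k + z 2 * z k"
      have kk: "?k (v 2) = (\<Sum>k<4. ?c k *\<^sub>R v k)"
        unfolding g22 unfolding g2 by (simp add: lessThan_4 vec_eq_iff scaleR_conv_of_real algebra_simps)
      have "1 + z 2 + z 2 * z 2 = 0" using fixed_coords(1)[OF g(1,3) v(4,2,3) gk kk] by simp
      then have "(1 + 2 * z 2)\<^sup>2 + 3 = 0" by (simp add: power2_eq_square algebra_simps)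
      then show False using zero_le_power2[of "1 + 2 * z 2"] by linarith
    qed
    then have "vol (v(3 := g (v 2))) \<noteq> 0" using vol_replace[OF _ z, of 3] v(4) by simp
    moreover have "?P (v(3 := g (v 2)))" using v g(2) by auto
    ultimately show ?thesis by blast
  qed
  have "\<exists>v. ?P v \<and> lattice_basis v \<Lambda>"
  proof (rule adapted_basis[OF ex])
    fix v y assume P: "?P v" and v: "vol v \<noteq> 0" and w: "(\<Sum>k<4. y k *\<^sub>R v k) \<in> \<Lambda>"
    show "(\<forall>i<4. y i \<in> \<int>) \<or> (\<exists>v'. ?P v' \<and> vol v' \<noteq> 0 \<and> \<bar>vol v'\<bar> < \<bar>vol v\<bar>)"
    proof (rule disjCI)
      assume no: "\<nexists>v'. ?P v' \<and> vol v' \<noteq> 0 \<and> \<bar>vol v'\<bar> < \<bar>vol v\<bar>"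
      \<comment> \<open>Rounding to the nearest integer gives remainders of absolute value at most
        1/2, as required by \<open>norm_form_less_1\<close>.\<close>
      define t where "t k = y k - of_int (round (y k))" for k
      have tb: "\<bar>t k\<bar> \<le> 1/2" for k using of_int_round_abs_le[of "y k"] by (simp add: t_def abs_minus_commute)
      have yI: "y i \<in> \<int>" if "t i = 0" for i using that by (metis Ints_of_int eq_iff_diff_eq_0 t_def)
      define x where "x = (\<Sum>k<4. t k *\<^sub>R v k)"
      have "x = (\<Sum>k<4. y k *\<^sub>R v k) - (\<Sum>k<4. of_int (round (y k)) *\<^sub>R v k)"
        by (simp add: x_def t_def scaleR_left_diff_distrib sum_subtractf)
      then have xL: "x \<in> \<Lambda>" using lattice_diff[OF w lattice_int_comb] P by simp
      obtain p q where pq: "?k (v 2) = p *\<^sub>R v 0 + q *\<^sub>R v 1" using kv[of v "v 2"] P v by blast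
      have g3: "g (v 3) = p *\<^sub>R v 0 + q *\<^sub>R v 1 - v 2 - v 3" using pq P by (simp add: algebra_simps)
      let ?N = "(t 2)\<^sup>2 - 1 * t 2 * t 3 + (t 3)\<^sup>2"
      let ?u = "v(2 := x, 3 := g x)"
      have gx: "g x = (t 0 + t 3 * p) *\<^sub>R v 0 + (t 1 + t 3 * q) *\<^sub>R v 1 + (- t 3) *\<^sub>R v 2 + (t 2 - t 3) *\<^sub>R v 3"
      proof -
        have "g x = t 0 *\<^sub>R v 0 + t 1 *\<^sub>R v 1 + t 2 *\<^sub>R v 3 + t 3 *\<^sub>R g (v 3)"
          using P by (simp add: x_def lessThan_4 gl)
        then show ?thesis unfolding g3 by (simp add: algebra_simps)
      qed
      have "vol ?u = det4 (\<lambda>i k. if i = 2 then t k else if i = 3 then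
          (if k = 0 then t 0 + t 3 * p else if k = 1 then t 1 + t 3 * q else if k = 2 then - t 3 else t 2 - t 3)
          else if i = k then 1 else 0) * vol v"
        by (rule vol_comb) (use gx in \<open>auto simp: less_4_cases lessThan_4 x_def\<close>)
      also have "\<dots> = ?N * vol v" by (simp add: det4_def power2_eq_square algebra_simps)
      finally have vu: "vol ?u = ?N * vol v" .
      have N: "?N < 1" "?N \<ge> 0" "?N = 0 \<Longrightarrow> t 2 = 0 \<and> t 3 = 0" using norm_form_less_1[of 1 "t 2" "t 3"] tb by auto
      have "?P ?u" using P xL g(2) by auto
      then have "?N = 0" using no abs_mult_less[OF vu v N(2,1)] by blast
      then have t23: "t 2 = 0" "t 3 = 0" using N(3) by auto
      then have y23: "y 2 \<in> \<int>" "y 3 \<in> \<int>" by (auto intro: yI)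
      have gx0: "g x = x" using gx t23 P by (simp add: x_def lessThan_4)
      have "t i = 0" if i: "i = 0 \<or> i = 1" for i
      proof (rule ccontr)
        assume ti: "t i \<noteq> 0"
        have "vol (v(i := x)) = t i * vol v" by (rule vol_replace) (use i x_def in auto)
        moreover have "\<bar>t i * vol v\<bar> < \<bar>vol v\<bar>" using tb[of i] v by (simp add: abs_mult)
        moreover have "?P (v(i := x))" using P xL gx0 i by auto
        ultimately show False using no ti v by (metis mult_eq_0_iff)
      qed
      then have "y 0 \<in> \<int>" "y 1 \<in> \<int>" by (auto intro: yI)
      then show "\<forall>i<4. y i \<in> \<int>" using y23 by (auto simp: less_4_cases)
    qed
  qed blast
  then obtain v where v: "?P v" "lattice_basis v \<Lambda>" by blast
  interpret V: torus \<Lambda> v by unfold_locales (rule v(2))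
  let ?f = "?k (v 2)"
  have f: "?f \<in> \<Lambda>" using kL v(1) by auto
  define c where "c k = \<lfloor>V.crd ?f k\<rfloor>" for k
  have lc: "?f = (\<Sum>k<4. of_int (c k) *\<^sub>R v k)" unfolding c_def by (rule V.lattice_comb[OF f])
  have c23: "real_of_int (c 2) = 0" "real_of_int (c 3) = 0"
    using fixed_coords[OF g(1,3) V.vol_nonzero _ _ gk lc] v(1) by auto
  have "g (v 3) = - v 2 - v 3 + ?f" using v(1) by simp
  also have "?f = of_int (c 0) *\<^sub>R v 0 + of_int (c 1) *\<^sub>R v 1"
    unfolding lc using c23 by (simp add: lessThan_4)
  finally have r: "g (v 3) = - v 2 - v 3 + of_int (c 0) *\<^sub>R v 0 + of_int (c 1) *\<^sub>R v 1"
    by (simp only: add.assoc)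
  show thesis by (rule that[OF v(2) _ _ _ r]; use v(1) in simp)
qed

text \<open>When the second and the fourth vector are \<open>c\<close> times the first and the
  third, the volume is a squared modulus times a factor depending only on \<open>c\<close>, positive
  for nonreal \<open>c\<close>. Hence such a basis is always positively oriented.\<close>

lemma scalar_vol:
  assumes "v 1 = c *s v 0" "v 3 = c *s v 2" "cmod c = 1"
  shows "4 * vol v = (cmod (dC (v 0) (v 2)))\<^sup>2 * (2 - 2 * Re (c\<^sup>2))"
proof -
  let ?m = "dC (v 0) (v 2)"
  have cc: "c * cnj c = 1" using assms(3) complex_norm_square[of c] by simp
  have d: "dC (v 0) (v 1) = 0" "dC (v 2) (v 3) = 0" "dC (v 0) (v 3) = c * ?m" "dC (v 1) (v 2) = c * ?m" "dC (v 1) (v 3) = c * c * ?m"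
    by (simp_all only: assms(1,2) dC_def vector_smult_component) (simp_all add: algebra_simps)
  have "complex_of_real (4 * vol v) = (?m * cnj ?m) * (2 * (c * cnj c) - (c\<^sup>2 + cnj (c\<^sup>2)))"
    unfolding pf_dC[symmetric] pf_def d by (simp add: power2_eq_square algebra_simps)
  also have "\<dots> = of_real ((cmod ?m)\<^sup>2 * (2 - 2 * Re (c\<^sup>2)))"
    unfolding cc by (simp only: complex_norm_square[symmetric] complex_add_cnj) simp
  finally show ?thesis by (simp only: of_real_eq_iff)
qed

text \<open>Multiplication by \<open>c\<close> makes \<Lambda> a module over Z[i] when
  \<open>s = 0\<close> or the Eisenstein integers when \<open>s = 1\<close>. The shape consists of
  two blocks, each generated by one vector.\<close>

lemma scalar_basis:
  assumes c: "c\<^sup>2 = - of_real s * c - 1" "s = 0 \<or> s = 1" and g: "\<And>z. z \<in> \<Lambda> \<Longrightarrow> c *s z \<in> \<Lambda>"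
  obtains e where "lattice_basis e \<Lambda>" "e 1 = c *s e 0" "e 3 = c *s e 2" "vol e > 0"
proof -
  let ?P = "\<lambda>v. (\<forall>i<4. v i \<in> \<Lambda>) \<and> v 1 = c *s v 0 \<and> v 3 = c *s v 2"
  have im: "Im c \<noteq> 0"
  proof
    assume "Im c = 0"
    then have "(2 * Re c + s)\<^sup>2 + (4 - s\<^sup>2) = 0" using arg_cong[OF c(1), of Re] by (simp add: power2_eq_square algebra_simps)
    moreover have "(2 * Re c + s)\<^sup>2 \<ge> 0" by simp
    moreover have "s\<^sup>2 \<le> 1" using c(2) by auto
    ultimately show False by linarith
  qed
  have "c ^ 3 = 1 \<or> c ^ 4 = 1"
  proof (use c(2) in \<open>elim disjE\<close>)
    assume s: "s = 0"
    then have "c\<^sup>2 = - 1" using c(1) by simp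
    then have "c ^ 4 = 1" using power_mult[of c 2 2] by simp
    then show ?thesis by blast
  next
    assume s: "s = 1"
    then have "c * c\<^sup>2 = c * (- c - 1)" using c(1) by simp
    also have "\<dots> = - c\<^sup>2 - c" by (simp add: power2_eq_square algebra_simps)
    also have "\<dots> = 1" using c(1) s by simp
    finally have "c ^ 3 = 1" by (simp add: power3_eq_cube power2_eq_square mult.assoc)
    then show ?thesis by blast
  qed
  then have nc: "cmod c = 1" using norm_1_root[of c 3] norm_1_root[of c 4] by auto
  have c2: "Re (c\<^sup>2) < 1"
  proof -
    have "(Re c)\<^sup>2 + (Im c)\<^sup>2 = 1" using nc cmod_power2[of c] by simp
    moreover have "(Im c)\<^sup>2 > 0" using im by simp
    moreover have "Re (c\<^sup>2) = (Re c)\<^sup>2 - (Im c)\<^sup>2" by (simp add: power2_eq_square)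
    ultimately show ?thesis by linarith
  qed
  have sv: "4 * vol v = (cmod (dC (v 0) (v 2)))\<^sup>2 * (2 - 2 * Re (c\<^sup>2))" if "?P v" for v
    using scalar_vol[OF _ _ nc, of v] that by blast
  have ex: "\<exists>v. ?P v \<and> vol v \<noteq> 0"
  proof -
    have "\<exists>i<4. \<exists>j<4. dC (b i) (b j) \<noteq> 0"
    proof (rule ccontr)
      assume "\<not> ?thesis"
      then have "pf (\<lambda>i j. dC (b i) (b j)) (\<lambda>i j. cnj (dC (b i) (b j))) = 0" by (simp add: pf_def)
      then show False unfolding pf_dC using vol_nonzero by simp
    qed
    then obtain i j where ij: "i < 4" "j < 4" "dC (b i) (b j) \<noteq> 0" by blast
    define v where "v k = (if k = 0 then b i else if k = 1 then c *s b i else if k = 2 then b j else c *s b j)" for k :: nat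
    have P: "?P v" using b_in_lattice ij g by (auto simp: v_def)
    have "v 0 = b i" "v 2 = b j" by (simp_all add: v_def)
    then have "4 * vol v \<noteq> 0" unfolding sv[OF P] using ij(3) c2 by simp
    then have "vol v \<noteq> 0" by simp
    then show ?thesis using P by blast
  qed
  have cc: "c *s (c *s z) = (- s) *\<^sub>R (c *s z) - z" for z :: "complex^2"
  proof -
    have "c *s (c *s z) = (c\<^sup>2) *s z" by (simp add: power2_eq_square)
    then show ?thesis unfolding c(1) by (simp add: scaleR_smult vec.scale_left_diff_distrib)
  qed
  have "\<exists>v. ?P v \<and> lattice_basis v \<Lambda>"
  proof (rule adapted_basis[OF ex])
    fix v y assume P: "?P v" and v: "vol v \<noteq> 0" and w: "(\<Sum>k<4. y k *\<^sub>R v k) \<in> \<Lambda>"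
    show "(\<forall>i<4. y i \<in> \<int>) \<or> (\<exists>v'. ?P v' \<and> vol v' \<noteq> 0 \<and> \<bar>vol v'\<bar> < \<bar>vol v\<bar>)"
    proof (rule disjCI)
      assume no: "\<nexists>v'. ?P v' \<and> vol v' \<noteq> 0 \<and> \<bar>vol v'\<bar> < \<bar>vol v\<bar>"
      define t where "t k = y k - of_int (round (y k))" for k
      have tb: "\<bar>t k\<bar> \<le> 1/2" for k using of_int_round_abs_le[of "y k"] by (simp add: t_def abs_minus_commute)
      have yI: "y i \<in> \<int>" if "t i = 0" for i using that by (metis Ints_of_int eq_iff_diff_eq_0 t_def)
      define x where "x = (\<Sum>k<4. t k *\<^sub>R v k)"
      have "x = (\<Sum>k<4. y k *\<^sub>R v k) - (\<Sum>k<4. of_int (round (y k)) *\<^sub>R v k)"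
        by (simp add: x_def t_def scaleR_left_diff_distrib sum_subtractf)
      then have xL: "x \<in> \<Lambda>" using lattice_diff[OF w lattice_int_comb] P by simp
      have cv: "c *s v 1 = (- s) *\<^sub>R v 1 - v 0" "c *s v 3 = (- s) *\<^sub>R v 3 - v 2" using P cc by simp_all
      have cs: "c *s (r *\<^sub>R z) = r *\<^sub>R (c *s z)" for r and z :: "complex^2" by (simp add: scaleR_smult mult.commute)
      have cx: "c *s x = (- t 1) *\<^sub>R v 0 + (t 0 - s * t 1) *\<^sub>R v 1 + (- t 3) *\<^sub>R v 2 + (t 2 - s * t 3) *\<^sub>R v 3"
      proof -
        have "c *s x = t 0 *\<^sub>R (c *s v 0) + t 1 *\<^sub>R (c *s v 1) + t 2 *\<^sub>R (c *s v 2) + t 3 *\<^sub>R (c *s v 3)"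
          by (simp only: x_def lessThan_4) (simp add: vec.scale_right_distrib cs add_ac)
        then show ?thesis unfolding cv using P by (simp add: algebra_simps)
      qed
      let ?c = "\<lambda>k::nat. if k = 0 then - t 1 else if k = 1 then t 0 - s * t 1 else if k = 2 then - t 3 else t 2 - s * t 3"
      \<comment> \<open>One remainder \<open>x\<close> is tried in both blocks; each attempt
        multiplies the volume by the norm of the corresponding pair of coordinates, so minimality
        makes both norms vanish.\<close>
      let ?u = "v(0 := x, 1 := c *s x)" and ?w = "v(2 := x, 3 := c *s x)"
      let ?N = "(t 0)\<^sup>2 - s * t 0 * t 1 + (t 1)\<^sup>2" and ?K = "(t 2)\<^sup>2 - s * t 2 * t 3 + (t 3)\<^sup>2"
      have "vol ?u = det4 (\<lambda>i k. if i = 0 then t k else if i = 1 then ?c k else if i = k then 1 else 0) * vol v"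
        by (rule vol_comb) (use cx in \<open>auto simp: less_4_cases lessThan_4 x_def\<close>)
      also have "\<dots> = ?N * vol v" by (simp add: det4_def power2_eq_square algebra_simps)
      finally have vu: "vol ?u = ?N * vol v" .
      have "vol ?w = det4 (\<lambda>i k. if i = 2 then t k else if i = 3 then ?c k else if i = k then 1 else 0) * vol v"
        by (rule vol_comb) (use cx in \<open>auto simp: less_4_cases lessThan_4 x_def\<close>)
      also have "\<dots> = ?K * vol v" by (simp add: det4_def power2_eq_square algebra_simps)
      finally have vw: "vol ?w = ?K * vol v" .
      have PP: "?P ?u" "?P ?w" using P xL g by auto
      have N: "?N < 1" "?N \<ge> 0" "?N = 0 \<Longrightarrow> t 0 = 0 \<and> t 1 = 0" using norm_form_less_1[OF c(2), of "t 0" "t 1"] tb by auto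
      have K: "?K < 1" "?K \<ge> 0" "?K = 0 \<Longrightarrow> t 2 = 0 \<and> t 3 = 0" using norm_form_less_1[OF c(2), of "t 2" "t 3"] tb by auto
      have "?N = 0" using no PP(1) abs_mult_less[OF vu v N(2,1)] by blast
      moreover have "?K = 0" using no PP(2) abs_mult_less[OF vw v K(2,1)] by blast
      ultimately have "t 0 = 0" "t 1 = 0" "t 2 = 0" "t 3 = 0" using N(3) K(3) by auto
      then show "\<forall>i<4. y i \<in> \<int>" by (auto simp: less_4_cases intro: yI)
    qed
  qed blast
  then obtain v where v: "?P v" "lattice_basis v \<Lambda>" by blast
  interpret V: torus \<Lambda> v by unfold_locales (rule v(2))
  have "4 * vol v \<ge> 0" unfolding sv[OF v(1)] using c2 by simp
  then have "vol v > 0" using V.vol_nonzero by simp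
  then show thesis using v by (intro that[of v]) simp_all
qed

end

section \<open>Arithmetic of the fifth roots of unity\<close>

lemma rational_square_5:
  assumes "r \<in> \<rat>" "r\<^sup>2 = 5 * s\<^sup>2" "s \<in> \<rat>" shows "(s :: real) = 0"
proof (rule ccontr)
  assume s: "s \<noteq> 0"
  have "r / s \<in> \<rat>" using assms by simp
  then obtain m n where mn: "n \<noteq> 0" "\<bar>r / s\<bar> = real m / real n" "coprime m n" by (rule Rats_abs_nat_div_natE)
  have "(r / s)\<^sup>2 = 5" using assms(2) s by (simp add: power_divide)
  then have "(real m / real n)\<^sup>2 = 5" using mn(2) by (metis power2_abs)
  then have "real (m\<^sup>2) = real (5 * n\<^sup>2)" using mn(1) by (simp add: power_divide field_simps)
  then have e: "m\<^sup>2 = 5 * n\<^sup>2" by (simp only: of_nat_eq_iff)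
  have p5: "prime (5::nat)" by simp
  have "5 dvd m\<^sup>2" using e by simp
  then have m: "5 dvd m" using p5 prime_dvd_power by blast
  then obtain k where "m = 5 * k" by (rule dvdE)
  then have "n\<^sup>2 = 5 * k\<^sup>2" using e by (simp add: power2_eq_square)
  then have "5 dvd n\<^sup>2" by simp
  then have "5 dvd n" using p5 prime_dvd_power by blast
  then have "5 dvd gcd m n" using m by simp
  then show False using mn(3) unfolding coprime_iff_gcd_eq_1 by simp
qed

text \<open>Five points on a circle of length 1, cut into five arcs of length 1/5: either some arc is empty, or
  every arc contains exactly one point.\<close>

lemma round_5:
  fixes y :: "nat \<Rightarrow> real"
  obtains k :: "nat \<Rightarrow> int" where "5 * (\<Sum>i<5. (y i - of_int (k i))\<^sup>2) - (\<Sum>i<5. y i - of_int (k i))\<^sup>2 < 4"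
proof -
  define x where "x i = y i - of_int \<lfloor>y i\<rfloor>" for i
  have x: "0 \<le> x i" "x i < 1" for i unfolding x_def by linarith+
  define c where "c i = nat \<lfloor>5 * x i\<rfloor>" for i
  have c: "real (c i) \<le> 5 * x i" "5 * x i < real (c i) + 1" "c i < 5" for i
  proof -
    have "0 \<le> \<lfloor>5 * x i\<rfloor>" "\<lfloor>5 * x i\<rfloor> < 5" using x[of i] by (simp_all add: floor_less_iff)
    then show "real (c i) \<le> 5 * x i" "5 * x i < real (c i) + 1" "c i < 5" unfolding c_def by linarith+
  qed
  show thesis
  proof (cases "c ` {..<5} = {..<5}")
    case True
    have "inj_on c {..<5}" by (rule eq_card_imp_inj_on) (simp_all add: True)
    then have bij: "bij_betw c {..<5} {..<5}" using True by (simp add: bij_betw_def)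
    define s where "s = (\<lambda>j. x (inv_into {..<5} c j))"
    have sc: "s (c i) = x i" if "i < 5" for i using that bij by (simp add: s_def bij_betw_inv_into_left)
    have s: "real j \<le> 5 * s j" "5 * s j < real j + 1" if "j < 5" for j
    proof -
      have "j \<in> c ` {..<5}" using that unfolding True by simp
      then obtain i where "i < 5" "j = c i" by blast
      then show "real j \<le> 5 * s j" "5 * s j < real j + 1" using c sc by auto
    qed
    have "(\<Sum>i<5. (x i)\<^sup>2) = (\<Sum>j<5. (s j)\<^sup>2)"
      using sum.reindex_bij_betw[OF bij, of "\<lambda>j. (s j)\<^sup>2"] sc by simp
    moreover have "(\<Sum>i<5. x i) = (\<Sum>j<5. s j)" using sum.reindex_bij_betw[OF bij, of s] sc by simp
    moreover have "5 * (\<Sum>j<5. (s j)\<^sup>2) - (\<Sum>j<5. s j)\<^sup>2 < 4"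
    proof -
      have l: "{..<5::nat} = {0, 1, 2, 3, 4}" by auto
      have d: "(5 * s j - 5 * s i)\<^sup>2 < (real j - real i + 1)\<^sup>2" if "i < j" "j < 5" for i j
        by (rule power_strict_mono) (use s[of i] s[of j] that in auto)
      \<comment> \<open>A sum of squares over the ten pairs of points. Differences of points in arcs
        at distance 1, 2, 3, 4 are below 2, 3, 4, 5, so the total is below 4 * 4 + 3 * 9 + 2 * 16 +
        25 = 100.\<close>
      have "25 * (5 * (\<Sum>j<5. (s j)\<^sup>2) - (\<Sum>j<5. s j)\<^sup>2) =
        (5 * s 1 - 5 * s 0)\<^sup>2 + (5 * s 2 - 5 * s 0)\<^sup>2 + (5 * s 3 - 5 * s 0)\<^sup>2 + (5 * s 4 - 5 * s 0)\<^sup>2 + (5 * s 2 - 5 * s 1)\<^sup>2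
        + (5 * s 3 - 5 * s 1)\<^sup>2 + (5 * s 4 - 5 * s 1)\<^sup>2 + (5 * s 3 - 5 * s 2)\<^sup>2 + (5 * s 4 - 5 * s 2)\<^sup>2 + (5 * s 4 - 5 * s 3)\<^sup>2"
        by (simp add: l power2_eq_square algebra_simps)
      also have "\<dots> < 100"
        using d[of 0 1] d[of 0 2] d[of 0 3] d[of 0 4] d[of 1 2] d[of 1 3] d[of 1 4] d[of 2 3] d[of 2 4] d[of 3 4] by simp
      finally show ?thesis by simp
    qed
    ultimately show thesis by (intro that[of "\<lambda>i. \<lfloor>y i\<rfloor>"]) (simp add: x_def)
  next
    case False
    then obtain j where j: "j < 5" "\<And>i. i < 5 \<Longrightarrow> c i \<noteq> j" using c(3) by blast
    \<comment> \<open>The circle is opened at the empty arc \<open>j\<close>: points beyond it are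
      moved back by one turn, and all points lie in an interval of length 4/5 with centre
      \<open>j / 5 - 2 / 5\<close>.\<close>
    define k where "k i = \<lfloor>y i\<rfloor> + (if c i > j then 1 else 0)" for i
    define u where "u i = y i - of_int (k i) - (real j / 5 - 2 / 5)" for i
    have u: "- (2/5) \<le> u i" "u i < 2/5" if "i < 5" for i
    proof -
      have "y i - of_int (k i) = x i - (if c i > j then 1 else 0)" by (simp add: k_def x_def)
      moreover have "c i + 1 \<le> j \<or> j + 1 \<le> c i" using j(2)[OF that] by linarith
      moreover have "real (c i) + 1 \<le> 5" using c(3)[of i] by linarith
      ultimately show "- (2/5) \<le> u i" "u i < 2/5"
        using c(1,2)[of i] j(1) by (auto simp: u_def simp flip: of_nat_less_iff)
    qed
    have u2: "(u i)\<^sup>2 \<le> 4/25" if "i < 5" for i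
    proof -
      have "\<bar>u i\<bar> \<le> 2/5" using u[OF that] by simp
      then have "\<bar>u i\<bar>\<^sup>2 \<le> (2/5)\<^sup>2" by (intro power_mono) simp_all
      then show ?thesis by (simp add: power_divide)
    qed
    \<comment> \<open>The form depends only on differences, so the centre of the interval may be
      subtracted from all points.\<close>
    have T: "5 * (\<Sum>i<5. (y i - of_int (k i))\<^sup>2) - (\<Sum>i<5. y i - of_int (k i))\<^sup>2 = 5 * (\<Sum>i<5. (u i)\<^sup>2) - (\<Sum>i<5. u i)\<^sup>2"
    proof -
      define e where "e = real j / 5 - 2 / 5"
      have y: "y i - of_int (k i) = u i + e" for i by (simp add: u_def e_def)
      have "(\<Sum>i<5. (u i + e)\<^sup>2) = (\<Sum>i<5. (u i)\<^sup>2) + 2 * e * (\<Sum>i<5. u i) + 5 * e\<^sup>2"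
        by (simp add: power2_sum sum.distrib sum_distrib_left algebra_simps)
      moreover have "(\<Sum>i<5. u i + e) = (\<Sum>i<5. u i) + 5 * e" by (simp add: sum.distrib)
      ultimately show ?thesis unfolding y by (simp add: power2_eq_square algebra_simps)
    qed
    \<comment> \<open>Every square is at most 4/25, which gives at most 4. Equality would need all
      \<open>u i\<close> at the left end, and then the subtracted square is not 0.\<close>
    have "5 * (\<Sum>i<5. (u i)\<^sup>2) - (\<Sum>i<5. u i)\<^sup>2 < 4"
    proof (cases "\<forall>i<5. u i = - (2/5)")
      case True
      then have "(\<Sum>i<5. (u i)\<^sup>2) = (\<Sum>i<5::nat. (- (2/5))\<^sup>2)" "(\<Sum>i<5. u i) = (\<Sum>i<5::nat. - (2/5))"
        by (intro sum.cong; simp)+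
      then show ?thesis by (simp add: power2_eq_square)
    next
      case False
      then obtain i where i: "i < 5" "u i \<noteq> - (2/5)" by blast
      then have "\<bar>u i\<bar> < 2/5" using u[of i] by auto
      then have "\<bar>u i\<bar>\<^sup>2 < (2/5)\<^sup>2" by (intro power_strict_mono) simp_all
      then have "(u i)\<^sup>2 < 4/25" by (simp add: power_divide)
      then have "(\<Sum>i<5. (u i)\<^sup>2) < (\<Sum>i<5::nat. 4/25)" by (intro sum_strict_mono_ex1) (use u2 i(1) in auto)
      then have "5 * (\<Sum>i<5. (u i)\<^sup>2) < 4" by simp
      moreover have "0 \<le> (\<Sum>i<5. u i)\<^sup>2" by simp
      ultimately show ?thesis by linarith
    qed
    then show thesis using T by (intro that[of k]) simp
  qed
qed

lemma dC_linear:
  "dC (u + v) w = dC u w + dC v w" "dC w (u + v) = dC w u + dC w v"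
  "dC (c *s u) w = c * dC u w" "dC w (c *s u) = c * dC w u" "dC (- u) w = - dC u w" "dC w (- u) = - dC w u"
  "dC u u = 0" "dC (r *\<^sub>R u) w = of_real r * dC u w" "dC w (r *\<^sub>R u) = of_real r * dC w u"
  "dC (u - v) w = dC u w - dC v w" "dC w (u - v) = dC w u - dC w v"
  by (simp_all add: dC_def scaleR_smult algebra_simps)

lemma dC_sum: "dC (sum f A) w = (\<Sum>a\<in>A. dC (f a) w)" "dC w (sum f A) = (\<Sum>a\<in>A. dC w (f a))"
  by (induction A rule: infinite_finite_induct) (simp_all add: dC_linear, simp_all add: dC_def)

lemma cdet_affine:
  assumes "clinear2 g" shows "cdet (\<lambda>z. p *s z + q *s g z) = p\<^sup>2 + p * q * ctr g + q\<^sup>2 * cdet g"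
  by (simp add: cdet_def dC_linear ctr_def power2_eq_square algebra_simps) (simp add: dC_def axis_def algebra_simps)

text \<open>The trace of a primitive fifth root is a root of X^2 + X - 1, which is irrational. Equal
  traces would have an irrational sum, so integrality makes them the two different roots, with sum
  -1.\<close>

lemma fifth_roots:
  assumes a: "a ^ 5 = 1" "a \<noteq> 1" and c: "c ^ 5 = 1" "c \<noteq> 1" and s: "2 * Re a + 2 * Re c = of_int s"
  shows "2 * Re a + 2 * Re c = - 1" "(2 * Re a)\<^sup>2 + 2 * Re a = 1" "(2 * Re c)\<^sup>2 + 2 * Re c = 1" "Im a \<noteq> 0" "Im c \<noteq> 0"
    "cmod a = 1" "cmod c = 1"
proof -
  have R: "(2 * Re z)\<^sup>2 + 2 * Re z = 1 \<and> Im z \<noteq> 0 \<and> cmod z = 1" if z: "z ^ 5 = 1" "z \<noteq> 1" for z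
  proof -
    have n: "cmod z = 1" using norm_1_root[OF z(1)] by simp
    then have zc: "z * cnj z = 1" using complex_norm_square[of z] by simp
    have "(z - 1) * (1 + z + z^2 + z^3 + z^4) = z ^ 5 - 1" by (simp add: eval_nat_numeral algebra_simps)
    then have S: "1 + z + z^2 + z^3 + z^4 = 0" using z by simp
    have "(cnj z)^2 * (1 + z + z^2 + z^3 + z^4) = (cnj z)^2 + (z * cnj z) * cnj z + (z * cnj z)^2 + (z * cnj z)^2 * z + (z * cnj z)^2 * z^2"
      by (simp add: eval_nat_numeral algebra_simps)
    then have "(cnj z)^2 + cnj z + 1 + z + z^2 = 0" unfolding zc S by simp
    moreover have "(z + cnj z)^2 + (z + cnj z) - 1 = (cnj z)^2 + cnj z + 2 * (z * cnj z) - 1 + z + z^2"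
      by (simp add: power2_eq_square algebra_simps)
    ultimately have "(z + cnj z)^2 + (z + cnj z) - 1 = 0" unfolding zc by (simp add: add_ac)
    then have "complex_of_real ((2 * Re z)^2 + 2 * Re z - 1) = 0" unfolding complex_add_cnj by simp
    then have r: "(2 * Re z)^2 + 2 * Re z - 1 = 0" by (simp only: of_real_eq_0_iff)
    have "Im z \<noteq> 0"
    proof
      assume "Im z = 0"
      then have "(Re z)\<^sup>2 = 1" using n cmod_power2[of z] by simp
      then have "Re z = 1 \<or> Re z = - 1" by (simp add: power2_eq_1_iff)
      then show False using r by auto
    qed
    then show ?thesis using r n by simp
  qed
  show A: "(2 * Re a)\<^sup>2 + 2 * Re a = 1" and B: "(2 * Re c)\<^sup>2 + 2 * Re c = 1" and "Im a \<noteq> 0" "Im c \<noteq> 0" "cmod a = 1" "cmod c = 1"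
    using R[OF a] R[OF c] by auto
  have "2 * Re a \<noteq> 2 * Re c"
  proof
    assume e: "2 * Re a = 2 * Re c"
    have "(2 * (2 * Re a) + 1)\<^sup>2 = 5 * 1\<^sup>2" using A by (simp add: power2_eq_square algebra_simps)
    moreover have "2 * (2 * Re a) + 1 = real_of_int (s + 1)" using e s by simp
    ultimately show False using rational_square_5[of "2 * (2 * Re a) + 1" 1] by auto
  qed
  moreover have "(2 * Re a - 2 * Re c) * (2 * Re a + 2 * Re c + 1) = 0"
    using A B by (simp add: power2_eq_square algebra_simps)
  ultimately show "2 * Re a + 2 * Re c = - 1" by simp
qed

context torus begin

text \<open>Through \<open>g\<close> the lattice is a module of rank one over the ring of a
  primitive fifth root of unity, and the shape is the orbit of one vector. The element
  \<open>y 0 + y 1 * g + y 2 * g^2 + y 3 * g^3\<close> acts as \<open>Y y\<close> and multiplies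
  volumes by its norm, so division with a remainder of norm below 1 is needed.\<close>

lemma order_5_basis:
  assumes g: "clinear2 g" "\<And>z. z \<in> \<Lambda> \<Longrightarrow> g z \<in> \<Lambda>"
    and ct: "\<alpha> + \<beta> = ctr g" "\<alpha> * \<beta> = cdet g"
    and a: "\<alpha> ^ 5 = 1" "\<alpha> \<noteq> 1" and b: "\<beta> ^ 5 = 1" "\<beta> \<noteq> 1" and d1: "cdet g \<noteq> 1" and s: "2 * Re \<alpha> + 2 * Re \<beta> = of_int s"
  obtains e where "lattice_basis e \<Lambda>" "g (e 0) = e 1" "g (e 1) = e 2" "g (e 2) = e 3" "g (e 3) = - e 0 - e 1 - e 2 - e 3"
proof -
  note fr = fifth_roots[OF a b s]
  define t d where "t = ctr g" and "d = cdet g"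
  let ?A = "2 * Re \<alpha>" and ?B = "2 * Re \<beta>"
  have lin: "linear g" by (rule clinear2_linear[OF g(1)])
  note gl = linear_add[OF lin] linear_scale[OF lin] linear_diff[OF lin] linear_neg[OF lin] clinear2_smult[OF g(1)]
  have gg: "g (g z) = t *s g z - d *s z" for z unfolding t_def d_def by (rule cayley_hamilton[OF g(1)])
  have AB: "?A \<noteq> ?B"
  proof
    assume "?A = ?B"
    then have "?A = - (1/2)" using fr(1) by simp
    then show False using fr(2) by (simp add: power2_eq_square)
  qed
  then have ab: "\<alpha> \<noteq> \<beta>" by auto
  have root: "\<alpha>\<^sup>2 = t * \<alpha> - d" "\<beta>\<^sup>2 = t * \<beta> - d" by (simp_all add: t_def d_def ct[symmetric] power2_eq_square algebra_simps)
  have root3: "\<alpha>^3 = (t\<^sup>2 - d) * \<alpha> - t * d" "\<beta>^3 = (t\<^sup>2 - d) * \<beta> - t * d"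
  proof -
    have "z^3 = (t\<^sup>2 - d) * z - t * d" if "z\<^sup>2 = t * z - d" for z
    proof -
      have "z^3 = z * z\<^sup>2" by (simp add: power2_eq_square power3_eq_cube)
      also have "\<dots> = z * (t * z - d)" unfolding that ..
      also have "\<dots> = t * z\<^sup>2 - d * z" by (simp add: power2_eq_square algebra_simps)
      finally have e: "z^3 = t * (t * z - d) - d * z" unfolding that .
      show ?thesis unfolding e by (simp add: power2_eq_square algebra_simps)
    qed
    then show "\<alpha>^3 = (t\<^sup>2 - d) * \<alpha> - t * d" "\<beta>^3 = (t\<^sup>2 - d) * \<beta> - t * d" using root by auto
  qed
  have ggg: "g (g (g z)) = (t\<^sup>2 - d) *s g z - (t * d) *s z" for z
    unfolding gg[of "g z"] unfolding gg by (simp add: vec_eq_iff power2_eq_square algebra_simps)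
  define p q where "p y = of_real (y 0) - of_real (y 2) * d - of_real (y 3) * t * d"
    and "q y = of_real (y 1) + of_real (y 2) * t + of_real (y 3) * (t\<^sup>2 - d)" for y :: "nat \<Rightarrow> real"
  define Y where "Y y z = y 0 *\<^sub>R z + y 1 *\<^sub>R g z + y 2 *\<^sub>R g (g z) + y 3 *\<^sub>R g (g (g z))" for y :: "nat \<Rightarrow> real" and z
  have Ypq: "Y y z = p y *s z + q y *s g z" for y z
    unfolding Y_def ggg unfolding p_def q_def gg by (simp add: vec_eq_iff scaleR_smult algebra_simps)
  define E where "E y x = of_real (y 0) + of_real (y 1) * x + of_real (y 2) * x^2 + of_real (y 3) * x^3" for y :: "nat \<Rightarrow> real" and x :: complex
  have Epq: "E y \<alpha> = p y + q y * \<alpha>" "E y \<beta> = p y + q y * \<beta>" for y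
    unfolding E_def p_def q_def root root3 by (simp_all add: algebra_simps)
  have Ycl: "clinear2 (Y y)" for y
    unfolding Y_def clinear2_def by (auto simp: gl clinear2_add[OF g(1)] vec_eq_iff scaleR_smult algebra_simps)
  have cdY: "cdet (Y y) = E y \<alpha> * E y \<beta>" for y
  proof -
    have "cdet (Y y) = (p y)\<^sup>2 + p y * q y * ctr g + (q y)\<^sup>2 * cdet g"
      unfolding Ypq[abs_def] by (rule cdet_affine[OF g(1)])
    then show ?thesis unfolding Epq ct[symmetric] by (simp add: power2_eq_square algebra_simps)
  qed
  \<comment> \<open>In the squared modulus of \<open>E y x\<close> the products of coefficients are
    grouped by the distance of their indices. Distances 2 and 3 fall together in \<open>c2\<close>
    because \<open>x^5 = 1\<close>.\<close>
  define S0 c1 c2 where "S0 y = (y 0)\<^sup>2 + (y 1)\<^sup>2 + (y 2)\<^sup>2 + (y 3)\<^sup>2"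
    and "c1 y = y 0 * y 1 + y 1 * y 2 + y 2 * y 3" and "c2 y = y 0 * y 2 + y 1 * y 3 + y 0 * y 3" for y :: "nat \<Rightarrow> real"
  have nE: "(cmod (E y x))\<^sup>2 = S0 y + c1 y * (2 * Re x) + c2 y * (- 1 - 2 * Re x)"
    if x: "x ^ 5 = 1" "cmod x = 1" "(2 * Re x)\<^sup>2 + 2 * Re x = 1" for x y
  proof -
    let ?c = "cnj x"
    have xc: "x * ?c = 1" using x(2) complex_norm_square[of x] by simp
    have c5: "?c ^ 5 = 1" using arg_cong[OF x(1), of cnj] by simp
    have x3: "x^3 = ?c\<^sup>2" "?c^3 = x\<^sup>2"
    proof -
      have "x^5 * ?c\<^sup>2 = x^3 * (x * ?c)\<^sup>2" "?c^5 * x\<^sup>2 = ?c^3 * (x * ?c)\<^sup>2" by (simp_all add: eval_nat_numeral algebra_simps)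
      then show "x^3 = ?c\<^sup>2" "?c^3 = x\<^sup>2" unfolding xc x(1) c5 by simp_all
    qed
    have cE: "cnj (E y x) = of_real (y 0) + of_real (y 1) * ?c + of_real (y 2) * ?c^2 + of_real (y 3) * ?c^3" by (simp add: E_def)
    define X2 C2 X3 C3 where "X2 = x\<^sup>2" and "C2 = ?c\<^sup>2" and "X3 = x^3" and "C3 = ?c^3"
    have m: "X2 * C2 = 1" "X3 * C3 = 1" "x * C2 = ?c" "X2 * ?c = x" "x * C3 = C2" "X3 * ?c = X2" "X2 * C3 = ?c" "X3 * C2 = x"
    proof -
      have "X2 * C2 = (x * ?c)^2" "X3 * C3 = (x * ?c)^3" "x * C2 = (x * ?c) * ?c" "X2 * ?c = (x * ?c) * x"
        "x * C3 = (x * ?c) * C2" "X3 * ?c = (x * ?c) * X2" "X2 * C3 = (x * ?c)^2 * ?c" "X3 * C2 = (x * ?c)^2 * x"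
        by (simp_all add: X2_def C2_def X3_def C3_def eval_nat_numeral algebra_simps)
      then show "X2 * C2 = 1" "X3 * C3 = 1" "x * C2 = ?c" "X2 * ?c = x" "x * C3 = C2" "X3 * ?c = X2" "X2 * C3 = ?c" "X3 * C2 = x"
        unfolding xc by simp_all
    qed
    have "complex_of_real ((cmod (E y x))\<^sup>2) = E y x * cnj (E y x)" by (rule complex_norm_square)
    also have "\<dots> = of_real ((y 0)\<^sup>2) + of_real ((y 1)\<^sup>2) * (x * ?c) + of_real ((y 2)\<^sup>2) * (X2 * C2) + of_real ((y 3)\<^sup>2) * (X3 * C3)
      + of_real (y 0 * y 1) * (x + ?c) + of_real (y 1 * y 2) * (x * C2 + X2 * ?c) + of_real (y 2 * y 3) * (X2 * C3 + X3 * C2)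
      + of_real (y 0 * y 2) * (X2 + C2) + of_real (y 1 * y 3) * (x * C3 + X3 * ?c) + of_real (y 0 * y 3) * (X3 + C3)"
      unfolding cE unfolding E_def X2_def C2_def X3_def C3_def by (simp add: algebra_simps power2_eq_square)
    also have "\<dots> = of_real (S0 y) + of_real (c1 y) * (x + ?c) + of_real (c2 y) * (X2 + C2)"
      unfolding m xc using x3 by (simp add: S0_def c1_def c2_def X2_def C2_def X3_def C3_def algebra_simps)
    also have "X2 + C2 = (x + ?c)\<^sup>2 - 2 * (x * ?c)" by (simp add: X2_def C2_def power2_eq_square algebra_simps)
    also have "\<dots> = of_real ((2 * Re x)\<^sup>2 - 2)" unfolding xc complex_add_cnj by simp
    also have "(2 * Re x)\<^sup>2 - 2 = - 1 - 2 * Re x" using x(3) by simp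
    finally have "complex_of_real ((cmod (E y x))\<^sup>2) = of_real (S0 y + c1 y * (2 * Re x) + c2 y * (- 1 - 2 * Re x))"
      unfolding complex_add_cnj by simp
    then show ?thesis by (simp only: of_real_eq_iff)
  qed
  \<comment> \<open>The sum of the squared moduli of the element under its four complex embeddings.
    By \<open>N\<close> the norm is at most the square of \<open>T / 4\<close>, so
    \<open>T < 4\<close> suffices.\<close>
  define T where "T y = 4 * S0 y - 2 * (c1 y + c2 y)" for y
  have N: "16 * (cmod (cdet (Y y)))\<^sup>2 = (T y)\<^sup>2 - 20 * (c1 y - c2 y)\<^sup>2" for y
  proof -
    have B: "?B = - 1 - ?A" using fr(1) by simp
    have "(cmod (cdet (Y y)))\<^sup>2 = (S0 y + c1 y * ?A + c2 y * ?B) * (S0 y + c1 y * ?B + c2 y * ?A)"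
      unfolding cdY norm_mult power_mult_distrib nE[OF a(1) fr(6,2)] nE[OF b(1) fr(7,3)] unfolding B by (simp add: algebra_simps)
    also have "\<dots> = (S0 y)\<^sup>2 + S0 y * (c1 y + c2 y) * (?A + ?B) + ((c1 y)\<^sup>2 + (c2 y)\<^sup>2) * (?A * ?B) + c1 y * c2 y * (?A\<^sup>2 + ?B\<^sup>2)"
      by (simp add: power2_eq_square algebra_simps)
    also have "?A + ?B = - 1" by (rule fr(1))
    also have AB1: "?A * ?B = - 1" unfolding B using fr(2) by (simp add: power2_eq_square algebra_simps)
    also have "?A\<^sup>2 + ?B\<^sup>2 = 3" using fr(1-3) by linarith
    finally show ?thesis by (simp add: T_def power2_eq_square algebra_simps)
  qed
  \<comment> \<open>Cayley-Hamilton reduces the sum of the five powers to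
    \<open>?P + ?Q * g\<close>. As a polynomial of degree one it vanishes at the two different
    eigenvalues, so both coefficients are 0.\<close>
  have sum0: "g (g (g (g z))) = - z - g z - g (g z) - g (g (g z))" for z
  proof -
    let ?P = "1 - d - t * d - (t\<^sup>2 - d) * d" and ?Q = "1 + t + (t\<^sup>2 - d) + (t\<^sup>2 - d) * t - t * d"
    have "z + g z + g (g z) + g (g (g z)) + g (g (g (g z))) = ?P *s z + ?Q *s g z"
      unfolding ggg[of "g z"] unfolding ggg[of z] unfolding gg by (simp add: vec_eq_iff algebra_simps)
    moreover have "?P + ?Q * x = 0" if x: "x^5 = 1" "x \<noteq> 1" "x\<^sup>2 = t * x - d" "x^3 = (t\<^sup>2 - d) * x - t * d" for x
    proof -
      have "(x - 1) * (1 + x + x^2 + x^3 + x^4) = x ^ 5 - 1" by (simp add: eval_nat_numeral algebra_simps)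
      then have S: "1 + x + x^2 + x^3 + x^4 = 0" using x by simp
      have "x^4 = x * x^3" by (simp add: eval_nat_numeral)
      also have "\<dots> = (t\<^sup>2 - d) * x\<^sup>2 - t * d * x" unfolding x(4) by (simp add: power2_eq_square algebra_simps)
      finally have x4: "x^4 = (t\<^sup>2 - d) * (t * x - d) - t * d * x" unfolding x(3) .
      show ?thesis using S unfolding x4 x(4) x(3) by (simp add: algebra_simps)
    qed
    from this[OF a root(1) root3(1)] this[OF b root(2) root3(2)] have PQ: "?P + ?Q * \<alpha> = 0" "?P + ?Q * \<beta> = 0" by auto
    have "?Q * (\<alpha> - \<beta>) = (?P + ?Q * \<alpha>) - (?P + ?Q * \<beta>)" by (simp add: algebra_simps)
    then have "?Q * (\<alpha> - \<beta>) = 0" by (simp only: PQ diff_self)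
    then have "?Q = 0" using ab by simp
    then have "?P = 0" using PQ(1) by simp
    ultimately have "z + g z + g (g z) + g (g (g z)) + g (g (g (g z))) = 0" using \<open>?Q = 0\<close> by simp
    then show ?thesis by (simp add: eq_neg_iff_add_eq_0 algebra_simps)
  qed
  let ?P = "\<lambda>v. v 0 \<in> \<Lambda> \<and> v 1 = g (v 0) \<and> v 2 = g (g (v 0)) \<and> v 3 = g (g (g (v 0)))"
  have nd: "cmod d = 1" unfolding d_def ct(2)[symmetric] norm_mult using fr(6,7) by simp
  \<comment> \<open>The factor is nonzero because \<open>d \<noteq> 1\<close> and the eigenvalues
    are not real. Its sign is that of \<open>Im \<alpha> * Im \<beta>\<close>, which is left
    undetermined, so the orientation of this basis is not known.\<close>
  have volP: "4 * vol v = (cmod (dC (v 0) (g (v 0))))\<^sup>2 * (8 * (1 - Re d) * (Im \<alpha> * Im \<beta>))" if P: "?P v" for v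
  proof -
    let ?m = "dC (v 0) (g (v 0))"
    have dd: "d * cnj d = 1" using nd complex_norm_square[of d] by simp
    have v: "v 1 = g (v 0)" "v 2 = t *s g (v 0) - d *s v 0" "v 3 = (t\<^sup>2 - d) *s g (v 0) - (t * d) *s v 0"
      using P gg ggg by auto
    have m: "dC (v 0) (v 1) = ?m" "dC (v 0) (v 2) = t * ?m" "dC (v 0) (v 3) = (t\<^sup>2 - d) * ?m"
      "dC (v 1) (v 2) = d * ?m" "dC (v 1) (v 3) = t * d * ?m" "dC (v 2) (v 3) = d\<^sup>2 * ?m"
      by (simp_all only: v dC_def vector_minus_component vector_smult_component)
        (simp_all add: power2_eq_square algebra_simps)
    have tt: "t * cnj d = cnj t" "cnj t * d = t"
    proof -
      have ab1: "\<alpha> * cnj \<alpha> = 1" "\<beta> * cnj \<beta> = 1" using fr(6,7) complex_norm_square[of \<alpha>] complex_norm_square[of \<beta>] by auto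
      have "t * cnj d = (\<alpha> * cnj \<alpha>) * cnj \<beta> + (\<beta> * cnj \<beta>) * cnj \<alpha>"
        by (simp add: t_def d_def ct[symmetric] algebra_simps)
      then show 1: "t * cnj d = cnj t" unfolding ab1 by (simp add: t_def ct[symmetric])
      show "cnj t * d = t" using arg_cong[OF 1, of cnj] by simp
    qed
    have e: "t * t * cnj d = t * cnj t" "cnj t * cnj t * d = t * cnj t"
      using tt by (metis mult.assoc, metis mult.assoc mult.commute)
    have d2: "d * cnj d * d = d" "d * cnj d * cnj d = cnj d" "(d * cnj d) * (d * cnj d) = 1" using dd by simp_all
    have "complex_of_real (4 * vol v) = (?m * cnj ?m) * (cnj d * cnj d + d * d - (t * cnj t) * (cnj d + d)
        + (t * t * cnj d) + (cnj t * cnj t * d) - 2 * (d * cnj d))"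
      unfolding pf_dC[symmetric] pf_def m by (simp add: power2_eq_square algebra_simps)
    also have "\<dots> = (?m * cnj ?m) * ((d + cnj d)\<^sup>2 - 4 + (t * cnj t) * (2 - (d + cnj d)))"
      unfolding e dd using dd by (simp add: power2_eq_square algebra_simps)
    also have "\<dots> = of_real ((cmod ?m)\<^sup>2 * ((2 * Re d)\<^sup>2 - 4 + (cmod t)\<^sup>2 * (2 - 2 * Re d)))"
      by (simp only: complex_norm_square[symmetric] complex_add_cnj) simp
    finally have 1: "4 * vol v = (cmod ?m)\<^sup>2 * ((2 * Re d)\<^sup>2 - 4 + (cmod t)\<^sup>2 * (2 - 2 * Re d))" by (simp only: of_real_eq_iff)
    have a1: "(Re \<alpha>)\<^sup>2 + (Im \<alpha>)\<^sup>2 = 1" "(Re \<beta>)\<^sup>2 + (Im \<beta>)\<^sup>2 = 1" using fr(6,7) cmod_power2[of \<alpha>] cmod_power2[of \<beta>] by auto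
    have t2: "(cmod t)\<^sup>2 = 2 + 2 * (Re \<alpha> * Re \<beta> + Im \<alpha> * Im \<beta>)"
      unfolding cmod_power2 t_def ct(1)[symmetric] using a1 by (simp add: power2_eq_square algebra_simps)
    have "Re d = Re \<alpha> * Re \<beta> - Im \<alpha> * Im \<beta>" by (simp add: d_def ct(2)[symmetric])
    then have t3: "(cmod t)\<^sup>2 = 2 + 2 * Re d + 4 * (Im \<alpha> * Im \<beta>)" unfolding t2 by simp
    have "(2 * Re d)\<^sup>2 - 4 + (cmod t)\<^sup>2 * (2 - 2 * Re d) = 8 * (1 - Re d) * (Im \<alpha> * Im \<beta>)"
      unfolding t3 by (simp add: power2_eq_square algebra_simps)
    then show ?thesis using 1 by simp
  qed
  have ex: "\<exists>v. ?P v \<and> vol v \<noteq> 0"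
  proof -
    \<comment> \<open>If all lattice vectors were eigenvectors, polarisation and real linearity
      would extend this to all vectors; then \<open>g\<close> would be a scalar and its eigenvalues
      equal.\<close>
    have "\<exists>z\<in>\<Lambda>. dC z (g z) \<noteq> 0"
    proof (rule ccontr)
      assume "\<not> ?thesis"
      then have 0: "dC z (g z) = 0" if "z \<in> \<Lambda>" for z using that by blast
      have pol: "dC u (g v) + dC v (g u) = 0" if "u \<in> \<Lambda>" "v \<in> \<Lambda>" for u v
        using 0[OF lattice_add[OF that]] 0[OF that(1)] 0[OF that(2)] by (simp add: gl dC_linear add.commute)
      let ?f = "\<lambda>u v. dC u (g v) + dC v (g u)"
      have gs: "g (\<Sum>i<4. c i *\<^sub>R b i) = (\<Sum>i<4. c i *\<^sub>R g (b i))" for c and b :: "nat \<Rightarrow> complex^2"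
        using lin by (simp add: linear_sum linear_scale)
      have fl: "?f u (\<Sum>i<4. c i *\<^sub>R b i) = (\<Sum>i<4. of_real (c i) * ?f u (b i))" for u c and b :: "nat \<Rightarrow> complex^2"
        unfolding gs dC_sum dC_linear by (simp add: algebra_simps sum.distrib)
      have z1: "?f u z = 0" if "u \<in> \<Lambda>" for u z
        using fl[of u "crd z" b] pol[OF that b_in_lattice] by (simp add: sum_crd)
      have z2: "?f z u = 0" for z u using fl[of u "crd z" b] z1[OF b_in_lattice, of _ u] by (simp add: sum_crd add.commute)
      have z: "dC z (g z) = 0" for z using z2[of z z] by simp
      have e: "g (axis 1 1) $ 2 = 0" "g (axis 2 1) $ 1 = 0" using z[of "axis 1 1"] z[of "axis 2 1"] by (simp_all add: dC_def axis_def)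
      have "g (axis 1 1) $ 1 = g (axis 2 1) $ 2" using z2[of "axis 1 1" "axis 2 1"] e by (simp add: dC_def axis_def)
      then have "(\<alpha> + \<beta>)\<^sup>2 = 4 * (\<alpha> * \<beta>)"
        unfolding ct ctr_def cdet_def dC_def using e by (simp add: power2_eq_square)
      then have "(\<alpha> - \<beta>)\<^sup>2 = 0" by (simp add: power2_eq_square algebra_simps)
      then show False using ab by simp
    qed
    then obtain z where z: "z \<in> \<Lambda>" "dC z (g z) \<noteq> 0" by blast
    define v where "v k = (if k = 0 then z else if k = 1 then g z else if k = 2 then g (g z) else g (g (g z)))" for k :: nat
    have P: "?P v" using z by (simp add: v_def)
    have v0: "v 0 = z" by (simp add: v_def)
    have "Re d < 1"
    proof (rule ccontr)
      assume "\<not> Re d < 1"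
      moreover have "(Re d)\<^sup>2 + (Im d)\<^sup>2 = 1" using nd cmod_power2[of d] by simp
      moreover have "\<bar>Re d\<bar> \<le> 1" using abs_Re_le_cmod[of d] nd by simp
      ultimately have "Re d = 1" "Im d = 0" by auto
      then show False using d1 by (simp add: d_def complex_eq_iff)
    qed
    then have "4 * vol v \<noteq> 0" unfolding volP[OF P] v0 using z fr(4,5) by simp
    then have "vol v \<noteq> 0" by simp
    then show ?thesis using P by blast
  qed
  have PL: "v i \<in> \<Lambda>" if "?P v" "i < 4" for v and i :: nat using that g(2) by (auto simp: less_4_cases)
  have "\<exists>v. ?P v \<and> lattice_basis v \<Lambda>"
  proof (rule adapted_basis[OF ex])
    fix v y assume P: "?P v" and v: "vol v \<noteq> 0" and w: "(\<Sum>k<4. y k *\<^sub>R v k) \<in> \<Lambda>"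
    show "(\<forall>i<4. y i \<in> \<int>) \<or> (\<exists>v'. ?P v' \<and> vol v' \<noteq> 0 \<and> \<bar>vol v'\<bar> < \<bar>vol v\<bar>)"
    proof (rule disjCI)
      assume no: "\<nexists>v'. ?P v' \<and> vol v' \<noteq> 0 \<and> \<bar>vol v'\<bar> < \<bar>vol v\<bar>"
      \<comment> \<open>The five powers of \<open>g\<close> add up to 0, so a fifth coordinate 0 may
        be adjoined. Subtracting the rounded value of this coordinate from the others turns
        \<open>T\<close> into the form bounded in \<open>round_5\<close>.\<close>
      obtain k where k: "5 * (\<Sum>i<5. ((y(4 := 0)) i - of_int (k i))\<^sup>2) - (\<Sum>i<5. (y(4 := 0)) i - of_int (k i))\<^sup>2 < 4"
        using round_5[of "y(4 := 0)"] by blast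
      define u where "u i = y i - of_int (k i - k 4)" for i
      have l: "{..<5::nat} = {0, 1, 2, 3, 4}" by auto
      have T4: "T u < 4"
      proof -
        have "T u = 5 * (\<Sum>i<5. ((y(4 := 0)) i - of_int (k i))\<^sup>2) - (\<Sum>i<5. (y(4 := 0)) i - of_int (k i))\<^sup>2"
          by (simp add: l T_def S0_def c1_def c2_def u_def power2_eq_square algebra_simps)
        then show ?thesis using k by simp
      qed
      have T0: "T u \<ge> 0"
      proof -
        have "T u = (u 0)\<^sup>2 + (u 1)\<^sup>2 + (u 2)\<^sup>2 + (u 3)\<^sup>2 + (u 0 - u 1)\<^sup>2 + (u 0 - u 2)\<^sup>2 + (u 0 - u 3)\<^sup>2 + (u 1 - u 2)\<^sup>2 + (u 1 - u 3)\<^sup>2 + (u 2 - u 3)\<^sup>2"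
          by (simp add: T_def S0_def c1_def c2_def power2_eq_square algebra_simps)
        then show ?thesis by simp
      qed
      define x where "x = (\<Sum>k<4. u k *\<^sub>R v k)"
      have xe: "x = (\<Sum>k<4. y k *\<^sub>R v k) - (\<Sum>i<4. of_int (k i - k 4) *\<^sub>R v i)"
        unfolding x_def u_def by (simp only: scaleR_left_diff_distrib sum_subtractf)
      have "(\<Sum>i<4. of_int (k i - k 4) *\<^sub>R v i) \<in> \<Lambda>" by (rule lattice_int_comb) (rule PL[OF P])
      then have xL: "x \<in> \<Lambda>" unfolding xe by (rule lattice_diff[OF w])
      have xY: "x = Y u (v 0)" using P by (simp add: x_def Y_def lessThan_4 add_ac)
      have gY: "g (Y u z) = Y u (g z)" for z by (simp add: Y_def gl)
      let ?v = "\<lambda>k. Y u (v k)"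
      have P': "?P ?v" using P xL xY gY by simp
      have vv: "vol ?v = (cmod (cdet (Y u)))\<^sup>2 * vol v" by (rule vol_clinear2[OF Ycl])
      have "(T u)\<^sup>2 < 16" using power_strict_mono[OF T4 T0, of 2] by simp
      then have lt: "(cmod (cdet (Y u)))\<^sup>2 < 1" using N[of u] zero_le_power2[of "c1 u - c2 u"] by linarith
      have "(cmod (cdet (Y u)))\<^sup>2 = 0"
      proof (rule ccontr)
        assume "(cmod (cdet (Y u)))\<^sup>2 \<noteq> 0"
        from conjI[OF P' abs_mult_less[OF vv v zero_le_power2 lt this]]
        have "\<exists>v'. ?P v' \<and> vol v' \<noteq> 0 \<and> \<bar>vol v'\<bar> < \<bar>vol v\<bar>" by (rule exI[of _ ?v])
        with no show False by (rule notE)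
      qed
      \<comment> \<open>A vanishing norm makes \<open>T u / 2\<close> equal to the square root of 5
        times a rational number up to sign, so both sides are 0. Then \<open>T u\<close>, a sum of
        squares involving every coordinate, vanishes and so do the coordinates.\<close>
      then have "(T u)\<^sup>2 = 20 * (c1 u - c2 u)\<^sup>2" using N[of u] by simp
      then have sq: "(T u / 2)\<^sup>2 = 5 * (c1 u - c2 u)\<^sup>2" by (simp add: power_divide)
      \<comment> \<open>Cramer's rule: each coordinate is a quotient of volumes of lattice tuples,
        which are integral multiples of \<open>vol b\<close>.\<close>
      have rat: "u i \<in> \<rat>" if i: "i < 4" for i
      proof -
        obtain n1 :: int where n1: "vol v = of_int n1 * vol b" by (rule vol_lattice[of v, OF PL[OF P]])
        have "(v(i := x)) j \<in> \<Lambda>" if "j < 4" for j using xL PL[OF P that] by (cases "j = i") simp_all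
        then obtain n2 :: int where n2: "vol (v(i := x)) = of_int n2 * vol b" by (rule vol_lattice)
        have "(u i * of_int n1) * vol b = of_int n2 * vol b"
          using vol_replace[OF i x_def] unfolding n1 n2 by (simp only: mult.assoc)
        then have "u i * of_int n1 = of_int n2" using vol_nonzero by simp
        moreover have "real_of_int n1 \<noteq> 0" using v n1 by auto
        ultimately have "u i = of_int n2 / of_int n1" by (simp only: eq_divide_eq if_True) simp
        then show ?thesis by simp
      qed
      have r: "T u / 2 \<in> \<rat>" "c1 u - c2 u \<in> \<rat>"
        using rat[of 0] rat[of 1] rat[of 2] rat[of 3] by (simp_all add: T_def S0_def c1_def c2_def)
      have "c1 u - c2 u = 0" by (rule rational_square_5[OF r(1) sq r(2)])
      then have "T u = 0" using sq by simp
      then have "(u 0)\<^sup>2 + (u 1)\<^sup>2 + (u 2)\<^sup>2 + (u 3)\<^sup>2 + (u 0 - u 1)\<^sup>2 + (u 0 - u 2)\<^sup>2 + (u 0 - u 3)\<^sup>2 + (u 1 - u 2)\<^sup>2 + (u 1 - u 3)\<^sup>2 + (u 2 - u 3)\<^sup>2 = 0"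
        by (simp add: T_def S0_def c1_def c2_def power2_eq_square algebra_simps)
      then have "u 0 = 0" "u 1 = 0" "u 2 = 0" "u 3 = 0" by (simp_all add: add_nonneg_eq_0_iff)
      then have "\<forall>i<4. y i = of_int (k i - k 4)" by (auto simp: less_4_cases u_def)
      then show "\<forall>i<4. y i \<in> \<int>" by simp
    qed
  qed (rule PL)
  then obtain v where v: "?P v" "lattice_basis v \<Lambda>" by blast
  show thesis by (rule that[OF v(2)]; use v(1) sum0 in simp)
qed

end

section \<open>Coordinates on the cohomology lattice\<close>

text \<open>Coordinates in \<open>U\<^sup>3\<close> of the alternating form \<open>a\<close>; the sign \<open>s\<close> is the orientation of the basis.\<close>

definition U3_vec :: "'a::comm_ring_1 \<Rightarrow> (nat \<Rightarrow> nat \<Rightarrow> 'a) \<Rightarrow> 'a^(2+2+2)" where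
  "U3_vec s a = vcat (vec2 (s * a 0 1) (a 2 3)) (vcat (vec2 (- (s * a 0 2)) (a 1 3)) (vec2 (s * a 0 3) (a 1 2)))"

lemma U3_vec_nth [simp]:
  "U3_vec s a $ Inl 1 = s * a 0 1" "U3_vec s a $ Inl 2 = a 2 3"
  "U3_vec s a $ Inr (Inl 1) = - (s * a 0 2)" "U3_vec s a $ Inr (Inl 2) = a 1 3"
  "U3_vec s a $ Inr (Inr 1) = s * a 0 3" "U3_vec s a $ Inr (Inr 2) = a 1 2"
  by (simp_all add: U3_vec_def)

lemma gram_U3_pf:
  fixes s :: "'a::comm_ring_1"
  shows "gram_form gram_U3 (U3_vec s a) (U3_vec s c) = s * pf a c"
  by (simp add: gram_form_def small_vec pf_def algebra_simps)

lemma gram_U3_sym: "gram_U3 $ i $ j = gram_U3 $ j $ i"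
proof -
  have "\<forall>i j. gram_U3 $ i $ j = gram_U3 $ j $ i" by (simp add: small_vec)
  then show ?thesis by blast
qed

text \<open>Inverse to \<open>U3_vec s\<close> when \<open>s\<close> is a sign. Only the six entries
  above the diagonal are meaningful; all other index pairs receive the last value by
  default.\<close>

definition U3_form :: "'a::comm_ring_1 \<Rightarrow> 'a^(2+2+2) \<Rightarrow> nat \<Rightarrow> nat \<Rightarrow> 'a" where
  "U3_form s w i j = (if (i, j) = (0, 1) then s * w $ Inl 1 else if (i, j) = (2, 3) then w $ Inl 2
    else if (i, j) = (0, 2) then - (s * w $ Inr (Inl 1)) else if (i, j) = (1, 3) then w $ Inr (Inl 2)
    else if (i, j) = (0, 3) then s * w $ Inr (Inr 1) else w $ Inr (Inr 2))"

lemma U3_form_nth [simp]: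
  "U3_form s w 0 1 = s * w $ Inl 1" "U3_form s w 0 (Suc 0) = s * w $ Inl 1" "U3_form s w 2 3 = w $ Inl 2"
  "U3_form s w 0 2 = - (s * w $ Inr (Inl 1))" "U3_form s w 1 3 = w $ Inr (Inl 2)" "U3_form s w (Suc 0) 3 = w $ Inr (Inl 2)"
  "U3_form s w 0 3 = s * w $ Inr (Inr 1)" "U3_form s w 1 2 = w $ Inr (Inr 2)" "U3_form s w (Suc 0) 2 = w $ Inr (Inr 2)"
  by (simp_all add: U3_form_def)

lemma U3_vec_form: "s * s = 1 \<Longrightarrow> U3_vec s (U3_form s w) = w"
  by (simp add: vec_eq_iff small_vec mult.assoc[symmetric])

lemma U3_vec_eq_iff:
  fixes s :: "'a::comm_ring_1"
  assumes "s * s = 1"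
  shows "U3_vec s a = U3_vec s c \<longleftrightarrow> a 0 1 = c 0 1 \<and> a 0 2 = c 0 2 \<and> a 0 3 = c 0 3 \<and> a 1 2 = c 1 2 \<and> a 1 3 = c 1 3 \<and> a 2 3 = c 2 3"
proof -
  have "s * x = s * y \<longleftrightarrow> x = y" for x y using assms by (metis mult.assoc mult_1)
  then show ?thesis by (auto simp: vec_eq_iff small_vec)
qed

lemma wedge_lin:
  "wedge M (\<lambda>i j. a i j + c i j) = (\<lambda>i j. wedge M a i j + wedge M c i j)"
  "wedge M (\<lambda>i j. x * a i j) = (\<lambda>i j. x * wedge M a i j)"
  by (intro ext, simp add: wedge_def algebra_simps)+

lemma wedge_of_int: "wedge (\<lambda>i j. of_int (M i j)) (\<lambda>i j. of_int (a i j)) = (\<lambda>i j. of_int (wedge M a i j) :: complex)"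
  by (intro ext) (simp add: wedge_def)

lemma wedge_cong:
  assumes "a 0 1 = c 0 1" "a 0 2 = c 0 2" "a 0 3 = c 0 3" "a 1 2 = c 1 2" "a 1 3 = c 1 3" "a 2 3 = c 2 3"
  shows "wedge M a i j = wedge M c i j"
  by (simp only: wedge_def assms)

definition U3_act :: "'a::comm_ring_1 \<Rightarrow> (nat \<Rightarrow> nat \<Rightarrow> 'a) \<Rightarrow> 'a^(2+2+2) \<Rightarrow> 'a^(2+2+2)" where
  "U3_act s M w = U3_vec s (wedge M (U3_form s w))"

lemma U3_form_lin:
  "U3_form s (x + y) = (\<lambda>i j. U3_form s x i j + U3_form s y i j)" "U3_form s (r *s x) = (\<lambda>i j. r * U3_form s x i j)"
  by (intro ext, simp add: U3_form_def algebra_simps)+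

lemma U3_vec_lin:
  "U3_vec s (\<lambda>i j. a i j + c i j) = U3_vec s a + U3_vec s c" "U3_vec s (\<lambda>i j. r * a i j) = r *s U3_vec s a"
  by (simp_all add: vec_eq_iff small_vec algebra_simps)

lemma U3_act_lin: "U3_act s M (x + y) = U3_act s M x + U3_act s M y" "U3_act s M (r *s x) = r *s U3_act s M x"
  unfolding U3_act_def by (simp_all only: U3_form_lin wedge_lin U3_vec_lin)

lemma complex_extension_U3_act:
  "complex_extension (U3_act s M) w = U3_act (of_int s) (\<lambda>i j. of_int (M i j)) w"
proof (rule complex_extension_eqI[OF U3_act_lin(1)])
  show "clin (U3_act (of_int s) (\<lambda>i j. complex_of_int (M i j)))" by (simp only: clin_def U3_act_lin) simp
  fix x
  have 1: "U3_form (of_int s) (cvec x) = (\<lambda>i j. of_int (U3_form s x i j) :: complex)"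
    by (intro ext) (simp add: U3_form_def cvec_def)
  have 2: "U3_vec (of_int s) (\<lambda>i j. complex_of_int (a i j)) = cvec (U3_vec s a)" for a
    by (simp add: vec_eq_iff small_vec cvec_def)
  show "U3_act (of_int s) (\<lambda>i j. complex_of_int (M i j)) (cvec x) = cvec (U3_act s M x)"
    by (simp only: U3_act_def 1 wedge_of_int 2)
qed

context torus begin

definition U3_coords :: "(torus_point chain \<Rightarrow> int) set \<Rightarrow> int^(2+2+2)" where
  "U3_coords x = U3_vec \<epsilon> (Alt x)"

lemma Alt_exists: "\<exists>x\<in>H2. Alt x 0 1 = a01 \<and> Alt x 0 2 = a02 \<and> Alt x 0 3 = a03 \<and> Alt x 1 2 = a12 \<and> Alt x 1 3 = a13 \<and> Alt x 2 3 = a23"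
proof (rule Alt_surj[of "\<lambda>i j. if (i, j) = (0, 1) then a01 else if (i, j) = (0, 2) then a02 else if (i, j) = (0, 3) then a03 else
     if (i, j) = (1, 2) then a12 else if (i, j) = (1, 3) then a13 else a23"])
  fix x assume xH: "x \<in> H2" and x: "\<And>i j. i < j \<Longrightarrow> j < 4 \<Longrightarrow> Alt x i j =
    (if (i, j) = (0, 1) then a01 else if (i, j) = (0, 2) then a02 else if (i, j) = (0, 3) then a03 else
     if (i, j) = (1, 2) then a12 else if (i, j) = (1, 3) then a13 else a23)"
  show ?thesis
    using x[of 0 1] x[of 0 2] x[of 0 3] x[of 1 2] x[of 1 3] x[of 2 3] by (intro bexI[OF _ xH]) simp
qed

lemma Alt_mult: "x \<in> H2 \<Longrightarrow> y \<in> H2 \<Longrightarrow> i < 4 \<Longrightarrow> j < 4 \<Longrightarrow> Alt (x \<otimes>\<^bsub>H2_lattice \<Lambda>\<^esub> y) i j = Alt x i j + Alt y i j"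
  using alt_mult b_in_lattice by simp

lemma U3_coords_isometry: "U3_coords \<in> isometries (H2_lattice \<Lambda>) (gram_lattice gram_U3)"
proof (rule isometriesI)
  show "U3_coords \<in> hom (H2_lattice \<Lambda>) (gram_lattice gram_U3)"
    by (auto simp: hom_def gram_lattice_def U3_coords_def vec_eq_iff small_vec Alt_mult algebra_simps)
  fix x y assume xy: "x \<in> H2" "y \<in> H2"
  show "x = y" if "U3_coords x = U3_coords y"
    using that Alt_inj[OF xy] by (simp add: U3_coords_def U3_vec_eq_iff[OF \<epsilon>_sq])
  show "bform (H2_lattice \<Lambda>) x y = gram_form gram_U3 (U3_coords x) (U3_coords y)"
    unfolding U3_coords_def gram_U3_pf by (rule bform_pf[OF xy])
next
  fix v
  obtain x where "x \<in> H2" "Alt x 0 1 = U3_form \<epsilon> v 0 1 \<and> Alt x 0 2 = U3_form \<epsilon> v 0 2 \<and> Alt x 0 3 = U3_form \<epsilon> v 0 3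
    \<and> Alt x 1 2 = U3_form \<epsilon> v 1 2 \<and> Alt x 1 3 = U3_form \<epsilon> v 1 3 \<and> Alt x 2 3 = U3_form \<epsilon> v 2 3" using Alt_exists by blast
  then have "U3_coords x = v"
    unfolding U3_coords_def by (subst U3_vec_form[OF \<epsilon>_sq, of v, symmetric]) (simp only: U3_vec_eq_iff[OF \<epsilon>_sq])
  then show "\<exists>x\<in>H2. U3_coords x = v" using \<open>x \<in> H2\<close> by blast
qed

lemma U3_coords_nu:
  assumes L: "lattice_auto L L'" "\<And>z. s (proj z) = proj (L z)" and x: "x \<in> H2"
  shows "U3_coords (nu \<Lambda> s x) = U3_act \<epsilon> (gmat L) (U3_coords x)"
proof -
  have "wedge (gmat L) (U3_form \<epsilon> (U3_vec \<epsilon> (Alt x))) i j = wedge (gmat L) (Alt x) i j" for i j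
    by (rule wedge_cong) (use \<epsilon>_sq in \<open>simp_all add: mult.assoc[symmetric] del: One_nat_def\<close>)
  then show ?thesis
    unfolding U3_coords_def U3_act_def using Alt_nu[OF L x] by (simp add: U3_vec_eq_iff[OF \<epsilon>_sq])
qed

text \<open>The vector \<open>w\<close> is the class of dz1 dz2. It is an eigenvector because
  \<open>L\<close> scales that form, and \<open>pf_dC_0\<close> and \<open>pf_dC\<close> are its
  Riemann relations; the sign \<open>\<epsilon>\<close> cancels the orientation of the
  basis.\<close>

lemma period_vector:
  assumes L: "lattice_auto L L'"
  defines "w \<equiv> U3_vec (of_int \<epsilon>) (\<lambda>i j. dC (b i) (b j))"
  shows "U3_act (of_int \<epsilon>) (\<lambda>i j. of_int (gmat L i j)) w = cdet L *s w"
    "gram_form gram_U3 w w = 0" "Re (gram_form gram_U3 w (\<chi> i. cnj (w $ i))) > 0"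
proof -
  have eps: "complex_of_int \<epsilon> * of_int \<epsilon> = 1" using \<epsilon>_sq by (metis of_int_mult of_int_1)
  have cl: "clinear2 L" and LL: "\<And>z. z \<in> \<Lambda> \<Longrightarrow> L z \<in> \<Lambda>" using L by (auto simp: lattice_auto_def)
  have Lb: "L (b i) = (\<Sum>k<4. of_int (gmat L i k) *s b k)" if "i < 4" for i
    using mat_comb[OF LL that] by (simp add: scaleR_smult)
  have "wedge (\<lambda>i j. of_int (gmat L i j)) (\<lambda>i j. dC (b i) (b j)) i j = cdet L * dC (b i) (b j)" if "i < 4" "j < 4" for i j
  proof -
    have "cdet L * dC (b i) (b j) = dC (L (b i)) (L (b j))" by (rule dC_clinear2[OF cl, symmetric])
    also have "\<dots> = wedge (\<lambda>i j. of_int (gmat L i j)) (\<lambda>i j. dC (b i) (b j)) i j"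
      unfolding Lb[OF that(1)] Lb[OF that(2)] by (simp add: wedge_def lessThan_4 dC_def algebra_simps)
    finally show ?thesis by simp
  qed
  moreover have "wedge M (U3_form (of_int \<epsilon>) w) i j = wedge M (\<lambda>i j. dC (b i) (b j)) i j" for M i j
    by (rule wedge_cong) (use eps in \<open>simp_all add: w_def mult.assoc[symmetric] del: One_nat_def\<close>)
  ultimately show "U3_act (of_int \<epsilon>) (\<lambda>i j. of_int (gmat L i j)) w = cdet L *s w"
    unfolding U3_act_def by (simp add: w_def U3_vec_lin(2)[symmetric] U3_vec_eq_iff[OF eps])
  show "gram_form gram_U3 w w = 0" unfolding w_def gram_U3_pf pf_dC_0 by simp
  have "(\<chi> i. cnj (w $ i)) = U3_vec (of_int \<epsilon>) (\<lambda>i j. cnj (dC (b i) (b j)))"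
    unfolding w_def by (simp add: vec_eq_iff small_vec)
  then have "gram_form gram_U3 w (\<chi> i. cnj (w $ i)) = of_int \<epsilon> * of_real (4 * vol b)"
    unfolding w_def gram_U3_pf by (simp only: gram_U3_pf pf_dC)
  then have "Re (gram_form gram_U3 w (\<chi> i. cnj (w $ i))) = 4 * (of_int \<epsilon> * vol b)" by simp
  then show "Re (gram_form gram_U3 w (\<chi> i. cnj (w $ i))) > 0" using \<epsilon>_vol by simp
qed

text \<open>Any marking \<open>\<phi>\<close> differs from \<open>U3_coords\<close> by an isometry
  \<open>\<theta>\<close> of the target. It conjugates the action and carries the period vector
  along, so the dimension can be computed in the coordinates of the basis.\<close>

lemma family_dimension_eigenspace:
  assumes \<sigma>: "\<sigma> \<in> carrier (Aut0 \<Lambda>)" and L: "lattice_auto L L'" "\<And>z. \<sigma> (proj z) = proj (L z)"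
    and d: "(cdet L)\<^sup>2 \<noteq> 1 \<and> vec.dim {w. U3_act (of_int \<epsilon>) (\<lambda>i j. of_int (gmat L i j)) w = cdet L *s w} = Suc d \<or>
      cdet L = - 1 \<and> vec.dim {w. U3_act (of_int \<epsilon>) (\<lambda>i j. of_int (gmat L i j)) w = cdet L *s w} = Suc (Suc d)"
  shows "family_dimension \<Lambda> \<sigma> d"
proof -
  interpret H: comm_group "H2_lattice \<Lambda>" by (rule comm_group_H2)
  let ?\<psi> = "U3_coords" and ?M = "U3_act \<epsilon> (gmat L)" and ?G = "gram_lattice gram_U3"
  have cl: "clinear2 L" using L(1) by (simp add: lattice_auto_def)
  have \<psi>: "?\<psi> \<in> isometries (H2_lattice \<Lambda>) ?G" by (rule U3_coords_isometry)
  have nH: "nu \<Lambda> \<sigma> \<in> isometries (H2_lattice \<Lambda>) (H2_lattice \<Lambda>)" using nu_isometry[OF \<sigma>] by blast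
  have G: "carrier ?G = UNIV" "\<And>x y. x \<otimes>\<^bsub>?G\<^esub> y = x + y" "\<And>x y. bform ?G x y = gram_form gram_U3 x y"
    by (simp_all add: gram_lattice_def)
  have "projective_dimension (period_domain gram_U3 (\<lambda>x. \<phi> (nu \<Lambda> \<sigma> (inv_into H2 \<phi> x))) (form_eigenvalue \<Lambda> \<sigma>)) d"
    if \<phi>: "\<phi> \<in> isometries (H2_lattice \<Lambda>) ?G" for \<phi>
  proof -
    let ?i = "inv_into H2 \<phi>" and ?j = "inv_into H2 ?\<psi>"
    have ii: "?i \<in> isometries ?G (H2_lattice \<Lambda>)" "?j \<in> isometries ?G (H2_lattice \<Lambda>)"
      using isometries_inv[OF H.group_axioms] \<phi> \<psi> by auto
    have bij: "bij_betw \<phi> H2 UNIV" "bij_betw ?\<psi> H2 UNIV" using isometriesD(2)[OF \<phi>] isometriesD(2)[OF \<psi>] G by auto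
    have iH: "?i x \<in> H2" "?j x \<in> H2" for x
      using bij_betw_inv_into[OF bij(1)] bij_betw_inv_into[OF bij(2)] by (auto simp: bij_betw_def)
    have ji: "?j (?\<psi> x) = x" "?i (\<phi> x) = x" if "x \<in> H2" for x
      using that bij by (simp_all add: bij_betw_inv_into_left)
    have ij: "?\<psi> (?j x) = x" "\<phi> (?i x) = x" for x using bij by (simp_all add: bij_betw_inv_into_right)
    define \<theta> \<kappa> h' where "\<theta> = \<phi> \<circ> ?j" and "\<kappa> = ?\<psi> \<circ> ?i" and "h' = \<phi> \<circ> (nu \<Lambda> \<sigma> \<circ> ?i)"
    have iso: "\<theta> \<in> isometries ?G ?G" "\<kappa> \<in> isometries ?G ?G" "h' \<in> isometries ?G ?G"
      unfolding \<theta>_def \<kappa>_def h'_def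
      by (rule isometries_comp[OF ii(2) \<phi>] isometries_comp[OF ii(1) \<psi>] isometries_comp[OF isometries_comp[OF ii(1) nH] \<phi>])+
    have add: "f (x + y) = f x + f y" "gram_form gram_U3 (f x) (f y) = gram_form gram_U3 x y" if "f \<in> isometries ?G ?G" for f x y
      using isometriesD(1)[OF that] isometriesD(3)[OF that, of x y] by (auto simp: hom_def G)
    have inv: "\<kappa> (\<theta> x) = x" "\<theta> (\<kappa> x) = x" for x
      by (simp_all add: \<theta>_def \<kappa>_def ji ij iH)
    have nuH: "nu \<Lambda> \<sigma> x \<in> H2" if "x \<in> H2" for x using isometriesD(1)[OF nH] that by (auto simp: hom_def)
    have h': "h' x = \<theta> (?M (\<kappa> x))" for x
      by (simp add: h'_def \<theta>_def \<kappa>_def U3_coords_nu[OF L iH(1), symmetric] ji iH nuH)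
    let ?w = "U3_vec (of_int \<epsilon>) (\<lambda>i j. dC (b i) (b j)) :: complex^(2+2+2)"
    note w = period_vector[OF L(1)]
    note conj = dim_eigenspace_conj[OF add(1)[OF iso(1)] add(1)[OF iso(2)] U3_act_lin(1) inv h']
    have "projective_dimension (period_domain gram_U3 h' (cdet L)) d"
    proof (rule projective_dimensionI[OF gram_U3_sym add[OF iso(3)]])
      show "complex_extension h' (complex_extension \<theta> ?w) = cdet L *s complex_extension \<theta> ?w"
        unfolding conj(2) complex_extension_U3_act w(1) by (rule clin_smult[OF clin_complex_extension])
      show "gram_form gram_U3 (complex_extension \<theta> ?w) (complex_extension \<theta> ?w) = 0"
        unfolding complex_extension_isometry[OF add[OF iso(1)]] by (rule w(2))
      show "Re (gram_form gram_U3 (complex_extension \<theta> ?w) (\<chi> i. cnj (complex_extension \<theta> ?w $ i))) > 0"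
        unfolding complex_extension_cnj[symmetric] complex_extension_isometry[OF add[OF iso(1)]] by (rule w(3))
      show "(cdet L)\<^sup>2 \<noteq> 1 \<and> vec.dim {w. complex_extension h' w = cdet L *s w} = Suc d \<or>
        cdet L = - 1 \<and> vec.dim {w. complex_extension h' w = cdet L *s w} = Suc (Suc d)"
        unfolding conj(1) complex_extension_U3_act by (rule d)
    qed
    moreover have "h' = (\<lambda>x. \<phi> (nu \<Lambda> \<sigma> (?i x)))" by (simp add: h'_def comp_def)
    ultimately show ?thesis by (simp only: form_eigenvalue_eq[OF cl L(2)])
  qed
  then show ?thesis unfolding family_dimension_def marking_def using \<psi> by blast
qed

end

section \<open>The action of an automorphism in an adapted basis\<close>

text \<open>Alternating forms are represented by matrices whose entries on and below the diagonal
  are ignored.\<close>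

definition alt_eq :: "(nat \<Rightarrow> nat \<Rightarrow> 'a) \<Rightarrow> (nat \<Rightarrow> nat \<Rightarrow> 'a) \<Rightarrow> bool" where
  "alt_eq a c \<longleftrightarrow> a 0 1 = c 0 1 \<and> a 0 2 = c 0 2 \<and> a 0 3 = c 0 3 \<and> a 1 2 = c 1 2 \<and> a 1 3 = c 1 3 \<and> a 2 3 = c 2 3"

definition alt6 :: "'a \<Rightarrow> 'a \<Rightarrow> 'a \<Rightarrow> 'a \<Rightarrow> 'a \<Rightarrow> 'a \<Rightarrow> nat \<Rightarrow> nat \<Rightarrow> 'a" where
  "alt6 a01 a02 a03 a12 a13 a23 i j = (if (i, j) = (0, 1) then a01 else if (i, j) = (0, 2) then a02 else
     if (i, j) = (0, 3) then a03 else if (i, j) = (1, 2) then a12 else if (i, j) = (1, 3) then a13 else a23)"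

lemma alt6_simps [simp]:
  "alt6 a01 a02 a03 a12 a13 a23 0 (Suc 0) = a01" "alt6 a01 a02 a03 a12 a13 a23 0 2 = a02"
  "alt6 a01 a02 a03 a12 a13 a23 0 3 = a03" "alt6 a01 a02 a03 a12 a13 a23 (Suc 0) 2 = a12"
  "alt6 a01 a02 a03 a12 a13 a23 (Suc 0) 3 = a13" "alt6 a01 a02 a03 a12 a13 a23 2 3 = a23"
  by (simp_all add: alt6_def)

text \<open>The sign \<open>s\<close> relates \<open>L\<close> to the map \<open>g\<close> of order
  \<open>p\<close> whose matrix is \<open>M\<close>. It disappears in the exterior square, so
  cohomology can be computed with \<open>M\<close>.\<close>

locale torus_auto = torus +
  fixes \<sigma> :: "torus_point \<Rightarrow> torus_point" and L L' :: "complex^2 \<Rightarrow> complex^2" and M :: "nat \<Rightarrow> nat \<Rightarrow> int" and s :: int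
  assumes \<sigma>: "\<sigma> \<in> carrier (Aut0 \<Lambda>)" and L: "lattice_auto L L'" and lift: "\<And>z. \<sigma> (proj z) = proj (L z)"
    and M: "\<And>i k. i < 4 \<Longrightarrow> k < 4 \<Longrightarrow> gmat L i k = s * M i k" and s: "s * s = 1"
begin

abbreviation "T \<equiv> invariant_lattice \<Lambda> \<sigma>"
abbreviation "\<zeta> \<equiv> cdet L"
abbreviation "MC \<equiv> \<lambda>i j. complex_of_int (M i j)"
abbreviation "\<epsilon>C \<equiv> complex_of_int \<epsilon>"
abbreviation "eigenspace \<equiv> {w. U3_act \<epsilon>C (\<lambda>i j. of_int (gmat L i j)) w = \<zeta> *s w}"

lemma wedge_gmat:
  assumes "i < 4" "j < 4"
  shows "wedge (gmat L) a i j = wedge M a i j"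
    "wedge (\<lambda>i j. complex_of_int (gmat L i j)) c i j = wedge MC c i j"
proof -
  have m: "s * x * (s * y) = x * y" for x y using s by (metis mult.assoc mult.left_commute mult_1)
  have mC: "complex_of_int (s * x) * of_int (s * y) = of_int x * of_int y" for x y
    unfolding of_int_mult[symmetric] m ..
  show "wedge (gmat L) a i j = wedge M a i j" using assms by (simp only: wedge_def M m; simp add: M m)
  show "wedge (\<lambda>i j. complex_of_int (gmat L i j)) c i j = wedge MC c i j"
    using assms by (simp only: wedge_def M mC; simp add: M mC del: of_int_mult)
qed

lemma fixed_iff:
  assumes x: "x \<in> H2" shows "nu \<Lambda> \<sigma> x = x \<longleftrightarrow> alt_eq (wedge M (Alt x)) (Alt x)"
proof -
  have nx: "nu \<Lambda> \<sigma> x \<in> H2" using isometriesD(1)[of "nu \<Lambda> \<sigma>"] nu_isometry[OF \<sigma>] x by (auto simp: hom_def)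
  have a: "Alt (nu \<Lambda> \<sigma> x) i j = wedge M (Alt x) i j" if "i < 4" "j < 4" for i j
    using Alt_nu[OF L lift x that] wedge_gmat(1)[OF that] by simp
  show ?thesis
  proof
    assume e: "nu \<Lambda> \<sigma> x = x"
    show "alt_eq (wedge M (Alt x)) (Alt x)" unfolding alt_eq_def using a unfolding e by simp
  next
    assume "alt_eq (wedge M (Alt x)) (Alt x)"
    then show "nu \<Lambda> \<sigma> x = x" using a by (intro Alt_inj[OF nx x]) (simp_all add: alt_eq_def)
  qed
qed

lemma carrier_T: "carrier T = {x \<in> H2. alt_eq (wedge M (Alt x)) (Alt x)}"
  using invariant_carrier[OF \<sigma>] fixed_iff by auto

lemma T_simps: "monoid.mult T = monoid.mult (H2_lattice \<Lambda>)" "bform T = bform (H2_lattice \<Lambda>)"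
  by (simp_all add: invariant_lattice_def)

lemma group_T: "group T"
proof -
  interpret H: comm_group "H2_lattice \<Lambda>" by (rule comm_group_H2)
  have hom: "nu \<Lambda> \<sigma> \<in> hom (H2_lattice \<Lambda>) (H2_lattice \<Lambda>)" using isometriesD(1) nu_isometry[OF \<sigma>] by blast
  interpret n: group_hom "H2_lattice \<Lambda>" "H2_lattice \<Lambda>" "nu \<Lambda> \<sigma>" by unfold_locales (rule hom)
  have "subgroup {x \<in> H2. nu \<Lambda> \<sigma> x = x} (H2_lattice \<Lambda>)"
    by (rule H.subgroupI) (auto intro: exI[of _ "\<one>\<^bsub>H2_lattice \<Lambda>\<^esub>"])
  then have "group (H2_lattice \<Lambda>\<lparr>carrier := {x \<in> H2. nu \<Lambda> \<sigma> x = x}\<rparr>)" by (rule subgroup.subgroup_is_group) (rule H.group_axioms)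
  moreover have "H2_lattice \<Lambda>\<lparr>carrier := {x \<in> H2. nu \<Lambda> \<sigma> x = x}\<rparr> = T"
    using invariant_carrier[OF \<sigma>] by (simp add: invariant_lattice_def)
  ultimately show ?thesis by simp
qed

text \<open>The invariant classes are the integral solutions of a linear system. Once
  \<open>F\<close> parametrises them bijectively, the Gram matrix is read off from the Pfaffian
  pairing.\<close>

lemma invariant_isometry:
  fixes F :: "int^'n \<Rightarrow> nat \<Rightarrow> nat \<Rightarrow> int"
  assumes sol: "\<And>a :: nat \<Rightarrow> nat \<Rightarrow> int. alt_eq (wedge M a) a \<longleftrightarrow> (\<exists>v. alt_eq a (F v))"
    and add: "\<And>v w. alt_eq (F (v + w)) (\<lambda>i j. F v i j + F w i j)"
    and inj: "\<And>v w. alt_eq (F v) (F w) \<Longrightarrow> v = w"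
    and form: "\<And>v w. \<epsilon> * pf (F v) (F w) = gram_form N v w"
  shows "\<exists>c. c \<in> isometries T (gram_lattice N)"
proof -
  interpret H: comm_group "H2_lattice \<Lambda>" by (rule comm_group_H2)
  interpret T: group T by (rule group_T)
  define c where "c x = (SOME v. alt_eq (Alt x) (F v))" for x
  have sym: "alt_eq a d \<Longrightarrow> alt_eq d a" and trans: "alt_eq a d \<Longrightarrow> alt_eq d e \<Longrightarrow> alt_eq a e" for a d e :: "nat \<Rightarrow> nat \<Rightarrow> int"
    by (simp_all add: alt_eq_def)
  have c: "alt_eq (Alt x) (F (c x))" if "x \<in> carrier T" for x
    unfolding c_def by (rule someI_ex) (use that sol carrier_T in blast)
  have cu: "c x = v" if "x \<in> carrier T" "alt_eq (Alt x) (F v)" for x v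
    by (rule inj) (rule trans[OF sym[OF c[OF that(1)]] that(2)])
  have TH: "x \<in> H2" if "x \<in> carrier T" for x using that carrier_T by blast
  have "c \<in> isometries T (gram_lattice N)"
  proof (rule isometriesI)
    show "c \<in> hom T (gram_lattice N)"
    proof (rule homI)
      fix x y assume xy: "x \<in> carrier T" "y \<in> carrier T"
      have "alt_eq (Alt (x \<otimes>\<^bsub>T\<^esub> y)) (F (c x + c y))"
        using c[OF xy(1)] c[OF xy(2)] add[of "c x" "c y"] Alt_mult[OF TH[OF xy(1)] TH[OF xy(2)]]
        by (simp add: alt_eq_def T_simps)
      then have "c (x \<otimes>\<^bsub>T\<^esub> y) = c x + c y" by (rule cu[OF T.m_closed[OF xy]])
      then show "c (x \<otimes>\<^bsub>T\<^esub> y) = c x \<otimes>\<^bsub>gram_lattice N\<^esub> c y" by (simp add: gram_lattice_def)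
    qed (simp add: gram_lattice_def)
    fix x y assume xy: "x \<in> carrier T" "y \<in> carrier T"
    show "x = y" if "c x = c y"
    proof -
      have "alt_eq (Alt x) (Alt y)" using c[OF xy(1)] c[OF xy(2)] unfolding that by (rule trans[OF _ sym])
      then show ?thesis using Alt_inj[OF TH[OF xy(1)] TH[OF xy(2)]] by (simp add: alt_eq_def)
    qed
    have "pf (Alt x) (Alt y) = pf (F (c x)) (F (c y))"
      using c[OF xy(1)] c[OF xy(2)] unfolding pf_def alt_eq_def by (elim conjE) (simp only:)
    then show "bform T x y = gram_form N (c x) (c y)"
      using bform_pf[OF TH[OF xy(1)] TH[OF xy(2)]] form by (simp add: T_simps)
  next
    fix v
    obtain x where x: "x \<in> H2" "alt_eq (Alt x) (F v)"
      using Alt_exists[of "F v 0 1" "F v 0 2" "F v 0 3" "F v 1 2" "F v 1 3" "F v 2 3"] unfolding alt_eq_def by blast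
    then have "x \<in> carrier T" using carrier_T sol by blast
    then show "\<exists>x\<in>carrier T. c x = v" using cu x(2) by blast
  qed
  then show ?thesis by blast
qed

lemma eigenspace_iff:
  "U3_act \<epsilon>C (\<lambda>i j. of_int (gmat L i j)) w = \<zeta> *s w \<longleftrightarrow>
   alt_eq (wedge MC (U3_form \<epsilon>C w)) (\<lambda>i j. \<zeta> * U3_form \<epsilon>C w i j)"
proof -
  have eps: "\<epsilon>C * \<epsilon>C = 1" using \<epsilon>_sq by (metis of_int_mult of_int_1)
  have "\<zeta> *s w = U3_vec \<epsilon>C (\<lambda>i j. \<zeta> * U3_form \<epsilon>C w i j)"
    unfolding U3_vec_lin U3_vec_form[OF eps] ..
  then show ?thesis unfolding U3_act_def by (simp only: U3_vec_eq_iff[OF eps] alt_eq_def) (simp add: wedge_gmat)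
qed

lemma eigenspace_dim:
  fixes A :: "complex^'k \<Rightarrow> nat \<Rightarrow> nat \<Rightarrow> complex"
  assumes sol: "\<And>a. alt_eq (wedge MC a) (\<lambda>i j. \<zeta> * a i j) \<longleftrightarrow> (\<exists>v. alt_eq a (A v))"
    and lin: "\<And>v w. alt_eq (A (v + w)) (\<lambda>i j. A v i j + A w i j)" "\<And>r v. alt_eq (A (r *s v)) (\<lambda>i j. r * A v i j)"
    and inj: "\<And>v. alt_eq (A v) (\<lambda>i j. 0) \<Longrightarrow> v = 0"
  shows "vec.dim eigenspace = CARD('k)"
proof (rule dim_param)
  have eps: "\<epsilon>C * \<epsilon>C = 1" using \<epsilon>_sq by (metis of_int_mult of_int_1)
  have cong: "U3_vec \<epsilon>C a = U3_vec \<epsilon>C d \<longleftrightarrow> alt_eq a d" for a d by (simp only: U3_vec_eq_iff[OF eps] alt_eq_def)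
  show "clin (\<lambda>v. U3_vec \<epsilon>C (A v))"
    unfolding clin_def U3_vec_lin[symmetric] cong using lin by blast
  show "v = 0" if "U3_vec \<epsilon>C (A v) = 0" for v
  proof -
    have "U3_vec \<epsilon>C (\<lambda>i j. 0) = 0" by (simp add: vec_eq_iff small_vec)
    then have "U3_vec \<epsilon>C (A v) = U3_vec \<epsilon>C (\<lambda>i j. 0)" using that by simp
    then show ?thesis unfolding cong by (rule inj)
  qed
  show "range (\<lambda>v. U3_vec \<epsilon>C (A v)) = eigenspace"
  proof (intro equalityI subsetI)
    fix w assume "w \<in> range (\<lambda>v. U3_vec \<epsilon>C (A v))"
    then obtain v where "w = U3_vec \<epsilon>C (A v)" by blast
    then have "alt_eq (U3_form \<epsilon>C w) (A v)" by (simp only: cong[symmetric] U3_vec_form[OF eps])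
    then show "w \<in> eigenspace" unfolding mem_Collect_eq eigenspace_iff sol by blast
  next
    fix w assume "w \<in> eigenspace"
    then obtain v where "alt_eq (U3_form \<epsilon>C w) (A v)" unfolding mem_Collect_eq eigenspace_iff sol by blast
    then have "w = U3_vec \<epsilon>C (A v)" by (simp only: cong[symmetric] U3_vec_form[OF eps])
    then show "w \<in> range (\<lambda>v. U3_vec \<epsilon>C (A v))" by blast
  qed
qed

text \<open>The period vector shows that the eigenspace is not 0; the hypothesis says that the
  single coordinate \<open>n\<close> determines its elements.\<close>

lemma eigenspace_dim_1:
  assumes inj: "\<And>w. alt_eq (wedge MC (U3_form \<epsilon>C w)) (\<lambda>i j. \<zeta> * U3_form \<epsilon>C w i j) \<Longrightarrow> w $ n = 0 \<Longrightarrow> alt_eq (U3_form \<epsilon>C w) (\<lambda>i j. 0)"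
  shows "vec.dim eigenspace = 1"
proof (rule dim_eq_1I)
  have eps: "\<epsilon>C * \<epsilon>C = 1" using \<epsilon>_sq by (metis of_int_mult of_int_1)
  let ?w = "U3_vec \<epsilon>C (\<lambda>i j. dC (b i) (b j))"
  have z: "U3_act \<epsilon>C N 0 = 0" for N using U3_act_lin(2)[of \<epsilon>C N 0 0] by simp
  show "vec.subspace eigenspace"
    unfolding vec.subspace_def by (simp add: U3_act_lin z vec.scale_right_distrib mult.commute)
  show "?w \<in> eigenspace" using period_vector(1)[OF L] by simp
  show "?w \<noteq> 0"
  proof
    assume "?w = 0"
    then show False using period_vector(3)[OF L] by (simp add: gram_form_bilinear)
  qed
  fix w assume "w \<in> eigenspace" and n: "w $ n = 0"
  then have "alt_eq (U3_form \<epsilon>C w) (\<lambda>i j. 0)" using inj eigenspace_iff by blast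
  then have "U3_vec \<epsilon>C (U3_form \<epsilon>C w) = U3_vec \<epsilon>C (\<lambda>i j. 0)" by (simp only: U3_vec_eq_iff[OF eps] alt_eq_def)
  moreover have "U3_vec \<epsilon>C (\<lambda>i j. 0) = 0" by (simp add: vec_eq_iff small_vec)
  ultimately show "w = 0" unfolding U3_vec_form[OF eps] by simp
qed

section \<open>The five normal forms and their invariants\<close>

lemma family_dimensionI:
  assumes "\<zeta>\<^sup>2 \<noteq> 1 \<and> vec.dim eigenspace = Suc d \<or>
    \<zeta> = - 1 \<and> vec.dim eigenspace = Suc (Suc d)"
  shows "family_dimension \<Lambda> \<sigma> d"
  by (rule family_dimension_eigenspace[OF \<sigma> L lift assms])

lemma invariantsI:
  fixes N :: "int^'n^'n"
  assumes "c \<in> isometries T (gram_lattice N)" "CARD('n) = r" "family_dimension \<Lambda> \<sigma> d" "has_length T p a"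
  shows "invariants \<Lambda> \<sigma> p (p, r, d, a) \<and> isometric T (gram_lattice N)"
  using assms has_rank_gram[OF assms(1)] by (auto simp: invariants_def isometric_def)

text \<open>The class with only the entry \<open>a 2 3\<close> is isotropic and pairs to
  \<open>k\<close>, up to sign, with the solution given by \<open>u = 1\<close>. Adding
  \<open>K\<close> to the last entry of that solution makes it isotropic too, and the factor
  \<open>\<epsilon>\<close> on the other generator fixes the sign.\<close>

lemma hyperbolic_isometry:
  fixes k qa qb qc qd K :: int
  assumes sol: "\<And>a :: nat \<Rightarrow> nat \<Rightarrow> int. alt_eq (wedge M a) a \<longleftrightarrow>
      (\<exists>u. a 0 1 = k * u \<and> a 0 2 = qa * u \<and> a 0 3 = qb * u \<and> a 1 2 = qc * u \<and> a 1 3 = qd * u)"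
    and k: "k \<noteq> 0" and K: "K * k = qa * qd - qb * qc"
  shows "\<exists>c. c \<in> isometries T (gram_lattice (scaled gram_U k))"
proof -
  let ?F = "\<lambda>v :: int^2. alt6 (k * v $ 1) (qa * v $ 1) (qb * v $ 1) (qc * v $ 1) (qd * v $ 1) (\<epsilon> * v $ 2 + K * v $ 1)"
  show ?thesis
  proof (rule invariant_isometry[where F = ?F])
    fix a :: "nat \<Rightarrow> nat \<Rightarrow> int"
    show "alt_eq (wedge M a) a \<longleftrightarrow> (\<exists>v. alt_eq a (?F v))"
    proof
      assume "alt_eq (wedge M a) a"
      then obtain u where "a 0 1 = k * u" "a 0 2 = qa * u" "a 0 3 = qb * u" "a 1 2 = qc * u" "a 1 3 = qd * u" unfolding sol by blast
      then show "\<exists>v. alt_eq a (?F v)" using \<epsilon>_sq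
        by (intro exI[of _ "vec2 u (\<epsilon> * (a 2 3 - K * u))"]) (simp add: alt_eq_def mult.assoc[symmetric])
    next
      assume "\<exists>v. alt_eq a (?F v)"
      then show "alt_eq (wedge M a) a" unfolding sol by (auto simp: alt_eq_def)
    qed
  next
    fix v w :: "int^2" assume A: "alt_eq (?F v) (?F w)"
    have v1: "v $ 1 = w $ 1" using A k by (simp add: alt_eq_def)
    have "v $ 2 = w $ 2" using A v1 \<epsilon>_sq by (auto simp: alt_eq_def)
    then show "v = w" using v1 by (simp add: vec_eq_iff small_vec)
  next
    fix v w :: "int^2"
    have "pf (?F v) (?F w) = k * \<epsilon> * (v $ 1 * w $ 2 + v $ 2 * w $ 1) + 2 * (K * k - (qa * qd - qb * qc)) * (v $ 1 * w $ 1)"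
      by (simp add: pf_def algebra_simps)
    then have "\<epsilon> * pf (?F v) (?F w) = k * (\<epsilon> * \<epsilon>) * (v $ 1 * w $ 2 + v $ 2 * w $ 1)" unfolding K by simp
    then show "\<epsilon> * pf (?F v) (?F w) = gram_form (scaled gram_U k) v w"
      unfolding \<epsilon>_sq by (simp add: gram_form_def small_vec algebra_simps)
  qed (simp add: alt_eq_def algebra_simps)
qed

lemma scaled_1: "scaled N 1 = N"
  by (simp add: scaled_def vec_eq_iff)

lemma involution_case:
  assumes z: "\<zeta> = - 1" and M: "M = (\<lambda>i k. [[1, 0, 0, 0], [0, 1, 0, 0], [n0, n1, - 1, 0], [m0, m1, 0, - 1]] ! i ! k)"
  shows "invariants \<Lambda> \<sigma> 2 (2, 2, 2, 0) \<and> isometric T (gram_lattice gram_U) \<or>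
     invariants \<Lambda> \<sigma> 2 (2, 2, 2, 2) \<and> isometric T (gram_lattice (scaled gram_U 2)) \<or>
     invariants \<Lambda> \<sigma> 2 (2, 2, 2, 2) \<and> isometric T (gram_lattice (gram_single 2 \<oplus>\<^sub>L gram_single (-2)))"
proof -
  have dim: "family_dimension \<Lambda> \<sigma> 2"
  proof (rule family_dimensionI, rule disjI2, rule conjI[OF z])
    let ?A = "\<lambda>v :: complex^(2+2). alt6 0 (v $ Inl 1) (v $ Inl 2) (v $ Inr 1) (v $ Inr 2)
      (- (of_int m0 * v $ Inl 1 - of_int n0 * v $ Inl 2 + of_int m1 * v $ Inr 1 - of_int n1 * v $ Inr 2) / 2)"
    have "vec.dim eigenspace = CARD(2+2)"
    proof (rule eigenspace_dim[where A = ?A])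
      fix a :: "nat \<Rightarrow> nat \<Rightarrow> complex"
      let ?r = "of_int m0 * a 0 2 - of_int n0 * a 0 3 + of_int m1 * a 1 2 - of_int n1 * a 1 3"
      have "alt_eq (wedge MC a) (\<lambda>i j. \<zeta> * a i j) \<longleftrightarrow> a 0 1 = 0 \<and> a 2 3 = - ?r / 2"
      proof
        assume A: "alt_eq (wedge MC a) (\<lambda>i j. \<zeta> * a i j)"
        have a01: "a 0 1 = 0" using A by (simp add: alt_eq_def wedge_def M z)
        then have h: "?r + a 2 3 = - a 2 3" using A by (simp add: alt_eq_def wedge_def M z algebra_simps)
        then have "?r = - 2 * a 2 3" by (simp add: eq_neg_iff_add_eq_0 add.assoc flip: mult_2)
        with a01 show "a 0 1 = 0 \<and> a 2 3 = - ?r / 2" by simp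
      next
        assume h: "a 0 1 = 0 \<and> a 2 3 = - ?r / 2"
        then have "?r + a 2 3 = - a 2 3" by (simp add: field_simps)
        then show "alt_eq (wedge MC a) (\<lambda>i j. \<zeta> * a i j)" using h by (simp add: alt_eq_def wedge_def M z) (simp add: algebra_simps)
      qed
      also have "\<dots> \<longleftrightarrow> (\<exists>v. alt_eq a (?A v))"
      proof
        assume "a 0 1 = 0 \<and> a 2 3 = - ?r / 2"
        then show "\<exists>v. alt_eq a (?A v)"
          by (intro exI[of _ "vcat (vec2 (a 0 2) (a 0 3)) (vec2 (a 1 2) (a 1 3))"]) (simp add: alt_eq_def)
      qed (auto simp: alt_eq_def)
      finally show "alt_eq (wedge MC a) (\<lambda>i j. \<zeta> * a i j) \<longleftrightarrow> (\<exists>v. alt_eq a (?A v))" .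
    qed (auto simp: alt_eq_def field_simps vec_eq_iff small_vec)
    then show "vec.dim eigenspace = Suc (Suc 2)" by simp
  qed
  have sol: "alt_eq (wedge M a) a \<longleftrightarrow> 2 * a 0 2 = n1 * a 0 1 \<and> 2 * a 0 3 = m1 * a 0 1 \<and> 2 * a 1 2 = - (n0 * a 0 1) \<and> 2 * a 1 3 = - (m0 * a 0 1)" (is "_ \<longleftrightarrow> ?S a")
    for a :: "nat \<Rightarrow> nat \<Rightarrow> int"
  proof
    assume "alt_eq (wedge M a) a"
    then show "?S a" by (simp add: alt_eq_def wedge_def M)
  next
    assume S: "?S a"
    have "2 * ((n0 * m1 - n1 * m0) * a 0 1 + m0 * a 0 2 - n0 * a 0 3 + m1 * a 1 2 - n1 * a 1 3)
      = 2 * ((n0 * m1 - n1 * m0) * a 0 1) + m0 * (2 * a 0 2) - n0 * (2 * a 0 3) + m1 * (2 * a 1 2) - n1 * (2 * a 1 3)"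
      by (simp add: algebra_simps)
    also have "\<dots> = 0" using S by (simp add: algebra_simps)
    finally have "(n0 * m1 - n1 * m0) * a 0 1 + m0 * a 0 2 - n0 * a 0 3 + m1 * a 1 2 - n1 * a 1 3 = 0" by simp
    then show "alt_eq (wedge M a) a" using S by (simp add: alt_eq_def wedge_def M algebra_simps)
  qed
  \<comment> \<open>If the gluing data are even, the entry \<open>a 0 1\<close> is free and the
    lattice is U. Otherwise it must be even, and the parity of the minor \<open>N\<close> decides
    whether the second generator can be made isotropic.\<close>
  show ?thesis
  proof (cases "even n0 \<and> even n1 \<and> even m0 \<and> even m1")
    case True
    then obtain k0 k1 l0 l1 where k: "n0 = 2 * k0" "n1 = 2 * k1" "m0 = 2 * l0" "m1 = 2 * l1" by (auto elim!: evenE)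
    have "\<exists>c. c \<in> isometries T (gram_lattice (scaled gram_U 1))"
      by (rule hyperbolic_isometry[where qa = k1 and qb = l1 and qc = "- k0" and qd = "- l0" and K = "l1 * k0 - k1 * l0"])
        (auto simp: sol k)
    then obtain c where c: "c \<in> isometries T (gram_lattice gram_U)" unfolding scaled_1 by blast
    have "has_length T 2 0" by (rule length_U[OF _ group_T c]) simp
    from invariantsI[OF c _ dim this, of 2] show ?thesis by simp
  next
    case False
    have ev: "even (a 0 1)" if "alt_eq (wedge M a) a" for a
    proof -
      have "2 * a 0 2 = n1 * a 0 1" "2 * a 0 3 = m1 * a 0 1" "2 * (- a 1 2) = n0 * a 0 1" "2 * (- a 1 3) = m0 * a 0 1"
        using that unfolding sol by auto
      then have "even (n1 * a 0 1)" "even (m1 * a 0 1)" "even (n0 * a 0 1)" "even (m0 * a 0 1)" by (metis dvd_triv_left)+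
      then show ?thesis using False by auto
    qed
    define N where "N = n0 * m1 - n1 * m0"
    show ?thesis
    proof (cases "even N")
      case True
      then obtain K where K: "n0 * m1 - n1 * m0 = 2 * K" unfolding N_def by (rule evenE)
      have "alt_eq (wedge M a) a \<longleftrightarrow> (\<exists>u. a 0 1 = 2 * u \<and> a 0 2 = n1 * u \<and> a 0 3 = m1 * u \<and> a 1 2 = - n0 * u \<and> a 1 3 = - m0 * u)"
        for a :: "nat \<Rightarrow> nat \<Rightarrow> int"
      proof
        assume a: "alt_eq (wedge M a) a"
        obtain u where "a 0 1 = 2 * u" using ev[OF a] by (rule evenE)
        then show "\<exists>u. a 0 1 = 2 * u \<and> a 0 2 = n1 * u \<and> a 0 3 = m1 * u \<and> a 1 2 = - n0 * u \<and> a 1 3 = - m0 * u"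
          using a unfolding sol by (intro exI[of _ u]) simp
      qed (auto simp: sol)
      then have "\<exists>c. c \<in> isometries T (gram_lattice (scaled gram_U 2))"
        by (rule hyperbolic_isometry[where K = K]) (use K in \<open>simp_all add: algebra_simps\<close>)
      then obtain c where c: "c \<in> isometries T (gram_lattice (scaled gram_U 2))" by blast
      have "has_length T 2 2" by (rule length_Uk[OF _ group_T]) (use c in simp_all)
      from invariantsI[OF c _ dim this, of 2] show ?thesis by simp
    next
      case False
      \<comment> \<open>For odd \<open>N\<close> the generator cannot be made isotropic. The sign
        \<open>\<epsilon>\<close> is added so that the square of the corrected generator becomes 2
        in the intersection form.\<close>
      then have "even (N + \<epsilon>)" by (auto simp: \<epsilon>_def)
      then obtain K where "N + \<epsilon> = 2 * K" by (rule evenE)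
      then have K: "n0 * m1 - n1 * m0 = 2 * K - \<epsilon>" by (simp add: N_def)
      \<comment> \<open>With \<open>t = v $ Inr 1\<close> the quadratic form is 2 u^2 + 4 \<epsilon>
        u t = 2 (u + \<epsilon> t)^2 - 2 t^2, so the first coordinate stands for u + \<epsilon>
        t.\<close>
      let ?u = "\<lambda>v :: int^(1+1). v $ Inl 1 - \<epsilon> * v $ Inr 1"
      let ?F = "\<lambda>v. alt6 (2 * ?u v) (n1 * ?u v) (m1 * ?u v) (- (n0 * ?u v)) (- (m0 * ?u v)) (v $ Inr 1 + K * ?u v)"
      have "\<exists>c. c \<in> isometries T (gram_lattice (gram_single 2 \<oplus>\<^sub>L gram_single (-2)))"
      proof (rule invariant_isometry[where F = ?F])
        fix a :: "nat \<Rightarrow> nat \<Rightarrow> int"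
        show "alt_eq (wedge M a) a \<longleftrightarrow> (\<exists>v. alt_eq a (?F v))"
        proof
          assume a: "alt_eq (wedge M a) a"
          obtain u where u: "a 0 1 = 2 * u" using ev[OF a] by (rule evenE)
          show "\<exists>v. alt_eq a (?F v)" using a u unfolding sol
            by (intro exI[of _ "vcat (vec1 (u + \<epsilon> * (a 2 3 - K * u))) (vec1 (a 2 3 - K * u))"]) (simp add: alt_eq_def)
        next
        assume "\<exists>v. alt_eq a (?F v)"
        then show "alt_eq (wedge M a) a" unfolding sol by (auto simp: alt_eq_def)
      qed
      next
        fix v w :: "int^(1+1)" assume "alt_eq (?F v) (?F w)"
        then have u: "?u v = ?u w" and "v $ Inr 1 + K * ?u v = w $ Inr 1 + K * ?u w" by (simp_all add: alt_eq_def)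
        then have "v $ Inr 1 = w $ Inr 1" by simp
        then show "v = w" using u by (simp add: vec_eq_iff small_vec)
      next
        fix v w :: "int^(1+1)"
        define u1 u2 where "u1 = ?u v" and "u2 = ?u w"
        have "pf (?F v) (?F w) = 2 * (u1 * w $ Inr 1 + v $ Inr 1 * u2) + 2 * (2 * K - (n0 * m1 - n1 * m0)) * (u1 * u2)"
          unfolding u1_def[symmetric] u2_def[symmetric] by (simp add: pf_def algebra_simps)
        then have "\<epsilon> * pf (?F v) (?F w) = 2 * \<epsilon> * (u1 * w $ Inr 1 + v $ Inr 1 * u2) + 2 * (\<epsilon> * \<epsilon>) * (u1 * u2)"
          unfolding K by (simp add: algebra_simps)
        also have "\<dots> = 2 * (v $ Inl 1 * w $ Inl 1) - 2 * (\<epsilon> * \<epsilon>) * (v $ Inr 1 * w $ Inr 1)"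
          unfolding u1_def u2_def \<epsilon>_sq using \<epsilon>_sq by (simp add: algebra_simps)
        finally show "\<epsilon> * pf (?F v) (?F w) = gram_form (gram_single 2 \<oplus>\<^sub>L gram_single (-2)) v w"
          unfolding \<epsilon>_sq by (simp add: gram_form_def small_vec)
      qed (simp add: alt_eq_def algebra_simps)
      then obtain c where c: "c \<in> isometries T (gram_lattice (gram_single 2 \<oplus>\<^sub>L gram_single (-2)))" by blast
      have "has_length T 2 2" by (rule length_2m2[OF group_T c])
      from invariantsI[OF c _ dim this, of 2] show ?thesis by simp
    qed
  qed
qed

text \<open>The part of the invariant lattice complementary to U is negative definite, so the
  orientation matters; \<open>scalar_vol\<close> is the reason why it can be assumed
  positive.\<close>

lemma square_minus_one_case:
  assumes z: "\<zeta> = - 1" and e: "\<epsilon> = 1" and M: "M = (\<lambda>i k. [[0, 1, 0, 0], [- 1, 0, 0, 0], [0, 0, 0, 1], [0, 0, - 1, 0]] ! i ! k)"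
  shows "invariants \<Lambda> \<sigma> 2 (2, 4, 0, 2) \<and> isometric T (gram_lattice (gram_U \<oplus>\<^sub>L gram_single (-2) \<oplus>\<^sub>L gram_single (-2)))"
proof -
  have dim: "family_dimension \<Lambda> \<sigma> 0"
  proof (rule family_dimensionI, rule disjI2, rule conjI[OF z])
    let ?A = "\<lambda>v :: complex^2. alt6 0 (v $ 1) (v $ 2) (v $ 2) (- v $ 1) 0"
    have "vec.dim eigenspace = CARD(2)"
    proof (rule eigenspace_dim[where A = ?A])
      fix a :: "nat \<Rightarrow> nat \<Rightarrow> complex"
      have n: "x = - x \<longleftrightarrow> x = 0" for x :: complex by (simp add: eq_neg_iff_add_eq_0 flip: mult_2)
      have "alt_eq (wedge MC a) (\<lambda>i j. \<zeta> * a i j) \<longleftrightarrow> a 0 1 = 0 \<and> a 2 3 = 0 \<and> a 1 3 = - a 0 2 \<and> a 1 2 = a 0 3"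
        using n[of "a 0 1"] n[of "a 2 3"] by (auto simp: alt_eq_def wedge_def M z)
      also have "\<dots> \<longleftrightarrow> (\<exists>v. alt_eq a (?A v))"
      proof
        assume "a 0 1 = 0 \<and> a 2 3 = 0 \<and> a 1 3 = - a 0 2 \<and> a 1 2 = a 0 3"
        then show "\<exists>v. alt_eq a (?A v)" by (intro exI[of _ "vec2 (a 0 2) (a 0 3)"]) (simp add: alt_eq_def)
      qed (auto simp: alt_eq_def)
      finally show "alt_eq (wedge MC a) (\<lambda>i j. \<zeta> * a i j) \<longleftrightarrow> (\<exists>v. alt_eq a (?A v))" .
    qed (auto simp: alt_eq_def field_simps vec_eq_iff small_vec)
    then show "vec.dim eigenspace = Suc (Suc 0)" by simp
  qed
  let ?F = "\<lambda>v :: int^(2+(1+1)). alt6 (v $ Inl 1) (v $ Inr (Inl 1)) (v $ Inr (Inr 1)) (- v $ Inr (Inr 1)) (v $ Inr (Inl 1)) (v $ Inl 2)"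
  have "\<exists>c. c \<in> isometries T (gram_lattice (gram_U \<oplus>\<^sub>L gram_single (-2) \<oplus>\<^sub>L gram_single (-2)))"
  proof (rule invariant_isometry[where F = ?F])
    fix a :: "nat \<Rightarrow> nat \<Rightarrow> int"
    have "alt_eq (wedge M a) a \<longleftrightarrow> a 1 3 = a 0 2 \<and> a 1 2 = - a 0 3" by (auto simp: alt_eq_def wedge_def M)
    also have "\<dots> \<longleftrightarrow> (\<exists>v. alt_eq a (?F v))"
    proof
      assume "a 1 3 = a 0 2 \<and> a 1 2 = - a 0 3"
      then show "\<exists>v. alt_eq a (?F v)"
        by (intro exI[of _ "vcat (vec2 (a 0 1) (a 2 3)) (vcat (vec1 (a 0 2)) (vec1 (a 0 3)))"]) (simp add: alt_eq_def)
    qed (auto simp: alt_eq_def)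
    finally show "alt_eq (wedge M a) a \<longleftrightarrow> (\<exists>v. alt_eq a (?F v))" .
  qed (auto simp: alt_eq_def vec_eq_iff small_vec pf_def gram_form_def e)
  then obtain c where c: "c \<in> isometries T (gram_lattice (gram_U \<oplus>\<^sub>L gram_single (-2) \<oplus>\<^sub>L gram_single (-2)))" by blast
  show ?thesis by (rule invariantsI[OF c _ dim length_Um2m2[OF group_T c]]) simp
qed

text \<open>As for involutions, except that the columns of the gluing data agree
  (\<open>qa = qb\<close> and \<open>qc = qd\<close>): the minor vanishes, the second generator is
  isotropic with \<open>K = 0\<close>, and only divisibility by 3 remains to be decided.\<close>

lemma order_3_case:
  assumes z: "\<zeta>\<^sup>2 \<noteq> 1" "\<zeta>\<^sup>2 + \<zeta> + 1 = 0" and M: "M = (\<lambda>i k. [[1, 0, 0, 0], [0, 1, 0, 0], [0, 0, 0, 1], [n0, n1, - 1, - 1]] ! i ! k)"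
  shows "invariants \<Lambda> \<sigma> 3 (3, 2, 1, 0) \<and> isometric T (gram_lattice gram_U) \<or>
     invariants \<Lambda> \<sigma> 3 (3, 2, 1, 2) \<and> isometric T (gram_lattice (scaled gram_U 3))"
proof -
  have z1: "\<zeta> \<noteq> 1" using z(1) by auto
  have dim: "family_dimension \<Lambda> \<sigma> 1"
  proof (rule family_dimensionI, rule disjI1, rule conjI[OF z(1)])
    let ?A = "\<lambda>v :: complex^2. alt6 0 (v $ 1) (\<zeta> * v $ 1) (v $ 2) (\<zeta> * v $ 2) ((of_int n0 * (\<zeta> * v $ 1) + of_int n1 * (\<zeta> * v $ 2)) / (1 - \<zeta>))"
    have "vec.dim eigenspace = CARD(2)"
    proof (rule eigenspace_dim[where A = ?A])
      fix a :: "nat \<Rightarrow> nat \<Rightarrow> complex"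
      let ?r = "of_int n0 * a 0 3 + of_int n1 * a 1 3"
      have zz: "\<zeta> * (\<zeta> * x) = - x - \<zeta> * x" for x
      proof -
        have "(\<zeta>\<^sup>2 + \<zeta> + 1) * x = 0" using z(2) by simp
        then show ?thesis by (simp add: power2_eq_square algebra_simps eq_neg_iff_add_eq_0 eq_diff_eq)
      qed
      have q: "x - y = \<zeta> * x \<longleftrightarrow> x = y / (1 - \<zeta>)" for x y using z1 by (auto simp: field_simps)
      have "alt_eq (wedge MC a) (\<lambda>i j. \<zeta> * a i j) \<longleftrightarrow> a 0 1 = 0 \<and> a 0 3 = \<zeta> * a 0 2 \<and> a 1 3 = \<zeta> * a 1 2 \<and> a 2 3 - ?r = \<zeta> * a 2 3"
        (is "?l \<longleftrightarrow> ?r'")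
      proof
        have w: "wedge MC a 0 1 = a 0 1" "wedge MC a 0 2 = a 0 3" "wedge MC a 0 3 = of_int n1 * a 0 1 - a 0 2 - a 0 3" "wedge MC a 1 2 = a 1 3"
          "wedge MC a 1 3 = - (of_int n0 * a 0 1) - a 1 2 - a 1 3" "wedge MC a 2 3 = a 2 3 - ?r"
          by (simp_all add: wedge_def M algebra_simps)
        show ?r' if l: ?l
        proof -
        have h: "a 0 1 = \<zeta> * a 0 1" "a 0 3 = \<zeta> * a 0 2" "a 1 3 = \<zeta> * a 1 2" "a 2 3 - ?r = \<zeta> * a 2 3"
          using l unfolding alt_eq_def w by blast+
        from h(1) have "(1 - \<zeta>) * a 0 1 = 0" by (simp add: algebra_simps)
        then have "a 0 1 = 0" using z1 by simp
          then show ?thesis using h by blast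
        qed
        show ?l if r: ?r'
        proof -
          have r1: "a 0 1 = 0" and r2: "a 0 3 = \<zeta> * a 0 2" and r3: "a 1 3 = \<zeta> * a 1 2" and r4: "a 2 3 - ?r = \<zeta> * a 2 3" using r by blast+
          show ?thesis unfolding alt_eq_def w
            by (intro conjI) (use r1 in simp, rule r2, simp only: r1 r2 zz, simp, rule r3, simp only: r1 r3 zz, simp, rule r4)
        qed
      qed
      also have "\<dots> \<longleftrightarrow> (\<exists>v. alt_eq a (?A v))" unfolding q
      proof
        assume "a 0 1 = 0 \<and> a 0 3 = \<zeta> * a 0 2 \<and> a 1 3 = \<zeta> * a 1 2 \<and> a 2 3 = ?r / (1 - \<zeta>)"
        then show "\<exists>v. alt_eq a (?A v)" by (intro exI[of _ "vec2 (a 0 2) (a 1 2)"]) (simp add: alt_eq_def)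
      qed (auto simp: alt_eq_def)
      finally show "alt_eq (wedge MC a) (\<lambda>i j. \<zeta> * a i j) \<longleftrightarrow> (\<exists>v. alt_eq a (?A v))" .
    qed (auto simp: alt_eq_def algebra_simps add_divide_distrib vec_eq_iff small_vec)
    then show "vec.dim eigenspace = Suc 1" by simp
  qed
  have sol: "alt_eq (wedge M a) a \<longleftrightarrow> a 0 3 = a 0 2 \<and> a 1 3 = a 1 2 \<and> 3 * a 0 2 = n1 * a 0 1 \<and> 3 * a 1 2 = - (n0 * a 0 1)" (is "_ \<longleftrightarrow> ?S a")
    for a :: "nat \<Rightarrow> nat \<Rightarrow> int"
  proof
    assume "alt_eq (wedge M a) a"
    then show "?S a" by (simp add: alt_eq_def wedge_def M)
  next
    assume S: "?S a"
    have "3 * (n0 * a 0 2 + n1 * a 1 2) = n0 * (3 * a 0 2) + n1 * (3 * a 1 2)" by (simp add: algebra_simps)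
    also have "\<dots> = 0" using S by (simp add: algebra_simps)
    finally have "n0 * a 0 2 + n1 * a 1 2 = 0" by simp
    then show "alt_eq (wedge M a) a" using S by (simp add: alt_eq_def wedge_def M algebra_simps)
  qed
  show ?thesis
  proof (cases "3 dvd n0 \<and> 3 dvd n1")
    case True
    then obtain k0 k1 where k: "n0 = 3 * k0" "n1 = 3 * k1" by (auto elim!: dvdE)
    have "\<exists>c. c \<in> isometries T (gram_lattice (scaled gram_U 1))"
      by (rule hyperbolic_isometry[where qa = k1 and qb = k1 and qc = "- k0" and qd = "- k0" and K = 0]) (auto simp: sol k)
    then obtain c where c: "c \<in> isometries T (gram_lattice gram_U)" unfolding scaled_1 by blast
    have "has_length T 3 0" by (rule length_U[OF _ group_T c]) simp
    from invariantsI[OF c _ dim this, of 2] show ?thesis by simp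
  next
    case False
    have p3: "prime (3::int)" by simp
    have d3: "3 dvd a 0 1" if "alt_eq (wedge M a) a" for a
    proof -
      have "3 * a 0 2 = n1 * a 0 1" "3 * (- a 1 2) = n0 * a 0 1" using that unfolding sol by auto
      then have "3 dvd n1 * a 0 1" "3 dvd n0 * a 0 1" by (metis dvd_triv_left)+
      then show ?thesis using False prime_dvd_multD[OF p3] by blast
    qed
    have "alt_eq (wedge M a) a \<longleftrightarrow> (\<exists>u. a 0 1 = 3 * u \<and> a 0 2 = n1 * u \<and> a 0 3 = n1 * u \<and> a 1 2 = - n0 * u \<and> a 1 3 = - n0 * u)"
      for a :: "nat \<Rightarrow> nat \<Rightarrow> int"
    proof
      assume a: "alt_eq (wedge M a) a"
      obtain u where "a 0 1 = 3 * u" using d3[OF a] by (rule dvdE)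
      then show "\<exists>u. a 0 1 = 3 * u \<and> a 0 2 = n1 * u \<and> a 0 3 = n1 * u \<and> a 1 2 = - n0 * u \<and> a 1 3 = - n0 * u"
        using a unfolding sol by (intro exI[of _ u]) simp
    qed (auto simp: sol)
    then have "\<exists>c. c \<in> isometries T (gram_lattice (scaled gram_U 3))"
      by (rule hyperbolic_isometry[where K = 0]) simp_all
    then obtain c where c: "c \<in> isometries T (gram_lattice (scaled gram_U 3))" by blast
    have "has_length T 3 2" by (rule length_Uk[OF _ group_T]) (use c in simp_all)
    from invariantsI[OF c _ dim this, of 2] show ?thesis by simp
  qed
qed

lemma scalar_order_3_case:
  assumes z: "\<zeta>\<^sup>2 \<noteq> 1" and e: "\<epsilon> = 1" and M: "M = (\<lambda>i k. [[0, 1, 0, 0], [- 1, - 1, 0, 0], [0, 0, 0, 1], [0, 0, - 1, - 1]] ! i ! k)"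
  shows "invariants \<Lambda> \<sigma> 3 (3, 4, 0, 1) \<and> isometric T (gram_lattice (gram_U \<oplus>\<^sub>L scaled gram_A2 (-1)))"
proof -
  have z1: "\<zeta> \<noteq> 1" using z by auto
  have fix0: "x = 0" if "x = \<zeta> * x" for x
  proof -
    have "(1 - \<zeta>) * x = 0" using that by (simp add: algebra_simps)
    then show ?thesis using z1 by simp
  qed
  have dim: "family_dimension \<Lambda> \<sigma> 0"
  proof (rule family_dimensionI, rule disjI1, rule conjI[OF z])
    have "vec.dim eigenspace = 1"
    \<comment> \<open>This coordinate is the entry \<open>a 0 2\<close> up to sign. If it vanishes
      then so does \<open>a 1 3\<close>, and the entries \<open>a 0 3\<close> and
      \<open>a 1 2\<close> are exchanged up to the factor \<open>- \<zeta>\<close>, which is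
      impossible for nonzero values as \<open>\<zeta>\<^sup>2 \<noteq> 1\<close>.\<close>
    proof (rule eigenspace_dim_1[where n = "Inr (Inl 1)"])
      fix w :: "complex^(2+2+2)"
      let ?a = "U3_form \<epsilon>C w"
      have w: "wedge MC a 0 1 = a 0 1" "wedge MC a 0 2 = a 1 3" "wedge MC a 0 3 = - a 1 2 - a 1 3" "wedge MC a 1 2 = - a 0 3 - a 1 3"
        "wedge MC a 2 3 = a 2 3" for a by (simp_all add: wedge_def M)
      assume "alt_eq (wedge MC ?a) (\<lambda>i j. \<zeta> * ?a i j)" and w0: "w $ Inr (Inl 1) = 0"
      then have h: "?a 0 1 = \<zeta> * ?a 0 1" "?a 1 3 = \<zeta> * ?a 0 2" "- ?a 1 2 - ?a 1 3 = \<zeta> * ?a 0 3" "- ?a 0 3 - ?a 1 3 = \<zeta> * ?a 1 2" "?a 2 3 = \<zeta> * ?a 2 3"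
        unfolding alt_eq_def w by blast+
      have 2: "?a 0 2 = 0" using w0 by simp
      have 13: "?a 1 3 = 0" using h(2) unfolding 2 by simp
      have "- ?a 1 2 = \<zeta> * ?a 0 3" using h(3) unfolding 13 by (simp del: U3_form_nth)
      then have 12: "?a 1 2 = - (\<zeta> * ?a 0 3)" by (rule minus_equation_iff[THEN iffD1, THEN sym])
      have "- ?a 0 3 = \<zeta> * ?a 1 2" using h(4) unfolding 13 by (simp del: U3_form_nth)
      then have 03: "?a 0 3 = - (\<zeta> * ?a 1 2)" by (rule minus_equation_iff[THEN iffD1, THEN sym])
      have "(1 - \<zeta>\<^sup>2) * ?a 0 3 = ?a 0 3 + \<zeta> * (- (\<zeta> * ?a 0 3))" by (simp add: power2_eq_square algebra_simps del: U3_form_nth)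
      also have "\<dots> = ?a 0 3 + \<zeta> * ?a 1 2" by (simp only: 12)
      also have "\<dots> = 0" by (subst 03) simp
      finally have "?a 0 3 = 0" using z by simp
      then show "alt_eq ?a (\<lambda>i j. 0)" using 12 13 2 fix0[OF h(1)] fix0[OF h(5)] by (simp add: alt_eq_def del: U3_form_nth)
    qed
    then show "vec.dim eigenspace = Suc 0" by simp
  qed
  let ?F = "\<lambda>v :: int^(2+2). alt6 (v $ Inl 1) (v $ Inr 1) (- v $ Inr 2 - v $ Inr 1) (v $ Inr 2) (v $ Inr 1) (v $ Inl 2)"
  have "\<exists>c. c \<in> isometries T (gram_lattice (gram_U \<oplus>\<^sub>L scaled gram_A2 (-1)))"
  proof (rule invariant_isometry[where F = ?F])
    fix a :: "nat \<Rightarrow> nat \<Rightarrow> int"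
    have "alt_eq (wedge M a) a \<longleftrightarrow> a 1 3 = a 0 2 \<and> a 0 3 = - a 1 2 - a 0 2" by (auto simp: alt_eq_def wedge_def M)
    also have "\<dots> \<longleftrightarrow> (\<exists>v. alt_eq a (?F v))"
    proof
      assume "a 1 3 = a 0 2 \<and> a 0 3 = - a 1 2 - a 0 2"
      then show "\<exists>v. alt_eq a (?F v)"
        by (intro exI[of _ "vcat (vec2 (a 0 1) (a 2 3)) (vec2 (a 0 2) (a 1 2))"]) (simp add: alt_eq_def)
    qed (auto simp: alt_eq_def)
    finally show "alt_eq (wedge M a) a \<longleftrightarrow> (\<exists>v. alt_eq a (?F v))" .
  qed (auto simp: alt_eq_def vec_eq_iff small_vec pf_def gram_form_def e algebra_simps)
  then obtain c where c: "c \<in> isometries T (gram_lattice (gram_U \<oplus>\<^sub>L scaled gram_A2 (-1)))" by blast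
  show ?thesis by (rule invariantsI[OF c _ dim length_UA2[OF group_T c]]) simp
qed

lemma order_5_case:
  assumes z: "\<zeta>\<^sup>2 \<noteq> 1" "\<zeta> \<noteq> 0" and M: "M = (\<lambda>i k. [[0, 1, 0, 0], [0, 0, 1, 0], [0, 0, 0, 1], [- 1, - 1, - 1, - 1]] ! i ! k)"
  shows "invariants \<Lambda> \<sigma> 5 (5, 2, 0, 1) \<and> isometric T (gram_lattice gram_H5)"
proof -
  have dim: "family_dimension \<Lambda> \<sigma> 0"
  proof (rule family_dimensionI, rule disjI1, rule conjI[OF z(1)])
    have "vec.dim eigenspace = 1"
    proof (rule eigenspace_dim_1[where n = "Inl 1"])
      fix w :: "complex^(2+2+2)"
      let ?a = "U3_form \<epsilon>C w"
      have w: "wedge MC a 0 1 = a 1 2" "wedge MC a 0 2 = a 1 3" "wedge MC a 0 3 = a 0 1 - a 1 2 - a 1 3" "wedge MC a 1 2 = a 2 3"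
        "wedge MC a 1 3 = a 0 2 + a 1 2 - a 2 3" for a by (simp_all add: wedge_def M)
      assume "alt_eq (wedge MC ?a) (\<lambda>i j. \<zeta> * ?a i j)" and w0: "w $ Inl 1 = 0"
      then have h: "?a 1 2 = \<zeta> * ?a 0 1" "?a 1 3 = \<zeta> * ?a 0 2" "?a 0 1 - ?a 1 2 - ?a 1 3 = \<zeta> * ?a 0 3" "?a 2 3 = \<zeta> * ?a 1 2" "?a 0 2 + ?a 1 2 - ?a 2 3 = \<zeta> * ?a 1 3"
        unfolding alt_eq_def w by blast+
      have 1: "?a 0 1 = 0" using w0 by simp
      have 12: "?a 1 2 = 0" using h(1) unfolding 1 by simp
      have 23: "?a 2 3 = 0" using h(4) unfolding 12 by simp
      have "(1 - \<zeta>\<^sup>2) * ?a 0 2 = ?a 0 2 - \<zeta> * (\<zeta> * ?a 0 2)" by (simp add: power2_eq_square algebra_simps)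
      also have "\<dots> = 0" using h(5) unfolding h(2)[symmetric] 12 23 by simp
      finally have 2: "?a 0 2 = 0" using z by simp
      have 13: "?a 1 3 = 0" using h(2) unfolding 2 by simp
      have "?a 0 3 = 0" using h(3) z(2) unfolding 1 12 13 by simp
      then show "alt_eq ?a (\<lambda>i j. 0)" using 1 2 12 13 23 by (simp add: alt_eq_def del: U3_form_nth)
    qed
    then show "vec.dim eigenspace = Suc 0" by simp
  qed
  \<comment> \<open>Negating the form of H5 amounts to the substitution of (y, -x) for (x, y); this
    is the difference between the two parametrisations, which serve the two orientations.\<close>
  let ?F = "\<lambda>v :: int^2. if \<epsilon> = 1 then alt6 (v $ 1) (- v $ 2) (v $ 2) (v $ 1) (- v $ 2) (v $ 1)
    else alt6 (v $ 2) (v $ 1) (- v $ 1) (v $ 2) (v $ 1) (v $ 2)"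
  have e: "\<epsilon> = 1 \<or> \<epsilon> = - 1" by (simp add: \<epsilon>_def)
  have "\<exists>c. c \<in> isometries T (gram_lattice gram_H5)"
  proof (rule invariant_isometry[where F = ?F])
    fix a :: "nat \<Rightarrow> nat \<Rightarrow> int"
    have "alt_eq (wedge M a) a \<longleftrightarrow> a 1 2 = a 0 1 \<and> a 2 3 = a 0 1 \<and> a 1 3 = a 0 2 \<and> a 0 3 = - a 0 2" by (auto simp: alt_eq_def wedge_def M)
    also have "\<dots> \<longleftrightarrow> (\<exists>v. alt_eq a (?F v))"
    proof
      assume "a 1 2 = a 0 1 \<and> a 2 3 = a 0 1 \<and> a 1 3 = a 0 2 \<and> a 0 3 = - a 0 2"
      then show "\<exists>v. alt_eq a (?F v)"
        by (intro exI[of _ "if \<epsilon> = 1 then vec2 (a 0 1) (- a 0 2) else vec2 (a 0 2) (a 0 1)"]) (simp add: alt_eq_def)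
    qed (auto simp: alt_eq_def split: if_splits)
    finally show "alt_eq (wedge M a) a \<longleftrightarrow> (\<exists>v. alt_eq a (?F v))" .
  next
    fix v w show "\<epsilon> * pf (?F v) (?F w) = gram_form gram_H5 v w"
      using e by (elim disjE) (simp_all add: pf_def gram_form_def small_vec algebra_simps)
  qed (auto simp: alt_eq_def vec_eq_iff small_vec split: if_splits)
  then obtain c where c: "c \<in> isometries T (gram_lattice gram_H5)" by blast
  show ?thesis by (rule invariantsI[OF c _ dim length_H5[OF group_T c]]) simp
qed

end

section \<open>The classification\<close>

context torus begin

lemma gmat_scaled:
  assumes g: "\<And>i. i < 4 \<Longrightarrow> g (b i) = (\<Sum>k<4. of_int (M i k) *\<^sub>R b k)" and L: "\<And>z. L z = of_int s *\<^sub>R g z"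
    and ik: "i < 4" "k < 4"
  shows "gmat L i k = s * M i k"
proof -
  have "L (b i) = (\<Sum>k<4. of_int (s * M i k) *\<^sub>R b k)"
    unfolding L g[OF ik(1)] by (simp add: scaleR_sum_right)
  then have "crd (L (b i)) k = real_of_int (s * M i k)" using crd_comb[OF ik(2), of "\<lambda>k. real_of_int (s * M i k)"] by (simp only:)
  then show ?thesis unfolding gmat_def by (simp only: floor_of_int)
qed

lemma torus_auto_basis:
  assumes \<sigma>: "\<sigma> \<in> carrier (Aut0 \<Lambda>)" and L: "lattice_auto L L'" "\<And>z. \<sigma> (torus_proj \<Lambda> z) = torus_proj \<Lambda> (L z)"
    and e: "lattice_basis e \<Lambda>" and g: "\<And>i. i < 4 \<Longrightarrow> g (e i) = (\<Sum>k<4. of_int (M i k) *\<^sub>R e k)"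
    and s: "\<And>z. L z = of_int s *\<^sub>R g z" "s * s = 1"
  shows "torus_auto \<Lambda> e \<sigma> L L' M s"
proof -
  interpret E: torus \<Lambda> e by unfold_locales (rule e)
  show ?thesis by unfold_locales (use \<sigma> L s(2) E.gmat_scaled[where g = g and M = M and L = L and s = s, OF g s(1)] in auto)
qed

end

lemma cdet_scalar: "cdet (\<lambda>z. c *s z) = c\<^sup>2"
  by (simp add: cdet_def dC_def axis_def power2_eq_square)

theorem proposition0p1:
  fixes \<Lambda> :: "(complex^2) set"
    and \<sigma> :: "torus_point \<Rightarrow> torus_point"
    and p :: nat
  assumes "complex_lattice \<Lambda>"
    and "\<sigma> \<in> carrier (Aut0 \<Lambda>)"
    and "\<not> symplectic \<Lambda> \<sigma>"
    and "prime p"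
    and "group.ord (isometry_group (H2_lattice \<Lambda>)) (nu \<Lambda> \<sigma>) = p"
  defines "T \<equiv> invariant_lattice \<Lambda> \<sigma>"
  shows
    "invariants \<Lambda> \<sigma> p (2, 2, 2, 0) \<and> isometric T (gram_lattice gram_U) \<or>
     invariants \<Lambda> \<sigma> p (2, 2, 2, 2) \<and> isometric T (gram_lattice (scaled gram_U 2)) \<or>
     invariants \<Lambda> \<sigma> p (2, 2, 2, 2) \<and> isometric T (gram_lattice (gram_single 2 \<oplus>\<^sub>L gram_single (-2))) \<or>
     invariants \<Lambda> \<sigma> p (2, 4, 0, 2) \<and> isometric T (gram_lattice (gram_U \<oplus>\<^sub>L gram_single (-2) \<oplus>\<^sub>L gram_single (-2))) \<or>
     invariants \<Lambda> \<sigma> p (3, 2, 1, 0) \<and> isometric T (gram_lattice gram_U) \<or>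
     invariants \<Lambda> \<sigma> p (3, 2, 1, 2) \<and> isometric T (gram_lattice (scaled gram_U 3)) \<or>
     invariants \<Lambda> \<sigma> p (3, 4, 0, 1) \<and> isometric T (gram_lattice (gram_U \<oplus>\<^sub>L scaled gram_A2 (-1))) \<or>
     invariants \<Lambda> \<sigma> p (5, 2, 0, 1) \<and> isometric T (gram_lattice gram_H5)"
proof -
  obtain b where b: "lattice_basis b \<Lambda>" using assms(1) unfolding complex_lattice_def by blast
  interpret torus \<Lambda> b by unfold_locales (rule b)
  obtain L L' where L: "lattice_auto L L'" and lift: "\<And>z. \<sigma> (torus_proj \<Lambda> z) = torus_proj \<Lambda> (L z)"
    using assms(2) Aut0_iff by blast
  have cl: "clinear2 L" and L\<Lambda>: "\<And>z. z \<in> \<Lambda> \<Longrightarrow> L z \<in> \<Lambda>" using L by (auto simp: lattice_auto_def)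
  have lin: "linear L" by (rule clinear2_linear[OF cl])
  have d1: "cdet L \<noteq> 1" using symplecticI[OF cl lift] assms(3) by blast
  have ord: "(\<forall>z. (L ^^ p) z = z) \<or> (\<forall>z. (L ^^ p) z = - z)" by (rule order_lift[OF assms(2) L lift assms(5)])
  note TA = torus_auto_basis[OF assms(2) L lift]
  have e1: "(axis 1 1 :: complex^2) \<noteq> 0" by (simp add: axis_eq_0_iff)
  have ax: "c = 0" if "c *s (axis 1 1 :: complex^2) = 0" for c using that e1 unfolding vec.scale_eq_0_iff by blast
  show ?thesis
  proof (cases "p = 2")
    case p2: True
    from ord have "(\<forall>z. L (L z) = z) \<or> (\<forall>z. L (L z) = - z)" unfolding p2 by (simp add: numeral_2_eq_2)
    then show ?thesis
    proof
      assume LL: "\<forall>z. L (L z) = z"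
      have "cdet L * cdet L = 1" using cdet_comp[OF cl, of L] LL cdet_id by simp
      then have z: "cdet L = - 1" using d1 by (simp add: square_eq_1_iff)
      \<comment> \<open>The map - 1 has determinant 1, so a non-symplectic involution has a vector
        on which it differs from - 1, as \<open>involution_basis\<close> requires.\<close>
      have "\<exists>z0. L z0 \<noteq> - z0"
      proof (rule ccontr)
        assume "\<not> ?thesis"
        then have "cdet L = 1" by (simp add: cdet_def dC_def axis_def)
        then show False using d1 by simp
      qed
      then obtain z0 where z0: "L z0 \<noteq> - z0" by blast
      obtain e and n m :: "nat \<Rightarrow> int" where e: "lattice_basis e \<Lambda>" "L (e 0) = e 0" "L (e 1) = e 1"
        "L (e 2) = - e 2 + of_int (n 0) *\<^sub>R e 0 + of_int (n 1) *\<^sub>R e 1"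
        "L (e 3) = - e 3 + of_int (m 0) *\<^sub>R e 0 + of_int (m 1) *\<^sub>R e 1"
        by (rule involution_basis[OF cl L\<Lambda> d1 spec[OF LL] z0])
      interpret A: torus_auto \<Lambda> e \<sigma> L L' "\<lambda>i k. [[1, 0, 0, 0], [0, 1, 0, 0], [n 0, n 1, - 1, 0], [m 0, m 1, 0, - 1]] ! i ! k" 1
        by (rule TA[OF e(1), where g = L]) (use e in \<open>auto simp: less_4_cases lessThan_4\<close>)
      from A.involution_case[OF z refl] show ?thesis unfolding T_def p2 by blast
    next
      assume LL: "\<forall>z. L (L z) = - z"
      \<comment> \<open>Comparing \<open>L (L z) = - z\<close> with Cayley-Hamilton leaves a linear
        relation between \<open>L z\<close> and \<open>z\<close>. Its coefficient
        \<open>ctr L\<close> is nonzero, since otherwise \<open>cdet L = 1\<close>; hence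
        \<open>L\<close> is a scalar.\<close>
      have tz: "ctr L *s L z = (cdet L - 1) *s z" for z
        using cayley_hamilton[OF cl, of z] LL by (simp add: vec.scale_left_diff_distrib eq_diff_eq algebra_simps)
      have t0: "ctr L \<noteq> 0"
      proof
        assume "ctr L = 0"
        then have "(cdet L - 1) *s (axis 1 1 :: complex^2) = 0" using tz[of "axis 1 1"] by simp
        then have "cdet L - 1 = 0" by (rule ax)
        then show False using d1 by simp
      qed
      define c where "c = (cdet L - 1) / ctr L"
      have Lc: "L z = c *s z" for z
      proof -
        have "c *s z = inverse (ctr L) *s ((cdet L - 1) *s z)" by (simp only: c_def divide_inverse vector_smult_assoc mult.commute)
        also have "\<dots> = L z"
          unfolding tz[symmetric] by (simp only: vector_smult_assoc left_inverse[OF t0] vector_smult_lid)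
        finally show ?thesis by simp
      qed
      have "(c * c + 1) *s (axis 1 1 :: complex^2) = 0"
        using spec[OF LL, of "axis 1 1"] unfolding Lc by (simp add: vec.scale_left_distrib)
      then have "c * c + 1 = 0" by (rule ax)
      then have cc: "c\<^sup>2 = - 1" by (simp add: power2_eq_square add_eq_0_iff2)
      have Le: "L = (\<lambda>z. c *s z)" using Lc by blast
      have z: "cdet L = - 1" unfolding Le cdet_scalar by (rule cc)
      have c0: "c\<^sup>2 = - of_real 0 * c - 1" using cc by simp
      have z01: "(0::real) = 0 \<or> (0::real) = 1" by simp
      have c\<Lambda>: "c *s z \<in> \<Lambda>" if "z \<in> \<Lambda>" for z using L\<Lambda>[OF that] unfolding Lc .
      obtain e where e: "lattice_basis e \<Lambda>" "e 1 = c *s e 0" "e 3 = c *s e 2" "vol e > 0"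
        by (rule scalar_basis[OF c0 z01 c\<Lambda>])
      have "c *s (c *s v) = - v" for v :: "complex^2" using LL unfolding Lc by (rule spec)
      then have Le: "L (e 0) = e 1" "L (e 1) = - e 0" "L (e 2) = e 3" "L (e 3) = - e 2" using e(2,3) Lc by simp_all
      interpret A: torus_auto \<Lambda> e \<sigma> L L' "\<lambda>i k. [[0, 1, 0, 0], [- 1, 0, 0, 0], [0, 0, 0, 1], [0, 0, - 1, 0]] ! i ! k" 1
        by (rule TA[OF e(1), where g = L]) (use Le in \<open>auto simp: less_4_cases lessThan_4\<close>)
      have "A.\<epsilon> = 1" using e(4) by (simp add: A.\<epsilon>_def)
      from A.square_minus_one_case[OF z this refl] show ?thesis unfolding T_def p2 by blast
    qed
  next
    case False
    then have odd: "odd p" using assms(4) prime_odd_nat prime_ge_2_nat[of p] by fastforce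
    \<comment> \<open>For odd \<open>p\<close> a map with p-th power - 1 becomes one of order
      dividing \<open>p\<close> after a change of sign, which affects neither the determinant nor
      the action on cohomology.\<close>
    obtain s :: int where s: "s * s = 1" "\<And>z. real_of_int s ^ p *\<^sub>R (L ^^ p) z = z"
    proof (use ord in \<open>elim disjE\<close>)
      assume "\<forall>z. (L ^^ p) z = z"
      then show thesis by (intro that[of 1]) simp_all
    next
      assume "\<forall>z. (L ^^ p) z = - z"
      then show thesis using odd by (intro that[of "- 1"]) simp_all
    qed
    define g where "g z = of_int s *\<^sub>R L z" for z
    have gn: "(g ^^ n) z = real_of_int s ^ n *\<^sub>R (L ^^ n) z" for n z
      by (induction n) (simp_all add: g_def linear_scale[OF lin])
    have gp: "(g ^^ p) z = z" for z unfolding gn by (rule s(2))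
    have ss: "real_of_int s * real_of_int s = 1" using s(1) by (metis of_int_mult of_int_1)
    have Lg: "L z = of_int s *\<^sub>R g z" for z by (simp add: g_def ss)
    have s1: "s = 1 \<or> s = - 1" using s(1) by (simp add: square_eq_1_iff)
    have gL: "g z \<in> \<Lambda>" if "z \<in> \<Lambda>" for z using s1 L\<Lambda>[OF that] by (auto simp: g_def lattice_minus)
    have gc: "clinear2 g" using cl by (simp add: clinear2_def g_def scaleR_right_distrib) (simp add: scaleR_smult mult.commute)
    have gd: "cdet g = cdet L" unfolding cdet_def g_def dC_linear using s1 by auto
    have d1: "cdet g \<noteq> 1" unfolding gd by (rule d1)
    have dp: "cdet g ^ p = 1"
    proof -
      have "cdet (g ^^ n) = cdet g ^ n" for n
      proof (induction n)
        case (Suc n)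
        then show ?case using cdet_comp[OF gc, of "g ^^ n"] by (simp add: comp_def)
      qed (simp add: id_def cdet_id)
      moreover have "g ^^ p = (\<lambda>z. z)" using gp by blast
      ultimately show ?thesis using cdet_id by metis
    qed
    note TA = TA[where g = g, OF _ _ Lg s(1)]
    obtain \<alpha> \<beta> where ab: "\<alpha> + \<beta> = ctr g" "\<alpha> * \<beta> = cdet g" by (rule quadratic_roots)
    note po = prime_order[OF gc gL assms(4) gp d1 ab]
    have "p = 3 \<or> p = 5" using po(3) False by blast
    then show ?thesis
    proof
      assume p3: "p = 3"
      have ggg: "g (g (g z)) = z" for z using gp[of z] unfolding p3 by (simp add: numeral_3_eq_3)
      have z3: "cdet g ^ 3 = 1" using dp unfolding p3 .
      have z2: "(cdet L)\<^sup>2 \<noteq> 1"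
      proof
        assume "(cdet L)\<^sup>2 = 1"
        then have "cdet g = 1" using z3 unfolding gd by (simp add: power3_eq_cube power2_eq_square)
        then show False using d1 by simp
      qed
      have zz: "(cdet L)\<^sup>2 + cdet L + 1 = 0"
      proof -
        have "(cdet L - 1) * ((cdet L)\<^sup>2 + cdet L + 1) = cdet L ^ 3 - 1" by (simp add: power3_eq_cube power2_eq_square algebra_simps)
        also have "\<dots> = 0" using z3 unfolding gd by simp
        finally show ?thesis using d1 unfolding gd by simp
      qed
      \<comment> \<open>With a nonzero fixed vector the eigenvalue 1 occurs and the fixed sublattice
        has rank two. Without one, \<open>1 + g + g^2\<close>, whose values are fixed, is 0.\<close>
      show ?thesis
      proof (cases "\<exists>z0. z0 \<noteq> 0 \<and> g z0 = z0")
        case True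
        then obtain z0 where z0: "z0 \<noteq> 0" "g z0 = z0" by blast
        obtain e and n :: "nat \<Rightarrow> int" where e: "lattice_basis e \<Lambda>" "g (e 0) = e 0" "g (e 1) = e 1" "g (e 2) = e 3"
          "g (e 3) = - e 2 - e 3 + of_int (n 0) *\<^sub>R e 0 + of_int (n 1) *\<^sub>R e 1"
          by (rule order_3_basis[OF gc gL d1 ggg z0])
        interpret A: torus_auto \<Lambda> e \<sigma> L L' "\<lambda>i k. [[1, 0, 0, 0], [0, 1, 0, 0], [0, 0, 0, 1], [n 0, n 1, - 1, - 1]] ! i ! k" s
          by (rule TA[OF e(1)]) (use e in \<open>auto simp: less_4_cases lessThan_4\<close>)
        from A.order_3_case[OF z2 zz refl] show ?thesis unfolding T_def p3 by blast
      next
        case False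
        have glin: "linear g" by (rule clinear2_linear[OF gc])
        have gg: "g (g z) = - g z - z" for z
        proof -
          have "g (z + g z + g (g z)) = z + g z + g (g z)" by (simp add: linear_add[OF glin] ggg add_ac)
          then have "z + g z + g (g z) = 0" using False by blast
          then show ?thesis by (simp add: eq_diff_eq eq_neg_iff_add_eq_0 add_ac)
        qed
        \<comment> \<open>As in the case of square - 1: the relation \<open>1 + g + g^2 = 0\<close>
          and Cayley-Hamilton together force \<open>g\<close> to be a scalar, since
          \<open>cdet g \<noteq> 1\<close>.\<close>
        have tz: "(ctr g + 1) *s g z = (cdet g - 1) *s z" for z
        proof -
          have "(ctr g + 1) *s g z - (cdet g - 1) *s z = (ctr g *s g z - cdet g *s z) + g z + z"
            by (simp add: vec_eq_iff algebra_simps)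
          also have "\<dots> = 0" unfolding cayley_hamilton[OF gc, of z, symmetric] gg by simp
          finally show ?thesis by simp
        qed
        have t0: "ctr g + 1 \<noteq> 0"
        proof
          assume "ctr g + 1 = 0"
          then have "(cdet g - 1) *s (axis 1 1 :: complex^2) = 0" using tz[of "axis 1 1"] by simp
          then have "cdet g - 1 = 0" by (rule ax)
          then show False using d1 by simp
        qed
        define c where "c = (cdet g - 1) / (ctr g + 1)"
        have Lc: "g z = c *s z" for z
        proof -
          have "c *s z = inverse (ctr g + 1) *s ((cdet g - 1) *s z)" by (simp only: c_def divide_inverse vector_smult_assoc mult.commute)
          also have "\<dots> = g z"
            unfolding tz[symmetric] by (simp only: vector_smult_assoc left_inverse[OF t0] vector_smult_lid)
          finally show ?thesis by simp
        qed
        have "(c * c + c + 1) *s (axis 1 1 :: complex^2) = 0"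
          using gg[of "axis 1 1"] unfolding Lc by (simp add: vec.scale_left_distrib)
        then have "c * c + c + 1 = 0" by (rule ax)
        then have cc: "c\<^sup>2 = - of_real 1 * c - 1"
          by (simp add: power2_eq_square eq_diff_eq eq_neg_iff_add_eq_0 add_ac)
        have z01: "(1::real) = 0 \<or> (1::real) = 1" by simp
        have c\<Lambda>: "c *s z \<in> \<Lambda>" if "z \<in> \<Lambda>" for z using gL[OF that] unfolding Lc .
        obtain e where e: "lattice_basis e \<Lambda>" "e 1 = c *s e 0" "e 3 = c *s e 2" "vol e > 0"
          by (rule scalar_basis[OF cc z01 c\<Lambda>])
        have e': "e 1 = g (e 0)" "e 3 = g (e 2)" using e(2,3) Lc by simp_all
        have Le: "g (e 0) = e 1" "g (e 1) = - e 0 - e 1" "g (e 2) = e 3" "g (e 3) = - e 2 - e 3"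
          unfolding e' by (simp_all add: gg algebra_simps)
        interpret A: torus_auto \<Lambda> e \<sigma> L L' "\<lambda>i k. [[0, 1, 0, 0], [- 1, - 1, 0, 0], [0, 0, 0, 1], [0, 0, - 1, - 1]] ! i ! k" s
          by (rule TA[OF e(1)]) (use Le in \<open>auto simp: less_4_cases lessThan_4\<close>)
        have "A.\<epsilon> = 1" using e(4) by (simp add: A.\<epsilon>_def)
        from A.scalar_order_3_case[OF z2 this refl] show ?thesis unfolding T_def p3 by blast
      qed
    next
      assume p5: "p = 5"
      obtain r :: int where r: "2 * Re \<alpha> + 2 * Re \<beta> = of_int r" using po(4) by blast
      have a5: "\<alpha> ^ 5 = 1" and b5: "\<beta> ^ 5 = 1" using po(1,2) unfolding p5 by auto
      \<comment> \<open>If one eigenvalue were 1, the trace of the other would be an integer.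
        Applying \<open>fifth_roots\<close> to the pair of two copies of the other root gives an
        even integer equal to -1.\<close>
      have no1: "y \<noteq> 1" if x: "x ^ 5 = 1" "x * y \<noteq> 1" "2 * Re x + 2 * Re y = of_int r" for x y :: complex
      proof
        assume y: "y = 1"
        then have "2 * Re x + 2 * Re x = of_int (2 * r - 4)" "x \<noteq> 1" using x by auto
        then have "real_of_int (2 * r - 4) = - 1" using fifth_roots(1)[OF x(1) _ x(1), of "2 * r - 4"] by simp
        then have "2 * r - 4 = - 1" by linarith
        then show False by presburger
      qed
      have a1: "\<alpha> \<noteq> 1" using no1[OF b5, of \<alpha>] r ab(2) d1 by (simp add: mult.commute add.commute)
      have b1: "\<beta> \<noteq> 1" using no1[OF a5, of \<beta>] r ab(2) d1 by simp
      obtain e where e: "lattice_basis e \<Lambda>" "g (e 0) = e 1" "g (e 1) = e 2" "g (e 2) = e 3" "g (e 3) = - e 0 - e 1 - e 2 - e 3"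
        by (rule order_5_basis[OF gc gL ab a5 a1 b5 b1 d1 r])
      interpret A: torus_auto \<Lambda> e \<sigma> L L' "\<lambda>i k. [[0, 1, 0, 0], [0, 0, 1, 0], [0, 0, 0, 1], [- 1, - 1, - 1, - 1]] ! i ! k" s
        by (rule TA[OF e(1)]) (use e in \<open>auto simp: less_4_cases lessThan_4\<close>)
      have z5: "cdet L ^ 5 = 1" using dp unfolding p5 gd .
      have "(cdet L)\<^sup>2 \<noteq> 1"
      proof
        assume z2: "(cdet L)\<^sup>2 = 1"
        have "cdet L ^ 5 = (cdet L)\<^sup>2 * (cdet L)\<^sup>2 * cdet L" by (simp add: eval_nat_numeral)
        then have "cdet L = 1" using z5 z2 by simp
        then show False using d1 unfolding gd by simp
      qed
      moreover have "cdet L \<noteq> 0" using z5 by auto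
      ultimately show ?thesis using A.order_5_case[OF _ _ refl] unfolding T_def p5 by blast
    qed
  qed
qed

end
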